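(* Suppose $B$ satisfies the following: there is $\vartheta_B>0$ such that for $p=1$ and $p=\infty$ the map $\mathbb R\to L^p(\mathbb R^d)$, $\theta\mapsto \hat B_\theta:=(u(\theta)B)^\wedge$ extends to an analytic map on $\{z\in\mathbb C:|z|<\vartheta_B\}$. Suppose $\psi_1,\psi_2\in L^2(\mathbb R^d)$ each satisfy: there is $\vartheta_\psi>0$ such that $\theta\mapsto\hat\psi(e^\theta\,\cdot)$, $\mathbb R\to L^2(\mathbb R^d)$, extends to an analytic map on $\{z\in\mathbb C:|z|<\vartheta_\psi\}$. Let $n\in\mathbb N$. Then for every $E>0$ the limits $$T_{n,\infty}[E\pm i0^+;\psi_1,\psi_2]:=\lim_{\eta\downarrow0}T_{n,\infty}[E\pm i\eta;\psi_1,\psi_2]$$ exist as finite complex numbers. Moreover, the function $z\mapsto T_{n,\infty}[z;\psi_1,\psi_2]$ on $\{z\in\mathbb C:\operatorname{Im}z>0\}$ has a continuous extension to $\{z:\operatorname{Im}z>0\}\cup\{z:\operatorname{Re}z>0,\ \operatorname{Im}z=0\}$.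
   Context: Fix $d\in\mathbb N$. For $L>0$ let $\Lambda_L=[-L/2,L/2)^d$, $\Lambda_L^*=(\frac1L\mathbb Z)^d$. For $h:\mathbb R^d\to\mathbb C$, $h_\#$ is the $L$-periodic extension of $h|_{\Lambda_L}$. Inner products on $L^2(\Lambda_L)$ are antilinear in the first argument. $\nu(p)=\frac12|p|^2$; $K_L$ is the self-adjoint operator on $L^2(\Lambda_L)$ with $\widehat{K_Lf}(p)=\nu(p)\hat f(p)$, $\hat f(p)=\int_{\Lambda_L}e^{-2\pi ip\cdot x}f(x)dx$, $p\in\Lambda_L^*$, on the domain $\{f:\nu\hat f\in\ell^2(\Lambda_L^* )\}$; $R_L(z)=(K_L-z)^{-1}$. $B$ is a real-valued Schwartz function on $\mathbb R^d$ which either has compact support or is invariant under each reflection $x_j\mapsto-x_j$. $M$ is Poisson with mean $|\Lambda_L|$, $y_{L,\gamma}$ i.i.d. uniform on $\Lambda_L$, $v_\gamma$ i.i.d. real with all moments $m_k=\mathbf E v_\gamma^k$ finite, all independent; $V_L(x)=\sum_{\gamma=1}^M v_\gamma B_\#(x-y_{L,\gamma})$; $\mathbf E_L$ is the joint expectation. $T_{n,L}[z;\psi_1,\psi_2]:=\mathbf E_L\langle\psi_{1,\#},R_L(z)[V_LR_L(z)]^n\psi_{2,\#}\rangle$ for $z\in\mathbb C\setminus[0,\infty)$; for such $z$ the limit $T_{n,\infty}[z;\psi_1,\psi_2]:=\lim_{L\to\infty}T_{n,L}[z;\psi_1,\psi_2]$ exists. The infinite-volume Fourier transform is $\hat f(k)=\int_{\mathbb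 R^d}e^{-2\pi ik\cdot x}f(x)dx$, and the dilation group on $L^2(\mathbb R^d)$ is $(u(\theta)\psi)(x)=e^{d\theta/2}\psi(e^\theta x)$. *)

theory Defs
  imports "HOL-Analysis.Analysis" "HOL-Probability.Probability"
begin

fun pderivs :: "'a::euclidean_space list \<Rightarrow> ('a \<Rightarrow> real) \<Rightarrow> 'a \<Rightarrow> real" where
  "pderivs [] f = f"
| "pderivs (v # vs) f = (\<lambda>x. frechet_derivative (pderivs vs f) (at x) v)"

definition schwartz :: "('a::euclidean_space \<Rightarrow> real) \<Rightarrow> bool" where
  "schwartz f \<longleftrightarrow>
     (\<forall>vs. set vs \<subseteq> Basis \<longrightarrow> (\<forall>x. pderivs vs f differentiable (at x))) \<and>
     (\<forall>vs (m::nat). set vs \<subseteq> Basis \<longrightarrow>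
        (\<exists>C. \<forall>x. (1 + norm x) ^ m * \<bar>pderivs vs f x\<bar> \<le> C))"

definition ft :: "(real^'d \<Rightarrow> complex) \<Rightarrow> real^'d \<Rightarrow> complex" where
  "ft f k = integral\<^sup>L lebesgue (\<lambda>x. cis (- 2 * pi * (k \<bullet> x)) * f x)"

definition in_L1 :: "(real^'d \<Rightarrow> complex) \<Rightarrow> bool" where
  "in_L1 f \<longleftrightarrow> integrable lebesgue f"

definition norm_L1 :: "(real^'d \<Rightarrow> complex) \<Rightarrow> real" where
  "norm_L1 f = integral\<^sup>L lebesgue (\<lambda>x. cmod (f x))"

definition in_L2 :: "(real^'d \<Rightarrow> complex) \<Rightarrow> bool" where
  "in_L2 f \<longleftrightarrow> f \<in> borel_measurable lebesgue \<and> integrable lebesgue (\<lambda>x. (cmod (f x))\<^sup>2)"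

definition norm_L2 :: "(real^'d \<Rightarrow> complex) \<Rightarrow> real" where
  "norm_L2 f = sqrt (integral\<^sup>L lebesgue (\<lambda>x. (cmod (f x))\<^sup>2))"

definition in_Linf :: "(real^'d \<Rightarrow> complex) \<Rightarrow> bool" where
  "in_Linf f \<longleftrightarrow> f \<in> borel_measurable lebesgue \<and>
     esssup lebesgue (\<lambda>x. ereal (cmod (f x))) < \<infinity>"

definition norm_Linf :: "(real^'d \<Rightarrow> complex) \<Rightarrow> real" where
  "norm_Linf f = real_of_ereal (esssup lebesgue (\<lambda>x. ereal (cmod (f x))))"

text \<open>Analytic (= strongly complex differentiable) map from an open set D into the
  Banach space described by membership predicate mem and norm nrm.\<close>
definition analytic_into ::
  "(('x \<Rightarrow> complex) \<Rightarrow> bool) \<Rightarrow> (('x \<Rightarrow> complex) \<Rightarrow> real) \<Rightarrow> complex set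
     \<Rightarrow> (complex \<Rightarrow> 'x \<Rightarrow> complex) \<Rightarrow> bool" where
  "analytic_into mem nrm D F \<longleftrightarrow>
     (\<forall>z\<in>D. mem (F z)) \<and>
     (\<forall>z\<in>D. \<exists>G. mem G \<and>
        ((\<lambda>w. nrm (\<lambda>x. (F w x - F z x) / (w - z) - G x)) \<longlongrightarrow> 0) (at z within D))"

definition dil :: "real \<Rightarrow> (real^'d \<Rightarrow> complex) \<Rightarrow> real^'d \<Rightarrow> complex" where
  "dil \<theta> \<psi> x = of_real (exp (real CARD('d) * \<theta> / 2)) * \<psi> (exp \<theta> *\<^sub>R x)"

definition is_ft_L2 :: "(real^'d \<Rightarrow> complex) \<Rightarrow> (real^'d \<Rightarrow> complex) \<Rightarrow> bool" where
  "is_ft_L2 \<psi> g \<longleftrightarrow> in_L2 g \<and>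
     ((\<lambda>R. norm_L2 (\<lambda>k. ft (\<lambda>x. indicator (cball 0 R) x * \<psi> x) k - g k)) \<longlongrightarrow> 0) at_top"

definition B_hyp :: "(real^'d \<Rightarrow> real) \<Rightarrow> bool" where
  "B_hyp B \<longleftrightarrow> (\<exists>th0>0.
     (\<exists>F. analytic_into in_L1 norm_L1 (ball 0 th0) F \<and>
        (\<forall>\<theta>::real. \<bar>\<theta>\<bar> < th0 \<longrightarrow>
           (AE k in lebesgue. F (of_real \<theta>) k = ft (dil \<theta> (\<lambda>x. of_real (B x))) k))) \<and>
     (\<exists>F. analytic_into in_Linf norm_Linf (ball 0 th0) F \<and>
        (\<forall>\<theta>::real. \<bar>\<theta>\<bar> < th0 \<longrightarrow>
           (AE k in lebesgue. F (of_real \<theta>) k = ft (dil \<theta> (\<lambda>x. of_real (B x))) k))))"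

definition psi_hyp :: "(real^'d \<Rightarrow> complex) \<Rightarrow> bool" where
  "psi_hyp \<psi> \<longleftrightarrow> (\<exists>g. is_ft_L2 \<psi> g \<and> (\<exists>th0>0. \<exists>F.
     analytic_into in_L2 norm_L2 (ball 0 th0) F \<and>
     (\<forall>\<theta>::real. \<bar>\<theta>\<bar> < th0 \<longrightarrow>
        (AE k in lebesgue. F (of_real \<theta>) k = g (exp \<theta> *\<^sub>R k)))))"

definition box_L :: "real \<Rightarrow> (real^'d) set" where
  "box_L L = {x. \<forall>i. - L / 2 \<le> x $ i \<and> x $ i < L / 2}"

definition wrap :: "real \<Rightarrow> real \<Rightarrow> real" where
  "wrap L t = t - L * of_int \<lfloor>t / L + 1 / 2\<rfloor>"

definition per :: "real \<Rightarrow> (real^'d \<Rightarrow> 'b) \<Rightarrow> real^'d \<Rightarrow> 'b" where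
  "per L h x = h (\<chi> i. wrap L (x $ i))"

definition dual_pt :: "real \<Rightarrow> int^'d \<Rightarrow> real^'d" where
  "dual_pt L k = (\<chi> i. of_int (k $ i) / L)"

definition nu :: "real^'d \<Rightarrow> real" where
  "nu p = (norm p)\<^sup>2 / 2"

definition fcoef :: "real \<Rightarrow> (real^'d \<Rightarrow> complex) \<Rightarrow> int^'d \<Rightarrow> complex" where
  "fcoef L f k = integral\<^sup>L (lebesgue_on (box_L L))
                   (\<lambda>x. cis (- 2 * pi * (dual_pt L k \<bullet> x)) * f x)"

definition in_L2_box :: "real \<Rightarrow> (real^'d \<Rightarrow> complex) \<Rightarrow> bool" where
  "in_L2_box L f \<longleftrightarrow> f \<in> borel_measurable (lebesgue_on (box_L L)) \<and>
     integrable (lebesgue_on (box_L L)) (\<lambda>x. (cmod (f x))\<^sup>2)"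

text \<open>Resolvent R_L(z) f = (K_L - z)^{-1} f: the L^2(box) function g in the domain
  of K_L whose Fourier coefficients are f^(p) / (nu(p) - z).  (Unique a.e.)\<close>
definition resolv :: "real \<Rightarrow> complex \<Rightarrow> (real^'d \<Rightarrow> complex) \<Rightarrow> real^'d \<Rightarrow> complex" where
  "resolv L z f = (SOME g. in_L2_box L g \<and>
      (\<forall>k. fcoef L g k = fcoef L f k / (of_real (nu (dual_pt L k)) - z)))"

definition inner_L :: "real \<Rightarrow> (real^'d \<Rightarrow> complex) \<Rightarrow> (real^'d \<Rightarrow> complex) \<Rightarrow> complex" where
  "inner_L L f g = integral\<^sup>L (lebesgue_on (box_L L)) (\<lambda>x. cnj (f x) * g x)"

definition pot :: "real \<Rightarrow> (real^'d \<Rightarrow> real) \<Rightarrow> nat \<Rightarrow> (nat \<Rightarrow> real^'d) \<Rightarrow> (nat \<Rightarrow> real)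
                    \<Rightarrow> real^'d \<Rightarrow> complex" where
  "pot L B m ys vs x = of_real (\<Sum>\<gamma><m. vs \<gamma> * per L B (x - ys \<gamma>))"

fun chain :: "real \<Rightarrow> complex \<Rightarrow> (real^'d \<Rightarrow> complex) \<Rightarrow> nat \<Rightarrow> (real^'d \<Rightarrow> complex)
               \<Rightarrow> real^'d \<Rightarrow> complex" where
  "chain L z V 0 g = resolv L z g"
| "chain L z V (Suc n) g = resolv L z (\<lambda>x. V x * chain L z V n g x)"

text \<open>Joint expectation E_L: M ~ Poisson(|Lambda_L|), y_gamma iid uniform on Lambda_L,
  v_gamma iid with law mu, all independent.\<close>
definition exp_L :: "real measure \<Rightarrow> real \<Rightarrow>
    (nat \<Rightarrow> (nat \<Rightarrow> real^'d) \<Rightarrow> (nat \<Rightarrow> real) \<Rightarrow> complex) \<Rightarrow> complex" where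
  "exp_L \<mu> L F = (\<Sum>m. of_real ((L ^ CARD('d)) ^ m / fact m * exp (- (L ^ CARD('d)))) *
      integral\<^sup>L (PiM {..<m} (\<lambda>_. uniform_measure lborel (box_L L)))
        (\<lambda>ys. integral\<^sup>L (PiM {..<m} (\<lambda>_. \<mu>)) (\<lambda>vs. F m ys vs)))"

definition T_L :: "real measure \<Rightarrow> (real^'d \<Rightarrow> real) \<Rightarrow> nat \<Rightarrow> real \<Rightarrow> complex
                   \<Rightarrow> (real^'d \<Rightarrow> complex) \<Rightarrow> (real^'d \<Rightarrow> complex) \<Rightarrow> complex" where
  "T_L \<mu> B n L z \<psi>1 \<psi>2 = exp_L \<mu> L (\<lambda>m ys vs.
      inner_L L (per L \<psi>1) (chain L z (pot L B m ys vs) n (per L \<psi>2)))"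

definition T_inf :: "real measure \<Rightarrow> (real^'d \<Rightarrow> real) \<Rightarrow> nat \<Rightarrow> complex
                   \<Rightarrow> (real^'d \<Rightarrow> complex) \<Rightarrow> (real^'d \<Rightarrow> complex) \<Rightarrow> complex" where
  "T_inf \<mu> B n z \<psi>1 \<psi>2 = Lim at_top (\<lambda>L. T_L \<mu> B n L z \<psi>1 \<psi>2)"

end

theory Submission
  imports Defs "HOL-Complex_Analysis.Conformal_Mappings"
begin

text \<open>In momentum space the expectation of the \<open>n\<close>-th order term at finite \<open>L\<close> becomes a finite sum over
  set partitions of \<open>{..<n}\<close> (which scatterers coincide) of lattice sums over the dual lattice, in which
  every block conserves momentum. As \<open>L \<rightarrow> \<infinity>\<close> these are Riemann sums: decay of the
  Fourier coefficients of \<open>B\<close> dominates the transfers, and \<open>L\<^sup>2\<close> convergence of the lattice samples of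
  the wave functions handles the outgoing momentum. For the boundary values, substitute
  \<open>x \<mapsto> e\<^sup>\<theta> x\<close> in the limit integral. This changes nothing for real \<open>\<theta>\<close>, and the resulting
  expression is holomorphic in \<open>\<theta>\<close> as long as the ray \<open>e\<^bsup>2\<theta>\<^esup> [0, \<infinity>)\<close> avoids \<open>z\<close>. Rotating the ray away from
  the half plane of \<open>z\<close> yields a formula that is holomorphic in \<open>z\<close> across the positive real axis.\<close>

section \<open>Fourier series on the box\<close>


text \<open>The alternative required of \<open>B\<close> is there for the lattice sums. Periodizing
  a function usually creates jumps across the faces of the box, and its Fourier coefficients then
  decay like the inverse momentum, which is not summable. If values on opposite faces agree, two
  integrations by parts in a coordinate leave no boundary term and gain an inverse square, uniformly
  in \<open>L\<close>. The Poisson law enters through its factorial moments, which are exact powers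
  of the volume, one factor per block. A conservation law costs one lattice point of weight
  \<open>L^(-d)\<close> per block, and the two cancel without remainder. Two norms of the dilated
  potential occur because conservation makes one transfer per block a function of the others. A
  potential at a free transfer supplies integrability in that variable; at a dependent transfer it
  can only be bounded. Both wave functions sit at the outgoing momentum, hence \<open>L2\<close>.
  The admissible \<open>\<theta>\<close> depend on \<open>z\<close>, but always include a real
  segment and one common imaginary point. The identity theorem moves the equality from the former to
  the latter; there the angle stays fixed and \<open>z\<close> varies.\<close>

definition upd :: "real^'d \<Rightarrow> 'd \<Rightarrow> real \<Rightarrow> real^'d" where
  "upd x i t = (\<chi> j. if j = i then t else x $ j)"

lemma upd_nth [simp]: "upd x i t $ j = (if j = i then t else x $ j)"
  by (simp add: upd_def)

section \<open>Lebesgue measure on \<open>real^'d\<close> as a product measure\<close>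

lemma Basis_vec_range: "(Basis :: (real^'d) set) = range (\<lambda>i. axis i 1)"
  by (auto simp: Basis_vec_def)

lemma prod_Basis_vec: "(\<Prod>b\<in>(Basis::(real^'d) set). f b) = (\<Prod>i\<in>UNIV. f (axis i 1))"
  unfolding Basis_vec_range by (subst prod.reindex) (auto simp: inj_on_def axis_eq_axis)

lemma measurable_PiM_vec [measurable]:
  "(\<lambda>f. (\<chi> i. f i) :: real^'d) \<in> borel_measurable (PiM UNIV (\<lambda>_::'d. lborel :: real measure))"
proof (subst borel_measurable_euclidean_space, safe)
  fix b :: "real^'d" assume "b \<in> Basis"
  then obtain i where b: "b = axis i 1" by (auto simp: Basis_vec_range)
  show "(\<lambda>f. (\<chi> i. f i) \<bullet> b) \<in> borel_measurable (PiM UNIV (\<lambda>_::'d. lborel :: real measure))"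
    unfolding b inner_axis by simp
qed

text \<open>Open boxes determine the measure, and both sides give a box the product of its side
  lengths. This is what lets integrals of products of one-variable functions factor over the
  coordinates.\<close>

lemma lborel_vec_PiM:
  "(lborel :: (real^'d) measure) = distr (PiM UNIV (\<lambda>_::'d. lborel)) borel (\<lambda>f. \<chi> i. f i)"
proof (rule lborel_eqI)
  fix l u :: "real^'d" assume le: "\<And>b. b \<in> Basis \<Longrightarrow> l \<bullet> b \<le> u \<bullet> b"
  have le': "l $ i \<le> u $ i" for i using le[of "axis i 1"] by (simp add: inner_axis)
  interpret product_sigma_finite "\<lambda>_::'d. lborel :: real measure" ..
  have eq: "(\<lambda>f. (\<chi> i. f i) :: real^'d) -` box l u \<inter> space (PiM UNIV (\<lambda>_::'d. lborel :: real measure))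
      = PiE UNIV (\<lambda>i. {l $ i <..< u $ i})"
    by (auto simp: mem_box_cart space_PiM PiE_iff)
  have "emeasure (distr (PiM UNIV (\<lambda>_::'d. lborel)) borel (\<lambda>f. \<chi> i. f i)) (box l u)
      = (\<Prod>i\<in>UNIV. emeasure lborel {l $ i <..< u $ i})"
    by (subst emeasure_distr) (auto simp: eq emeasure_PiM)
  also have "\<dots> = (\<Prod>i\<in>UNIV. ennreal (u $ i - l $ i))"
    by (simp add: le')
  also have "\<dots> = ennreal (\<Prod>i\<in>UNIV. u $ i - l $ i)"
    by (subst prod_ennreal) (auto simp: le')
  also have "(\<Prod>i\<in>UNIV. u $ i - l $ i) = (\<Prod>b\<in>Basis. (u - l) \<bullet> b)"
    by (simp add: prod_Basis_vec inner_axis)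
  finally show "emeasure (distr (PiM UNIV (\<lambda>_::'d. lborel)) borel (\<lambda>f. \<chi> i. f i)) (box l u)
      = (\<Prod>b\<in>Basis. (u - l) \<bullet> b)" by simp
qed simp

lemma integrable_vec_prod:
  fixes f :: "'d::finite \<Rightarrow> real \<Rightarrow> 'a::{real_normed_field,banach,second_countable_topology}"
  assumes "\<And>i. integrable lborel (f i)"
  shows "integrable lborel (\<lambda>x::real^'d. \<Prod>i\<in>UNIV. f i (x $ i))"
proof -
  interpret product_sigma_finite "\<lambda>_::'d. lborel :: real measure" ..
  have [measurable]: "f i \<in> borel_measurable borel" for i
    using borel_measurable_integrable[OF assms[of i]] by simp
  show ?thesis
    by (subst lborel_vec_PiM, subst integrable_distr_eq)
       (auto intro!: product_integrable_prod assms)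
qed

lemma integral_vec_prod:
  fixes f :: "'d::finite \<Rightarrow> real \<Rightarrow> 'a::{real_normed_field,banach,second_countable_topology}"
  assumes "\<And>i. integrable lborel (f i)"
  shows "(LINT x|lborel. (\<Prod>i\<in>UNIV. f i ((x::real^'d) $ i))) = (\<Prod>i\<in>UNIV. LINT t|lborel. f i t)"
proof -
  interpret product_sigma_finite "\<lambda>_::'d. lborel :: real measure" ..
  have [measurable]: "f i \<in> borel_measurable borel" for i
    using borel_measurable_integrable[OF assms[of i]] by simp
  show ?thesis
    by (subst lborel_vec_PiM, subst integral_distr)
       (auto intro!: product_integral_prod assms)
qed

text \<open>Fubini with the coordinate \<open>i\<close> innermost. It carries an integration by
  parts in one variable over to the integral on the whole space.\<close>

lemma integral_eq_along_line:
  fixes F G :: "real^'d \<Rightarrow> 'a::{banach,second_countable_topology}"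
  assumes F: "integrable lborel F" and G: "integrable lborel G"
    and eq: "\<And>x. (LINT t|lborel. F (upd x i t)) = (LINT t|lborel. G (upd x i t))"
  shows "integral\<^sup>L lborel F = integral\<^sup>L lborel G"
proof -
  interpret product_sigma_finite "\<lambda>_::'d. lborel :: real measure" ..
  have ins: "insert i (UNIV - {i}) = (UNIV::'d set)" by auto
  have *: "integral\<^sup>L lborel H = (\<integral>f. (LINT t|lborel. H (upd (\<chi> j. f j) i t)) \<partial>PiM (UNIV - {i}) (\<lambda>_::'d. lborel))"
    if H: "integrable lborel H" for H :: "real^'d \<Rightarrow> 'a"
  proof -
    have [measurable]: "H \<in> borel_measurable borel"
      using borel_measurable_integrable[OF H] by simp
    have int: "integrable (PiM (insert i (UNIV - {i})) (\<lambda>_::'d. lborel)) (\<lambda>f. H (\<chi> j. f j))"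
      using H by (subst (asm) lborel_vec_PiM, subst (asm) integrable_distr_eq) (auto simp: ins)
    have "integral\<^sup>L lborel H = (\<integral>f. H (\<chi> j. f j) \<partial>PiM (insert i (UNIV - {i})) (\<lambda>_::'d. lborel))"
      unfolding ins by (subst lborel_vec_PiM, subst integral_distr) auto
    also have "\<dots> = (\<integral>f. (LINT t|lborel. H (\<chi> j. (f(i := t)) j)) \<partial>PiM (UNIV - {i}) (\<lambda>_::'d. lborel))"
      by (rule product_integral_insert[OF _ _ int]) auto
    also have "(\<lambda>f t. (\<chi> j. (f(i := t)) j)) = (\<lambda>f t. upd (\<chi> j. f j) i t)"
      by (auto simp: fun_eq_iff vec_eq_iff)
    finally show ?thesis .
  qed
  show ?thesis unfolding *[OF F] *[OF G] eq ..
qed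

section \<open>The box and its characters\<close>

lemma box_L_iff: "x \<in> box_L L \<longleftrightarrow> (\<forall>i. x $ i \<in> {-L/2..<L/2})"
  by (auto simp: box_L_def)

lemma box_L_borel [measurable]: "box_L L \<in> sets borel"
proof -
  have "box_L L = (\<Inter>i. (\<lambda>x::real^'d. x $ i) -` {-L/2..<L/2})"
    by (auto simp: box_L_iff)
  also have "\<dots> \<in> sets borel"
    by (intro sets.countable_INT'') (auto intro!: measurable_sets_borel[of _ borel])
  finally show ?thesis .
qed

lemma indicator_box_L: "indicator (box_L L) x = (\<Prod>i\<in>UNIV. indicator {-L/2..<L/2} (x $ i) :: 'a::{comm_semiring_1})"
proof (cases "x \<in> box_L L")
  case True then show ?thesis by (auto simp: box_L_iff intro!: prod.neutral[symmetric])
next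
  case False
  then obtain i where "x $ i \<notin> {-L/2..<L/2}" by (auto simp: box_L_iff)
  then have "(\<Prod>i\<in>UNIV. indicator {-L/2..<L/2} (x $ i) :: 'a) = 0"
    by (intro prod_zero bexI[of _ i]) (simp_all add: indicator_def)
  then show ?thesis using False by simp
qed

lemma box_L_lebesgue [measurable, simp]: "box_L L \<in> sets lebesgue"
  by (simp add: box_L_borel)

lemma emeasure_box_L:
  assumes "L > 0" shows "emeasure lborel (box_L L :: (real^'d) set) = ennreal (L ^ CARD('d))"
proof -
  interpret product_sigma_finite "\<lambda>_::'d. lborel :: real measure" ..
  have eq: "(\<lambda>f. (\<chi> i. f i) :: real^'d) -` box_L L \<inter> space (PiM UNIV (\<lambda>_::'d. lborel :: real measure))
      = PiE UNIV (\<lambda>i. {-L/2..<L/2})"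
    by (auto simp: box_L_iff space_PiM PiE_iff)
  have "emeasure lborel (box_L L :: (real^'d) set) = (\<Prod>i\<in>(UNIV::'d set). emeasure lborel {-L/2..<L/2})"
    by (subst lborel_vec_PiM, subst emeasure_distr) (auto simp: eq emeasure_PiM)
  also have "\<dots> = (\<Prod>i\<in>(UNIV::'d set). ennreal L)"
    using assms by (subst emeasure_lborel_Ico) auto
  also have "\<dots> = ennreal (L ^ CARD('d))" using assms by (simp add: ennreal_power)
  finally show ?thesis .
qed

abbreviation boxm :: "real \<Rightarrow> (real^'d) measure" where "boxm L \<equiv> lebesgue_on (box_L L)"

lemma finite_measure_boxm: "L > 0 \<Longrightarrow> finite_measure (boxm L :: (real^'d) measure)"
  by (rule finite_measureI) (simp add: emeasure_restrict_space emeasure_box_L)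

lemma measure_boxm: "L > 0 \<Longrightarrow> measure (boxm L :: (real^'d) measure) (box_L L) = L ^ CARD('d)"
  by (simp add: measure_def emeasure_restrict_space emeasure_box_L)

text \<open>The characters of the torus of side \<open>L\<close>. Indexing by integer vectors keeps
  the momenta in a discrete group, where sums and shifts are exact.\<close>

definition ek :: "real \<Rightarrow> int^'d \<Rightarrow> real^'d \<Rightarrow> complex" where
  "ek L k x = cis (2 * pi * (dual_pt L k \<bullet> x))"

lemma dual_pt_add: "dual_pt L (k + l) = dual_pt L k + dual_pt L l"
  by (simp add: dual_pt_def vec_eq_iff add_divide_distrib)

lemma dual_pt_uminus: "dual_pt L (- k) = - dual_pt L k"
  by (simp add: dual_pt_def vec_eq_iff)

lemma dual_pt_diff: "dual_pt L (k - l) = dual_pt L k - dual_pt L l"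
  using dual_pt_add[of L k "-l"] by (simp add: dual_pt_uminus)

lemma dual_pt_0 [simp]: "dual_pt L 0 = 0"
  by (simp add: dual_pt_def vec_eq_iff)

lemma dual_pt_sum: "dual_pt L (\<Sum>i\<in>A. f i) = (\<Sum>i\<in>A. dual_pt L (f i))"
  by (induction A rule: infinite_finite_induct) (auto simp: dual_pt_add)

lemma ek_add: "ek L (k + l) x = ek L k x * ek L l x"
  by (simp add: ek_def dual_pt_add inner_add_left cis_mult ring_distribs)

lemma ek_0 [simp]: "ek L 0 x = 1" by (simp add: ek_def)

lemma norm_ek [simp]: "norm (ek L k x) = 1" by (simp add: ek_def)

lemma ek_uminus: "ek L (- k) x = cnj (ek L k x)"
  by (simp add: ek_def dual_pt_uminus cis_cnj)

lemma ek_diff_arg: "ek L k (x - y) = ek L k x * ek L (-k) y"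
  by (simp add: ek_def dual_pt_uminus inner_diff_right cis_mult ring_distribs)

lemma continuous_ek [continuous_intros]: "continuous_on S (ek L k)"
  unfolding ek_def cis_conv_exp by (intro continuous_intros)

lemma ek_borel [measurable]: "ek L k \<in> borel_measurable borel"
  by (intro borel_measurable_continuous_onI continuous_ek)

lemma ek_lebesgue_on [measurable]: "ek L k \<in> borel_measurable (boxm M)"
  by (intro measurable_restrict_space1) (simp add: measurable_completion)

lemma fcoef_ek: "fcoef L f k = (LINT x|boxm L. ek L (-k) x * f x)"
  by (simp add: fcoef_def ek_def dual_pt_uminus)

lemma ek_prod: "ek L k x = (\<Prod>i\<in>UNIV. cis (2 * pi * of_int (k $ i) / L * x $ i))"
proof -
  have "(\<Prod>i\<in>A. cis (f i)) = cis (\<Sum>i\<in>A. f i)" if "finite A" for A :: "'a set" and f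
    using that by (induction A) (auto simp: cis_mult)
  from this[of UNIV "\<lambda>i. 2 * pi * of_int (k $ i) / L * x $ i"] show ?thesis
    by (simp add: ek_def inner_vec_def dual_pt_def sum_distrib_left mult.assoc)
qed

lemma cis_borel [measurable (raw)]: "f \<in> borel_measurable M \<Longrightarrow> (\<lambda>x. cis (f x)) \<in> borel_measurable M"
  unfolding cis_conv_exp by measurable

lemma integral_cis_1d:
  assumes L: "L > 0"
  shows "integrable lborel (\<lambda>t. indicator {-L/2..<L/2} t *\<^sub>R cis (2 * pi * of_int k / L * t))" (is ?A)
    and "(LINT t|lborel. indicator {-L/2..<L/2} t *\<^sub>R cis (2 * pi * of_int k / L * t)) = (if k = 0 then of_real L else 0)" (is ?B)
proof -
  let ?w = "2 * pi * of_int k / L"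
  define F where "F t = (if k = 0 then of_real t else cis (?w * t) / (\<i> * of_real ?w))" for t :: real
  have w: "?w \<noteq> 0" if "k \<noteq> 0" using that L by simp
  have D: "(F has_vector_derivative cis (?w * t)) (at t within S)" for t S
  proof (cases "k = 0")
    case True
    then have "F = of_real" by (auto simp: F_def)
    then show ?thesis using True
      by (auto intro!: derivative_eq_intros has_vector_derivative_eq_rhs[OF has_vector_derivative_of_real[OF DERIV_ident[THEN DERIV_subset]]])
  next
    case False
    have "((\<lambda>t. cis (?w * t)) has_vector_derivative (\<i> * of_real ?w * cis (?w * t))) (at t within S)"
      unfolding cis_conv_exp
      by (rule has_vector_derivative_eq_rhs, rule field_vector_diff_chain_within[unfolded o_def, where g = exp])
         (auto intro!: derivative_eq_intros has_vector_derivative_eq_rhs[OF has_vector_derivative_mult_right] DERIV_exp[THEN DERIV_subset] simp: algebra_simps)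
    then have "((\<lambda>t. cis (?w * t) / (\<i> * of_real ?w)) has_vector_derivative (\<i> * of_real ?w * cis (?w * t)) / (\<i> * of_real ?w)) (at t within S)"
      by (rule has_vector_derivative_divide)
    then show ?thesis using False w by (simp add: F_def[abs_def])
  qed
  have c: "continuous_on {-L/2..L/2} (\<lambda>t. cis (?w * t))"
    unfolding cis_conv_exp by (intro continuous_intros)
  have H: "has_bochner_integral lborel (\<lambda>t. indicator {-L/2..L/2} t *\<^sub>R cis (?w * t)) (F (L/2) - F (-L/2))"
    by (rule has_bochner_integral_FTC_Icc) (use L D c in auto)
  have ae: "AE t in lborel. indicator {-L/2..L/2} t *\<^sub>R cis (?w * t) = indicator {-L/2..<L/2} t *\<^sub>R cis (?w * t)"
    using AE_lborel_singleton[of "L/2"] by eventually_elim (auto simp: indicator_def)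
  have H: "has_bochner_integral lborel (\<lambda>t. indicator {-L/2..<L/2} t *\<^sub>R cis (?w * t)) (F (L/2) - F (-L/2))"
    using H by (subst (asm) has_bochner_integral_cong_AE[OF _ _ ae]) auto
  have "F (L/2) - F (-L/2) = (if k = 0 then of_real L else 0)"
  proof (cases "k = 0")
    case False
    have 1: "?w * (L/2) = pi * of_int k" "?w * (-L/2) = - (pi * of_int k)" using L by (auto simp: field_simps)
    have "cis (pi * of_int k) = cis (- (pi * of_int k))"
      by (auto simp: complex_eq_iff mult.commute)
    then show ?thesis using False by (simp only: F_def 1) simp
  qed (simp add: F_def field_simps flip: of_real_add of_real_diff)
  with H show ?A ?B by (auto simp: has_bochner_integral_iff)
qed

lemma integral_boxm:
  fixes f :: "real^'d \<Rightarrow> 'a::{banach,second_countable_topology}"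
  assumes [measurable]: "f \<in> borel_measurable borel"
  shows "(LINT x|boxm L. f x) = (LINT x|lborel. indicator (box_L L) x *\<^sub>R f x)"
  by (subst integral_restrict_space) (auto simp: integral_completion)

lemma integral_ek:
  assumes L: "L > 0"
  shows "(LINT x|boxm L. ek L (k::int^'d) x) = (if k = 0 then of_real (L ^ CARD('d)) else 0)"
proof -
  have "(LINT x|boxm L. ek L k x) = (LINT x|lborel. indicator (box_L L) x *\<^sub>R ek L k x)"
    by (rule integral_boxm) simp
  also have "\<dots> = (LINT x|lborel. (\<Prod>i\<in>UNIV. (\<lambda>t. indicator {-L/2..<L/2} t *\<^sub>R cis (2 * pi * of_int (k $ i) / L * t)) (x $ i)))"
    by (simp only: indicator_box_L ek_prod scaleR_conv_of_real prod.distrib of_real_prod of_real_indicator)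
  also have "\<dots> = (\<Prod>i\<in>UNIV. if k $ i = 0 then of_real L else 0)"
    using integral_cis_1d[OF L] by (subst integral_vec_prod) auto
  also have "\<dots> = (if k = 0 then of_real (L ^ CARD('d)) else 0)"
  proof (cases "k = 0")
    case False
    then obtain i where "k $ i \<noteq> 0" by (auto simp: vec_eq_iff)
    then show ?thesis using False by (auto intro!: prod_zero)
  qed simp
  finally show ?thesis .
qed

text \<open>The source of momentum conservation: averaging a scatterer position over the box
  annihilates every nonzero total momentum.\<close>

lemma integral_unif_ek:
  assumes L: "L > 0"
  shows "(LINT x|uniform_measure lborel (box_L L). ek L (k::int^'d) x) = (if k = 0 then 1 else 0)"
proof -
  have U: "uniform_measure lborel (box_L L :: (real^'d) set) = density lborel (\<lambda>x. ennreal (indicator (box_L L) x / measure lborel (box_L L :: (real^'d) set)))"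
    unfolding uniform_measure_def using emeasure_box_L[OF L, where 'd = 'd] L
    by (intro density_cong) (auto simp: measure_def divide_ennreal indicator_def split: if_splits simp flip: ennreal_1)
  have "(LINT x|uniform_measure lborel (box_L L). ek L k x) = (LINT x|lborel. indicator (box_L L) x *\<^sub>R ek L k x) /\<^sub>R measure lborel (box_L L :: (real^'d) set)"
    using emeasure_box_L[OF L, where 'd = 'd] L
    unfolding U by (subst integral_density) (auto simp: divide_inverse_commute simp flip: scaleR_scaleR)
  also have "(LINT x|lborel. indicator (box_L L) x *\<^sub>R ek L k x) = (LINT x|boxm L. ek L k x)"
    by (rule integral_boxm[symmetric]) simp
  finally show ?thesis using emeasure_box_L[OF L, where 'd = 'd] L
    unfolding integral_ek[OF L] by (simp add: measure_def scaleR_conv_of_real)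
qed

section \<open>Elementary bounds and Borel representatives\<close>

lemma cmod_add_sq: "(cmod (x + y))\<^sup>2 \<le> 2 * (cmod x)\<^sup>2 + 2 * (cmod y)\<^sup>2"
proof -
  have "(cmod (x + y))\<^sup>2 \<le> (cmod x + cmod y)\<^sup>2"
    by (intro power_mono norm_triangle_ineq) auto
  also have "\<dots> \<le> 2 * (cmod x)\<^sup>2 + 2 * (cmod y)\<^sup>2"
    using zero_le_power2[of "cmod x - cmod y"] by (simp add: power2_eq_square algebra_simps)
  finally show ?thesis .
qed

lemma cmod_mult_le_sq: "cmod (x * y) \<le> ((cmod x)\<^sup>2 + (cmod y)\<^sup>2) / 2"
  using zero_le_power2[of "cmod x - cmod y"] by (simp add: norm_mult power2_eq_square algebra_simps)

lemma integrable_mult_bounded: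
  fixes f h :: "'a \<Rightarrow> complex"
  assumes f: "integrable M f" and [measurable]: "h \<in> borel_measurable M" and C: "AE x in M. cmod (h x) \<le> C"
  shows "integrable M (\<lambda>x. f x * h x)"
proof (rule Bochner_Integration.integrable_bound)
  show "integrable M (\<lambda>x. C * cmod (f x))" using f by auto
  have [measurable]: "f \<in> borel_measurable M" using f by auto
  show "(\<lambda>x. f x * h x) \<in> borel_measurable M" by measurable
  show "AE x in M. cmod (f x * h x) \<le> norm (C * cmod (f x))"
    using C
  proof eventually_elim
    case (elim x)
    have "cmod (f x * h x) \<le> cmod (f x) * C" unfolding norm_mult using elim by (intro mult_left_mono) auto
    then show ?case by (simp add: mult.commute)
  qed
qed

text \<open>Wave functions and their transforms are given as Lebesgue measurable functions.
  Composition and product measures call for Borel functions, so each is replaced by an almost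
  everywhere equal representative.\<close>

lemma lebesgue_complex_ex_borel:
  fixes f :: "'a::euclidean_space \<Rightarrow> complex"
  assumes f: "f \<in> borel_measurable lebesgue"
  shows "\<exists>g\<in>borel_measurable borel. AE x in lborel. f x = g x"
proof -
  have "(\<lambda>x. Re (f x)) \<in> borel_measurable lebesgue" "(\<lambda>x. Im (f x)) \<in> borel_measurable lebesgue"
    using f by auto
  from this[THEN completion_ex_borel_measurable_real]
  obtain r i where [measurable]: "r \<in> borel_measurable borel" "i \<in> borel_measurable borel"
    and ae: "AE x in lborel. Re (f x) = r x" "AE x in lborel. Im (f x) = i x" by auto
  have "AE x in lborel. f x = Complex (r x) (i x)"
    using ae by eventually_elim (simp add: complex_eq_iff)
  moreover have "(\<lambda>x. Complex (r x) (i x)) \<in> borel_measurable borel"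
    unfolding complex_of_real_i[symmetric] Complex_eq by measurable
  ultimately show ?thesis by (intro bexI[of _ "\<lambda>x. Complex (r x) (i x)"]) auto
qed

section \<open>Completeness of the characters\<close>

lemma AE_boxm_iff: "(AE x in boxm L. P x) \<longleftrightarrow> (AE x in lborel. x \<in> box_L L \<longrightarrow> P x)"
  by (subst AE_restrict_space_iff) (auto simp: AE_completion_iff)

lemma integrable_boxm_iff:
  fixes f :: "real^'d \<Rightarrow> 'b::{banach, second_countable_topology}"
  shows "integrable (boxm L) f \<longleftrightarrow> integrable lebesgue (\<lambda>x. indicator (box_L L) x *\<^sub>R f x)"
  by (subst integrable_restrict_space) auto

lemma borel_measurable_boxm:
  "f \<in> borel_measurable borel \<Longrightarrow> f \<in> borel_measurable (boxm L)"
  by (intro measurable_restrict_space1) (simp add: measurable_completion)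

text \<open>Open boxes form an intersection-stable generator of the Borel sets, so the vanishing of
  the integral spreads to all Borel sets by Dynkin induction; the vanishing total integral handles
  complements.\<close>

lemma integral_box_zero_imp_AE_zero:
  fixes g :: "real^'d \<Rightarrow> complex"
  assumes g: "integrable lborel g" and tot: "integral\<^sup>L lborel g = 0"
    and box: "\<And>l u. (LINT x:box l u|lborel. g x) = 0"
  shows "AE x in lborel. g x = 0"
proof (rule sigma_finite_measure.density_zero[OF lborel.sigma_finite_measure_axioms g])
  fix A :: "(real^'d) set" assume "A \<in> sets lborel"
  then have A: "A \<in> sigma_sets UNIV (range (\<lambda>(a, b). box a b))"
    by (simp add: borel_eq_box sets_measure_of)
  have si: "set_integrable lborel A g" if "A \<in> sets borel" for A
    using g that by (auto simp: set_integrable_def intro: integrable_mult_indicator)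
  have sb: "A \<in> sets borel" if "A \<in> sigma_sets UNIV (range (\<lambda>(a, b). box a b))" for A :: "(real^'d) set"
    using that by (simp add: borel_eq_box sets_measure_of)
  have Is: "Int_stable (range (\<lambda>(a, b). box a b :: (real^'d) set))"
    unfolding Int_stable_def by (auto simp: box_Int_box)
  have cl: "range (\<lambda>(a, b). box a b :: (real^'d) set) \<subseteq> Pow UNIV" by auto
  show "(LINT x:A|lborel. g x) = 0"
    using Is cl A
  proof (induction rule: sigma_sets_induct_disjoint)
    show "\<And>A. A \<in> range (\<lambda>(a, b). box a b) \<Longrightarrow> (LINT x:A|lborel. g x) = 0"
      using box by auto
    show "(LINT x:{}|lborel. g x) = 0" by (simp add: set_lebesgue_integral_def)
  next
    fix A :: "(real^'d) set" assume A: "A \<in> sigma_sets UNIV (range (\<lambda>(a, b). box a b))" and 0: "(LINT x:A|lborel. g x) = 0"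
    have "(LINT x:(A \<union> (UNIV - A))|lborel. g x) = (LINT x:A|lborel. g x) + (LINT x:(UNIV - A)|lborel. g x)"
      by (rule set_integral_Un) (use sb[OF A] si in auto)
    then show "(LINT x:(UNIV - A)|lborel. g x) = 0" using 0 tot by (simp add: set_lebesgue_integral_def)
  next
    fix A :: "nat \<Rightarrow> (real^'d) set" assume A: "disjoint_family A" "range A \<subseteq> sigma_sets UNIV (range (\<lambda>(a, b). box a b))"
      and 0: "\<And>i. (LINT x:A i|lborel. g x) = 0"
    have sA: "A i \<in> sets borel" for i using sb A(2) by auto
    have "(LINT x:(\<Union>i. A i)|lborel. g x) = (\<Sum>i. (LINT x:(A i)|lborel. g x))"
      by (rule lebesgue_integral_countable_add) (use sA A(1) si in \<open>auto simp: disjoint_family_on_def\<close>)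
    then show "(LINT x:(\<Union>i. A i)|lborel. g x) = 0" using 0 by simp
  qed
qed

text \<open>With \<open>Z\<close> the complementary arc, the indicator of the open arc is the
  pointwise limit of the continuous functions \<open>min 1 (n * infdist z Z)\<close>, and
  Stone-Weierstrass puts a polynomial within \<open>1 / (n + 1)\<close> of each on the circle. The
  uniform bound 2 is kept for dominated convergence.\<close>

lemma real_polynomial_arc_indicator:
  assumes L: "L > 0" and ab: "-L/2 \<le> a" "b \<le> L/2"
  obtains p where "\<And>n. real_polynomial_function (p n :: complex \<Rightarrow> real)"
    "\<And>n z. cmod z = 1 \<Longrightarrow> \<bar>p n z\<bar> \<le> 2"
    "\<And>t. -L/2 \<le> t \<Longrightarrow> t < L/2 \<Longrightarrow> (\<lambda>n. p n (cis (2 * pi * t / L))) \<longlonglongrightarrow> indicator {a<..<b} t"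
proof -
  define Z where "Z = (\<lambda>t. cis (2 * pi * t / L)) ` ({-L/2..a} \<union> {b..L/2})"
  define phi where "phi n z = min 1 (real n * infdist z Z)" for n z
  have "compact Z" unfolding Z_def cis_conv_exp
    by (intro compact_continuous_image continuous_intros compact_Un) (use L in auto)
  then have cl: "closed Z" by (rule compact_imp_closed)
  have ne: "Z \<noteq> {}" using ab by (auto simp: Z_def)
  have cp: "continuous_on (sphere 0 1) (phi n)" for n
    unfolding phi_def by (intro continuous_intros)
  have "\<exists>p. real_polynomial_function p \<and> (\<forall>z\<in>sphere 0 1. \<bar>phi n z - p z\<bar> < 1 / real (Suc n))" for n
    using Stone_Weierstrass_real_polynomial_function[OF compact_sphere cp[of n], where e = "1 / real (Suc n)"]
    by (metis of_nat_0_less_iff zero_less_Suc zero_less_divide_1_iff)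
  then obtain p where p: "\<And>n. real_polynomial_function (p n)"
    and pc: "\<And>n z. z \<in> sphere 0 1 \<Longrightarrow> \<bar>phi n z - p n z\<bar> < 1 / real (Suc n)" by metis
  have phi01: "0 \<le> phi n z" "phi n z \<le> 1" for n z by (auto simp: phi_def infdist_nonneg)
  show ?thesis
  proof (rule that[of p])
    show "real_polynomial_function (p n)" for n by (rule p)
    show "\<bar>p n z\<bar> \<le> 2" if "cmod z = 1" for n z
    proof -
      have "\<bar>phi n z - p n z\<bar> < 1" by (rule less_le_trans[OF pc]) (use that in auto)
      with phi01[of n z] show ?thesis by linarith
    qed
    fix t assume t: "-L/2 \<le> t" "t < L/2"
    let ?z = "cis (2 * pi * t / L)"
    have lim: "(\<lambda>n. phi n ?z) \<longlonglongrightarrow> indicator {a<..<b} t"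
    proof (cases "t \<in> {a<..<b}")
      case False
      then have "?z \<in> Z" using t unfolding Z_def by (intro imageI) auto
      then have "infdist ?z Z = 0" by (simp add: infdist_zero)
      then show ?thesis using False by (simp add: phi_def)
    next
      case True
      \<comment> \<open>Equality on the circle makes \<open>t - s\<close> an integer multiple of
        \<open>L\<close>; its modulus is less than \<open>L\<close>, so \<open>t = s\<close>, which
        the ranges exclude.\<close>
      have "?z \<notin> Z"
      proof
        assume "?z \<in> Z"
        then obtain s where s: "s \<in> {-L/2..a} \<union> {b..L/2}" "?z = cis (2 * pi * s / L)" unfolding Z_def by blast
        then have "sin (2 * pi * t / L) = sin (2 * pi * s / L) \<and> cos (2 * pi * t / L) = cos (2 * pi * s / L)"
          by (auto simp: complex_eq_iff)
        then obtain k :: int where "2 * pi * t / L = 2 * pi * s / L + 2 * pi * k"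
          unfolding sin_cos_eq_iff by auto
        then have "2 * pi * (t - s) = 2 * pi * (k * L)" using L by (simp add: field_simps)
        then have ts: "t - s = k * L" by simp
        have "\<bar>t - s\<bar> < L" using s(1) True ab t L by auto
        then have "\<bar>real_of_int k\<bar> * L < 1 * L" using ts L by (simp add: abs_mult)
        then have "\<bar>real_of_int k\<bar> < 1" using L by (simp only: mult_less_cancel_right_pos)
        then have "k = 0" by linarith
        with ts s(1) True show False by auto
      qed
      then have d: "infdist ?z Z > 0" using in_closed_iff_infdist_zero[OF cl ne, of ?z] infdist_nonneg[of ?z Z] by linarith
      obtain N where N: "real N * infdist ?z Z > 1" using reals_Archimedean3[OF d] by blast
      have "eventually (\<lambda>n. phi n ?z = 1) sequentially"
        using eventually_ge_at_top[of N]
      proof eventually_elim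
        case (elim n)
        then have "real N * infdist ?z Z \<le> real n * infdist ?z Z" using d by (intro mult_right_mono) auto
        with N show ?case by (simp add: phi_def)
      qed
      then show ?thesis using True by (auto intro: tendsto_eventually)
    qed
    have "(\<lambda>n. phi n ?z - p n ?z) \<longlonglongrightarrow> 0"
    proof (rule Lim_null_comparison)
      show "\<forall>\<^sub>F n in sequentially. norm (phi n ?z - p n ?z) \<le> 1 / real (Suc n)"
        using pc[of ?z] by (auto intro!: always_eventually less_imp_le)
      show "(\<lambda>n. 1 / real (Suc n)) \<longlonglongrightarrow> 0" using LIMSEQ_inverse_real_of_nat by (simp add: inverse_eq_divide)
    qed
    from tendsto_diff[OF lim this] show "(\<lambda>n. p n ?z) \<longlonglongrightarrow> indicator {a<..<b} t" by simp
  qed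
qed

text \<open>Completeness of the characters: the weights annihilated by every character against \<open>f\<close> form a
  class closed under multiplication by one-variable trigonometric polynomials, hence by
  one-variable indicator functions.\<close>
lemma fcoef_zero_imp_AE_zero:
  fixes f :: "real^'d \<Rightarrow> complex"
  assumes L: "L > 0" and f: "integrable (boxm L) f" and z: "\<And>k. fcoef L f k = 0"
  shows "AE x in boxm L. f x = 0"
proof -
  define Q where "Q h \<longleftrightarrow> h \<in> borel_measurable borel \<and> (\<exists>C. \<forall>x. cmod (h x) \<le> C) \<and>
     (\<forall>k. (LINT x|boxm L. f x * (h x * ek L k x)) = 0)" for h :: "real^'d \<Rightarrow> complex"
  have int: "integrable (boxm L) (\<lambda>x. f x * (h x * ek L k x))"
    if "h \<in> borel_measurable borel" "\<And>x. cmod (h x) \<le> C" for h k C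
    using that by (intro integrable_mult_bounded[OF f, of _ C]) (auto simp: norm_mult intro!: borel_measurable_boxm)
  define e where "e i x = cis (2 * pi * x / L)" for i :: 'd and x :: real
  have e_ek: "e i (x $ i) = ek L (axis i 1) x" for i x
    by (simp add: e_def ek_def dual_pt_def inner_vec_def axis_def if_distrib[where f = real_of_int] if_distrib[where f = "\<lambda>t. t / L"] if_distrib[where f = "\<lambda>t. t * _"] cong: if_cong)
  have Q1: "Q (\<lambda>x. of_real (p (e i (x $ i))) * h x)" if "real_polynomial_function p" "Q h" for p i h
    using that
  proof (induction p arbitrary: h rule: real_polynomial_function.induct)
    case (linear p)
    interpret bounded_linear p by (rule linear)
    define A where "A = (of_real (p 1) - \<i> * of_real (p \<i>)) / 2"
    define B where "B = (of_real (p 1) + \<i> * of_real (p \<i>)) / 2"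
    \<comment> \<open>A real-linear map of the plane has the form \<open>A z + B cnj z\<close>. On
      the circle this is a combination of two characters, so multiplying by it only shifts the
      momentum by plus or minus \<open>axis i 1\<close>.\<close>
    have pz: "complex_of_real (p z) = A * z + B * cnj z" for z
    proof -
      have "z = Re z *\<^sub>R 1 + Im z *\<^sub>R \<i>" by (simp add: complex_eq_iff)
      then have "p z = Re z * p 1 + Im z * p \<i>" by (metis add scaleR real_scaleR_def)
      then show ?thesis by (simp add: A_def B_def complex_eq_iff field_simps)
    qed
    from linear.prems obtain C where h [measurable]: "h \<in> borel_measurable borel" and C: "\<And>x. cmod (h x) \<le> C"
      and o: "\<And>k. (LINT x|boxm L. f x * (h x * ek L k x)) = 0" unfolding Q_def by auto
    have eq: "of_real (p (e i (x $ i))) = A * ek L (axis i 1) x + B * ek L (- axis i 1) x" for x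
      by (simp add: pz e_ek ek_uminus)
    have b: "cmod (of_real (p (e i (x $ i))) * h x) \<le> (cmod A + cmod B) * C" for x
      unfolding norm_mult
      by (intro mult_mono C) (auto simp: eq norm_mult intro!: norm_triangle_le)
    have "(LINT x|boxm L. f x * (of_real (p (e i (x $ i))) * h x * ek L k x)) = 0" for k
    proof -
      have "(\<lambda>x. f x * (of_real (p (e i (x $ i))) * h x * ek L k x)) =
        (\<lambda>x. A * (f x * (h x * ek L (k + axis i 1) x)) + B * (f x * (h x * ek L (k + - axis i 1) x)))"
        by (rule ext) (simp only: eq ek_add, simp add: algebra_simps)
      then show ?thesis using int[OF h C] o by simp
    qed
    moreover have "(\<lambda>x. of_real (p (e i (x $ i))) * h x) \<in> borel_measurable borel"
      unfolding eq by measurable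
    ultimately show ?case unfolding Q_def using b by blast
  next
    case (const c)
    then obtain C where h [measurable]: "h \<in> borel_measurable borel" and C: "\<And>x. cmod (h x) \<le> C"
      and o: "\<And>k. (LINT x|boxm L. f x * (h x * ek L k x)) = 0" unfolding Q_def by auto
    have "cmod (of_real c * h x) \<le> \<bar>c\<bar> * C" for x unfolding norm_mult by (intro mult_mono C) auto
    moreover have "(LINT x|boxm L. f x * (of_real c * h x * ek L k x)) = 0" for k
    proof -
      have "(\<lambda>x. f x * (of_real c * h x * ek L k x)) = (\<lambda>x. of_real c * (f x * (h x * ek L k x)))" by (auto simp: algebra_simps)
      then show ?thesis using o by simp
    qed
    moreover have "(\<lambda>x. complex_of_real c * h x) \<in> borel_measurable borel" by measurable
    ultimately show ?case unfolding Q_def by blast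
  next
    case (add p q)
    from add.IH(1)[OF add.prems] add.IH(2)[OF add.prems]
    obtain C D where m [measurable]: "(\<lambda>x. of_real (p (e i (x $ i))) * h x) \<in> borel_measurable borel"
         "(\<lambda>x. of_real (q (e i (x $ i))) * h x) \<in> borel_measurable borel"
      and C: "\<And>x. cmod (of_real (p (e i (x $ i))) * h x) \<le> C" "\<And>x. cmod (of_real (q (e i (x $ i))) * h x) \<le> D"
      and o: "\<And>k. (LINT x|boxm L. f x * (of_real (p (e i (x $ i))) * h x * ek L k x)) = 0"
             "\<And>k. (LINT x|boxm L. f x * (of_real (q (e i (x $ i))) * h x * ek L k x)) = 0"
      unfolding Q_def by blast
    have eq: "of_real (p (e i (x $ i)) + q (e i (x $ i))) * h x = of_real (p (e i (x $ i))) * h x + of_real (q (e i (x $ i))) * h x" for x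
      by (simp add: algebra_simps)
    have "cmod (of_real (p (e i (x $ i)) + q (e i (x $ i))) * h x) \<le> C + D" for x
      unfolding eq by (intro norm_triangle_le add_mono C)
    moreover have "(LINT x|boxm L. f x * (of_real (p (e i (x $ i)) + q (e i (x $ i))) * h x * ek L k x)) = 0" for k
      unfolding eq distrib_left distrib_right using int[OF m(1) C(1)] int[OF m(2) C(2)] o by simp
    moreover have "(\<lambda>x. of_real (p (e i (x $ i)) + q (e i (x $ i))) * h x) \<in> borel_measurable borel"
      unfolding eq by measurable
    ultimately show ?case unfolding Q_def by blast
  next
    case (mult p q)
    from mult.IH(1)[OF mult.IH(2)[OF mult.prems]] show ?case by (simp add: mult.assoc of_real_mult)
  qed
  have Q2: "Q (\<lambda>x. indicator {a<..<b} (x $ i) * h x)" if h: "Q h" and ab: "-L/2 \<le> a" "b \<le> L/2" for a b i h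
  proof -
    obtain p where p: "\<And>n. real_polynomial_function (p n)" "\<And>n z. cmod z = 1 \<Longrightarrow> \<bar>p n z\<bar> \<le> 2"
      "\<And>t. -L/2 \<le> t \<Longrightarrow> t < L/2 \<Longrightarrow> (\<lambda>n. p n (cis (2 * pi * t / L))) \<longlonglongrightarrow> indicator {a<..<b} t"
      using real_polynomial_arc_indicator[OF L ab] by blast
    from h obtain C where m [measurable]: "h \<in> borel_measurable borel" and C: "\<And>x. cmod (h x) \<le> C" unfolding Q_def by blast
    have q: "Q (\<lambda>x. of_real (p n (e i (x $ i))) * h x)" for n by (rule Q1[OF p(1) h])
    have fm [measurable]: "f \<in> borel_measurable (boxm L)" using f by auto
    have "(LINT x|boxm L. f x * (indicator {a<..<b} (x $ i) * h x * ek L k x)) = 0" for k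
    proof -
      have "(\<lambda>n. LINT x|boxm L. f x * (of_real (p n (e i (x $ i))) * h x * ek L k x)) \<longlonglongrightarrow>
         (LINT x|boxm L. f x * (indicator {a<..<b} (x $ i) * h x * ek L k x))"
      proof (rule integral_dominated_convergence)
        have "(\<lambda>x. indicator {a<..<b} (x $ i) * h x * ek L k x) \<in> borel_measurable (boxm L)"
          by (rule borel_measurable_boxm) measurable
        then show "(\<lambda>x. f x * (indicator {a<..<b} (x $ i) * h x * ek L k x)) \<in> borel_measurable (boxm L)" by measurable
        fix n
        have "(\<lambda>x. of_real (p n (e i (x $ i))) * h x) \<in> borel_measurable (boxm L)"
          using q[of n] unfolding Q_def by (intro borel_measurable_boxm) auto
        then show "(\<lambda>x. f x * (of_real (p n (e i (x $ i))) * h x * ek L k x)) \<in> borel_measurable (boxm L)" by measurable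
        show "AE x in boxm L. cmod (f x * (of_real (p n (e i (x $ i))) * h x * ek L k x)) \<le> 2 * C * cmod (f x)"
        proof (rule AE_I2)
          fix x
          have "cmod (of_real (p n (e i (x $ i)))) * cmod (h x) \<le> 2 * C"
            using p(2)[of "e i (x $ i)" n] by (intro mult_mono C) (auto simp: e_def)
          then have "cmod (f x) * (cmod (of_real (p n (e i (x $ i)))) * cmod (h x)) \<le> cmod (f x) * (2 * C)"
            by (intro mult_left_mono) auto
          then show "cmod (f x * (of_real (p n (e i (x $ i))) * h x * ek L k x)) \<le> 2 * C * cmod (f x)"
            by (simp add: norm_mult mult_ac)
        qed
        show "integrable (boxm L) (\<lambda>x. 2 * C * cmod (f x))" using f by auto
        show "AE x in boxm L. (\<lambda>n. f x * (of_real (p n (e i (x $ i))) * h x * ek L k x)) \<longlonglongrightarrow> f x * (indicator {a<..<b} (x $ i) * h x * ek L k x)"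
        proof (rule AE_I2)
          fix x :: "real^'d" assume "x \<in> space (boxm L)"
          then have "(\<lambda>n. p n (e i (x $ i))) \<longlonglongrightarrow> indicator {a<..<b} (x $ i)"
            unfolding e_def by (intro p(3)) (auto simp: space_restrict_space box_L_iff)
          then have "(\<lambda>n. complex_of_real (p n (e i (x $ i)))) \<longlonglongrightarrow> indicator {a<..<b} (x $ i)"
            by (subst of_real_indicator[symmetric]) (rule tendsto_of_real)
          then show "(\<lambda>n. f x * (of_real (p n (e i (x $ i))) * h x * ek L k x)) \<longlonglongrightarrow> f x * (indicator {a<..<b} (x $ i) * h x * ek L k x)"
            by (intro tendsto_intros)
        qed
      qed
      moreover have "(\<lambda>n. LINT x|boxm L. f x * (of_real (p n (e i (x $ i))) * h x * ek L k x)) = (\<lambda>_. 0)"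
        using q unfolding Q_def by auto
      ultimately show ?thesis by (simp add: LIMSEQ_const_iff)
    qed
    moreover have "cmod (indicator {a<..<b} (x $ i) * h x) \<le> C" for x
      using C[of x] by (auto simp: indicator_def intro: order_trans[OF norm_ge_zero])
    moreover have "(\<lambda>x. indicator {a<..<b} (x $ i) * h x) \<in> borel_measurable borel" by measurable
    ultimately show ?thesis unfolding Q_def by blast
  qed
  have Q0: "Q (\<lambda>x. 1)"
  proof -
    have "(LINT x|boxm L. f x * (1 * ek L k x)) = 0" for k
      using z[of "-k"] unfolding fcoef_ek by (simp add: mult.commute)
    then show ?thesis unfolding Q_def by (auto intro!: exI[of _ 1])
  qed
  have Q3: "Q (\<lambda>x. \<Prod>i\<in>S. indicator {a i<..<b i} (x $ i))" if "finite S" "\<And>i. -L/2 \<le> a i" "\<And>i. b i \<le> L/2" for S a b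
    using that(1) by (induction S) (auto intro!: Q0 Q2 that)
  have bint: "(LINT x|boxm L. f x * indicator (box l u) x) = 0" for l u :: "real^'d"
  proof -
    \<comment> \<open>Arc indicators are available inside one period only, so the box
      \<open>box l u\<close> is clipped to the fundamental cell. What the clipping changes lies on
      the boundary of the cell, a null set.\<close>
    define a where "a i = max (-L/2) (l $ i)" for i
    define b where "b i = min (L/2) (u $ i)" for i
    have "Q (\<lambda>x. \<Prod>i\<in>UNIV. indicator {a i<..<b i} (x $ i))" by (rule Q3) (auto simp: a_def b_def)
    then have "(LINT x|boxm L. f x * ((\<Prod>i\<in>UNIV. indicator {a i<..<b i} (x $ i)) * ek L 0 x)) = 0"
      unfolding Q_def by blast
    also have "(LINT x|boxm L. f x * ((\<Prod>i\<in>UNIV. indicator {a i<..<b i} (x $ i)) * ek L 0 x)) = (LINT x|boxm L. f x * indicator (box l u) x)"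
    proof (rule integral_cong_AE)
      show "(\<lambda>x. f x * ((\<Prod>i\<in>UNIV. indicator {a i<..<b i} (x $ i)) * ek L 0 x)) \<in> borel_measurable (boxm L)"
        using f by (intro borel_measurable_times[OF borel_measurable_integrable borel_measurable_boxm]) auto
      show "(\<lambda>x. f x * indicator (box l u) x) \<in> borel_measurable (boxm L)"
        using f by (intro borel_measurable_times[OF borel_measurable_integrable borel_measurable_boxm]) auto
      have "negligible (cbox (\<chi> i. -L/2) (\<chi> i. L/2) - box (\<chi> i. -L/2) (\<chi> i. L/2) :: (real^'d) set)"
        by (rule negligible_frontier_interval)
      then have "AE x in lebesgue. x \<notin> cbox (\<chi> i. -L/2) (\<chi> i. L/2) - box (\<chi> i. -L/2) (\<chi> i. L/2 :: real^'d)"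
        unfolding negligible_iff_null_sets by (rule AE_not_in)
      then show "AE x in boxm L. f x * ((\<Prod>i\<in>UNIV. indicator {a i<..<b i} (x $ i)) * ek L 0 x) = f x * indicator (box l u) x"
        unfolding AE_boxm_iff AE_completion_iff
      proof eventually_elim
        case (elim x)
        show ?case
        proof
          assume "x \<in> box_L L"
          then have "x \<in> cbox (\<chi> i. -L/2) (\<chi> i. L/2)" by (auto simp: box_L_iff mem_box_cart less_imp_le)
          with elim have x: "x \<in> box (\<chi> i. -L/2) (\<chi> i. L/2)" by auto
          have "(\<Prod>i\<in>UNIV. indicator {a i<..<b i} (x $ i)) = (indicator (box l u) x :: complex)"
          proof (cases "x \<in> box l u")
            case True
            then show ?thesis using x by (auto simp: mem_box_cart a_def b_def intro!: prod.neutral)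
          next
            case False
            then obtain i where "\<not> (l $ i < x $ i \<and> x $ i < u $ i)" by (auto simp: mem_box_cart)
            then have "x $ i \<notin> {a i<..<b i}" by (auto simp: a_def b_def)
            then have "(\<Prod>i\<in>UNIV. indicator {a i<..<b i} (x $ i)) = (0 :: complex)"
              by (intro prod_zero bexI[of _ i]) (simp_all add: indicator_def)
            then show ?thesis using False by simp
          qed
          then show "f x * ((\<Prod>i\<in>UNIV. indicator {a i<..<b i} (x $ i)) * ek L 0 x) = f x * indicator (box l u) x" by simp
        qed
      qed
    qed
    finally show ?thesis .
  qed
  have lf: "integrable lebesgue (\<lambda>x. indicator (box_L L) x *\<^sub>R f x)" using f by (simp add: integrable_boxm_iff)
  then obtain g where g [measurable]: "g \<in> borel_measurable borel" and ae: "AE x in lborel. indicator (box_L L) x *\<^sub>R f x = g x"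
    using lebesgue_complex_ex_borel[OF borel_measurable_integrable] by blast
  have ae': "AE x in lebesgue. indicator (box_L L) x *\<^sub>R f x = g x" using ae by (simp add: AE_completion_iff)
  have "integrable lebesgue g" using lf integrable_cong_AE_imp[OF lf _ ae'] by (auto simp: measurable_completion)
  then have gi: "integrable lborel g" by (simp add: integrable_completion)
  have gbox: "(LINT x:A|lborel. g x) = (LINT x|boxm L. f x * indicator A x)" if A [measurable]: "A \<in> sets borel" for A
  proof -
    have "(LINT x:A|lborel. g x) = (LINT x|lebesgue. indicator A x *\<^sub>R g x)"
      unfolding set_lebesgue_integral_def by (rule integral_completion[symmetric]) auto
    also have "\<dots> = (LINT x|lebesgue. indicator (box_L L) x *\<^sub>R (f x * indicator A x))"
    proof (rule integral_cong_AE)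
      show "AE x in lebesgue. indicator A x *\<^sub>R g x = indicator (box_L L) x *\<^sub>R (f x * indicator A x)"
        using ae' by eventually_elim (auto simp: indicator_def)
      show "(\<lambda>x. indicator A x *\<^sub>R g x) \<in> borel_measurable lebesgue"
        by (intro measurable_completion) auto
      have "(\<lambda>x. indicator (box_L L) x *\<^sub>R f x * indicator A x) \<in> borel_measurable lebesgue"
        by (rule borel_measurable_times[OF borel_measurable_integrable[OF lf] measurable_completion]) auto
      then show "(\<lambda>x. indicator (box_L L) x *\<^sub>R (f x * indicator A x)) \<in> borel_measurable lebesgue"
        by (simp add: mult.commute scaleR_conv_of_real mult.left_commute)
    qed
    also have "\<dots> = (LINT x|boxm L. f x * indicator A x)"
      by (subst integral_restrict_space) auto
    finally show ?thesis .
  qed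
  have "AE x in lborel. g x = 0"
  proof (rule integral_box_zero_imp_AE_zero[OF gi])
    have "(LINT x:UNIV|lborel. g x) = (LINT x|boxm L. f x * indicator UNIV x)" by (rule gbox) auto
    also have "\<dots> = 0" using z[of 0] by (simp add: fcoef_ek)
    finally show "integral\<^sup>L lborel g = 0" by (simp add: set_lebesgue_integral_def)
    show "(LINT x:box l u|lborel. g x) = 0" for l u using bint gbox[of "box l u"] by auto
  qed
  with ae show ?thesis unfolding AE_boxm_iff by eventually_elim (auto)
qed

section \<open>The weighted dual lattice\<close>

text \<open>Every lattice point carries the volume \<open>L^(-d)\<close> of a cell of the dual
  lattice. With this weight Parseval is an isometry and lattice sums are Riemann sums.\<close>

definition latm :: "real \<Rightarrow> (int^'d) measure" where
  "latm L = density (count_space UNIV) (\<lambda>_. ennreal (1 / L ^ CARD('d)))"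

lemma sets_latm [simp, measurable_cong]: "sets (latm L) = UNIV" by (simp add: latm_def)
lemma space_latm [simp]: "space (latm L) = UNIV" by (simp add: latm_def)

lemma measurable_latm [simp]: "f \<in> measurable (latm L) N \<longleftrightarrow> f \<in> UNIV \<rightarrow> space N"
  by (auto simp: measurable_def)

lemma measurable_from_latm [measurable]: "f \<in> borel_measurable (latm L)"
  by simp

lemma borel_measurable_cnj: "cnj \<in> borel_measurable borel"
  by (intro borel_measurable_continuous_onI continuous_intros)

lemma integral_latm:
  fixes f :: "int^'d \<Rightarrow> 'b::{banach, second_countable_topology}"
  assumes "L > 0"
  shows "integral\<^sup>L (latm L) f = (1 / L ^ CARD('d)) *\<^sub>R integral\<^sup>L (count_space UNIV) f"
  using assms unfolding latm_def by (subst integral_density) auto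

lemma emeasure_latm_singleton: "emeasure (latm L) {k::int^'d} = ennreal (1 / L ^ CARD('d))"
  unfolding latm_def by (subst emeasure_density) (auto simp: nn_integral_count_space_indicator[symmetric] nn_integral_count_space_finite)

lemma sigma_finite_latm: "L > 0 \<Longrightarrow> sigma_finite_measure (latm L :: (int^'d) measure)"
proof (rule sigma_finite_measure.intro)
  show "\<exists>A::(int^'d) set set. countable A \<and> A \<subseteq> sets (latm L) \<and> \<Union> A = space (latm L) \<and> (\<forall>a\<in>A. emeasure (latm L) a \<noteq> (\<infinity>::ennreal))"
    by (intro exI[of _ "range (\<lambda>k::int^'d. {k})"]) (auto simp: emeasure_latm_singleton)
qed

lemma nn_integral_latm_enum:
  fixes f :: "int^'d \<Rightarrow> ennreal"
  shows "(\<integral>\<^sup>+k. f k \<partial>latm L) = ennreal (1 / L ^ CARD('d)) * (\<Sum>n. f (from_nat_into UNIV n))"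
proof -
  have inf: "infinite (UNIV :: (int^'d) set)"
  proof
    assume "finite (UNIV :: (int^'d) set)"
    then have "finite (range (\<lambda>n::int. (\<chi> i. n) :: int^'d))" by (rule finite_subset[rotated]) auto
    then show False by (subst (asm) finite_image_iff) (auto simp: inj_on_def vec_eq_iff)
  qed
  have "(\<integral>\<^sup>+k. f k \<partial>latm L) = ennreal (1 / L ^ CARD('d)) * (\<integral>\<^sup>+k. f k \<partial>count_space UNIV)"
    unfolding latm_def by (subst nn_integral_density) (auto simp: nn_integral_cmult)
  also have "(\<integral>\<^sup>+k. f k \<partial>count_space UNIV) = (\<integral>\<^sup>+n. f (from_nat_into UNIV n) \<partial>count_space UNIV)"
    by (rule nn_integral_bij_count_space[symmetric]) (rule bij_betw_from_nat_into[OF _ inf], auto)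
  finally show ?thesis by (simp add: nn_integral_count_space_nat)
qed

lemma bij_from_nat_into_vec: "bij (from_nat_into (UNIV :: (int^'d) set))"
proof (rule bij_betw_from_nat_into)
  show "infinite (UNIV :: (int^'d) set)"
  proof
    assume "finite (UNIV :: (int^'d) set)"
    then have "finite (range (\<lambda>n::int. (\<chi> i. n) :: int^'d))" by (rule finite_subset[rotated]) auto
    then show False by (subst (asm) finite_image_iff) (auto simp: inj_on_def vec_eq_iff)
  qed
qed auto

section \<open>Square integrable functions on the box: Bessel, Riesz-Fischer, Parseval\<close>

lemma integrable_boxm_of_sq:
  assumes L: "L > 0" and [measurable]: "f \<in> borel_measurable (boxm L)" and f2: "integrable (boxm L) (\<lambda>x. (cmod (f x))\<^sup>2)"
  shows "integrable (boxm L) f"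
proof -
  interpret finite_measure "boxm L" by (rule finite_measure_boxm[OF L])
  have "integrable (boxm L) (\<lambda>x. (cmod (f x))\<^sup>2 + 1)" using f2 by auto
  then show ?thesis
  proof (rule Bochner_Integration.integrable_bound)
    have "cmod (f x) \<le> (cmod (f x))\<^sup>2 + 1" for x
      using zero_le_power2[of "cmod (f x) - 1"] by (simp add: power2_eq_square algebra_simps) (smt (verit) norm_ge_zero zero_le_mult_iff)
    then show "AE x in boxm L. norm (f x) \<le> norm ((cmod (f x))\<^sup>2 + 1)" by (intro AE_I2) (smt (verit, best) real_norm_def)
  qed auto
qed

lemma in_L2_box_integrable: "L > 0 \<Longrightarrow> in_L2_box L f \<Longrightarrow> integrable (boxm L) f"
  unfolding in_L2_box_def by (metis integrable_boxm_of_sq)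

lemma integrable_mult_L2:
  fixes f g :: "'a \<Rightarrow> complex"
  assumes [measurable]: "f \<in> borel_measurable M" "g \<in> borel_measurable M"
    and "integrable M (\<lambda>x. (cmod (f x))\<^sup>2)" "integrable M (\<lambda>x. (cmod (g x))\<^sup>2)"
  shows "integrable M (\<lambda>x. f x * g x)"
proof (rule Bochner_Integration.integrable_bound)
  show "integrable M (\<lambda>x. ((cmod (f x))\<^sup>2 + (cmod (g x))\<^sup>2) / 2)" using assms by auto
  show "AE x in M. norm (f x * g x) \<le> norm (((cmod (f x))\<^sup>2 + (cmod (g x))\<^sup>2) / 2)"
    using cmod_mult_le_sq by (intro AE_I2) (smt (verit, best) real_norm_def)
qed auto

lemma integrable_add_L2:
  fixes f g :: "'a \<Rightarrow> complex"
  assumes [measurable]: "f \<in> borel_measurable M" "g \<in> borel_measurable M"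
    and "integrable M (\<lambda>x. (cmod (f x))\<^sup>2)" "integrable M (\<lambda>x. (cmod (g x))\<^sup>2)"
  shows "integrable M (\<lambda>x. (cmod (f x + g x))\<^sup>2)"
proof (rule Bochner_Integration.integrable_bound)
  show "integrable M (\<lambda>x. 2 * (cmod (f x))\<^sup>2 + 2 * (cmod (g x))\<^sup>2)" using assms by auto
  show "AE x in M. norm ((cmod (f x + g x))\<^sup>2) \<le> norm (2 * (cmod (f x))\<^sup>2 + 2 * (cmod (g x))\<^sup>2)"
    using cmod_add_sq by (intro AE_I2) (auto intro: order_trans)
qed auto

lemma integrable_scale_L2:
  fixes f :: "'a \<Rightarrow> complex"
  assumes "integrable M (\<lambda>x. (cmod (f x))\<^sup>2)"
  shows "integrable M (\<lambda>x. (cmod (c * f x))\<^sup>2)"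
  using assms by (simp add: norm_mult power_mult_distrib)

lemma in_L2_box_add: "in_L2_box L f \<Longrightarrow> in_L2_box L g \<Longrightarrow> in_L2_box L (\<lambda>x. f x + g x)"
  unfolding in_L2_box_def by (elim conjE, intro conjI borel_measurable_add integrable_add_L2; assumption)

lemma in_L2_box_scale: "in_L2_box L f \<Longrightarrow> in_L2_box L (\<lambda>x. c * f x)"
  unfolding in_L2_box_def
  by (elim conjE, intro conjI borel_measurable_times borel_measurable_const integrable_scale_L2; assumption)

lemma integrable_ek_mult: "integrable (boxm L) f \<Longrightarrow> integrable (boxm L) (\<lambda>x. ek L k x * f x)"
  by (subst mult.commute, rule integrable_mult_bounded[where C = 1]) auto

lemma fcoef_add:
  assumes "integrable (boxm L) f" "integrable (boxm L) g"
  shows "fcoef L (\<lambda>x. f x + g x) k = fcoef L f k + fcoef L g k"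
  unfolding fcoef_ek distrib_left
  by (rule Bochner_Integration.integral_add) (rule assms[THEN integrable_ek_mult])+

lemma fcoef_scale: "fcoef L (\<lambda>x. c * f x) k = c * fcoef L f k"
  unfolding fcoef_ek mult.left_commute[of _ c] by simp

text \<open>The division by the volume makes \<open>a\<close> itself the family of Fourier
  coefficients on \<open>K\<close>.\<close>

definition tpoly :: "real \<Rightarrow> (int^'d \<Rightarrow> complex) \<Rightarrow> (int^'d) set \<Rightarrow> real^'d \<Rightarrow> complex" where
  "tpoly L a K x = (\<Sum>k\<in>K. a k * ek L k x) / of_real (L ^ CARD('d))"

lemma tpoly_borel [measurable]: "tpoly L a K \<in> borel_measurable borel"
  unfolding tpoly_def[abs_def] by measurable

lemma tpoly_bounded: "cmod (tpoly L a K x) \<le> (\<Sum>k\<in>K. cmod (a k)) / \<bar>L\<bar> ^ CARD('d)" for x :: "real^'d"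
proof -
  have "cmod (\<Sum>k\<in>K. a k * ek L k x) \<le> (\<Sum>k\<in>K. cmod (a k * ek L k x))" by (rule norm_sum)
  then show ?thesis unfolding tpoly_def norm_divide by (simp add: norm_mult norm_power divide_right_mono)
qed

lemma integrable_boxm_bounded:
  fixes f :: "real^'d \<Rightarrow> 'b::{banach, second_countable_topology}"
  assumes L: "L > 0" and f: "f \<in> borel_measurable borel" and "\<And>x. norm (f x) \<le> C"
  shows "integrable (boxm L) f"
proof -
  interpret finite_measure "boxm L" by (rule finite_measure_boxm[OF L])
  show ?thesis using assms by (intro integrable_const_bound[of _ C] borel_measurable_boxm) auto
qed

lemma integrable_tpoly: "L > 0 \<Longrightarrow> integrable (boxm L) (tpoly L a K)"
  by (rule integrable_boxm_bounded[OF _ _ tpoly_bounded]) auto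

lemma in_L2_tpoly: "L > 0 \<Longrightarrow> in_L2_box L (tpoly L a K)"
  unfolding in_L2_box_def
proof
  assume L: "L > 0"
  show "tpoly L a K \<in> borel_measurable (boxm L)" by (rule borel_measurable_boxm) simp
  have "norm ((cmod (tpoly L a K x))\<^sup>2) \<le> ((\<Sum>k\<in>K. cmod (a k)) / \<bar>L\<bar> ^ CARD('a))\<^sup>2" for x
    using power_mono[OF tpoly_bounded norm_ge_zero, of L a K x 2] by simp
  then show "integrable (boxm L) (\<lambda>x. (cmod (tpoly L a K x))\<^sup>2)"
    by (intro integrable_boxm_bounded[OF L]) auto
qed

lemma fcoef_tpoly:
  fixes K :: "(int^'d) set"
  assumes L: "L > 0" and K: "finite K"
  shows "fcoef L (tpoly L a K) k = (if k \<in> K then a k else 0)"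
proof -
  have "fcoef L (tpoly L a K) k = (LINT x|boxm L. (\<Sum>l\<in>K. (a l / of_real (L ^ CARD('d))) * ek L (l - k) x))"
    unfolding fcoef_ek tpoly_def diff_conv_add_uminus ek_add
    by (simp add: sum_divide_distrib sum_distrib_left algebra_simps)
  also have "\<dots> = (\<Sum>l\<in>K. (a l / of_real (L ^ CARD('d))) * (LINT x|boxm L. ek L (l - k) x))"
    by (subst Bochner_Integration.integral_sum)
       (auto simp del: times_divide_eq_left intro!: Bochner_Integration.integrable_mult_right integrable_boxm_bounded[OF L, where C = 1])
  also have "\<dots> = (\<Sum>l\<in>K. if l = k then a l else 0)"
    by (intro sum.cong refl) (use L in \<open>auto simp: integral_ek\<close>)
  finally show ?thesis using K by (simp add: sum.delta)
qed

lemma integral_cnj_tpoly: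
  fixes K :: "(int^'d) set"
  assumes L: "L > 0" and K: "finite K" and f: "integrable (boxm L) f"
  shows "(LINT x|boxm L. cnj (tpoly L a K x) * f x) = (\<Sum>k\<in>K. cnj (a k) * fcoef L f k) / of_real (L ^ CARD('d))"
proof -
  have "(LINT x|boxm L. cnj (tpoly L a K x) * f x) = (LINT x|boxm L. (\<Sum>l\<in>K. (cnj (a l) / of_real (L ^ CARD('d))) * (ek L (-l) x * f x)))"
    unfolding tpoly_def
    by (intro Bochner_Integration.integral_cong refl) (simp add: sum_divide_distrib sum_distrib_left sum_distrib_right ek_uminus mult_ac)
  also have "\<dots> = (\<Sum>l\<in>K. (cnj (a l) / of_real (L ^ CARD('d))) * fcoef L f l)"
    unfolding fcoef_ek
    by (subst Bochner_Integration.integral_sum) (auto intro!: integrable_mult_right integrable_ek_mult f)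
  finally show ?thesis by (simp add: sum_divide_distrib)
qed

lemma cnj_mult_self: "cnj z * z = of_real ((cmod z)\<^sup>2)"
  by (simp only: complex_norm_square mult.commute)

lemma norm_tpoly:
  fixes K :: "(int^'d) set"
  assumes L: "L > 0" and K: "finite K"
  shows "(LINT x|boxm L. (cmod (tpoly L a K x))\<^sup>2) = (\<Sum>k\<in>K. (cmod (a k))\<^sup>2) / L ^ CARD('d)"
proof -
  have "complex_of_real (LINT x|boxm L. (cmod (tpoly L a K x))\<^sup>2) = (LINT x|boxm L. cnj (tpoly L a K x) * tpoly L a K x)"
    by (subst integral_complex_of_real[symmetric]) (simp only: cnj_mult_self)
  also have "\<dots> = (\<Sum>k\<in>K. cnj (a k) * a k) / of_real (L ^ CARD('d))"
    by (subst integral_cnj_tpoly[OF L K integrable_tpoly[OF L]]) (auto simp: fcoef_tpoly[OF L K])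
  also have "\<dots> = complex_of_real ((\<Sum>k\<in>K. (cmod (a k))\<^sup>2) / L ^ CARD('d))"
    by (simp only: cnj_mult_self of_real_divide of_real_sum)
  finally show ?thesis by (simp only: of_real_eq_iff)
qed

text \<open>Expand the nonnegative squared distance between \<open>f\<close> and its projection onto
  the characters in \<open>K\<close>.\<close>

lemma Bessel_finite:
  fixes K :: "(int^'d) set"
  assumes L: "L > 0" and K: "finite K" and f: "in_L2_box L f"
  shows "(\<Sum>k\<in>K. (cmod (fcoef L f k))\<^sup>2) / L ^ CARD('d) \<le> (LINT x|boxm L. (cmod (f x))\<^sup>2)"
proof -
  let ?t = "tpoly L (fcoef L f) K"
  let ?S = "(\<Sum>k\<in>K. (cmod (fcoef L f k))\<^sup>2) / L ^ CARD('d)"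
  have f1: "integrable (boxm L) f" by (rule in_L2_box_integrable[OF L f])
  have i: "integrable (boxm L) (\<lambda>x. (cmod (f x))\<^sup>2)" "f \<in> borel_measurable (boxm L)" using f by (auto simp: in_L2_box_def)
  have it: "integrable (boxm L) (\<lambda>x. (cmod (?t x))\<^sup>2)" "?t \<in> borel_measurable (boxm L)" using in_L2_tpoly[OF L] by (auto simp: in_L2_box_def)
  have ic: "integrable (boxm L) (\<lambda>x. cnj (?t x) * f x)"
    by (rule integrable_mult_L2) (use i it in \<open>auto intro: measurable_compose[OF _ borel_measurable_cnj]\<close>)
  have eq: "(cmod (f x - ?t x))\<^sup>2 = (cmod (f x))\<^sup>2 - 2 * Re (cnj (?t x) * f x) + (cmod (?t x))\<^sup>2" for x
    unfolding cmod_power2 by (simp add: power2_eq_square algebra_simps)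
  have "Re (LINT x|boxm L. cnj (?t x) * f x) = ?S"
    unfolding integral_cnj_tpoly[OF L K f1] cnj_mult_self of_real_sum[symmetric] of_real_divide[symmetric] by (rule Re_complex_of_real)
  moreover have "0 \<le> (LINT x|boxm L. (cmod (f x - ?t x))\<^sup>2)" by (intro Bochner_Integration.integral_nonneg) auto
  moreover have "(LINT x|boxm L. (cmod (f x - ?t x))\<^sup>2) = (LINT x|boxm L. (cmod (f x))\<^sup>2) - 2 * Re (LINT x|boxm L. cnj (?t x) * f x) + (LINT x|boxm L. (cmod (?t x))\<^sup>2)"
  proof -
    define R where "R x = Re (cnj (?t x) * f x)" for x
    have "integrable (boxm L) R" "(LINT x|boxm L. R x) = Re (LINT x|boxm L. cnj (?t x) * f x)"
      unfolding R_def using ic by (auto intro: integrable_Re simp del: times_complex.sel)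
    then show ?thesis unfolding eq R_def[symmetric] using i it by simp
  qed
  ultimately show ?thesis unfolding norm_tpoly[OF L K] by simp
qed

lemma Bessel:
  fixes f :: "real^'d \<Rightarrow> complex"
  assumes L: "L > 0" and f: "in_L2_box L f"
  shows "integrable (latm L) (\<lambda>k. (cmod (fcoef L f k))\<^sup>2)"
    and "(LINT k|latm L. (cmod (fcoef L f k))\<^sup>2) \<le> (LINT x|boxm L. (cmod (f x))\<^sup>2)"
proof -
  let ?e = "from_nat_into (UNIV :: (int^'d) set)"
  let ?I = "LINT x|boxm L. (cmod (f x))\<^sup>2"
  have "(\<integral>\<^sup>+k. ennreal ((cmod (fcoef L f k))\<^sup>2) \<partial>latm L) = (\<Sum>n. ennreal ((cmod (fcoef L f (?e n)))\<^sup>2 / L ^ CARD('d)))"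
    unfolding nn_integral_latm_enum using L by (subst ennreal_suminf_cmult[symmetric]) (simp add: ennreal_mult'[symmetric])
  also have "\<dots> \<le> ennreal ?I"
  proof (rule suminf_le_const)
    fix n
    have "(\<Sum>i<n. (cmod (fcoef L f (?e i)))\<^sup>2 / L ^ CARD('d)) = (\<Sum>k\<in>?e ` {..<n}. (cmod (fcoef L f k))\<^sup>2) / L ^ CARD('d)"
      using bij_from_nat_into_vec[where 'd='d] by (subst sum.reindex) (auto simp: bij_def inj_on_def sum_divide_distrib)
    also have "\<dots> \<le> ?I" by (rule Bessel_finite[OF L _ f]) simp
    finally show "(\<Sum>i<n. ennreal ((cmod (fcoef L f (?e i)))\<^sup>2 / L ^ CARD('d))) \<le> ennreal ?I"
      using L by (subst sum_ennreal) (auto intro: ennreal_leI)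
  qed simp
  finally have le: "(\<integral>\<^sup>+k. ennreal ((cmod (fcoef L f k))\<^sup>2) \<partial>latm L) \<le> ennreal ?I" .
  show int: "integrable (latm L) (\<lambda>k. (cmod (fcoef L f k))\<^sup>2)"
    using le by (intro integrableI_bounded) (auto intro: le_less_trans)
  show "(LINT k|latm L. (cmod (fcoef L f k))\<^sup>2) \<le> ?I"
    using le by (subst (asm) nn_integral_eq_integral[OF int]) (auto simp: ennreal_le_iff)
qed

lemma AE_summable_of_summable_integral:
  fixes h :: "nat \<Rightarrow> 'a \<Rightarrow> 'b::{banach, second_countable_topology}"
  assumes int: "\<And>j. integrable M (h j)" and sm: "summable (\<lambda>j. LINT x|M. norm (h j x))"
  shows "AE x in M. summable (\<lambda>j. norm (h j x))"
proof -
  have [measurable]: "h j \<in> borel_measurable M" for j using int by auto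
  have "(\<integral>\<^sup>+x. (\<Sum>j. ennreal (norm (h j x))) \<partial>M) = (\<Sum>j. \<integral>\<^sup>+x. ennreal (norm (h j x)) \<partial>M)"
    by (rule nn_integral_suminf) auto
  also have "\<dots> = (\<Sum>j. ennreal (LINT x|M. norm (h j x)))"
    by (intro suminf_cong nn_integral_eq_integral integrable_norm int) auto
  also have "\<dots> = ennreal (\<Sum>j. LINT x|M. norm (h j x))"
    by (intro suminf_ennreal2 sm) auto
  finally have "(\<integral>\<^sup>+x. (\<Sum>j. ennreal (norm (h j x))) \<partial>M) \<noteq> \<infinity>" by simp
  then have "AE x in M. (\<Sum>j. ennreal (norm (h j x))) \<noteq> \<infinity>"
    by (intro nn_integral_PInf_AE) auto
  then show ?thesis
    by eventually_elim (rule summable_suminf_not_top, auto)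
qed

text \<open>The usual completeness argument: along a subsequence with rapidly shrinking increments
  the partial sums converge absolutely almost everywhere. This produces the limit together with an
  integrable majorant \<open>w\<close>, so the coefficients pass to the limit. The norm bound is
  Fatou's lemma.\<close>

lemma Riesz_Fischer:
  fixes a :: "int^'d \<Rightarrow> complex"
  assumes L: "L > 0" and a: "integrable (latm L) (\<lambda>k. (cmod (a k))\<^sup>2)"
  obtains g where "in_L2_box L g" "\<And>k. fcoef L g k = a k"
    "(LINT x|boxm L. (cmod (g x))\<^sup>2) \<le> (LINT k|latm L. (cmod (a k))\<^sup>2)"
proof -
  interpret bm: finite_measure "boxm L :: (real^'d) measure" by (rule finite_measure_boxm[OF L])
  define c where "c = L ^ CARD('d)"
  have c: "c > 0" using L by (simp add: c_def)
  define e where "e = from_nat_into (UNIV :: (int^'d) set)"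
  have inj_e: "inj e" and surj_e: "surj e" using bij_from_nat_into_vec[where 'd='d] by (auto simp: e_def bij_def)
  define al where "al n = (cmod (a (e n)))\<^sup>2 / c" for n
  have al0: "al n \<ge> 0" for n using c by (simp add: al_def)
  define A where "A = (LINT k|latm L. (cmod (a k))\<^sup>2)"
  have "(\<Sum>n. ennreal (al n)) = (\<integral>\<^sup>+k. ennreal ((cmod (a k))\<^sup>2) \<partial>latm L)"
    unfolding nn_integral_latm_enum ennreal_suminf_cmult[symmetric]
    using c by (intro suminf_cong) (simp add: al_def c_def e_def ennreal_mult'[symmetric])
  also have "\<dots> = ennreal A" unfolding A_def by (rule nn_integral_eq_integral[OF a]) auto
  finally have sA: "(\<Sum>n. ennreal (al n)) = ennreal A" .
  have A0: "A \<ge> 0" unfolding A_def by (rule Bochner_Integration.integral_nonneg) auto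
  have sm: "summable al" by (rule summable_suminf_not_top) (auto simp: sA al0)
  have sumA: "sum al {..<n} \<le> A" for n
  proof -
    have "ennreal (sum al {..<n}) = (\<Sum>i<n. ennreal (al i))" by (simp add: sum_ennreal al0)
    also have "\<dots> \<le> ennreal A" unfolding sA[symmetric] by (rule sum_le_suminf) auto
    finally show ?thesis using A0 by simp
  qed
  \<comment> \<open>Squared \<open>L2\<close> norms of the increments below \<open>(1/4)^j\<close>
    give \<open>L1\<close> norms of order \<open>(1/2)^j\<close>, which are summable.\<close>
  have "\<exists>N. \<forall>m\<ge>N. \<forall>n. norm (sum al {m..<n}) < (1/4) ^ j" for j :: nat
    using sm unfolding summable_Cauchy by (meson zero_less_power zero_less_divide_1_iff zero_less_numeral)
  then obtain N where N: "\<And>j m n. m \<ge> N j \<Longrightarrow> norm (sum al {m..<n}) < (1/4) ^ j" by metis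
  \<comment> \<open>Accumulating the \<open>N i\<close> makes the cut-offs nondecreasing; the extra
    \<open>j\<close> forces them to infinity, so that each coefficient is eventually
    included.\<close>
  define M where "M j = (\<Sum>i\<le>j. N i) + j" for j
  have M1: "M j \<le> M (Suc j)" and Mj: "j \<le> M j" and MN: "N j \<le> M j" for j
    by (auto simp: M_def) (metis le_add1 atMost_iff finite_atMost le_refl member_le_sum trans_le_add1 zero_le)
  define S where "S j = tpoly L a (e ` {..<M j})" for j
  define h where "h j = tpoly L a (e ` {M j..<M (Suc j)})" for j
  have Sh: "S (Suc j) x = S j x + h j x" for j x
  proof -
    have "e ` {..<M (Suc j)} = e ` {..<M j} \<union> e ` {M j..<M (Suc j)}"
      using M1[of j] by (subst image_Un[symmetric], subst ivl_disj_un) auto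
    moreover have "e ` {..<M j} \<inter> e ` {M j..<M (Suc j)} = {}"
      by (auto dest!: injD[OF inj_e])
    ultimately show ?thesis
      by (simp add: S_def h_def tpoly_def sum.union_disjoint add_divide_distrib)
  qed
  have nt: "(LINT x|boxm L. (cmod (tpoly L a (e ` B) x))\<^sup>2) = sum al B" if "finite B" for B
    using that inj_e by (subst norm_tpoly[OF L]) (auto simp: sum.reindex inj_on_def al_def c_def sum_divide_distrib)
  have h_int: "integrable (boxm L) (h j)" and h2_int: "integrable (boxm L) (\<lambda>x. (cmod (h j x))\<^sup>2)" for j
    using in_L2_tpoly[OF L] in_L2_box_integrable[OF L] unfolding h_def in_L2_box_def by auto
  have S_int: "integrable (boxm L) (S j)" and S2_int: "integrable (boxm L) (\<lambda>x. (cmod (S j x))\<^sup>2)"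
     and S_m [measurable]: "S j \<in> borel_measurable (boxm L)" for j
    using in_L2_tpoly[OF L] in_L2_box_integrable[OF L] unfolding S_def in_L2_box_def by auto
  have h1: "(LINT x|boxm L. cmod (h j x)) \<le> (1/2) ^ j * ((c + 1) / 2)" for j
  proof -
    have "(LINT x|boxm L. cmod (h j x)) \<le> (LINT x|boxm L. ((1/2) ^ j + 2 ^ j * (cmod (h j x))\<^sup>2) / 2)"
    proof (rule integral_mono)
      fix x
      \<comment> \<open>The balance \<open>2^j\<close> in this quadratic inequality trades the
        constant term, integrated over a box of finite volume, against the squared
        increment.\<close>
      have "0 \<le> (1 - 2 ^ j * cmod (h j x))\<^sup>2 / 2 ^ j" by simp
      also have "\<dots> = (1/2) ^ j + 2 ^ j * (cmod (h j x))\<^sup>2 - 2 * cmod (h j x)"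
        by (simp add: power2_eq_square field_simps)
      finally show "cmod (h j x) \<le> ((1/2) ^ j + 2 ^ j * (cmod (h j x))\<^sup>2) / 2" by simp
    qed (use h_int h2_int in auto)
    also have "\<dots> = ((1/2) ^ j * c + 2 ^ j * (LINT x|boxm L. (cmod (h j x))\<^sup>2)) / 2"
      using h2_int by (simp add: measure_boxm[OF L] c_def)
    also have "(LINT x|boxm L. (cmod (h j x))\<^sup>2) = sum al {M j..<M (Suc j)}" unfolding h_def by (rule nt) simp
    also have "sum al {M j..<M (Suc j)} \<le> (1/4) ^ j" using N[OF MN, of j "M (Suc j)"] by simp
    also have "((1/2) ^ j * c + 2 ^ j * (1/4) ^ j) / 2 = (1/2) ^ j * ((c + 1) / 2)"
    proof -
      have "2 ^ j * (1/4) ^ j = (1/2 :: real) ^ j" by (simp flip: power_mult_distrib)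
      then show ?thesis by (simp add: field_simps)
    qed
    finally show ?thesis by simp
  qed
  have sh: "summable (\<lambda>j. LINT x|boxm L. norm (h j x))"
  proof (rule summable_comparison_test'[of _ 0])
    show "summable (\<lambda>j. (1/2 :: real) ^ j * ((c + 1) / 2))" by (intro summable_mult2 summable_geometric) simp
    show "norm (LINT x|boxm L. norm (h j x)) \<le> (1/2) ^ j * ((c + 1) / 2)" for j
      using h1[of j] by (simp add: Bochner_Integration.integral_nonneg)
  qed
  have ae: "AE x in boxm L. summable (\<lambda>j. norm (h j x))" by (rule AE_summable_of_summable_integral[OF h_int sh])
  have Ssum: "S J x = S 0 x + (\<Sum>j<J. h j x)" for J x by (induction J) (auto simp: Sh)
  define g where "g x = lim (\<lambda>j. S j x)" for x
  define w where "w x = cmod (S 0 x) + (\<Sum>j. cmod (h j x))" for x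
  have g_m [measurable]: "g \<in> borel_measurable (boxm L)" unfolding g_def by (rule borel_measurable_lim_metric) simp
  have w_int: "integrable (boxm L) w"
    unfolding w_def
  proof (intro Bochner_Integration.integrable_add integrable_norm S_int integrable_suminf)
    show "AE x in boxm L. summable (\<lambda>j. norm (cmod (h j x)))" using ae by simp
    show "summable (\<lambda>j. LINT x|boxm L. norm (cmod (h j x)))" using sh by simp
  qed (rule h_int)
  have lim: "AE x in boxm L. (\<lambda>j. S j x) \<longlonglongrightarrow> g x"
    using ae
  proof eventually_elim
    case (elim x)
    then have "summable (\<lambda>j. h j x)" by (rule summable_norm_cancel)
    then have "(\<lambda>J. S 0 x + (\<Sum>j<J. h j x)) \<longlonglongrightarrow> S 0 x + (\<Sum>j. h j x)"
      by (intro tendsto_intros) (simp add: summable_LIMSEQ)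
    then have "(\<lambda>J. S J x) \<longlonglongrightarrow> S 0 x + (\<Sum>j. h j x)" by (subst Ssum)
    then have "convergent (\<lambda>J. S J x)" by (rule convergentI)
    then show ?case unfolding g_def by (simp add: convergent_LIMSEQ_iff)
  qed
  have dom: "AE x in boxm L. cmod (S J x) \<le> w x" for J
    using ae
  proof eventually_elim
    case (elim x)
    have "cmod (S J x) \<le> cmod (S 0 x) + cmod (\<Sum>j<J. h j x)" unfolding Ssum[of J] by (rule norm_triangle_ineq)
    also have "cmod (\<Sum>j<J. h j x) \<le> (\<Sum>j<J. cmod (h j x))" by (rule norm_sum)
    also have "\<dots> \<le> (\<Sum>j. cmod (h j x))" by (rule sum_le_suminf[OF elim]) auto
    finally show ?case by (simp add: w_def)
  qed
  have coef: "fcoef L g k = a k" for k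
  proof -
    have "(\<lambda>J. fcoef L (S J) k) \<longlonglongrightarrow> fcoef L g k"
      unfolding fcoef_ek
    proof (rule integral_dominated_convergence[where w = w])
      show "AE x in boxm L. (\<lambda>i. ek L (- k) x * S i x) \<longlonglongrightarrow> ek L (- k) x * g x"
        using lim by eventually_elim (intro tendsto_intros)
      show "AE x in boxm L. cmod (ek L (- k) x * S i x) \<le> w x" for i
        using dom[of i] by eventually_elim (simp add: norm_mult)
    qed (use w_int in measurable)
    moreover have "eventually (\<lambda>J. fcoef L (S J) k = a k) sequentially"
    proof -
      obtain n where n: "k = e n" using surj_e by auto
      show ?thesis using eventually_gt_at_top[of n]
      proof eventually_elim
        case (elim J)
        then have "k \<in> e ` {..<M J}" using Mj[of J] n by auto
        then show ?case unfolding S_def by (subst fcoef_tpoly[OF L]) auto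
      qed
    qed
    then have "(\<lambda>J. fcoef L (S J) k) \<longlonglongrightarrow> a k" by (rule tendsto_eventually)
    ultimately show ?thesis by (rule LIMSEQ_unique)
  qed
  have fat: "(\<integral>\<^sup>+x. ennreal ((cmod (g x))\<^sup>2) \<partial>boxm L) \<le> ennreal A"
  proof -
    have "(\<integral>\<^sup>+x. ennreal ((cmod (g x))\<^sup>2) \<partial>boxm L) = (\<integral>\<^sup>+x. liminf (\<lambda>j. ennreal ((cmod (S j x))\<^sup>2)) \<partial>boxm L)"
    proof (rule nn_integral_cong_AE)
      show "AE x in boxm L. ennreal ((cmod (g x))\<^sup>2) = liminf (\<lambda>j. ennreal ((cmod (S j x))\<^sup>2))"
        using lim
      proof eventually_elim
        case (elim x)
        then have "(\<lambda>j. ennreal ((cmod (S j x))\<^sup>2)) \<longlonglongrightarrow> ennreal ((cmod (g x))\<^sup>2)"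
          by (intro tendsto_ennrealI tendsto_intros)
        then show ?case by (rule lim_imp_Liminf[OF trivial_limit_sequentially, symmetric])
      qed
    qed
    also have "\<dots> \<le> liminf (\<lambda>j. \<integral>\<^sup>+x. ennreal ((cmod (S j x))\<^sup>2) \<partial>boxm L)"
      by (rule nn_integral_liminf) auto
    also have "\<dots> \<le> liminf (\<lambda>j. ennreal A)"
    proof (rule Liminf_mono, rule always_eventually, rule allI)
      fix j
      have "(\<integral>\<^sup>+x. ennreal ((cmod (S j x))\<^sup>2) \<partial>boxm L) = ennreal (LINT x|boxm L. (cmod (S j x))\<^sup>2)"
        by (rule nn_integral_eq_integral[OF S2_int]) auto
      also have "\<dots> \<le> ennreal A" unfolding S_def using sumA by (subst nt) (auto intro: ennreal_leI)
      finally show "(\<integral>\<^sup>+x. ennreal ((cmod (S j x))\<^sup>2) \<partial>boxm L) \<le> ennreal A" .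
    qed
    finally show ?thesis by (simp add: Liminf_const)
  qed
  have g2: "integrable (boxm L) (\<lambda>x. (cmod (g x))\<^sup>2)"
    by (rule integrableI_bounded) (use fat in \<open>auto intro: le_less_trans\<close>)
  show ?thesis
  proof (rule that)
    show "in_L2_box L g" using g2 by (simp add: in_L2_box_def)
    show "fcoef L g k = a k" for k by (rule coef)
    show "(LINT x|boxm L. (cmod (g x))\<^sup>2) \<le> (LINT k|latm L. (cmod (a k))\<^sup>2)"
      using fat nn_integral_eq_integral[OF g2] A0 unfolding A_def[symmetric] by simp
  qed
qed

text \<open>\<open>Riesz_Fischer\<close> provides a function with the same coefficients whose norm
  is at most that of the coefficients; completeness of the characters identifies it with
  \<open>f\<close>, which reverses the Bessel inequality.\<close>

lemma Parseval_norm: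
  fixes f :: "real^'d \<Rightarrow> complex"
  assumes L: "L > 0" and f: "in_L2_box L f"
  shows "(LINT x|boxm L. (cmod (f x))\<^sup>2) = (LINT k|latm L. (cmod (fcoef L f k))\<^sup>2)"
proof -
  obtain g where g: "in_L2_box L g" "\<And>k. fcoef L g k = fcoef L f k"
    "(LINT x|boxm L. (cmod (g x))\<^sup>2) \<le> (LINT k|latm L. (cmod (fcoef L f k))\<^sup>2)"
    using Riesz_Fischer[OF L Bessel(1)[OF L f]] by blast
  have i: "integrable (boxm L) f" "integrable (boxm L) (\<lambda>x. (-1) * g x)"
    using in_L2_box_integrable[OF L] f g by auto
  have "AE x in boxm L. f x + (-1) * g x = 0"
  proof (rule fcoef_zero_imp_AE_zero[OF L])
    show "integrable (boxm L) (\<lambda>x. f x + (-1) * g x)" by (rule Bochner_Integration.integrable_add[OF i])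
    show "fcoef L (\<lambda>x. f x + (-1) * g x) k = 0" for k
      unfolding fcoef_add[OF i] fcoef_scale g(2) by simp
  qed
  then have "AE x in boxm L. (cmod (f x))\<^sup>2 = (cmod (g x))\<^sup>2" by eventually_elim simp
  then have "(LINT x|boxm L. (cmod (f x))\<^sup>2) = (LINT x|boxm L. (cmod (g x))\<^sup>2)"
    using f g(1) by (intro integral_cong_AE) (auto simp: in_L2_box_def)
  with g(3) Bessel(2)[OF L f] show ?thesis by simp
qed

lemma polarization: "cnj x * y = (of_real ((cmod (x + y))\<^sup>2) - of_real ((cmod (x + (-1) * y))\<^sup>2)
    + \<i> * (of_real ((cmod (x + (-\<i>) * y))\<^sup>2) - of_real ((cmod (x + \<i> * y))\<^sup>2))) / 4"
  unfolding cmod_power2 by (simp add: complex_eq_iff power2_eq_square algebra_simps)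

lemma integral_polarization:
  fixes f g :: "'a \<Rightarrow> complex"
  assumes [measurable]: "f \<in> borel_measurable M" "g \<in> borel_measurable M"
    and f: "integrable M (\<lambda>x. (cmod (f x))\<^sup>2)" and g: "integrable M (\<lambda>x. (cmod (g x))\<^sup>2)"
  defines "N \<equiv> \<lambda>c. complex_of_real (LINT x|M. (cmod (f x + c * g x))\<^sup>2)"
  shows "(LINT x|M. cnj (f x) * g x) = (N 1 - N (-1) + \<i> * (N (-\<i>) - N \<i>)) / 4"
proof -
  have i: "integrable M (\<lambda>x. complex_of_real ((cmod (f x + c * g x))\<^sup>2))" for c
    by (intro integrable_of_real integrable_add_L2 f integrable_scale_L2 g) auto
  have N: "N c = (LINT x|M. complex_of_real ((cmod (f x + c * g x))\<^sup>2))" for c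
    unfolding N_def by (rule integral_complex_of_real[symmetric])
  show ?thesis
    unfolding polarization N using i[of 1] i[of "-1"] i[of "-\<i>"] i[of \<i>]
    by (simp del: of_real_power)
qed

text \<open>Polarization of the norm identity, carried out on both sides with the same four
  combinations of \<open>f\<close> and \<open>g\<close>.\<close>

lemma Parseval_inner:
  fixes f g :: "real^'d \<Rightarrow> complex"
  assumes L: "L > 0" and f: "in_L2_box L f" and g: "in_L2_box L g"
  shows "inner_L L f g = (LINT k|latm L. cnj (fcoef L f k) * fcoef L g k)"
proof -
  have i: "integrable (boxm L) f" "integrable (boxm L) (\<lambda>x. c * g x)" for c
    using in_L2_box_integrable[OF L] f g by auto
  have *: "(LINT x|boxm L. (cmod (f x + c * g x))\<^sup>2) = (LINT k|latm L. (cmod (fcoef L f k + c * fcoef L g k))\<^sup>2)" for c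
    unfolding Parseval_norm[OF L in_L2_box_add[OF f in_L2_box_scale[OF g]]] fcoef_add[OF i] fcoef_scale ..
  have "inner_L L f g = (LINT x|boxm L. cnj (f x) * g x)" by (simp add: inner_L_def)
  also have "\<dots> = (LINT k|latm L. cnj (fcoef L f k) * fcoef L g k)"
  proof -
    have "(LINT x|boxm L. cnj (f x) * g x) = (complex_of_real (LINT x|boxm L. (cmod (f x + 1 * g x))\<^sup>2)
       - of_real (LINT x|boxm L. (cmod (f x + (-1) * g x))\<^sup>2) + \<i> * (of_real (LINT x|boxm L. (cmod (f x + (-\<i>) * g x))\<^sup>2)
       - of_real (LINT x|boxm L. (cmod (f x + \<i> * g x))\<^sup>2))) / 4"
      using f g by (intro integral_polarization) (auto simp: in_L2_box_def)
    also have "\<dots> = (LINT k|latm L. cnj (fcoef L f k) * fcoef L g k)"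
      unfolding * using Bessel(1)[OF L f] Bessel(1)[OF L g]
      by (intro integral_polarization[symmetric]) auto
    finally show ?thesis .
  qed
  finally show ?thesis .
qed

section \<open>The free resolvent as a Fourier multiplier\<close>

lemma norm_resolvent_le:
  assumes "Im z \<noteq> 0" shows "cmod (1 / (of_real t - z)) \<le> 1 / \<bar>Im z\<bar>"
proof -
  have "\<bar>Im z\<bar> \<le> cmod (of_real t - z)" using abs_Im_le_cmod[of "of_real t - z"] by simp
  then show ?thesis using assms by (simp add: norm_divide frac_le)
qed

text \<open>\<open>resolv\<close> chooses a function with prescribed coefficients. One exists by
  \<open>Riesz_Fischer\<close>, because off the real axis the multiplier is bounded by
  \<open>1 / |Im z|\<close>. These two facts are the interface through which the resolvent is
  used.\<close>

lemma resolv: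
  fixes f :: "real^'d \<Rightarrow> complex"
  assumes L: "L > 0" and z: "Im z \<noteq> 0" and f: "in_L2_box L f"
  shows "in_L2_box L (resolv L z f)"
    and "fcoef L (resolv L z f) k = fcoef L f k / (of_real (nu (dual_pt L k)) - z)"
proof -
  let ?a = "\<lambda>k. fcoef L f k / (of_real (nu (dual_pt L k)) - z)"
  have "integrable (latm L) (\<lambda>k. (cmod (?a k))\<^sup>2)"
  proof (rule Bochner_Integration.integrable_bound)
    show "integrable (latm L) (\<lambda>k. (1 / \<bar>Im z\<bar>)\<^sup>2 * (cmod (fcoef L f k))\<^sup>2)"
      using Bessel(1)[OF L f] by auto
    have "(cmod (?a k))\<^sup>2 \<le> (1 / \<bar>Im z\<bar>)\<^sup>2 * (cmod (fcoef L f k))\<^sup>2" for k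
    proof -
      have "cmod (?a k) = cmod (1 / (of_real (nu (dual_pt L k)) - z)) * cmod (fcoef L f k)" by (simp add: norm_divide)
      also have "\<dots> \<le> 1 / \<bar>Im z\<bar> * cmod (fcoef L f k)" by (intro mult_right_mono norm_resolvent_le z) auto
      finally show ?thesis by (metis norm_ge_zero power_mono power_mult_distrib)
    qed
    then show "AE k in latm L. norm ((cmod (?a k))\<^sup>2) \<le> norm ((1 / \<bar>Im z\<bar>)\<^sup>2 * (cmod (fcoef L f k))\<^sup>2)"
      by (intro AE_I2) (auto intro: order_trans)
  qed simp
  then obtain g where "in_L2_box L g" "\<And>k. fcoef L g k = ?a k" by (rule Riesz_Fischer[OF L]) blast
  then have "\<exists>g. in_L2_box L g \<and> (\<forall>k. fcoef L g k = ?a k)" by blast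
  from someI_ex[OF this] show "in_L2_box L (resolv L z f)" "fcoef L (resolv L z f) k = ?a k"
    unfolding resolv_def by blast+
qed

section \<open>Measurability and Fubini on products of lattices\<close>

lemma borel_measurable_discrete_pair:
  fixes f :: "'a \<times> 'b \<Rightarrow> 'c::topological_space"
  assumes M: "sets M = Pow A" "countable A" and f: "\<And>x. x \<in> A \<Longrightarrow> (\<lambda>y. f (x, y)) \<in> borel_measurable N"
  shows "f \<in> borel_measurable (M \<Otimes>\<^sub>M N)"
proof -
  have "sets (M \<Otimes>\<^sub>M N) = sets (count_space A \<Otimes>\<^sub>M N)"
    by (intro sets_pair_measure_cong) (auto simp: M)
  from measurable_cong_sets[OF this refl] show ?thesis
    using measurable_pair_measure_countable1[OF M(2) f] by blast
qed

lemma sets_PiM_latm: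
  assumes "finite I" shows "sets (PiM I (\<lambda>_. latm L :: (int^'d) measure)) = Pow (PiE I (\<lambda>_. UNIV))"
proof -
  have "sets (PiM I (\<lambda>_. latm L :: (int^'d) measure)) = sets (PiM I (\<lambda>_. count_space (UNIV :: (int^'d) set)))"
    by (intro sets_PiM_cong) auto
  also have "\<dots> = Pow (PiE I (\<lambda>_. UNIV))" using assms by (subst count_space_PiM_finite) auto
  finally show ?thesis .
qed

lemma borel_measurable_PiM_latm:
  fixes f :: "('i \<Rightarrow> int^'d) \<Rightarrow> 'c::topological_space"
  assumes "finite I" shows "f \<in> borel_measurable (PiM I (\<lambda>_. latm L))"
proof (rule measurableI)
  fix A assume "A \<in> sets (borel :: 'c measure)"
  show "f -` A \<inter> space (PiM I (\<lambda>_. latm L)) \<in> sets (PiM I (\<lambda>_. latm L))"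
    unfolding sets_PiM_latm[OF assms] by (auto simp: space_PiM)
qed simp

lemma borel_measurable_PiM_latm_pair:
  fixes f :: "('i \<Rightarrow> int^'d) \<times> 'b \<Rightarrow> 'c::topological_space"
  assumes "finite I" "\<And>x. x \<in> PiE I (\<lambda>_. UNIV) \<Longrightarrow> (\<lambda>y. f (x, y)) \<in> borel_measurable N"
  shows "f \<in> borel_measurable (PiM I (\<lambda>_. latm L) \<Otimes>\<^sub>M N)"
  by (rule borel_measurable_discrete_pair[OF sets_PiM_latm[OF assms(1)]]) (auto intro: countable_PiE assms)

lemma borel_measurable_latm_pair:
  fixes f :: "(int^'d) \<times> 'b \<Rightarrow> 'c::topological_space"
  assumes "\<And>x. (\<lambda>y. f (x, y)) \<in> borel_measurable N"
  shows "f \<in> borel_measurable (latm L \<Otimes>\<^sub>M N)"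
  by (rule borel_measurable_discrete_pair[where A = UNIV]) (auto intro: assms)

lemma (in pair_sigma_finite) integrable_fst_mult_snd:
  fixes f g :: "_ \<Rightarrow> complex"
  assumes f: "integrable M1 f" and g: "integrable M2 g"
  shows "integrable (M1 \<Otimes>\<^sub>M M2) (\<lambda>(x, y). f x * g y)"
proof (rule Fubini_integrable)
  have [measurable]: "f \<in> borel_measurable M1" "g \<in> borel_measurable M2" using f g by auto
  show "(\<lambda>(x, y). f x * g y) \<in> borel_measurable (M1 \<Otimes>\<^sub>M M2)" by measurable
  show "integrable M1 (\<lambda>x. LINT y|M2. norm (case (x, y) of (x, y) \<Rightarrow> f x * g y))"
    using f by (simp add: norm_mult integrable_norm)
  show "AE x in M1. integrable M2 (\<lambda>y. case (x, y) of (x, y) \<Rightarrow> f x * g y)"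
    using g by simp
qed

text \<open>Fubini with the new coordinate outermost: this is the order in which the recursion for
  the chain adds a momentum transfer.\<close>

lemma (in product_sigma_finite) product_integral_insert_outer:
  fixes f :: "_ \<Rightarrow> _::{banach, second_countable_topology}"
  assumes I: "finite I" "i \<notin> I" and f: "integrable (Pi\<^sub>M (insert i I) M) f"
  shows "integral\<^sup>L (Pi\<^sub>M (insert i I) M) f = (\<integral>x. (\<integral>y. f (y(i := x)) \<partial>Pi\<^sub>M I M) \<partial>M i)"
proof -
  interpret I: finite_product_sigma_finite M I by standard fact
  have ins: "insert i I = {i} \<union> I" by simp
  have [measurable]: "f \<in> borel_measurable (Pi\<^sub>M (insert i I) M)" using f by auto
  have "integral\<^sup>L (Pi\<^sub>M (insert i I) M) f = (\<integral>x. (\<integral>y. f (merge {i} I (x, y)) \<partial>Pi\<^sub>M I M) \<partial>Pi\<^sub>M {i} M)"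
    unfolding ins using I f by (intro product_integral_fold) auto
  also have "\<dots> = (\<integral>x. (\<integral>y. f (y(i := x i)) \<partial>Pi\<^sub>M I M) \<partial>Pi\<^sub>M {i} M)"
  proof (intro Bochner_Integration.integral_cong refl)
    fix x y assume "x \<in> space (Pi\<^sub>M {i} M)" "y \<in> space (Pi\<^sub>M I M)"
    then have "merge {i} I (x, y) = y(i := x i)" using I
      by (auto simp: merge_def space_PiM PiE_def extensional_def fun_eq_iff)
    then show "f (merge {i} I (x, y)) = f (y(i := x i))" by simp
  qed
  also have "\<dots> = (\<integral>x. (\<integral>y. f (y(i := x)) \<partial>Pi\<^sub>M I M) \<partial>M i)"
  proof (rule product_integral_singleton[where f = "\<lambda>x. \<integral>y. f (y(i := x)) \<partial>Pi\<^sub>M I M"])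
    have "(\<lambda>(x, y). y(i := x)) \<in> measurable (M i \<Otimes>\<^sub>M Pi\<^sub>M I M) (Pi\<^sub>M (insert i I) M)"
      unfolding case_prod_beta by (rule measurable_fun_upd[where J = I]) auto
    then have "(\<lambda>(x, y). f (y(i := x))) \<in> borel_measurable (M i \<Otimes>\<^sub>M Pi\<^sub>M I M)"
      using measurable_compose[of "\<lambda>(x, y). y(i := x)" _ _ f] by (simp add: case_prod_beta)
    then show "(\<lambda>x. \<integral>y. f (y(i := x)) \<partial>Pi\<^sub>M I M) \<in> borel_measurable (M i)"
      by (intro I.borel_measurable_lebesgue_integral)
  qed
  finally show ?thesis .
qed

section \<open>Periodization and the Fourier series of the potential\<close>

lemma wrap_shift: "L > 0 \<Longrightarrow> wrap L (t + L * of_int k) = wrap L t"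
proof -
  assume "L > 0"
  then have "(t + L * of_int k) / L + 1 / 2 = t / L + 1 / 2 + of_int k" by (simp add: field_simps)
  then have "\<lfloor>(t + L * of_int k) / L + 1 / 2\<rfloor> = \<lfloor>t / L + 1 / 2\<rfloor> + k" by (simp only: floor_add_int)
  then show ?thesis by (simp add: wrap_def algebra_simps)
qed

lemma wrap_id: "L > 0 \<Longrightarrow> -L/2 \<le> t \<Longrightarrow> t < L/2 \<Longrightarrow> wrap L t = t"
proof -
  assume "L > 0" "-L/2 \<le> t" "t < L/2"
  then have "\<lfloor>t / L + 1 / 2\<rfloor> = 0" by (intro floor_unique) (auto simp: field_simps)
  then show ?thesis by (simp add: wrap_def)
qed

lemma wrap_range: assumes "L > 0" shows "wrap L t \<in> {-L/2..<L/2}"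
proof -
  define n where "n = \<lfloor>t / L + 1 / 2\<rfloor>"
  have "of_int n \<le> t / L + 1 / 2" "t / L + 1 / 2 < of_int n + 1" unfolding n_def by linarith+
  then have "L * of_int n \<le> L * (t / L + 1 / 2)" "L * (t / L + 1 / 2) < L * (of_int n + 1)"
    using assms by (auto intro: mult_left_mono mult_strict_left_mono)
  then show ?thesis using assms unfolding wrap_def n_def[symmetric] by (auto simp: distrib_left)
qed

lemma per_id: "L > 0 \<Longrightarrow> x \<in> box_L L \<Longrightarrow> per L h x = h x"
  unfolding per_def by (rule arg_cong[of _ _ h]) (auto simp: vec_eq_iff box_L_iff intro!: wrap_id)

lemma vec_borel_measurable:
  fixes f :: "'a \<Rightarrow> real^'d"
  assumes "\<And>i. (\<lambda>x. f x $ i) \<in> borel_measurable M"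
  shows "f \<in> borel_measurable M"
proof (subst borel_measurable_euclidean_space, safe)
  fix b :: "real^'d" assume "b \<in> Basis"
  then obtain i where "b = axis i 1" by (auto simp: Basis_vec_range)
  then show "(\<lambda>x. f x \<bullet> b) \<in> borel_measurable M" using assms by (simp add: inner_axis)
qed

lemma per_borel:
  assumes "h \<in> borel_measurable borel" shows "per L (h :: real^'d \<Rightarrow> 'b::topological_space) \<in> borel_measurable borel"
proof -
  have "(\<lambda>x::real^'d. \<chi> i. wrap L (x $ i)) \<in> borel_measurable borel"
    by (rule vec_borel_measurable) (simp add: wrap_def)
  then show ?thesis unfolding per_def[abs_def] using assms by (rule measurable_compose)
qed

lemma fcoef_cong: "(\<And>x. x \<in> box_L L \<Longrightarrow> f x = g x) \<Longrightarrow> fcoef L f k = fcoef L g k"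
  unfolding fcoef_def by (intro Bochner_Integration.integral_cong) (auto simp: space_restrict_space)

lemma in_L2_box_cong: "(\<And>x. x \<in> box_L L \<Longrightarrow> f x = g x) \<Longrightarrow> in_L2_box L f \<longleftrightarrow> in_L2_box L g"
  unfolding in_L2_box_def
  by (intro arg_cong2[of _ _ _ _ "(\<and>)"] measurable_cong Bochner_Integration.integrable_cong) (auto simp: space_restrict_space)

lemma in_L2_imp_box: "in_L2 \<psi> \<Longrightarrow> in_L2_box L \<psi>"
  unfolding in_L2_def in_L2_box_def integrable_boxm_iff
  by (intro conjI measurable_restrict_space1 integrable_mult_indicator) auto

text \<open>Fourier coefficients of the truncated potential; on \<open>box_L L\<close> it agrees with its periodization.\<close>
definition bL :: "real \<Rightarrow> (real^'d \<Rightarrow> real) \<Rightarrow> int^'d \<Rightarrow> complex" where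
  "bL L B = fcoef L (\<lambda>x. of_real (B x))"

text \<open>Summability makes the series an integrable function whose coefficients are computed by
  Fubini. They agree with those of \<open>f\<close>, and completeness of the characters finishes the
  argument.\<close>

lemma fourier_series_AE:
  fixes f :: "real^'d \<Rightarrow> complex"
  assumes L: "L > 0" and f: "integrable (boxm L) f" and b: "integrable (latm L) (fcoef L f)"
  shows "AE x in boxm L. f x = (LINT k|latm L. fcoef L f k * ek L k x)"
proof -
  interpret bm: finite_measure "boxm L :: (real^'d) measure" by (rule finite_measure_boxm[OF L])
  interpret lm: sigma_finite_measure "latm L :: (int^'d) measure" by (rule sigma_finite_latm[OF L])
  interpret P: pair_sigma_finite "latm L :: (int^'d) measure" "boxm L :: (real^'d) measure" ..
  let ?a = "fcoef L f"
  define g where "g x = (LINT k|latm L. ?a k * ek L k x)" for x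
  have int: "integrable (latm L \<Otimes>\<^sub>M boxm L) (\<lambda>(k, x). ?a k * ek L k x * ek L l x)" for l
  proof -
    have "integrable (latm L \<Otimes>\<^sub>M boxm L) (\<lambda>p. (case p of (k, x) \<Rightarrow> ?a k * 1) * (ek L (fst p) (snd p) * ek L l (snd p)))"
    proof (rule integrable_mult_bounded[where C = 1])
      show "integrable (latm L \<Otimes>\<^sub>M (boxm L :: (real^'d) measure)) (\<lambda>(k, x). ?a k * 1)"
        using P.integrable_fst_mult_snd[OF b, of "\<lambda>_. 1"] by (simp add: case_prod_unfold)
      show "(\<lambda>p. ek L (fst p) (snd p) * ek L l (snd p)) \<in> borel_measurable (latm L \<Otimes>\<^sub>M boxm L)"
        by (rule borel_measurable_latm_pair) (auto intro!: borel_measurable_times)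
    qed (auto simp: norm_mult)
    then show ?thesis by (simp add: case_prod_unfold mult.assoc)
  qed
  have g_int: "integrable (boxm L) g"
    using P.integrable_snd[OF int[of 0]] by (simp add: g_def[abs_def])
  have gc: "fcoef L g l = ?a l" for l
  proof -
    have "fcoef L g l = (LINT x|boxm L. LINT k|latm L. ?a k * ek L k x * ek L (-l) x)"
      unfolding fcoef_ek g_def
      by (intro Bochner_Integration.integral_cong refl) (simp add: mult.commute[of "ek L (-l) _"] flip: integral_mult_left_zero)
    also have "\<dots> = (LINT k|latm L. LINT x|boxm L. ?a k * ek L k x * ek L (-l) x)"
      by (rule P.Fubini_integral[OF int])
    also have "\<dots> = (LINT k|latm L. ?a k * (if k = l then of_real (L ^ CARD('d)) else 0))"
      unfolding mult.assoc ek_add[symmetric]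
      by (intro Bochner_Integration.integral_cong refl) (simp add: integral_ek[OF L])
    also have "\<dots> = ?a l"
      using L unfolding integral_latm[OF L]
      by (subst lebesgue_integral_count_space_finite_support) (auto simp: if_distrib scaleR_conv_of_real field_simps cong: if_cong)
    finally show ?thesis .
  qed
  have i: "integrable (boxm L) (\<lambda>x. (-1) * g x)" using g_int by auto
  have "AE x in boxm L. f x + (-1) * g x = 0"
  proof (rule fcoef_zero_imp_AE_zero[OF L])
    show "integrable (boxm L) (\<lambda>x. f x + (-1) * g x)" by (rule Bochner_Integration.integrable_add[OF f i])
    show "fcoef L (\<lambda>x. f x + (-1) * g x) k = 0" for k
      unfolding fcoef_add[OF f i] fcoef_scale gc by simp
  qed
  then show ?thesis by eventually_elim (simp add: g_def)
qed

lemma AE_lborel_translate: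
  assumes P: "AE x in lborel. P (x::real^'d)" and [measurable]: "{x. P x} \<in> sets borel"
  shows "AE x in lborel. P (x + a)"
proof -
  have "AE x in distr lborel borel ((+) a). P x" using P by (subst lborel_distr_plus)
  then show ?thesis by (subst (asm) AE_distr_iff) (auto simp: add.commute)
qed

text \<open>The countably many translates of the box by \<open>L\<close> times integer vectors cover
  space, so a periodic function inherits the exceptional null set of one cell. The shift
  \<open>a\<close> is there for the scatterer position.\<close>

lemma AE_box_periodic:
  fixes D :: "real^'d \<Rightarrow> complex"
  assumes L: "L > 0" and [measurable]: "D \<in> borel_measurable borel"
    and per: "\<And>x k. D (x + (\<chi> i. L * of_int (k $ i))) = D x"
    and ae: "AE x in boxm L. D x = 0"
  shows "AE x in lborel. D (x + a) = 0"
proof (rule AE_lborel_translate)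
  let ?s = "\<lambda>k::int^'d. (\<chi> i. L * of_int (k $ i)) :: real^'d"
  have "AE x in lborel. x + ?s k \<in> box_L L \<longrightarrow> D (x + ?s k) = 0" for k
    using ae unfolding AE_boxm_iff by (rule AE_lborel_translate) measurable
  then have "AE x in lborel. \<forall>k. x + ?s k \<in> box_L L \<longrightarrow> D (x + ?s k) = 0"
    by (simp add: AE_all_countable)
  then show "AE x in lborel. D x = 0"
  proof eventually_elim
    case (elim x)
    let ?k = "\<chi> i. - \<lfloor>x $ i / L + 1 / 2\<rfloor> :: int^'d"
    have "x + ?s ?k \<in> box_L L" using wrap_range[OF L] by (auto simp: box_L_iff wrap_def)
    with elim have "D (x + ?s ?k) = 0" by blast
    then show ?case by (simp only: per)
  qed
  show "{x. D x = 0} \<in> sets borel" by measurable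
qed

lemma ek_periodic: "L > 0 \<Longrightarrow> ek L k (x + (\<chi> i. L * of_int (l $ i))) = ek L k x"
proof -
  assume L: "L > 0"
  have "dual_pt L k \<bullet> (\<chi> i. L * of_int (l $ i)) = of_int (\<Sum>i\<in>UNIV. k $ i * l $ i)"
    using L by (simp add: inner_vec_def dual_pt_def)
  then show ?thesis
    by (simp add: ek_def inner_add_right distrib_left cis_mult[symmetric] cis_multiple_2pi del: of_int_sum)
qed

text \<open>On the box the periodization is \<open>B\<close> and equals its series; both sides are
  periodic, so the equality survives the shift by \<open>y\<close>.\<close>

lemma per_AE_series:
  fixes B :: "real^'d \<Rightarrow> real"
  assumes L: "L > 0" and B [measurable]: "B \<in> borel_measurable borel" and Bb: "\<And>x. \<bar>B x\<bar> \<le> C"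
    and b: "integrable (latm L) (bL L B)"
  shows "AE x in boxm L. of_real (per L B (x - y)) = (LINT k|latm L. bL L B k * ek L k (x - y))"
proof -
  interpret lm: sigma_finite_measure "latm L :: (int^'d) measure" by (rule sigma_finite_latm[OF L])
  have i: "integrable (boxm L) (\<lambda>x. complex_of_real (B x))"
    by (rule integrable_boxm_bounded[OF L, where C = C]) (use Bb in auto)
  define D where "D x = of_real (per L B x) - (LINT k|latm L. bL L B k * ek L k x)" for x
  have Dm: "D \<in> borel_measurable borel"
  proof -
    have "(\<lambda>(x, k). bL L B k * ek L k x) \<in> borel_measurable (borel \<Otimes>\<^sub>M latm L)"
      unfolding case_prod_beta
      by (subst measurable_pair_swap_iff) (rule borel_measurable_latm_pair, simp)
    then have "(\<lambda>x. LINT k|latm L. bL L B k * ek L k x) \<in> borel_measurable borel"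
      by (intro lm.borel_measurable_lebesgue_integral)
    then show ?thesis unfolding D_def using per_borel[OF B, of L] by measurable
  qed
  have Dp: "D (x + (\<chi> i. L * of_int (k $ i))) = D x" for x k
    using L by (simp add: D_def per_def ek_periodic wrap_shift)
  have D0: "AE x in boxm L. D x = 0"
    using fourier_series_AE[OF L i] b unfolding bL_def[symmetric] AE_boxm_iff
    by (auto simp: D_def per_id[OF L] elim!: eventually_mono)
  have "AE x in lborel. D (x + (- y)) = 0" by (rule AE_box_periodic[OF L Dm Dp D0])
  then show ?thesis unfolding AE_boxm_iff by eventually_elim (simp add: D_def)
qed

lemma pot_borel:
  assumes "B \<in> borel_measurable borel" shows "pot L B m ys vs \<in> borel_measurable borel"
proof -
  have [measurable]: "per L B \<in> borel_measurable borel" by (rule per_borel[OF assms])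
  show ?thesis unfolding pot_def[abs_def] by measurable
qed

lemma pot_bounded:
  assumes "\<And>x. \<bar>B x\<bar> \<le> C" shows "cmod (pot L B m ys vs x) \<le> (\<Sum>g<m. \<bar>vs g\<bar> * C)"
proof -
  have "cmod (pot L B m ys vs x) = \<bar>\<Sum>g<m. vs g * per L B (x - ys g)\<bar>" unfolding pot_def by (rule norm_of_real)
  also have "\<dots> \<le> (\<Sum>g<m. \<bar>vs g * per L B (x - ys g)\<bar>)" by (rule sum_abs)
  also have "\<dots> \<le> (\<Sum>g<m. \<bar>vs g\<bar> * C)" unfolding abs_mult
    by (intro sum_mono mult_left_mono) (auto simp: per_def assms)
  finally show ?thesis .
qed

text \<open>Multiplication becomes convolution on the dual lattice, and a scatterer at
  \<open>y\<close> attaches the phase \<open>ek L (- u) y\<close> to the transfer \<open>u\<close>.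
  Summability of \<open>bL L B\<close> and integrability of \<open>f\<close> justify Fubini.\<close>

lemma fcoef_pot_mult:
  fixes B :: "real^'d \<Rightarrow> real"
  assumes L: "L > 0" and B [measurable]: "B \<in> borel_measurable borel" and Bb: "\<And>x. \<bar>B x\<bar> \<le> C"
    and b: "integrable (latm L) (bL L B)" and f: "integrable (boxm L) f"
  shows "fcoef L (\<lambda>x. pot L B m ys vs x * f x) k =
     (\<Sum>g<m. of_real (vs g) * (LINT u|latm L. bL L B u * ek L (-u) (ys g) * fcoef L f (k - u)))"
proof -
  interpret bm: finite_measure "boxm L :: (real^'d) measure" by (rule finite_measure_boxm[OF L])
  interpret lm: sigma_finite_measure "latm L :: (int^'d) measure" by (rule sigma_finite_latm[OF L])
  interpret P: pair_sigma_finite "latm L :: (int^'d) measure" "boxm L :: (real^'d) measure" ..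
  have [measurable]: "f \<in> borel_measurable (boxm L)" using f by auto
  have pm: "(\<lambda>x. complex_of_real (per L B (x - y))) \<in> borel_measurable (boxm L)" for y
  proof (rule borel_measurable_boxm)
    have [measurable]: "per L B \<in> borel_measurable borel" by (rule per_borel[OF B])
    show "(\<lambda>x. complex_of_real (per L B (x - y))) \<in> borel_measurable borel" by measurable
  qed
  have i1: "integrable (boxm L) (\<lambda>x. ek L (-k) x * (f x * of_real (per L B (x - y))))" for y
    by (rule integrable_ek_mult, rule integrable_mult_bounded[OF f pm, of _ C]) (use Bb in \<open>auto simp: per_def\<close>)
  have one: "(LINT x|boxm L. ek L (-k) x * (f x * of_real (per L B (x - y)))) =
     (LINT u|latm L. bL L B u * ek L (-u) y * fcoef L f (k - u))" for y
  proof -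
    have int: "integrable (latm L \<Otimes>\<^sub>M boxm L) (\<lambda>(u, x). bL L B u * f x * (ek L u (x - y) * ek L (-k) x))"
    proof -
      have "integrable (latm L \<Otimes>\<^sub>M boxm L) (\<lambda>p. (case p of (u, x) \<Rightarrow> bL L B u * f x) * (ek L (fst p) (snd p - y) * ek L (-k) (snd p)))"
      proof (rule integrable_mult_bounded[where C = 1])
        show "integrable (latm L \<Otimes>\<^sub>M boxm L) (\<lambda>(u, x). bL L B u * f x)"
          by (rule P.integrable_fst_mult_snd[OF b f])
        show "(\<lambda>p. ek L (fst p) (snd p - y) * ek L (-k) (snd p)) \<in> borel_measurable (latm L \<Otimes>\<^sub>M boxm L)"
          by (rule borel_measurable_latm_pair) (auto intro!: borel_measurable_times borel_measurable_boxm)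
      qed (auto simp: norm_mult)
      then show ?thesis by (simp add: case_prod_unfold mult.assoc)
    qed
    have "(LINT x|boxm L. ek L (-k) x * (f x * of_real (per L B (x - y)))) =
      (LINT x|boxm L. LINT u|latm L. bL L B u * f x * (ek L u (x - y) * ek L (-k) x))"
    proof (rule integral_cong_AE)
      show "(\<lambda>x. ek L (-k) x * (f x * of_real (per L B (x - y)))) \<in> borel_measurable (boxm L)" using i1 by auto
      show "(\<lambda>x. LINT u|latm L. bL L B u * f x * (ek L u (x - y) * ek L (-k) x)) \<in> borel_measurable (boxm L)"
        using P.integrable_snd[OF int] by auto
      show "AE x in boxm L. ek L (-k) x * (f x * of_real (per L B (x - y))) = (LINT u|latm L. bL L B u * f x * (ek L u (x - y) * ek L (-k) x))"
        using per_AE_series[OF L B Bb b, of y]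
      proof eventually_elim
        case (elim x)
        have "(LINT u|latm L. bL L B u * f x * (ek L u (x - y) * ek L (-k) x)) = (LINT u|latm L. (f x * ek L (-k) x) * (bL L B u * ek L u (x - y)))"
          by (intro Bochner_Integration.integral_cong refl) (simp add: mult_ac)
        also have "\<dots> = (f x * ek L (-k) x) * (LINT u|latm L. bL L B u * ek L u (x - y))" by (rule integral_mult_right_zero)
        finally have *: "(LINT u|latm L. bL L B u * f x * (ek L u (x - y) * ek L (-k) x)) = \<dots>" .
        show ?case unfolding elim * by (simp add: mult_ac)
      qed
    qed
    also have "\<dots> = (LINT u|latm L. LINT x|boxm L. bL L B u * f x * (ek L u (x - y) * ek L (-k) x))"
      by (rule P.Fubini_integral[OF int])
    also have "\<dots> = (LINT u|latm L. bL L B u * ek L (-u) y * fcoef L f (k - u))"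
    proof (intro Bochner_Integration.integral_cong refl)
      fix u
      have "(LINT x|boxm L. bL L B u * f x * (ek L u (x - y) * ek L (-k) x)) = (LINT x|boxm L. (bL L B u * ek L (-u) y) * (ek L (-(k-u)) x * f x))"
        unfolding ek_diff_arg minus_diff_eq diff_conv_add_uminus[of u k] ek_add
        by (intro Bochner_Integration.integral_cong refl) (simp add: mult_ac)
      then show "(LINT x|boxm L. bL L B u * f x * (ek L u (x - y) * ek L (-k) x)) = bL L B u * ek L (-u) y * fcoef L f (k - u)"
        unfolding fcoef_ek by simp
    qed
    finally show ?thesis .
  qed
  have "fcoef L (\<lambda>x. pot L B m ys vs x * f x) k = (LINT x|boxm L. (\<Sum>g<m. of_real (vs g) * (ek L (-k) x * (f x * of_real (per L B (x - ys g))))))"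
    unfolding fcoef_ek pot_def
    by (intro Bochner_Integration.integral_cong refl) (simp add: sum_distrib_left sum_distrib_right mult_ac)
  also have "\<dots> = (\<Sum>g<m. of_real (vs g) * (LINT x|boxm L. ek L (-k) x * (f x * of_real (per L B (x - ys g)))))"
    by (subst Bochner_Integration.integral_sum) (use i1 in auto)
  finally show ?thesis unfolding one .
qed

section \<open>Momentum representation of the chain\<close>

lemma product_sigma_finite_latm: "L > 0 \<Longrightarrow> product_sigma_finite (\<lambda>_. latm L :: (int^'d) measure)"
  by (rule product_sigma_finite.intro) (rule sigma_finite_latm)

lemma integrable_PiM_prod_bounded:
  fixes f :: "'i \<Rightarrow> int^'d \<Rightarrow> complex"
  assumes L: "L > 0" and I: "finite I" and f: "\<And>i. i \<in> I \<Longrightarrow> integrable (latm L) (f i)" and h: "\<And>u. cmod (h u) \<le> C"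
  shows "integrable (PiM I (\<lambda>_. latm L)) (\<lambda>u. (\<Prod>i\<in>I. f i (u i)) * h u)"
proof -
  interpret product_sigma_finite "\<lambda>_. latm L :: (int^'d) measure" by (rule product_sigma_finite_latm[OF L])
  show ?thesis
    by (rule integrable_mult_bounded[where C = C, OF product_integrable_prod[OF I f]])
       (auto intro: borel_measurable_PiM_latm I h)
qed

text \<open>Factor \<open>j = n\<close> is the leftmost resolvent, at the outgoing momentum
  \<open>k\<close>. Factor \<open>j\<close> sees \<open>k\<close> minus the transfers of the
  potentials to its left, so \<open>j = 0\<close> sits at the incoming momentum.\<close>

definition resprod :: "real \<Rightarrow> complex \<Rightarrow> nat \<Rightarrow> int^'d \<Rightarrow> (nat \<Rightarrow> int^'d) \<Rightarrow> complex" where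
  "resprod L z n k u = (\<Prod>j\<le>n. 1 / (of_real (nu (dual_pt L (k - (\<Sum>i=j..<n. u i)))) - z))"

lemma resprod_0: "resprod L z 0 k u = 1 / (of_real (nu (dual_pt L k)) - z)"
  by (simp add: resprod_def)

lemma resprod_Suc: "resprod L z (Suc n) k (u(n := x)) = 1 / (of_real (nu (dual_pt L k)) - z) * resprod L z n (k - x) u"
proof -
  have "(\<Sum>i=j..<Suc n. (u(n := x)) i) = x + (\<Sum>i=j..<n. u i)" if "j \<le> n" for j
    using that by (simp add: add.commute)
  then have eq: "k - (\<Sum>i=j..<Suc n. (u(n := x)) i) = k - x - (\<Sum>i=j..<n. u i)" if "j \<le> n" for j
    using that by (simp only: diff_diff_eq)
  have "(\<Prod>j\<le>n. 1 / (of_real (nu (dual_pt L (k - (\<Sum>i=j..<Suc n. (u(n := x)) i)))) - z)) = resprod L z n (k - x) u"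
    unfolding resprod_def by (intro prod.cong refl) (simp only: eq atMost_iff)
  then show ?thesis by (simp add: resprod_def[of _ _ "Suc n"] prod.atMost_Suc mult.commute)
qed

lemma resprod_bound: "Im z \<noteq> 0 \<Longrightarrow> cmod (resprod L z n k u) \<le> (1 / \<bar>Im z\<bar>) ^ (n + 1)"
proof -
  assume z: "Im z \<noteq> 0"
  have "cmod (resprod L z n k u) \<le> (\<Prod>j\<le>n. 1 / \<bar>Im z\<bar>)"
    unfolding resprod_def prod_norm[symmetric] by (intro prod_mono conjI norm_ge_zero norm_resolvent_le z)
  then show ?thesis by simp
qed

lemma resprod_cong: "(\<And>j. j < n \<Longrightarrow> u j = v j) \<Longrightarrow> resprod L z n k u = resprod L z n k v"
  unfolding resprod_def by (auto intro!: prod.cong sum.cong arg_cong[where f = "\<lambda>x. 1 / (of_real (nu (dual_pt L (k - x))) - z)"])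

lemma in_L2_box_bounded_mult:
  assumes V: "V \<in> borel_measurable borel" "\<And>x. cmod (V x) \<le> C" and f: "in_L2_box L f"
  shows "in_L2_box L (\<lambda>x. V x * f x)"
proof -
  have [measurable]: "f \<in> borel_measurable (boxm L)" "V \<in> borel_measurable (boxm L)" and fi: "integrable (boxm L) (\<lambda>x. (cmod (f x))\<^sup>2)"
    using f V(1) by (auto simp: in_L2_box_def intro: borel_measurable_boxm)
  have "integrable (boxm L) (\<lambda>x. (cmod (V x * f x))\<^sup>2)"
  proof (rule Bochner_Integration.integrable_bound)
    show "integrable (boxm L) (\<lambda>x. C\<^sup>2 * (cmod (f x))\<^sup>2)" using fi by auto
    show "AE x in boxm L. norm ((cmod (V x * f x))\<^sup>2) \<le> norm (C\<^sup>2 * (cmod (f x))\<^sup>2)"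
      using V(2) by (intro AE_I2) (auto simp: norm_mult power_mult_distrib intro!: mult_right_mono power_mono)
  qed measurable
  then show ?thesis by (simp add: in_L2_box_def)
qed

lemma in_L2_box_chain:
  assumes L: "L > 0" and z: "Im z \<noteq> 0" and V: "V \<in> borel_measurable borel" "\<And>x. cmod (V x) \<le> C" and f: "in_L2_box L f"
  shows "in_L2_box L (chain L z V n f)"
  by (induction n) (auto intro!: resolv(1)[OF L z] in_L2_box_bounded_mult[OF V] f)

lemma fcoef_bounded: "integrable (boxm L) f \<Longrightarrow> cmod (fcoef L f k) \<le> (LINT x|boxm L. cmod (f x))"
  unfolding fcoef_ek using integral_norm_bound[of "boxm L" "\<lambda>x. ek L (-k) x * f x"] by (simp add: norm_mult)

text \<open>Induction along the chain. Expanding each potential over the scatterers produces the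
  label functions \<open>\<gamma>\<close>, and each convolution adds one lattice variable, stored as
  the last coordinate.\<close>

lemma fcoef_chain:
  fixes B :: "real^'d \<Rightarrow> real"
  assumes L: "L > 0" and z: "Im z \<noteq> 0" and B: "B \<in> borel_measurable borel" and Bb: "\<And>x. \<bar>B x\<bar> \<le> C"
    and b: "integrable (latm L) (bL L B)" and f: "in_L2_box L f"
  shows "fcoef L (chain L z (pot L B m ys vs) n f) k =
    (\<Sum>\<gamma>\<in>PiE {..<n} (\<lambda>_. {..<m}). (\<Prod>j<n. of_real (vs (\<gamma> j))) *
      (LINT u|PiM {..<n} (\<lambda>_. latm L). (\<Prod>j<n. bL L B (u j) * ek L (- u j) (ys (\<gamma> j))) * (resprod L z n k u * fcoef L f (k - (\<Sum>j<n. u j)))))"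
proof (induction n arbitrary: k)
  case 0
  interpret product_sigma_finite "\<lambda>_. latm L :: (int^'d) measure" by (rule product_sigma_finite_latm[OF L])
  show ?case using resolv(2)[OF L z f] by (simp add: PiM_empty lebesgue_integral_count_space_finite resprod_0)
next
  case (Suc n)
  interpret product_sigma_finite "\<lambda>_. latm L :: (int^'d) measure" by (rule product_sigma_finite_latm[OF L])
  let ?V = "pot L B m ys vs"
  let ?C = "\<Sum>g<m. \<bar>vs g\<bar> * C"
  have V: "?V \<in> borel_measurable borel" "\<And>x. cmod (?V x) \<le> ?C" using pot_borel[OF B] pot_bounded[OF Bb] by auto
  let ?r = "\<lambda>k. 1 / (of_real (nu (dual_pt L k)) - z) :: complex"
  define F where "F n \<gamma> k u = (\<Prod>j<n. bL L B (u j) * ek L (- u j) (ys (\<gamma> j))) * (resprod L z n k u * fcoef L f (k - (\<Sum>j<n. u j)))"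
    for n \<gamma> k u
  define \<Phi> where "\<Phi> = (LINT x|boxm L. cmod (f x))"
  define D where "D n = (1 / \<bar>Im z\<bar>) ^ (n + 1) * \<Phi>" for n :: nat
  have hb: "cmod (resprod L z n k u * fcoef L f l) \<le> D n" for n k l and u :: "nat \<Rightarrow> int^'d"
    unfolding norm_mult D_def \<Phi>_def
    by (intro mult_mono resprod_bound z fcoef_bounded in_L2_box_integrable[OF L f]) auto
  have bi: "integrable (latm L) (\<lambda>u. bL L B u * ek L (- u) y)" for y
    by (rule integrable_mult_bounded[OF b, where C = 1]) auto
  have Fi: "integrable (PiM {..<n} (\<lambda>_. latm L)) (F n \<gamma> k)" for n \<gamma> k
    unfolding F_def by (rule integrable_PiM_prod_bounded[OF L _ _ hb]) (auto intro: bi)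
  \<comment> \<open>A bound on the inner integrals that does not depend on \<open>k\<close> or on
    the labels; it makes the integrand summable in the transfer that is added next.\<close>
  define E where "E = (LINT u|PiM {..<n} (\<lambda>_. latm L :: (int^'d) measure). (\<Prod>j<n. cmod (bL L B (u j))) * D n)"
  have Fb: "cmod (LINT u|PiM {..<n} (\<lambda>_. latm L). F n \<gamma> k u) \<le> E" for \<gamma> k
  proof -
    have "cmod (LINT u|PiM {..<n} (\<lambda>_. latm L). F n \<gamma> k u) \<le> (LINT u|PiM {..<n} (\<lambda>_. latm L). cmod (F n \<gamma> k u))"
      by (rule integral_norm_bound)
    also have "\<dots> \<le> E" unfolding E_def
    proof (rule integral_mono)
      show "integrable (PiM {..<n} (\<lambda>_. latm L :: (int^'d) measure)) (\<lambda>u. (\<Prod>j<n. cmod (bL L B (u j))) * D n)"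
        using b by (intro Bochner_Integration.integrable_mult_left product_integrable_prod) auto
      show "cmod (F n \<gamma> k u) \<le> (\<Prod>j<n. cmod (bL L B (u j))) * D n" for u
        using hb unfolding F_def norm_mult prod_norm[symmetric] by (auto intro!: mult_left_mono prod_nonneg)
    qed (use Fi in auto)
    finally show ?thesis .
  qed
  have ch: "in_L2_box L (chain L z ?V n f)" by (rule in_L2_box_chain[OF L z V f])
  have step: "?r k * (of_real (vs g) * (LINT x|latm L. bL L B x * ek L (-x) (ys g) * ((\<Prod>j<n. of_real (vs (\<gamma> j))) * (LINT u|PiM {..<n} (\<lambda>_. latm L). F n \<gamma> (k - x) u))))
     = (\<Prod>j<Suc n. of_real (vs ((\<gamma>(n := g)) j))) * (LINT u|PiM {..<Suc n} (\<lambda>_. latm L). F (Suc n) (\<gamma>(n := g)) k u)" for g \<gamma>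
  proof -
    have "(LINT u|PiM {..<Suc n} (\<lambda>_. latm L). F (Suc n) (\<gamma>(n := g)) k u)
       = (LINT x|latm L. LINT u|PiM {..<n} (\<lambda>_. latm L). F (Suc n) (\<gamma>(n := g)) k (u(n := x)))"
      using Fi[of "Suc n"] unfolding lessThan_Suc by (intro product_integral_insert_outer) auto
    also have "\<dots> = (LINT x|latm L. LINT u|PiM {..<n} (\<lambda>_. latm L). ?r k * (bL L B x * ek L (-x) (ys g)) * F n \<gamma> (k - x) u)"
      unfolding F_def resprod_Suc by (intro Bochner_Integration.integral_cong refl) (simp add: diff_diff_eq add.commute)
    also have "\<dots> = ?r k * (LINT x|latm L. bL L B x * ek L (-x) (ys g) * (LINT u|PiM {..<n} (\<lambda>_. latm L). F n \<gamma> (k - x) u))"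
      by (simp add: mult.assoc)
    finally have *: "(LINT u|PiM {..<Suc n} (\<lambda>_. latm L). F (Suc n) (\<gamma>(n := g)) k u) = \<dots>" .
    have "(LINT x|latm L. bL L B x * ek L (-x) (ys g) * ((\<Prod>j<n. of_real (vs (\<gamma> j))) * (LINT u|PiM {..<n} (\<lambda>_. latm L). F n \<gamma> (k - x) u)))
      = (\<Prod>j<n. of_real (vs (\<gamma> j))) * (LINT x|latm L. bL L B x * ek L (-x) (ys g) * (LINT u|PiM {..<n} (\<lambda>_. latm L). F n \<gamma> (k - x) u))"
      by (subst integral_mult_right_zero[symmetric]) (simp add: mult_ac)
    then show ?thesis unfolding * by (simp add: mult_ac)
  qed
  have "fcoef L (chain L z ?V (Suc n) f) k = ?r k * fcoef L (\<lambda>x. ?V x * chain L z ?V n f x) k"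
    using resolv(2)[OF L z in_L2_box_bounded_mult[OF V ch]] by simp
  also have "\<dots> = ?r k * (\<Sum>g<m. of_real (vs g) * (LINT x|latm L. bL L B x * ek L (-x) (ys g) * fcoef L (chain L z ?V n f) (k - x)))"
    by (subst fcoef_pot_mult[OF L B Bb b in_L2_box_integrable[OF L ch]]) simp
  also have "\<dots> = ?r k * (\<Sum>g<m. of_real (vs g) * (\<Sum>\<gamma>\<in>PiE {..<n} (\<lambda>_. {..<m}). LINT x|latm L. bL L B x * ek L (-x) (ys g) * ((\<Prod>j<n. of_real (vs (\<gamma> j))) * (LINT u|PiM {..<n} (\<lambda>_. latm L). F n \<gamma> (k - x) u))))"
  proof -
    have "integrable (latm L) (\<lambda>x. bL L B x * ek L (-x) (ys g) * ((\<Prod>j<n. of_real (vs (\<gamma> j))) * (LINT u|PiM {..<n} (\<lambda>_. latm L). F n \<gamma> (k - x) u)))" for g \<gamma>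
    proof (rule integrable_mult_bounded[OF bi])
      show "AE x in latm L. cmod ((\<Prod>j<n. of_real (vs (\<gamma> j))) * (LINT u|PiM {..<n} (\<lambda>_. latm L). F n \<gamma> (k - x) u)) \<le> cmod (\<Prod>j<n. of_real (vs (\<gamma> j))) * E"
        by (intro AE_I2) (auto simp only: norm_mult intro!: mult_left_mono Fb norm_ge_zero)
    qed simp
    then have "(LINT x|latm L. bL L B x * ek L (-x) (ys g) * fcoef L (chain L z ?V n f) (k - x))
      = (\<Sum>\<gamma>\<in>PiE {..<n} (\<lambda>_. {..<m}). LINT x|latm L. bL L B x * ek L (-x) (ys g) * ((\<Prod>j<n. of_real (vs (\<gamma> j))) * (LINT u|PiM {..<n} (\<lambda>_. latm L). F n \<gamma> (k - x) u)))" for g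
      unfolding Suc.IH F_def[symmetric] sum_distrib_left by (subst Bochner_Integration.integral_sum) auto
    then show ?thesis by (simp only:)
  qed
  also have "\<dots> = (\<Sum>(g, \<gamma>)\<in>{..<m} \<times> PiE {..<n} (\<lambda>_. {..<m}). (\<Prod>j<Suc n. of_real (vs ((\<gamma>(n := g)) j))) * (LINT u|PiM {..<Suc n} (\<lambda>_. latm L). F (Suc n) (\<gamma>(n := g)) k u))"
    unfolding sum_distrib_left step by (rule sum.cartesian_product)
  also have "\<dots> = (\<Sum>\<gamma>\<in>PiE {..<Suc n} (\<lambda>_. {..<m}). (\<Prod>j<Suc n. of_real (vs (\<gamma> j))) * (LINT u|PiM {..<Suc n} (\<lambda>_. latm L). F (Suc n) \<gamma> k u))"
    unfolding lessThan_Suc[of n] PiE_insert_eq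
    by (subst sum.reindex) (auto simp: case_prod_unfold intro!: inj_combinator[where T = "\<lambda>_. {..<m}", unfolded case_prod_unfold])
  finally show ?case unfolding F_def .
qed

lemma (in product_sigma_finite) product_integrable_insert_outer:
  fixes f :: "_ \<Rightarrow> _::{banach, second_countable_topology}"
  assumes I: "finite I" "i \<notin> I" and f: "integrable (Pi\<^sub>M (insert i I) M) f"
  shows "integrable (M i) (\<lambda>x. \<integral>y. f (y(i := x)) \<partial>Pi\<^sub>M I M)"
proof -
  interpret I: finite_product_sigma_finite M I by standard fact
  interpret J: finite_product_sigma_finite M "{i}" by standard simp
  interpret P: pair_sigma_finite "Pi\<^sub>M {i} M" "Pi\<^sub>M I M" ..
  have ins: "insert i I = {i} \<union> I" by simp
  have [measurable]: "f \<in> borel_measurable (Pi\<^sub>M (insert i I) M)" using f by auto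
  have f_int: "integrable (Pi\<^sub>M {i} M \<Otimes>\<^sub>M Pi\<^sub>M I M) (\<lambda>x. f (merge {i} I x))"
    by (rule integrable_distr[OF measurable_merge]) (subst distr_merge, use I f in auto)
  have "integrable (Pi\<^sub>M {i} M) (\<lambda>x. \<integral>y. f (merge {i} I (x, y)) \<partial>Pi\<^sub>M I M)"
    using P.integrable_fst'[OF f_int] by simp
  also have "?this \<longleftrightarrow> integrable (Pi\<^sub>M {i} M) (\<lambda>x. \<integral>y. f (y(i := x i)) \<partial>Pi\<^sub>M I M)"
  proof (intro Bochner_Integration.integrable_cong Bochner_Integration.integral_cong refl)
    fix x y assume "x \<in> space (Pi\<^sub>M {i} M)" "y \<in> space (Pi\<^sub>M I M)"
    then have "merge {i} I (x, y) = y(i := x i)" using I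
      by (auto simp: merge_def space_PiM PiE_def extensional_def fun_eq_iff)
    then show "f (merge {i} I (x, y)) = f (y(i := x i))" by simp
  qed
  finally have *: "integrable (Pi\<^sub>M {i} M) (\<lambda>x. \<integral>y. f (y(i := x i)) \<partial>Pi\<^sub>M I M)" .
  have m: "(\<lambda>x. \<integral>y. f (y(i := x)) \<partial>Pi\<^sub>M I M) \<in> borel_measurable (M i)"
  proof -
    have "(\<lambda>(x, y). y(i := x)) \<in> measurable (M i \<Otimes>\<^sub>M Pi\<^sub>M I M) (Pi\<^sub>M (insert i I) M)"
      unfolding case_prod_beta by (rule measurable_fun_upd[where J = I]) auto
    then have "(\<lambda>(x, y). f (y(i := x))) \<in> borel_measurable (M i \<Otimes>\<^sub>M Pi\<^sub>M I M)"
      using measurable_compose[of "\<lambda>(x, y). y(i := x)" _ _ f] by (simp add: case_prod_beta)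
    then show ?thesis by (intro I.borel_measurable_lebesgue_integral)
  qed
  have "integrable (distr (Pi\<^sub>M {i} M) (M i) (\<lambda>x. x i)) (\<lambda>x. \<integral>y. f (y(i := x)) \<partial>Pi\<^sub>M I M)"
    using * m by (subst integrable_distr_eq) auto
  then show ?thesis using distr_singleton[of i] by simp
qed

lemma nn_integral_latm_shift:
  "(\<integral>\<^sup>+k. f (k - s) \<partial>latm L) = (\<integral>\<^sup>+k. f (k :: int^'d) \<partial>latm L)"
proof -
  have "bij (\<lambda>k::int^'d. k - s)" by (rule bij_betw_byWitness[where f' = "\<lambda>k. k + s"]) auto
  then have "(\<integral>\<^sup>+k. ennreal (1 / L ^ CARD('d)) * f (k - s) \<partial>count_space UNIV) = (\<integral>\<^sup>+k. ennreal (1 / L ^ CARD('d)) * f k \<partial>count_space UNIV)"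
    by (rule nn_integral_bij_count_space[where f = "\<lambda>k. ennreal (1 / L ^ CARD('d)) * f k"])
  then show ?thesis unfolding latm_def by (simp add: nn_integral_density)
qed

text \<open>The integrand of the momentum representation: coordinates \<open>0, ..., n - 1\<close> carry the momentum
  transfers of the \<open>n\<close> potentials, coordinate \<open>n\<close> the outgoing momentum.\<close>
definition mom_integrand :: "real \<Rightarrow> complex \<Rightarrow> (int^'d \<Rightarrow> complex) \<Rightarrow> (int^'d \<Rightarrow> complex) \<Rightarrow> (int^'d \<Rightarrow> complex)
    \<Rightarrow> nat \<Rightarrow> (nat \<Rightarrow> int^'d) \<Rightarrow> complex" where
  "mom_integrand L z b f1 f2 n x = (\<Prod>j<n. b (x j)) * (resprod L z n (x n) x * cnj (f1 (x n)) * f2 (x n - (\<Sum>j<n. x j)))"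

text \<open>For fixed transfers the resolvents are bounded, and the product of the two wave
  functions is dominated by the sum of their squares, whose sum is unchanged by the momentum shift.
  The transfers are summed through \<open>b\<close>.\<close>

lemma integrable_mom_integrand:
  fixes b f1 f2 :: "int^'d \<Rightarrow> complex"
  assumes L: "L > 0" and z: "Im z \<noteq> 0" and b: "integrable (latm L) b"
    and f1: "integrable (latm L) (\<lambda>k. (cmod (f1 k))\<^sup>2)" and f2: "integrable (latm L) (\<lambda>k. (cmod (f2 k))\<^sup>2)"
  shows "integrable (PiM {..<Suc n} (\<lambda>_. latm L)) (mom_integrand L z b f1 f2 n)"
proof (rule integrableI_bounded)
  interpret product_sigma_finite "\<lambda>_. latm L :: (int^'d) measure" by (rule product_sigma_finite_latm[OF L])
  show "mom_integrand L z b f1 f2 n \<in> borel_measurable (PiM {..<Suc n} (\<lambda>_. latm L))"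
    by (rule borel_measurable_PiM_latm) simp
  define R where "R = (1 / \<bar>Im z\<bar>) ^ (n + 1)"
  have R0: "R \<ge> 0" by (simp add: R_def)
  define K where "K = (\<integral>\<^sup>+k. ennreal ((cmod (f1 k))\<^sup>2) \<partial>latm L) + (\<integral>\<^sup>+k. ennreal ((cmod (f2 k))\<^sup>2) \<partial>latm L)"
  have K: "K < \<infinity>"
    unfolding K_def using f1 f2 by (simp add: nn_integral_eq_integral)
  have "(\<integral>\<^sup>+x. ennreal (norm (mom_integrand L z b f1 f2 n x)) \<partial>PiM {..<Suc n} (\<lambda>_. latm L))
     = (\<integral>\<^sup>+u. (\<integral>\<^sup>+k. ennreal (norm (mom_integrand L z b f1 f2 n (u(n := k)))) \<partial>latm L) \<partial>PiM {..<n} (\<lambda>_. latm L))"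
    unfolding lessThan_Suc by (rule product_nn_integral_insert) (auto intro!: borel_measurable_PiM_latm measurable_compose[OF borel_measurable_PiM_latm measurable_ennreal])
  also have "\<dots> \<le> (\<integral>\<^sup>+u. ennreal (\<Prod>j<n. cmod (b (u j))) * (ennreal R * K) \<partial>PiM {..<n} (\<lambda>_. latm L))"
  proof (rule nn_integral_mono)
    fix u :: "nat \<Rightarrow> int^'d"
    let ?s = "\<Sum>j<n. u j"
    let ?P = "\<Prod>j<n. cmod (b (u j))"
    have P0: "?P \<ge> 0" by (intro prod_nonneg) auto
    have "(\<integral>\<^sup>+k. ennreal (norm (mom_integrand L z b f1 f2 n (u(n := k)))) \<partial>latm L)
       \<le> (\<integral>\<^sup>+k. ennreal (?P * R) * (ennreal ((cmod (f1 k))\<^sup>2) + ennreal ((cmod (f2 (k - ?s)))\<^sup>2)) \<partial>latm L)"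
    proof (rule nn_integral_mono)
      fix k
      have "norm (mom_integrand L z b f1 f2 n (u(n := k))) = ?P * (cmod (resprod L z n k (u(n := k))) * cmod (cnj (f1 k) * f2 (k - ?s)))"
        by (simp add: mom_integrand_def norm_mult prod_norm)
      also have "\<dots> \<le> ?P * (R * ((cmod (f1 k))\<^sup>2 + (cmod (f2 (k - ?s)))\<^sup>2))"
      proof (intro mult_left_mono mult_mono P0)
        show "cmod (resprod L z n k (u(n := k))) \<le> R" unfolding R_def by (rule resprod_bound[OF z])
        show "cmod (cnj (f1 k) * f2 (k - ?s)) \<le> (cmod (f1 k))\<^sup>2 + (cmod (f2 (k - ?s)))\<^sup>2"
          using cmod_mult_le_sq[of "cnj (f1 k)" "f2 (k - ?s)"] by (simp add: sum_power2_ge_zero) (smt (verit) zero_le_power2)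
      qed (use R0 in auto)
      finally have "ennreal (norm (mom_integrand L z b f1 f2 n (u(n := k)))) \<le> ennreal ((?P * R) * ((cmod (f1 k))\<^sup>2 + (cmod (f2 (k - ?s)))\<^sup>2))"
        by (simp add: mult.assoc ennreal_leI)
      also have "\<dots> = ennreal (?P * R) * (ennreal ((cmod (f1 k))\<^sup>2) + ennreal ((cmod (f2 (k - ?s)))\<^sup>2))"
        using P0 R0 by (simp add: ennreal_mult ennreal_plus)
      finally show "ennreal (norm (mom_integrand L z b f1 f2 n (u(n := k)))) \<le> \<dots>" .
    qed
    also have "\<dots> = ennreal (?P * R) * K"
      unfolding K_def using nn_integral_latm_shift[where f = "\<lambda>k. ennreal ((cmod (f2 k))\<^sup>2)" and s = ?s and L = L]
      by (subst nn_integral_cmult) (auto simp: nn_integral_add)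
    also have "\<dots> = ennreal ?P * (ennreal R * K)" using P0 R0 by (simp add: ennreal_mult mult.assoc)
    finally show "(\<integral>\<^sup>+k. ennreal (norm (mom_integrand L z b f1 f2 n (u(n := k)))) \<partial>latm L) \<le> ennreal ?P * (ennreal R * K)" .
  qed
  also have "\<dots> = (\<integral>\<^sup>+u. ennreal (\<Prod>j<n. cmod (b (u j))) \<partial>PiM {..<n} (\<lambda>_. latm L)) * (ennreal R * K)"
    by (rule nn_integral_multc) (auto intro!: measurable_compose[OF borel_measurable_PiM_latm measurable_ennreal])
  also have "\<dots> < \<infinity>"
  proof -
    have "integrable (PiM {..<n} (\<lambda>_. latm L)) (\<lambda>u. \<Prod>j<n. cmod (b (u j)))"
      using b by (intro product_integrable_prod) auto
    then have "(\<integral>\<^sup>+u. ennreal (\<Prod>j<n. cmod (b (u j))) \<partial>PiM {..<n} (\<lambda>_. latm L)) < \<infinity>"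
      by (subst nn_integral_eq_integral) (auto intro!: prod_nonneg)
    then show ?thesis using K by (simp add: ennreal_mult_less_top)
  qed
  finally show "(\<integral>\<^sup>+x. ennreal (norm (mom_integrand L z b f1 f2 n x)) \<partial>PiM {..<Suc n} (\<lambda>_. latm L)) < \<infinity>" .
qed

text \<open>Parseval adds the outgoing momentum as coordinate \<open>n\<close>. The random positions
  now occur only in the phases and the amplitudes only in the prefactor, so that both expectations
  can be taken explicitly.\<close>

lemma inner_chain:
  fixes B :: "real^'d \<Rightarrow> real"
  assumes L: "L > 0" and z: "Im z \<noteq> 0" and B: "B \<in> borel_measurable borel" and Bb: "\<And>x. \<bar>B x\<bar> \<le> C"
    and b: "integrable (latm L) (bL L B)" and f1: "in_L2_box L f1" and f2: "in_L2_box L f2"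
  shows "inner_L L f1 (chain L z (pot L B m ys vs) n f2) =
    (\<Sum>\<gamma>\<in>PiE {..<n} (\<lambda>_. {..<m}). (\<Prod>j<n. of_real (vs (\<gamma> j))) *
      (LINT x|PiM {..<Suc n} (\<lambda>_. latm L). (\<Prod>j<n. ek L (- x j) (ys (\<gamma> j))) * mom_integrand L z (bL L B) (fcoef L f1) (fcoef L f2) n x))"
proof -
  interpret product_sigma_finite "\<lambda>_. latm L :: (int^'d) measure" by (rule product_sigma_finite_latm[OF L])
  let ?V = "pot L B m ys vs"
  have V: "?V \<in> borel_measurable borel" "\<And>x. cmod (?V x) \<le> (\<Sum>g<m. \<bar>vs g\<bar> * C)" using pot_borel[OF B] pot_bounded[OF Bb] by auto
  have ch: "in_L2_box L (chain L z ?V n f2)" by (rule in_L2_box_chain[OF L z V f2])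
  let ?G = "mom_integrand L z (bL L B) (fcoef L f1) (fcoef L f2) n"
  let ?H = "\<lambda>\<gamma> x. (\<Prod>j<n. ek L (- x j) (ys (\<gamma> j))) * ?G x"
  have Hi: "integrable (PiM {..<Suc n} (\<lambda>_. latm L)) (?H \<gamma>)" for \<gamma>
    by (subst mult.commute, rule integrable_mult_bounded[OF integrable_mom_integrand[OF L z b Bessel(1)[OF L f1] Bessel(1)[OF L f2]], where C = 1])
       (auto simp: norm_mult prod_norm[symmetric] intro: borel_measurable_PiM_latm)
  let ?I = "\<lambda>\<gamma> k. LINT u|PiM {..<n} (\<lambda>_. latm L). (\<Prod>j<n. bL L B (u j) * ek L (- u j) (ys (\<gamma> j))) * (resprod L z n k u * fcoef L f2 (k - (\<Sum>j<n. u j)))"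
  have eq: "(LINT u|PiM {..<n} (\<lambda>_. latm L). ?H \<gamma> (u(n := k))) = cnj (fcoef L f1 k) * ?I \<gamma> k" for \<gamma> k
  proof -
    have "(LINT u|PiM {..<n} (\<lambda>_. latm L). ?H \<gamma> (u(n := k))) = (LINT u|PiM {..<n} (\<lambda>_. latm L). cnj (fcoef L f1 k) *
       ((\<Prod>j<n. bL L B (u j) * ek L (- u j) (ys (\<gamma> j))) * (resprod L z n k u * fcoef L f2 (k - (\<Sum>j<n. u j)))))"
    proof (intro Bochner_Integration.integral_cong refl)
      fix u :: "nat \<Rightarrow> int^'d"
      have "resprod L z n k (u(n := k)) = resprod L z n k u" by (rule resprod_cong) simp
      then show "?H \<gamma> (u(n := k)) = cnj (fcoef L f1 k) * ((\<Prod>j<n. bL L B (u j) * ek L (- u j) (ys (\<gamma> j))) * (resprod L z n k u * fcoef L f2 (k - (\<Sum>j<n. u j))))"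
        by (simp add: mom_integrand_def prod.distrib mult_ac)
    qed
    then show ?thesis by (simp only: integral_mult_right_zero)
  qed
  have ki: "integrable (latm L) (\<lambda>k. cnj (fcoef L f1 k) * ?I \<gamma> k)" for \<gamma>
    using product_integrable_insert_outer[of "{..<n}" n "?H \<gamma>"] Hi[of \<gamma>] unfolding eq lessThan_Suc by simp
  have "inner_L L f1 (chain L z ?V n f2) = (LINT k|latm L. cnj (fcoef L f1 k) * fcoef L (chain L z ?V n f2) k)"
    by (rule Parseval_inner[OF L f1 ch])
  also have "\<dots> = (LINT k|latm L. (\<Sum>\<gamma>\<in>PiE {..<n} (\<lambda>_. {..<m}). (\<Prod>j<n. of_real (vs (\<gamma> j))) * (cnj (fcoef L f1 k) * ?I \<gamma> k)))"
    unfolding fcoef_chain[OF L z B Bb b f2] sum_distrib_left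
    by (intro Bochner_Integration.integral_cong sum.cong refl) (simp only: mult_ac)
  also have "\<dots> = (\<Sum>\<gamma>\<in>PiE {..<n} (\<lambda>_. {..<m}). (\<Prod>j<n. of_real (vs (\<gamma> j))) * (LINT k|latm L. cnj (fcoef L f1 k) * ?I \<gamma> k))"
    using ki by (subst Bochner_Integration.integral_sum) (auto simp del: of_real_prod)
  also have "\<dots> = (\<Sum>\<gamma>\<in>PiE {..<n} (\<lambda>_. {..<m}). (\<Prod>j<n. of_real (vs (\<gamma> j))) * (LINT x|PiM {..<Suc n} (\<lambda>_. latm L). ?H \<gamma> x))"
    using product_integral_insert_outer[of "{..<n}" n "?H _"] Hi unfolding eq lessThan_Suc by simp
  finally show ?thesis .
qed

text \<open>The expectation only sees which of the \<open>n\<close> scatterer labels coincide, i.e. the partition of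
  \<open>{..<n}\<close> into level sets of \<open>f\<close>; \<open>firsts n f\<close> contains the least element of each block.\<close>
definition firsts :: "nat \<Rightarrow> (nat \<Rightarrow> nat) \<Rightarrow> nat set" where
  "firsts n f = {j. j < n \<and> (\<forall>i<j. f i \<noteq> f j)}"

definition mom_weight :: "real measure \<Rightarrow> nat \<Rightarrow> (nat \<Rightarrow> nat) \<Rightarrow> complex" where
  "mom_weight \<mu> n f = (\<Prod>j\<in>firsts n f. of_real (LINT v|\<mu>. v ^ card {i. i < n \<and> f i = f j}))"

definition conserve :: "nat \<Rightarrow> (nat \<Rightarrow> nat) \<Rightarrow> (nat \<Rightarrow> int^'d) \<Rightarrow> complex" where
  "conserve n f x = (if \<forall>j<n. (\<Sum>i | i < n \<and> f i = f j. x i) = 0 then 1 else 0)"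

definition block_rep :: "nat \<Rightarrow> (nat \<Rightarrow> nat) \<Rightarrow> nat \<Rightarrow> nat" where
  "block_rep n f = (\<lambda>j\<in>{..<n}. LEAST i. f i = f j)"

text \<open>Canonical forms of the set partitions of \<open>{..<n}\<close>: each index is sent to
  the least element of its block. This finite set is independent of the number of scatterers, unlike
  the set of label functions.\<close>

definition reps :: "nat \<Rightarrow> (nat \<Rightarrow> nat) set" where
  "reps n = {c \<in> PiE {..<n} (\<lambda>_. {..<n}). \<forall>j<n. c j \<le> j \<and> c (c j) = c j}"

section \<open>Averaging over amplitudes, positions and the number of scatterers\<close>

lemma finite_reps: "finite (reps n)"
  unfolding reps_def by (rule finite_subset[of _ "PiE {..<n} (\<lambda>_. {..<n})"]) (auto intro: finite_PiE)

lemma firsts_cong: "(\<And>i j. i < n \<Longrightarrow> j < n \<Longrightarrow> f i = f j \<longleftrightarrow> c i = c j) \<Longrightarrow> firsts n f = firsts n c"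
proof -
  assume *: "\<And>i j. i < n \<Longrightarrow> j < n \<Longrightarrow> f i = f j \<longleftrightarrow> c i = c j"
  have "(j < n \<and> (\<forall>i<j. f i \<noteq> f j)) \<longleftrightarrow> (j < n \<and> (\<forall>i<j. c i \<noteq> c j))" for j
    using *[of _ j] by (meson less_trans)
  then show ?thesis unfolding firsts_def by (rule Collect_cong)
qed

lemma mom_weight_cong: "(\<And>i j. i < n \<Longrightarrow> j < n \<Longrightarrow> f i = f j \<longleftrightarrow> c i = c j) \<Longrightarrow> mom_weight \<mu> n f = mom_weight \<mu> n c"
proof -
  assume *: "\<And>i j. i < n \<Longrightarrow> j < n \<Longrightarrow> f i = f j \<longleftrightarrow> c i = c j"
  then have e: "{i. i < n \<and> f i = f j} = {i. i < n \<and> c i = c j}" if "j < n" for j using that by auto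
  have fc: "firsts n f = firsts n c" by (rule firsts_cong) (rule *)
  show ?thesis unfolding mom_weight_def fc
  proof (intro prod.cong refl)
    fix j assume "j \<in> firsts n c"
    then have "j < n" by (simp add: firsts_def)
    then show "complex_of_real (LINT v|\<mu>. v ^ card {i. i < n \<and> f i = f j}) = complex_of_real (LINT v|\<mu>. v ^ card {i. i < n \<and> c i = c j})"
      by (simp only: e)
  qed
qed

lemma conserve_cong: "(\<And>i j. i < n \<Longrightarrow> j < n \<Longrightarrow> f i = f j \<longleftrightarrow> c i = c j) \<Longrightarrow> conserve n f = conserve n c"
proof -
  assume *: "\<And>i j. i < n \<Longrightarrow> j < n \<Longrightarrow> f i = f j \<longleftrightarrow> c i = c j"
  then have e: "{i. i < n \<and> f i = f j} = {i. i < n \<and> c i = c j}" if "j < n" for j using that by auto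
  have "(\<forall>j<n. (\<Sum>i | i < n \<and> f i = f j. x i) = 0) \<longleftrightarrow> (\<forall>j<n. (\<Sum>i | i < n \<and> c i = c j. x i) = 0)" for x :: "nat \<Rightarrow> int^'a"
    by (intro iff_allI imp_cong refl) (simp only: e)
  then show ?thesis unfolding conserve_def by (intro ext) (simp only:)
qed

lemma firsts_image: "f ` firsts n f = f ` {..<n}" "inj_on f (firsts n f)"
proof -
  show "inj_on f (firsts n f)"
  proof (rule inj_onI)
    fix i j assume "i \<in> firsts n f" "j \<in> firsts n f" "f i = f j"
    then show "i = j" by (cases i j rule: linorder_cases) (auto simp: firsts_def)
  qed
  have "f j \<in> f ` firsts n f" if "j < n" for j
  proof -
    define k where "k = (LEAST i. f i = f j)"
    have k: "f k = f j" unfolding k_def by (rule LeastI[of "\<lambda>i. f i = f j" j]) simp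
    moreover have "k \<le> j" unfolding k_def by (rule Least_le) simp
    moreover have "f i \<noteq> f k" if "i < k" for i using not_less_Least[OF that[unfolded k_def]] k by simp
    ultimately have "k \<in> firsts n f" using that by (auto simp: firsts_def)
    with k show ?thesis by (metis imageI)
  qed
  then show "f ` firsts n f = f ` {..<n}" by (auto simp: firsts_def)
qed

lemma prod_over_labels:
  assumes "\<gamma> \<in> PiE {..<n} (\<lambda>_. {..<m})" and one: "\<And>g. g \<notin> \<gamma> ` {..<n} \<Longrightarrow> F g = (1 :: 'a :: comm_monoid_mult)"
  shows "(\<Prod>g<m. F g) = (\<Prod>j\<in>firsts n \<gamma>. F (\<gamma> j))"
proof -
  have "(\<Prod>g<m. F g) = (\<Prod>g\<in>\<gamma> ` {..<n}. F g)"
    using assms by (intro prod.mono_neutral_right) auto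
  also have "\<dots> = (\<Prod>j\<in>firsts n \<gamma>. F (\<gamma> j))"
    unfolding firsts_image(1)[of \<gamma> n, symmetric] by (subst prod.reindex[OF firsts_image(2)]) simp
  finally show ?thesis .
qed

text \<open>Regroup the product by label and use independence: a scatterer met \<open>k\<close>
  times contributes the \<open>k\<close>-th moment, and one never met contributes 1.\<close>

lemma integral_prod_amplitudes:
  assumes mu: "prob_space \<mu>" and mom: "\<And>k::nat. integrable \<mu> (\<lambda>v. v ^ k)" and g: "\<gamma> \<in> PiE {..<n} (\<lambda>_. {..<m})"
  shows "integrable (PiM {..<m} (\<lambda>_. \<mu>)) (\<lambda>vs. \<Prod>j<n. complex_of_real (vs (\<gamma> j)))"
    and "(LINT vs|PiM {..<m} (\<lambda>_. \<mu>). (\<Prod>j<n. complex_of_real (vs (\<gamma> j)))) = mom_weight \<mu> n \<gamma>"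
proof -
  interpret prob_space \<mu> by (rule mu)
  interpret product_sigma_finite "\<lambda>_::nat. \<mu>" by (rule product_sigma_finite.intro) (rule sigma_finite_measure_axioms)
  let ?k = "\<lambda>g. card {i. i < n \<and> \<gamma> i = g}"
  have eq: "(\<Prod>j<n. complex_of_real (vs (\<gamma> j))) = (\<Prod>g<m. complex_of_real (vs g ^ ?k g))" for vs :: "nat \<Rightarrow> real"
  proof -
    have "(\<Prod>g<m. \<Prod>j | j \<in> {..<n} \<and> \<gamma> j = g. complex_of_real (vs (\<gamma> j))) = (\<Prod>j<n. complex_of_real (vs (\<gamma> j)))"
      using g by (intro prod.group) auto
    moreover have "(\<Prod>j | j \<in> {..<n} \<and> \<gamma> j = g. complex_of_real (vs (\<gamma> j))) = complex_of_real (vs g ^ ?k g)" for g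
    proof -
      have "(\<Prod>j | j \<in> {..<n} \<and> \<gamma> j = g. complex_of_real (vs (\<gamma> j))) = (\<Prod>j | j < n \<and> \<gamma> j = g. complex_of_real (vs g))"
        by (intro prod.cong) auto
      then show ?thesis by simp
    qed
    ultimately show ?thesis by simp
  qed
  have mi: "integrable \<mu> (\<lambda>v. complex_of_real (v ^ k))" for k by (rule integrable_of_real[OF mom])
  show "integrable (PiM {..<m} (\<lambda>_. \<mu>)) (\<lambda>vs. \<Prod>j<n. complex_of_real (vs (\<gamma> j)))"
    unfolding eq by (rule product_integrable_prod) (rule finite_lessThan, rule mi)
  have "(LINT vs|PiM {..<m} (\<lambda>_. \<mu>). (\<Prod>j<n. complex_of_real (vs (\<gamma> j)))) = (\<Prod>g<m. LINT v|\<mu>. complex_of_real (v ^ ?k g))"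
    unfolding eq by (rule product_integral_prod) (rule finite_lessThan, rule mi)
  also have "\<dots> = (\<Prod>g<m. complex_of_real (LINT v|\<mu>. v ^ ?k g))"
    by (simp only: integral_complex_of_real)
  also have "\<dots> = mom_weight \<mu> n \<gamma>"
    unfolding mom_weight_def
  proof (rule prod_over_labels[OF g])
    fix x assume "x \<notin> \<gamma> ` {..<n}"
    then have e: "{i. i < n \<and> \<gamma> i = x} = {}" by auto
    show "complex_of_real (LINT v|\<mu>. v ^ ?k x) = 1" unfolding e by (simp add: prob_space)
  qed
  finally show "(LINT vs|PiM {..<m} (\<lambda>_. \<mu>). (\<Prod>j<n. complex_of_real (vs (\<gamma> j)))) = mom_weight \<mu> n \<gamma>" .
qed

lemma ek_sum: "(\<Prod>j\<in>A. ek L (f j) y) = ek L (\<Sum>j\<in>A. f j) y"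
  by (induction A rule: infinite_finite_induct) (auto simp: ek_add)

lemma prob_space_unif: "L > 0 \<Longrightarrow> prob_space (uniform_measure lborel (box_L L :: (real^'d) set))"
  by (rule prob_space_uniform_measure) (simp_all add: emeasure_box_L)

text \<open>Regrouping by label collects at each scatterer the phase of the total transfer it
  receives, and averaging its position tests whether this total is zero.\<close>

lemma integral_prod_phases:
  fixes x :: "nat \<Rightarrow> int^'d"
  assumes L: "L > 0" and g: "\<gamma> \<in> PiE {..<n} (\<lambda>_. {..<m})"
  shows "(LINT ys|PiM {..<m} (\<lambda>_. uniform_measure lborel (box_L L)). (\<Prod>j<n. ek L (- x j) (ys (\<gamma> j)))) = conserve n \<gamma> x"
proof -
  let ?U = "uniform_measure lborel (box_L L :: (real^'d) set)"
  interpret prob_space ?U by (rule prob_space_unif[OF L])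
  interpret product_sigma_finite "\<lambda>_::nat. ?U" by (rule product_sigma_finite.intro) (rule sigma_finite_measure_axioms)
  let ?s = "\<lambda>g. \<Sum>j | j < n \<and> \<gamma> j = g. x j"
  have eq: "(\<Prod>j<n. ek L (- x j) (ys (\<gamma> j))) = (\<Prod>g<m. ek L (- ?s g) (ys g))" for ys
  proof -
    have "(\<Prod>g<m. \<Prod>j | j \<in> {..<n} \<and> \<gamma> j = g. ek L (- x j) (ys (\<gamma> j))) = (\<Prod>j<n. ek L (- x j) (ys (\<gamma> j)))"
      using g by (intro prod.group) auto
    moreover have "(\<Prod>j | j \<in> {..<n} \<and> \<gamma> j = g. ek L (- x j) (ys (\<gamma> j))) = ek L (- ?s g) (ys g)" for g
    proof -
      have "(\<Prod>j | j \<in> {..<n} \<and> \<gamma> j = g. ek L (- x j) (ys (\<gamma> j))) = (\<Prod>j | j < n \<and> \<gamma> j = g. ek L (- x j) (ys g))"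
        by (intro prod.cong) auto
      then show ?thesis by (simp add: ek_sum sum_negf)
    qed
    ultimately show ?thesis by simp
  qed
  have ui: "integrable ?U (ek L k)" for k
    by (rule integrable_const_bound[where B = 1]) auto
  have "(LINT ys|PiM {..<m} (\<lambda>_. ?U). (\<Prod>j<n. ek L (- x j) (ys (\<gamma> j)))) = (\<Prod>g<m. LINT y|?U. ek L (- ?s g) y)"
    unfolding eq by (intro product_integral_prod) (auto intro: ui)
  also have "\<dots> = (\<Prod>g<m. if ?s g = 0 then 1 else 0)" by (simp add: integral_unif_ek[OF L])
  also have "\<dots> = (if \<forall>g<m. ?s g = 0 then 1 else 0)"
  proof (cases "\<forall>g<m. ?s g = 0")
    case False
    then obtain g where "g < m" "?s g \<noteq> 0" by auto
    then have "(\<Prod>g<m. if ?s g = 0 then 1 else 0) = (0 :: complex)" by (intro prod_zero bexI[of _ g]) auto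
    then show ?thesis using False by (simp only: if_False)
  qed simp
  also have "(\<forall>g<m. ?s g = 0) \<longleftrightarrow> (\<forall>j<n. ?s (\<gamma> j) = 0)"
  proof
    assume *: "\<forall>j<n. ?s (\<gamma> j) = 0"
    show "\<forall>g<m. ?s g = 0"
    proof (intro allI impI)
      fix g assume "g < m"
      show "?s g = 0"
      proof (cases "\<exists>j<n. \<gamma> j = g")
        case False
        then have "{j. j < n \<and> \<gamma> j = g} = {}" by auto
        then show ?thesis by (simp only: sum.empty)
      qed (use * in auto)
    qed
  qed (use g in auto)
  finally show ?thesis by (simp add: conserve_def)
qed

lemma block_rep_in_reps: "block_rep n f \<in> reps n"
proof -
  have le: "(LEAST i. f i = f j) \<le> j" and eq: "f (LEAST i. f i = f j) = f j" for j
    by (rule Least_le, simp) (rule LeastI[of "\<lambda>i. f i = f j" j], simp)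
  show ?thesis unfolding reps_def block_rep_def
    using le eq by (auto simp: intro: le_less_trans)
qed

lemma block_rep_eq_iff: "i < n \<Longrightarrow> j < n \<Longrightarrow> block_rep n f i = block_rep n f j \<longleftrightarrow> f i = f j"
proof -
  have eq: "f (LEAST i. f i = f j) = f j" for j
    by (rule LeastI[of "\<lambda>i. f i = f j" j]) simp
  show "i < n \<Longrightarrow> j < n \<Longrightarrow> ?thesis" unfolding block_rep_def by auto (metis eq)
qed

text \<open>Labellings with a prescribed partition correspond to injections of the block
  representatives into \<open>{..<m}\<close>. If there are fewer scatterers than blocks, truncated
  subtraction produces a zero factor, as it must.\<close>

lemma card_block_rep_fiber:
  assumes c: "c \<in> reps n"
  shows "card {\<gamma> \<in> PiE {..<n} (\<lambda>_. {..<m}). block_rep n \<gamma> = c} = (\<Prod>i<card (c ` {..<n}). m - i)"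
proof -
  let ?R = "c ` {..<n}"
  have cn: "c j < n" "c j \<le> j" "c (c j) = c j" if "j < n" for j using c that by (auto simp: reps_def)
  have R: "?R \<subseteq> {..<n}" using cn by auto
  have fix_R: "c r = r" if "r \<in> ?R" for r using that cn by auto
  have c_ext: "c j = undefined" if "\<not> j < n" for j using c that by (auto simp: reps_def PiE_def extensional_def)
  let ?A = "{\<iota> \<in> PiE ?R (\<lambda>_. {..<m}). inj_on \<iota> ?R}"
  let ?G = "{\<gamma> \<in> PiE {..<n} (\<lambda>_. {..<m}). block_rep n \<gamma> = c}"
  have "bij_betw (\<lambda>\<iota>. \<lambda>j\<in>{..<n}. \<iota> (c j)) ?A ?G"
  proof (rule bij_betw_byWitness[where f' = "\<lambda>\<gamma>. restrict \<gamma> ?R"])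
    show "\<forall>\<iota>\<in>?A. restrict (\<lambda>j\<in>{..<n}. \<iota> (c j)) ?R = \<iota>"
    proof safe
      fix \<iota> assume i: "\<iota> \<in> PiE ?R (\<lambda>_. {..<m})"
      show "restrict (\<lambda>j\<in>{..<n}. \<iota> (c j)) ?R = \<iota>"
      proof (rule ext)
        fix x
        show "restrict (\<lambda>j\<in>{..<n}. \<iota> (c j)) ?R x = \<iota> x"
        proof (cases "x \<in> ?R")
          case True
          then show ?thesis using R fix_R[OF True] by (auto simp: restrict_def)
        next
          case False
          then show ?thesis using i by (simp add: PiE_def extensional_def)
        qed
      qed
    qed
    have fib: "\<gamma> (c j) = \<gamma> j" if "block_rep n \<gamma> = c" "j < n" for \<gamma> j
    proof -
      have "c j = (LEAST i. \<gamma> i = \<gamma> j)" using that by (auto simp: block_rep_def)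
      then show ?thesis using LeastI[of "\<lambda>i. \<gamma> i = \<gamma> j" j] by simp
    qed
    show "\<forall>\<gamma>\<in>?G. (\<lambda>j\<in>{..<n}. restrict \<gamma> ?R (c j)) = \<gamma>"
    proof safe
      fix \<gamma> assume g: "\<gamma> \<in> PiE {..<n} (\<lambda>_. {..<m})" "c = block_rep n \<gamma>"
      show "(\<lambda>j\<in>{..<n}. restrict \<gamma> (block_rep n \<gamma> ` {..<n}) (block_rep n \<gamma> j)) = \<gamma>"
      proof (rule ext)
        fix x
        show "(\<lambda>j\<in>{..<n}. restrict \<gamma> (block_rep n \<gamma> ` {..<n}) (block_rep n \<gamma> j)) x = \<gamma> x"
          using g fib[of \<gamma> x] by (cases "x < n") (auto simp: PiE_def extensional_def)
      qed
    qed
    show "(\<lambda>\<iota>. \<lambda>j\<in>{..<n}. \<iota> (c j)) ` ?A \<subseteq> ?G"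
    proof (intro image_subsetI CollectI conjI)
      fix \<iota> assume "\<iota> \<in> ?A"
      then have i: "\<iota> \<in> PiE ?R (\<lambda>_. {..<m})" "inj_on \<iota> ?R" by auto
      show "(\<lambda>j\<in>{..<n}. \<iota> (c j)) \<in> PiE {..<n} (\<lambda>_. {..<m})" using i(1) by (auto simp: PiE_def Pi_def)
      have "(LEAST i. (\<lambda>j\<in>{..<n}. \<iota> (c j)) i = (\<lambda>j\<in>{..<n}. \<iota> (c j)) j) = c j" if j: "j < n" for j
      proof (rule Least_equality)
        show "(\<lambda>j\<in>{..<n}. \<iota> (c j)) (c j) = (\<lambda>j\<in>{..<n}. \<iota> (c j)) j" using j cn[OF j] by simp
        fix i assume i': "(\<lambda>j\<in>{..<n}. \<iota> (c j)) i = (\<lambda>j\<in>{..<n}. \<iota> (c j)) j"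
        show "c j \<le> i"
        proof (cases "i < n")
          case True
          then have "\<iota> (c i) = \<iota> (c j)" using i' j by simp
          then have "c i = c j" using i(2) True j by (auto simp: inj_on_def)
          then show ?thesis using cn(2)[OF True] by simp
        qed (use cn[OF j] in auto)
      qed
      then show "block_rep n (\<lambda>j\<in>{..<n}. \<iota> (c j)) = c"
        unfolding block_rep_def by (intro ext) (auto simp: c_ext)
    qed
    show "(\<lambda>\<gamma>. restrict \<gamma> ?R) ` ?G \<subseteq> ?A"
    proof (intro image_subsetI CollectI conjI)
      fix \<gamma> assume "\<gamma> \<in> ?G"
      then have g: "\<gamma> \<in> PiE {..<n} (\<lambda>_. {..<m})" "block_rep n \<gamma> = c" by auto
      show "restrict \<gamma> ?R \<in> PiE ?R (\<lambda>_. {..<m})"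
        using g R by (auto simp: PiE_def Pi_def)
      have "inj_on \<gamma> ?R"
      proof (rule inj_onI)
        fix r s assume rs: "r \<in> ?R" "s \<in> ?R" "\<gamma> r = \<gamma> s"
        then have "c r = c s" using R g(2) block_rep_eq_iff[of r n s \<gamma>] by auto
        then show "r = s" using fix_R[OF rs(1)] fix_R[OF rs(2)] by metis
      qed
      then show "inj_on (restrict \<gamma> ?R) ?R" by (simp add: inj_on_def)
    qed
  qed
  then have "card ?G = card ?A" by (rule bij_betw_same_card[symmetric])
  also have "\<dots> = (\<Prod>i<card ?R. m - i)"
    by (subst card_inj_on_subset_funcset) (auto simp: atLeast0LessThan)
  finally show ?thesis .
qed

text \<open>The falling factorial cancels against \<open>fact m\<close> and shifts the exponential
  series by \<open>k\<close>. With the volume as mean, each block of a partition gains exactly one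
  factor of volume.\<close>

lemma Poisson_factorial_moment:
  assumes "lam > 0"
  shows "(\<lambda>m. complex_of_real (lam ^ m / fact m * exp (- lam)) * of_nat (\<Prod>i<k. m - i)) sums of_real (lam ^ k)"
proof -
  have ff: "real (\<Prod>i<k. m + k - i) * fact m = fact (m + k)" for m
  proof (induction k)
    case (Suc k)
    have "(\<Prod>i<Suc k. m + Suc k - i) = (m + Suc k) * (\<Prod>i<k. m + k - i)"
      by (subst prod.lessThan_Suc_shift) simp
    then show ?case by (simp only: of_nat_mult mult.assoc Suc.IH) (simp add: algebra_simps)
  qed simp
  have "(\<lambda>m. lam ^ m /\<^sub>R fact m) sums exp lam" by (rule exp_converges)
  then have "(\<lambda>m. (lam ^ k * exp (- lam)) * (lam ^ m /\<^sub>R fact m)) sums ((lam ^ k * exp (- lam)) * exp lam)"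
    by (rule sums_mult)
  also have "(lam ^ k * exp (- lam)) * exp lam = lam ^ k" by (simp add: exp_minus)
  also have "(\<lambda>m. (lam ^ k * exp (- lam)) * (lam ^ m /\<^sub>R fact m)) = (\<lambda>m. lam ^ (m + k) / fact (m + k) * exp (- lam) * real (\<Prod>i<k. m + k - i))"
  proof
    fix m
    have "real (\<Prod>i<k. m + k - i) / fact (m + k) = 1 / fact m"
      using ff[of m] by (simp add: field_simps del: of_nat_prod)
    then have *: "lam ^ (m + k) * exp (- lam) * (real (\<Prod>i<k. m + k - i) / fact (m + k)) = lam ^ (m + k) * exp (- lam) * (1 / fact m)" by (simp only:)
    have "(lam ^ k * exp (- lam)) * (lam ^ m /\<^sub>R fact m) = lam ^ (m + k) * exp (- lam) * (1 / fact m)"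
      by (simp add: power_add divide_inverse mult_ac)
    also note *[symmetric]
    finally show "(lam ^ k * exp (- lam)) * (lam ^ m /\<^sub>R fact m) = lam ^ (m + k) / fact (m + k) * exp (- lam) * real (\<Prod>i<k. m + k - i)"
      by (simp add: divide_inverse mult_ac del: of_nat_prod)
  qed
  \<comment> \<open>The terms with \<open>m < k\<close> vanish by truncated subtraction, so nothing
    is lost in the shift.\<close>
  finally have "(\<lambda>m. lam ^ m / fact m * exp (- lam) * real (\<Prod>i<k. m - i)) sums (lam ^ k)"
    by (subst (asm) sums_zero_iff_shift[where f = "\<lambda>m. lam ^ m / fact m * exp (- lam) * real (\<Prod>i<k. m - i)"])
       (auto intro!: prod_zero)
  from sums_of_real[OF this, where ?'a = complex] show ?thesis by simp
qed

text \<open>Positions and momenta may be interchanged because the phases have modulus one and the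
  positions live on a probability space.\<close>

lemma integral_phases_mom_integrand:
  fixes b f1 f2 :: "int^'d \<Rightarrow> complex"
  assumes L: "L > 0" and g: "\<gamma> \<in> PiE {..<n} (\<lambda>_. {..<m})"
    and G: "integrable (PiM {..<Suc n} (\<lambda>_. latm L :: (int^'d) measure)) G"
  defines "U \<equiv> uniform_measure lborel (box_L L :: (real^'d) set)"
  shows "integrable (PiM {..<m} (\<lambda>_. U)) (\<lambda>ys. LINT x|PiM {..<Suc n} (\<lambda>_. latm L). (\<Prod>j<n. ek L (- x j) (ys (\<gamma> j))) * G x)"
    and "(LINT ys|PiM {..<m} (\<lambda>_. U). LINT x|PiM {..<Suc n} (\<lambda>_. latm L). (\<Prod>j<n. ek L (- x j) (ys (\<gamma> j))) * G x)
       = (LINT x|PiM {..<Suc n} (\<lambda>_. latm L). conserve n \<gamma> x * G x)"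
proof -
  interpret U: prob_space U unfolding U_def by (rule prob_space_unif[OF L])
  interpret PUm: prob_space "PiM {..<m} (\<lambda>_. U)" by (rule prob_space_PiM) (rule U.prob_space_axioms)
  interpret product_sigma_finite "\<lambda>_. latm L :: (int^'d) measure" by (rule product_sigma_finite_latm[OF L])
  interpret PL: sigma_finite_measure "PiM {..<Suc n} (\<lambda>_. latm L :: (int^'d) measure)" by (rule sigma_finite) simp
  interpret P: pair_sigma_finite "PiM {..<Suc n} (\<lambda>_. latm L :: (int^'d) measure)" "PiM {..<m} (\<lambda>_. U)" ..
  have gm: "\<gamma> j < m" if "j < n" for j using g that by auto
  have "integrable (PiM {..<Suc n} (\<lambda>_. latm L) \<Otimes>\<^sub>M PiM {..<m} (\<lambda>_. U)) (\<lambda>p. (case p of (x, ys) \<Rightarrow> G x * 1) * (\<Prod>j<n. ek L (- fst p j) (snd p (\<gamma> j))))"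
  proof (rule integrable_mult_bounded[where C = 1])
    show "integrable (PiM {..<Suc n} (\<lambda>_. latm L) \<Otimes>\<^sub>M PiM {..<m} (\<lambda>_. U)) (\<lambda>(x, ys). G x * 1)"
      by (rule P.integrable_fst_mult_snd[OF G]) simp
    show "(\<lambda>p. \<Prod>j<n. ek L (- fst p j) (snd p (\<gamma> j))) \<in> borel_measurable (PiM {..<Suc n} (\<lambda>_. latm L) \<Otimes>\<^sub>M PiM {..<m} (\<lambda>_. U))"
    proof (rule borel_measurable_PiM_latm_pair)
      fix x :: "nat \<Rightarrow> int^'d"
      have "(\<lambda>ys. ek L (- x j) (ys (\<gamma> j))) \<in> borel_measurable (PiM {..<m} (\<lambda>_. U))" if "j < n" for j
        using gm[OF that] by (intro measurable_compose[OF measurable_component_singleton]) (auto simp: U_def)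
      then show "(\<lambda>ys. \<Prod>j<n. ek L (- fst (x, ys) j) (snd (x, ys) (\<gamma> j))) \<in> borel_measurable (PiM {..<m} (\<lambda>_. U))"
        by (auto intro!: borel_measurable_prod)
    qed simp
  qed (auto simp: prod_norm[symmetric])
  then have int: "integrable (PiM {..<Suc n} (\<lambda>_. latm L) \<Otimes>\<^sub>M PiM {..<m} (\<lambda>_. U)) (\<lambda>(x, ys). (\<Prod>j<n. ek L (- x j) (ys (\<gamma> j))) * G x)"
    by (simp add: case_prod_unfold mult.commute)
  show "integrable (PiM {..<m} (\<lambda>_. U)) (\<lambda>ys. LINT x|PiM {..<Suc n} (\<lambda>_. latm L). (\<Prod>j<n. ek L (- x j) (ys (\<gamma> j))) * G x)"
    by (rule P.integrable_snd[OF int])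
  have "(LINT ys|PiM {..<m} (\<lambda>_. U). LINT x|PiM {..<Suc n} (\<lambda>_. latm L). (\<Prod>j<n. ek L (- x j) (ys (\<gamma> j))) * G x)
     = (LINT x|PiM {..<Suc n} (\<lambda>_. latm L). LINT ys|PiM {..<m} (\<lambda>_. U). (\<Prod>j<n. ek L (- x j) (ys (\<gamma> j))) * G x)"
    by (rule P.Fubini_integral[OF int])
  also have "\<dots> = (LINT x|PiM {..<Suc n} (\<lambda>_. latm L). conserve n \<gamma> x * G x)"
    unfolding U_def by (simp add: integral_prod_phases[OF L g])
  finally show "(LINT ys|PiM {..<m} (\<lambda>_. U). LINT x|PiM {..<Suc n} (\<lambda>_. latm L). (\<Prod>j<n. ek L (- x j) (ys (\<gamma> j))) * G x)
       = (LINT x|PiM {..<Suc n} (\<lambda>_. latm L). conserve n \<gamma> x * G x)" .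
qed

text \<open>The expectations are taken from the inside out: amplitudes give
  \<open>mom_weight\<close>, positions give \<open>conserve\<close>, and the number of labellings
  with a given partition has a power of the volume as its Poisson mean.\<close>

lemma T_L_lattice:
  fixes B :: "real^'d \<Rightarrow> real"
  assumes L: "L > 0" and z: "Im z \<noteq> 0" and B: "B \<in> borel_measurable borel" and Bb: "\<And>x. \<bar>B x\<bar> \<le> C"
    and b: "integrable (latm L) (bL L B)" and psi: "in_L2 \<psi>1" "in_L2 \<psi>2"
    and mu: "prob_space \<mu>" and mom: "\<And>k::nat. integrable \<mu> (\<lambda>v. v ^ k)"
  shows "T_L \<mu> B n L z \<psi>1 \<psi>2 = (\<Sum>c\<in>reps n. mom_weight \<mu> n c * of_real ((L ^ CARD('d)) ^ card (c ` {..<n})) *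
     (LINT x|PiM {..<Suc n} (\<lambda>_. latm L). conserve n c x * mom_integrand L z (bL L B) (fcoef L \<psi>1) (fcoef L \<psi>2) n x))"
proof -
  have p2: "in_L2_box L (per L \<psi>1)" "in_L2_box L (per L \<psi>2)"
    using in_L2_box_cong[of L _ "per L _"] per_id[OF L] in_L2_imp_box[OF psi(1), of L] in_L2_imp_box[OF psi(2), of L]
    by (metis (no_types, lifting))+
  have pf: "fcoef L (per L \<psi>) = fcoef L \<psi>" for \<psi> :: "real^'d \<Rightarrow> complex"
    by (rule ext, rule fcoef_cong) (rule per_id[OF L])
  let ?U = "uniform_measure lborel (box_L L :: (real^'d) set)"
  let ?G = "mom_integrand L z (bL L B) (fcoef L \<psi>1) (fcoef L \<psi>2) n"
  have G: "integrable (PiM {..<Suc n} (\<lambda>_. latm L)) ?G"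
    by (rule integrable_mom_integrand[OF L z b]) (use Bessel(1)[OF L p2(1)] Bessel(1)[OF L p2(2)] in \<open>simp_all add: pf\<close>)
  define X where "X c = mom_weight \<mu> n c * (LINT x|PiM {..<Suc n} (\<lambda>_. latm L). conserve n c x * ?G x)" for c
  let ?W = "\<lambda>\<gamma> ys. LINT x|PiM {..<Suc n} (\<lambda>_. latm L). (\<Prod>j<n. ek L (- x j) (ys (\<gamma> j))) * ?G x"
  have fin: "finite (PiE {..<n} (\<lambda>_. {..<m::nat}))" for m by (rule finite_PiE) auto
  have vs: "(LINT vs|PiM {..<m} (\<lambda>_. \<mu>). inner_L L (per L \<psi>1) (chain L z (pot L B m ys vs) n (per L \<psi>2)))
     = (\<Sum>\<gamma>\<in>PiE {..<n} (\<lambda>_. {..<m}). mom_weight \<mu> n \<gamma> * ?W \<gamma> ys)" for m ys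
  proof -
    have "(LINT vs|PiM {..<m} (\<lambda>_. \<mu>). inner_L L (per L \<psi>1) (chain L z (pot L B m ys vs) n (per L \<psi>2)))
      = (LINT vs|PiM {..<m} (\<lambda>_. \<mu>). (\<Sum>\<gamma>\<in>PiE {..<n} (\<lambda>_. {..<m}). (\<Prod>j<n. of_real (vs (\<gamma> j))) * ?W \<gamma> ys))"
      unfolding inner_chain[OF L z B Bb b p2] pf ..
    also have "\<dots> = (\<Sum>\<gamma>\<in>PiE {..<n} (\<lambda>_. {..<m}). LINT vs|PiM {..<m} (\<lambda>_. \<mu>). (\<Prod>j<n. of_real (vs (\<gamma> j))) * ?W \<gamma> ys)"
      by (rule Bochner_Integration.integral_sum)
         (intro Bochner_Integration.integrable_mult_left integral_prod_amplitudes(1)[OF mu mom])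
    also have "\<dots> = (\<Sum>\<gamma>\<in>PiE {..<n} (\<lambda>_. {..<m}). mom_weight \<mu> n \<gamma> * ?W \<gamma> ys)"
      by (intro sum.cong refl) (simp only: integral_mult_left_zero integral_prod_amplitudes(2)[OF mu mom])
    finally show ?thesis .
  qed
  have ys: "(LINT ys|PiM {..<m} (\<lambda>_. ?U). LINT vs|PiM {..<m} (\<lambda>_. \<mu>). inner_L L (per L \<psi>1) (chain L z (pot L B m ys vs) n (per L \<psi>2)))
     = (\<Sum>c\<in>reps n. of_nat (\<Prod>i<card (c ` {..<n}). m - i) * X c)" for m
  proof -
    have "(LINT ys|PiM {..<m} (\<lambda>_. ?U). LINT vs|PiM {..<m} (\<lambda>_. \<mu>). inner_L L (per L \<psi>1) (chain L z (pot L B m ys vs) n (per L \<psi>2)))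
       = (\<Sum>\<gamma>\<in>PiE {..<n} (\<lambda>_. {..<m}). LINT ys|PiM {..<m} (\<lambda>_. ?U). mom_weight \<mu> n \<gamma> * ?W \<gamma> ys)"
      unfolding vs by (rule Bochner_Integration.integral_sum)
         (intro Bochner_Integration.integrable_mult_right integral_phases_mom_integrand(1)[OF L _ G])
    also have "\<dots> = (\<Sum>\<gamma>\<in>PiE {..<n} (\<lambda>_. {..<m}). X \<gamma>)"
      unfolding X_def by (intro sum.cong refl) (simp only: integral_mult_right_zero integral_phases_mom_integrand(2)[OF L _ G])
    \<comment> \<open>Weight and conservation law see only the partition of the labels, so
      labellings can be grouped by \<open>block_rep\<close> and counted.\<close>
    also have "\<dots> = (\<Sum>\<gamma>\<in>PiE {..<n} (\<lambda>_. {..<m}). X (block_rep n \<gamma>))"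
    proof (intro sum.cong refl)
      fix \<gamma> :: "nat \<Rightarrow> nat"
      have "mom_weight \<mu> n \<gamma> = mom_weight \<mu> n (block_rep n \<gamma>)" "conserve n \<gamma> = (conserve n (block_rep n \<gamma>) :: (nat \<Rightarrow> int^'d) \<Rightarrow> _)"
        by (rule mom_weight_cong conserve_cong, simp add: block_rep_eq_iff)+
      then show "X \<gamma> = X (block_rep n \<gamma>)" unfolding X_def by (simp only:)
    qed
    also have "\<dots> = (\<Sum>c\<in>reps n. \<Sum>\<gamma> | \<gamma> \<in> PiE {..<n} (\<lambda>_. {..<m}) \<and> block_rep n \<gamma> = c. X (block_rep n \<gamma>))"
      by (rule sum.group[symmetric]) (auto intro: fin finite_reps block_rep_in_reps)
    also have "\<dots> = (\<Sum>c\<in>reps n. of_nat (\<Prod>i<card (c ` {..<n}). m - i) * X c)"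
    proof (intro sum.cong refl)
      fix c assume c: "c \<in> reps n"
      have "(\<Sum>\<gamma> | \<gamma> \<in> PiE {..<n} (\<lambda>_. {..<m}) \<and> block_rep n \<gamma> = c. X (block_rep n \<gamma>))
         = (\<Sum>\<gamma> | \<gamma> \<in> PiE {..<n} (\<lambda>_. {..<m}) \<and> block_rep n \<gamma> = c. X c)" by (intro sum.cong) auto
      also have "\<dots> = of_nat (card {\<gamma> \<in> PiE {..<n} (\<lambda>_. {..<m}). block_rep n \<gamma> = c}) * X c" by (rule sum_constant)
      finally show "(\<Sum>\<gamma> | \<gamma> \<in> PiE {..<n} (\<lambda>_. {..<m}) \<and> block_rep n \<gamma> = c. X (block_rep n \<gamma>)) = of_nat (\<Prod>i<card (c ` {..<n}). m - i) * X c"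
        unfolding card_block_rep_fiber[OF c] .
    qed
    finally show ?thesis .
  qed
  have lam: "L ^ CARD('d) > 0" using L by simp
  have "(\<lambda>m. of_real ((L ^ CARD('d)) ^ m / fact m * exp (- (L ^ CARD('d)))) * (\<Sum>c\<in>reps n. of_nat (\<Prod>i<card (c ` {..<n}). m - i) * X c))
     sums (\<Sum>c\<in>reps n. of_real ((L ^ CARD('d)) ^ card (c ` {..<n})) * X c)"
    unfolding sum_distrib_left mult.assoc[symmetric]
    by (intro sums_sum sums_mult2 Poisson_factorial_moment lam)
  then have "T_L \<mu> B n L z \<psi>1 \<psi>2 = (\<Sum>c\<in>reps n. of_real ((L ^ CARD('d)) ^ card (c ` {..<n})) * X c)"
    unfolding T_L_def exp_L_def ys by (rule sums_unique[symmetric])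
  then show ?thesis unfolding X_def by (simp only: mult_ac)
qed

text \<open>\<open>free_idx n c\<close> indexes the integration variables that survive momentum conservation in every
  block; \<open>ext_mom n c\<close> reconstructs the transfer of the block representatives.\<close>
definition free_idx :: "nat \<Rightarrow> (nat \<Rightarrow> nat) \<Rightarrow> nat set" where
  "free_idx n c = {..<Suc n} - c ` {..<n}"

definition ext_mom :: "nat \<Rightarrow> (nat \<Rightarrow> nat) \<Rightarrow> (nat \<Rightarrow> 'a::ab_group_add) \<Rightarrow> nat \<Rightarrow> 'a" where
  "ext_mom n c x j = (if j \<in> c ` {..<n} then - (\<Sum>i | i < n \<and> i \<notin> c ` {..<n} \<and> c i = j. x i) else x j)"

section \<open>Solving the conservation laws\<close>

lemma mom_integrand_cong:
  assumes "\<And>j. j \<le> n \<Longrightarrow> x j = y j"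
  shows "mom_integrand L z b f1 f2 n x = mom_integrand L z b f1 f2 n y"
proof -
  have "resprod L z n (x n) x = resprod L z n (y n) y" using assms by (simp add: resprod_cong[of n x y])
  moreover have "(\<Prod>j<n. b (x j)) = (\<Prod>j<n. b (y j))" "(\<Sum>j<n. x j) = (\<Sum>j<n. y j)"
    using assms by (auto intro!: prod.cong sum.cong)
  ultimately show ?thesis using assms[of n] by (simp add: mom_integrand_def)
qed

lemma reps_props:
  assumes c: "c \<in> reps n"
  shows "c ` {..<n} \<subseteq> {..<n}" "\<And>r. r \<in> c ` {..<n} \<Longrightarrow> c r = r" "\<And>j. j < n \<Longrightarrow> c j < n"
  using c by (auto simp: reps_def)

lemma block_split:
  fixes x :: "nat \<Rightarrow> 'a::ab_group_add"
  assumes c: "c \<in> reps n" and r: "r \<in> c ` {..<n}"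
  shows "(\<Sum>i | i < n \<and> c i = r. x i) = x r + (\<Sum>i | i < n \<and> i \<notin> c ` {..<n} \<and> c i = r. x i)"
proof -
  have "{i. i < n \<and> c i = r} = insert r {i. i < n \<and> i \<notin> c ` {..<n} \<and> c i = r}"
  proof -
    have "i = r" if "i \<in> c ` {..<n}" "c i = r" for i using reps_props(2)[OF c that(1)] that(2) by simp
    moreover have "r < n" using reps_props(1)[OF c] r by blast
    moreover have "c r = r" by (rule reps_props(2)[OF c r])
    ultimately show ?thesis by blast
  qed
  moreover have "r \<notin> {i. i < n \<and> i \<notin> c ` {..<n} \<and> c i = r}" using r by blast
  moreover have "finite {i. i < n \<and> i \<notin> c ` {..<n} \<and> c i = r}" by simp
  ultimately show ?thesis by (simp only: sum.insert not_False_eq_True)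
qed

text \<open>Each block adds up to zero by construction. Consequently the incoming and the outgoing
  momentum coincide after averaging, and both wave functions are evaluated at the same
  point.\<close>

lemma sum_ext_mom:
  assumes c: "c \<in> reps n"
  shows "(\<Sum>j<n. ext_mom n c x j) = (0 :: 'a::ab_group_add)"
proof -
  have "(\<Sum>j<n. ext_mom n c x j) = (\<Sum>r\<in>c ` {..<n}. \<Sum>j | j \<in> {..<n} \<and> c j = r. ext_mom n c x j)"
    by (rule sum.group[symmetric]) auto
  also have "\<dots> = (\<Sum>r\<in>c ` {..<n}. 0)"
  proof (intro sum.cong refl)
    fix r assume r: "r \<in> c ` {..<n}"
    have "(\<Sum>i | i < n \<and> i \<notin> c ` {..<n} \<and> c i = r. ext_mom n c x i) = (\<Sum>i | i < n \<and> i \<notin> c ` {..<n} \<and> c i = r. x i)"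
      by (intro sum.cong) (auto simp: ext_mom_def)
    then show "(\<Sum>j | j \<in> {..<n} \<and> c j = r. ext_mom n c x j) = 0"
      using block_split[OF c r, of "ext_mom n c x"] r by (simp add: ext_mom_def[of _ _ _ r])
  qed
  finally show ?thesis by simp
qed

text \<open>Each conservation law pins the transfer of one representative to a single lattice point
  of mass \<open>L^(-d)\<close>. The volume factors of the Poisson mean cancel these masses, leaving
  an integral over the free variables.\<close>

lemma integral_conserve:
  fixes G :: "(nat \<Rightarrow> int^'d) \<Rightarrow> complex"
  assumes L: "L > 0" and c: "c \<in> reps n" and G: "integrable (PiM {..<Suc n} (\<lambda>_. latm L)) G"
    and Gc: "\<And>x y. (\<And>j. j \<le> n \<Longrightarrow> x j = y j) \<Longrightarrow> G x = G y"
  shows "of_real ((L ^ CARD('d)) ^ card (c ` {..<n})) * (LINT x|PiM {..<Suc n} (\<lambda>_. latm L). conserve n c x * G x)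
     = (LINT x|PiM (free_idx n c) (\<lambda>_. latm L). G (ext_mom n c x))"
proof -
  interpret product_sigma_finite "\<lambda>_. latm L :: (int^'d) measure" by (rule product_sigma_finite_latm[OF L])
  define R where "R = c ` {..<n}"
  define D where "D = free_idx n c"
  have RS: "R \<subseteq> {..<n}" unfolding R_def by (rule reps_props(1)[OF c])
  have D: "D = {..<Suc n} - R" by (simp add: D_def free_idx_def R_def)
  have ext: "ext_mom n c x j = (if j \<in> R then - (\<Sum>i | i < n \<and> i \<notin> R \<and> c i = j. x i) else x j)" for x :: "nat \<Rightarrow> int^'d" and j
    by (simp only: ext_mom_def R_def)
  have split: "(\<Sum>i | i < n \<and> c i = r. x i) = x r + (\<Sum>i | i < n \<and> i \<notin> R \<and> c i = r. x i)" if "r \<in> R" for x :: "nat \<Rightarrow> int^'d" and r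
    using block_split[OF c] that unfolding R_def by blast
  have cR: "c j \<in> R" if "j < n" for j using that by (simp add: R_def)
  have Rc: "\<exists>j<n. r = c j" if "r \<in> R" for r using that by (auto simp: R_def)
  have fR: "finite R" and fD: "finite D" using RS by (auto simp: D intro: finite_subset)
  have un: "D \<union> R = {..<Suc n}" using RS by (auto simp: D)
  have disj: "D \<inter> R = {}" by (auto simp: D)
  have cG: "integrable (PiM (D \<union> R) (\<lambda>_. latm L)) (\<lambda>x. conserve n c x * G x)"
  proof -
    have "integrable (PiM {..<Suc n} (\<lambda>_. latm L)) (\<lambda>x. G x * conserve n c x)"
    proof (rule integrable_mult_bounded[OF G])
      show "conserve n c \<in> borel_measurable (PiM {..<Suc n} (\<lambda>_. latm L))"
        by (rule borel_measurable_PiM_latm) simp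
      show "AE x in PiM {..<Suc n} (\<lambda>_. latm L). cmod (conserve n c x) \<le> 1"
        by (rule AE_I2) (simp add: conserve_def)
    qed
    then show ?thesis unfolding un by (simp only: mult.commute)
  qed
  \<comment> \<open>The one choice of transfers at the representatives for which all blocks are
    balanced.\<close>
  define Y where "Y x = (\<lambda>r\<in>R. - (\<Sum>i | i < n \<and> i \<notin> R \<and> c i = r. x i))" for x :: "nat \<Rightarrow> int^'d"
  have key: "conserve n c (merge D R (x, y)) * G (merge D R (x, y)) = indicator {Y x} y *\<^sub>R G (ext_mom n c x)"
    if "x \<in> space (PiM D (\<lambda>_. latm L))" "y \<in> space (PiM R (\<lambda>_. latm L))" for x y
  proof -
    let ?m = "merge D R (x, y)"
    have mD: "?m i = x i" if "i < n" "i \<notin> R" for i using that by (simp add: merge_def D)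
    have mR: "?m r = y r" if "r \<in> R" for r using that by (simp add: merge_def D)
    have s: "(\<Sum>i | i < n \<and> c i = r. ?m i) = y r - Y x r" if r: "r \<in> R" for r
    proof -
      have "(\<Sum>i | i < n \<and> i \<notin> R \<and> c i = r. ?m i) = (\<Sum>i | i < n \<and> i \<notin> R \<and> c i = r. x i)"
        by (intro sum.cong refl) (simp add: mD)
      then show ?thesis unfolding split[OF r] mR[OF r] using r by (simp add: Y_def)
    qed
    have "(\<forall>j<n. (\<Sum>i | i < n \<and> c i = c j. ?m i) = 0) \<longleftrightarrow> (\<forall>r\<in>R. y r = Y x r)"
    proof
      assume *: "\<forall>j<n. (\<Sum>i | i < n \<and> c i = c j. ?m i) = 0"
      show "\<forall>r\<in>R. y r = Y x r"
      proof
        fix r assume r: "r \<in> R"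
        then obtain j where "j < n" "r = c j" using Rc by blast
        with * have "(\<Sum>i | i < n \<and> c i = r. ?m i) = 0" by blast
        then show "y r = Y x r" using s[OF r] by simp
      qed
    next
      assume *: "\<forall>r\<in>R. y r = Y x r"
      show "\<forall>j<n. (\<Sum>i | i < n \<and> c i = c j. ?m i) = 0"
      proof (intro allI impI)
        fix j assume "j < n"
        from s[OF cR[OF this]] * cR[OF this] show "(\<Sum>i | i < n \<and> c i = c j. ?m i) = 0" by simp
      qed
    qed
    also have "\<dots> \<longleftrightarrow> y = Y x"
      using that(2) by (auto simp: space_PiM PiE_def extensional_def Y_def fun_eq_iff)
    finally have cons: "conserve n c ?m = indicator {Y x} y" by (simp add: conserve_def indicator_def)
    have "G ?m = G (ext_mom n c x)" if "y = Y x"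
    proof (rule Gc)
      fix j assume "j \<le> n"
      then show "?m j = ext_mom n c x j" using that by (auto simp: merge_def D ext Y_def)
    qed
    then show ?thesis unfolding cons by (auto simp: indicator_def)
  qed
  have meas: "measure (PiM R (\<lambda>_. latm L)) {Y x} = (1 / L ^ CARD('d)) ^ card R" for x
  proof -
    have "{Y x} = PiE R (\<lambda>r. {Y x r})" by (rule PiE_singleton[symmetric]) (simp add: Y_def)
    then have "emeasure (PiM R (\<lambda>_. latm L)) {Y x} = (\<Prod>r\<in>R. ennreal (1 / L ^ CARD('d)))"
      using fR by (simp only:) (subst emeasure_PiM, auto simp: emeasure_latm_singleton)
    then show ?thesis using L by (simp add: measure_def ennreal_power)
  qed
  have emf: "emeasure (PiM R (\<lambda>_. latm L)) {Y x} < \<infinity>" for x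
  proof -
    have "{Y x} = PiE R (\<lambda>r. {Y x r})" by (rule PiE_singleton[symmetric]) (simp add: Y_def)
    then have "emeasure (PiM R (\<lambda>_. latm L)) {Y x} = (\<Prod>r\<in>R. ennreal (1 / L ^ CARD('d)))"
      using fR by (simp only:) (subst emeasure_PiM, auto simp: emeasure_latm_singleton)
    then show ?thesis by (simp add: power_less_top_ennreal)
  qed
  have "(LINT x|PiM {..<Suc n} (\<lambda>_. latm L). conserve n c x * G x)
     = (LINT x|PiM D (\<lambda>_. latm L). LINT y|PiM R (\<lambda>_. latm L). conserve n c (merge D R (x, y)) * G (merge D R (x, y)))"
    using product_integral_fold[OF disj fD fR cG] unfolding un .
  also have "\<dots> = (LINT x|PiM D (\<lambda>_. latm L). LINT y|PiM R (\<lambda>_. latm L). indicator {Y x} y *\<^sub>R G (ext_mom n c x))"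
    by (intro Bochner_Integration.integral_cong refl key)
  also have "\<dots> = (LINT x|PiM D (\<lambda>_. latm L). (1 / L ^ CARD('d)) ^ card R *\<^sub>R G (ext_mom n c x))"
  proof (intro Bochner_Integration.integral_cong refl)
    fix x
    have "{Y x} \<in> sets (PiM R (\<lambda>_. latm L))" unfolding sets_PiM_latm[OF fR] by (auto simp: Y_def)
    then have "has_bochner_integral (PiM R (\<lambda>_. latm L)) (\<lambda>y. indicator {Y x} y *\<^sub>R G (ext_mom n c x)) (measure (PiM R (\<lambda>_. latm L)) {Y x} *\<^sub>R G (ext_mom n c x))"
      using emf by (intro has_bochner_integral_scaleR_left has_bochner_integral_real_indicator) auto
    then show "(LINT y|PiM R (\<lambda>_. latm L). indicator {Y x} y *\<^sub>R G (ext_mom n c x)) = (1 / L ^ CARD('d)) ^ card R *\<^sub>R G (ext_mom n c x)"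
      unfolding meas by (rule has_bochner_integral_integral_eq)
  qed
  finally show ?thesis unfolding R_def[symmetric] D_def[symmetric] using L by (simp add: power_one_over scaleR_conv_of_real)
qed

section \<open>The infinite-volume limit\<close>

text \<open>Index of the cell of side \<open>1 / L\<close> containing \<open>x\<close>. Pulling a
  lattice function back along it gives a step function on momentum space.\<close>

definition rnd :: "real \<Rightarrow> real^'d \<Rightarrow> int^'d" where
  "rnd L x = (\<chi> i. \<lfloor>L * x $ i\<rfloor>)"

section \<open>Lattice sums as integrals of step functions\<close>

lemma emeasure_vec_rect:
  assumes [measurable]: "\<And>i. A i \<in> sets (borel :: real measure)"
  shows "emeasure lborel {x::real^'d. \<forall>i. x $ i \<in> A i} = (\<Prod>i\<in>UNIV. emeasure lborel (A i))"
proof -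
  interpret product_sigma_finite "\<lambda>_::'d. lborel :: real measure" ..
  have eq: "(\<lambda>f. (\<chi> i. f i) :: real^'d) -` {x. \<forall>i. x $ i \<in> A i} \<inter> space (PiM UNIV (\<lambda>_::'d. lborel :: real measure)) = PiE UNIV A"
    by (auto simp: space_PiM PiE_iff)
  have "{x::real^'d. \<forall>i. x $ i \<in> A i} \<in> sets borel" by measurable
  then show ?thesis
    by (subst lborel_vec_PiM, subst emeasure_distr[OF measurable_PiM_vec]) (simp_all only: eq, simp add: emeasure_PiM)
qed

lemma rnd_vimage: "rnd L -` {k} = {x. \<forall>i. x $ i \<in> (\<lambda>t. \<lfloor>L * t\<rfloor>) -` {k $ i}}"
  by (auto simp: rnd_def vec_eq_iff)

lemma rnd_vimage_borel: "rnd L -` {k :: int^'d} \<in> sets borel"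
proof -
  have "(\<lambda>t::real. \<lfloor>L * t\<rfloor>) -` {k $ i} \<in> sets borel" for i
  proof -
    have "{t \<in> space borel. \<lfloor>L * t\<rfloor> = k $ i} \<in> sets borel" by measurable
    then show ?thesis by (simp add: vimage_def)
  qed
  note [measurable] = this
  show ?thesis unfolding rnd_vimage by measurable
qed

lemma rnd_measurable [measurable]: "rnd L \<in> measurable lborel (latm L)"
proof (rule measurableI)
  fix A :: "(int^'d) set"
  have "rnd L -` A = (\<Union>k\<in>A. rnd L -` {k})" by auto
  moreover have "(\<Union>k\<in>A. rnd L -` {k}) \<in> sets borel" by (intro sets.countable_UN'' rnd_vimage_borel) auto
  ultimately show "rnd L -` A \<inter> space lborel \<in> sets lborel" by simp
qed simp

text \<open>A cell has volume \<open>L^(-d)\<close>, the mass of a lattice point. Lattice sums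
  thereby become Lebesgue integrals over a space that does not change with \<open>L\<close>, where
  dominated convergence applies.\<close>

lemma distr_rnd:
  assumes L: "L > 0" shows "distr lborel (latm L) (rnd L) = (latm L :: (int^'d) measure)"
proof (rule measure_eqI_countable[where A = UNIV])
  fix k :: "int^'d"
  have "emeasure (distr lborel (latm L) (rnd L)) {k} = emeasure lborel (rnd L -` {k})"
    by (subst emeasure_distr) auto
  also have "\<dots> = (\<Prod>i\<in>(UNIV::'d set). emeasure lborel {of_int (k $ i) / L ..< (of_int (k $ i) + 1) / L})"
  proof -
    have "(\<lambda>t::real. \<lfloor>L * t\<rfloor>) -` {j} = {j / L ..< (j + 1) / L}" for j
    proof -
      have "\<lfloor>L * t\<rfloor> = j \<longleftrightarrow> t \<in> {of_int j / L ..< (of_int j + 1) / L}" for t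
        unfolding floor_eq_iff using L by (auto simp: field_simps)
      then show ?thesis by (intro set_eqI) (simp only: vimage_eq singleton_iff)
    qed
    then show ?thesis unfolding rnd_vimage by (simp only:) (rule emeasure_vec_rect, simp)
  qed
  also have "\<dots> = (\<Prod>i\<in>(UNIV::'d set). ennreal (1 / L))"
    using L by (intro prod.cong refl) (subst emeasure_lborel_Ico, auto simp: field_simps)
  also have "\<dots> = emeasure (latm L) {k}" using L
    by (simp add: emeasure_latm_singleton ennreal_power power_one_over)
  finally show "emeasure (distr lborel (latm L) (rnd L)) {k} = emeasure (latm L) {k}" .
qed (auto simp: )

lemma rnd_PiM_measurable:
  "(\<lambda>x. \<lambda>j\<in>I. rnd L (x j)) \<in> measurable (PiM I (\<lambda>_. lborel :: (real^'d) measure)) (PiM I (\<lambda>_. latm L))"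
proof (rule measurable_restrict)
  fix j assume "j \<in> I"
  then have "(\<lambda>x. x j) \<in> measurable (PiM I (\<lambda>_. lborel :: (real^'d) measure)) lborel"
    by (rule measurable_component_singleton)
  from measurable_compose[OF this rnd_measurable] show "(\<lambda>x. rnd L (x j)) \<in> measurable (PiM I (\<lambda>_. lborel :: (real^'d) measure)) (latm L)" .
qed

lemma distr_PiM_rnd:
  assumes L: "L > 0" and I: "finite I"
  shows "distr (PiM I (\<lambda>_. lborel)) (PiM I (\<lambda>_. latm L)) (\<lambda>x. \<lambda>j\<in>I. rnd L (x j)) = PiM I (\<lambda>_. latm L :: (int^'d) measure)"
proof -
  interpret product_sigma_finite "\<lambda>_. latm L :: (int^'d) measure" by (rule product_sigma_finite_latm[OF L])
  interpret l: product_sigma_finite "\<lambda>_. lborel :: (real^'d) measure" ..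
  show ?thesis
  proof (rule PiM_eqI[OF I])
    fix A :: "'a \<Rightarrow> (int^'d) set"
    have m: "(\<lambda>x. \<lambda>j\<in>I. rnd L (x j)) \<in> measurable (PiM I (\<lambda>_. lborel :: (real^'d) measure)) (PiM I (\<lambda>_. latm L))"
      by (rule rnd_PiM_measurable)
    have v: "rnd L -` B \<in> sets lborel" for B :: "(int^'d) set"
      using measurable_sets[OF rnd_measurable[of L], of B] by simp
    have "emeasure (distr (PiM I (\<lambda>_. lborel)) (PiM I (\<lambda>_. latm L)) (\<lambda>x. \<lambda>j\<in>I. rnd L (x j))) (Pi\<^sub>E I A)
      = emeasure (PiM I (\<lambda>_. lborel :: (real^'d) measure)) (PiE I (\<lambda>j. rnd L -` A j))"
      by (subst emeasure_distr[OF m]) (auto simp: sets_PiM_latm[OF I] space_PiM PiE_def Pi_def extensional_def intro!: arg_cong[where f = "emeasure _"])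
    also have "\<dots> = (\<Prod>j\<in>I. emeasure lborel (rnd L -` A j :: (real^'d) set))"
      by (rule l.emeasure_PiM[OF I v])
    also have "\<dots> = (\<Prod>j\<in>I. emeasure (latm L) (A j))"
    proof (intro prod.cong refl)
      fix j
      have "emeasure (distr lborel (latm L) (rnd L)) (A j) = emeasure lborel (rnd L -` A j :: (real^'d) set)"
        by (subst emeasure_distr) auto
      then show "emeasure lborel (rnd L -` A j :: (real^'d) set) = emeasure (latm L) (A j)" unfolding distr_rnd[OF L] ..
    qed
    finally show "emeasure (distr (PiM I (\<lambda>_. lborel)) (PiM I (\<lambda>_. latm L)) (\<lambda>x. \<lambda>j\<in>I. rnd L (x j))) (Pi\<^sub>E I A) = (\<Prod>j\<in>I. emeasure (latm L) (A j))" .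
  qed simp
qed

lemma integral_PiM_rnd:
  fixes G :: "('i \<Rightarrow> int^'d) \<Rightarrow> complex"
  assumes L: "L > 0" and I: "finite I"
  shows "(LINT x|PiM I (\<lambda>_. latm L). G x) = (LINT x|PiM I (\<lambda>_. lborel). G (\<lambda>j\<in>I. rnd L (x j)))"
proof -
  have m: "(\<lambda>x. \<lambda>j\<in>I. rnd L (x j)) \<in> measurable (PiM I (\<lambda>_. lborel :: (real^'d) measure)) (PiM I (\<lambda>_. latm L))"
    by (rule rnd_PiM_measurable)
  have "(LINT x|PiM I (\<lambda>_. latm L). G x) = (LINT x|distr (PiM I (\<lambda>_. lborel)) (PiM I (\<lambda>_. latm L)) (\<lambda>x. \<lambda>j\<in>I. rnd L (x j)). G x)"
    unfolding distr_PiM_rnd[OF L I] ..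
  also have "\<dots> = (LINT x|PiM I (\<lambda>_. lborel). G (\<lambda>j\<in>I. rnd L (x j)))"
    by (rule integral_distr[OF m]) (rule borel_measurable_PiM_latm[OF I])
  finally show ?thesis .
qed

lemma measurable_PiM_rnd:
  fixes G :: "('i \<Rightarrow> int^'d) \<Rightarrow> 'c::topological_space"
  assumes I: "finite I"
  shows "(\<lambda>x. G (\<lambda>j\<in>I. rnd L (x j))) \<in> borel_measurable (PiM I (\<lambda>_. lborel))"
proof -
  have "(\<lambda>x. \<lambda>j\<in>I. rnd L (x j)) \<in> measurable (PiM I (\<lambda>_. lborel :: (real^'d) measure)) (PiM I (\<lambda>_. latm L))"
    by (rule rnd_PiM_measurable)
  then show ?thesis by (rule measurable_compose) (rule borel_measurable_PiM_latm[OF I])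
qed

lemma dual_pt_rnd_close: "L > 0 \<Longrightarrow> \<bar>dual_pt L (rnd L x) $ i - x $ i\<bar> \<le> 1 / L"
proof -
  assume L: "L > 0"
  have "\<bar>of_int \<lfloor>L * x $ i\<rfloor> - L * x $ i\<bar> \<le> 1" by linarith
  then have "\<bar>of_int \<lfloor>L * x $ i\<rfloor> - L * x $ i\<bar> / L \<le> 1 / L" using L by (intro divide_right_mono) auto
  moreover have "dual_pt L (rnd L x) $ i - x $ i = (of_int \<lfloor>L * x $ i\<rfloor> - L * x $ i) / L"
    using L by (simp add: dual_pt_def rnd_def field_simps)
  ultimately show ?thesis using L by simp
qed

lemma dual_pt_rnd_tendsto: "((\<lambda>L. dual_pt L (rnd L x)) \<longlongrightarrow> x) at_top"
proof (rule vec_tendstoI)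
  fix i
  have "((\<lambda>L. dual_pt L (rnd L x) $ i - x $ i) \<longlongrightarrow> 0) at_top"
  proof (rule Lim_null_comparison)
    show "\<forall>\<^sub>F L in at_top. norm (dual_pt L (rnd L x) $ i - x $ i) \<le> 1 / L"
      using eventually_gt_at_top[of 0] by eventually_elim (simp add: dual_pt_rnd_close)
    show "((\<lambda>L::real. 1 / L) \<longlongrightarrow> 0) at_top" by real_asymp
  qed
  then show "((\<lambda>L. dual_pt L (rnd L x) $ i) \<longlongrightarrow> x $ i) at_top" by (simp add: LIM_zero_iff)
qed

lemma dual_pt_ext_mom: "dual_pt L (ext_mom n c x j) = ext_mom n c (\<lambda>j. dual_pt L (x j)) j"
  by (simp add: ext_mom_def dual_pt_uminus dual_pt_sum)

lemma ext_mom_cong: "(\<And>j. j \<in> free_idx n c \<Longrightarrow> x j = y j) \<Longrightarrow> j \<le> n \<Longrightarrow> ext_mom n c x j = ext_mom n c y j"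
proof -
  assume *: "\<And>j. j \<in> free_idx n c \<Longrightarrow> x j = y j" and j: "j \<le> n"
  have "(\<Sum>i | i < n \<and> i \<notin> c ` {..<n} \<and> c i = j. x i) = (\<Sum>i | i < n \<and> i \<notin> c ` {..<n} \<and> c i = j. y i)"
    by (intro sum.cong refl *) (simp add: free_idx_def)
  then show ?thesis using *[of j] j unfolding ext_mom_def by (auto simp: free_idx_def)
qed

definition resprodR :: "complex \<Rightarrow> nat \<Rightarrow> real^'d \<Rightarrow> (nat \<Rightarrow> real^'d) \<Rightarrow> complex" where
  "resprodR z n p u = (\<Prod>j\<le>n. 1 / (of_real (nu (p - (\<Sum>i=j..<n. u i))) - z))"

lemma resprod_dual: "resprod L z n k u = resprodR z n (dual_pt L k) (\<lambda>j. dual_pt L (u j))"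
  by (simp add: resprod_def resprodR_def dual_pt_diff dual_pt_sum)

lemma resprodR_bound: "Im z \<noteq> 0 \<Longrightarrow> cmod (resprodR z n k u) \<le> (1 / \<bar>Im z\<bar>) ^ (n + 1)"
proof -
  assume z: "Im z \<noteq> 0"
  have "cmod (resprodR z n k u) \<le> (\<Prod>j\<le>n. 1 / \<bar>Im z\<bar>)"
    unfolding resprodR_def prod_norm[symmetric] by (intro prod_mono conjI norm_ge_zero norm_resolvent_le z)
  then show ?thesis by simp
qed

lemma resprodR_cong: "(\<And>j. j < n \<Longrightarrow> u j = v j) \<Longrightarrow> resprodR z n k u = resprodR z n k v"
  unfolding resprodR_def by (auto intro!: prod.cong sum.cong arg_cong[where f = "\<lambda>x. 1 / (of_real (nu (k - x)) - z)"])

text \<open>Still an exact formula at finite \<open>L\<close>: the lattice integral of each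
  partition is rewritten with step functions, and \<open>sum_ext_mom\<close> removes the shift from
  the argument of the second wave function.\<close>

lemma T_L_integral:
  fixes B :: "real^'d \<Rightarrow> real"
  assumes L: "L > 0" and z: "Im z \<noteq> 0" and B: "B \<in> borel_measurable borel" and Bb: "\<And>x. \<bar>B x\<bar> \<le> C"
    and b: "integrable (latm L) (bL L B)" and psi: "in_L2 \<psi>1" "in_L2 \<psi>2"
    and mu: "prob_space \<mu>" and mom: "\<And>k::nat. integrable \<mu> (\<lambda>v. v ^ k)"
  shows "T_L \<mu> B n L z \<psi>1 \<psi>2 = (\<Sum>c\<in>reps n. mom_weight \<mu> n c *
     (LINT x|PiM (free_idx n c) (\<lambda>_. lborel). cnj (fcoef L \<psi>1 (rnd L (x n))) * fcoef L \<psi>2 (rnd L (x n)) *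
        ((\<Prod>j<n. bL L B (ext_mom n c (\<lambda>j. rnd L (x j)) j)) *
          resprodR z n (dual_pt L (rnd L (x n))) (ext_mom n c (\<lambda>j. dual_pt L (rnd L (x j)))))))"
proof -
  have p2: "in_L2_box L \<psi>1" "in_L2_box L \<psi>2" using psi by (auto intro: in_L2_imp_box)
  let ?G = "mom_integrand L z (bL L B) (fcoef L \<psi>1) (fcoef L \<psi>2) n"
  have G: "integrable (PiM {..<Suc n} (\<lambda>_. latm L)) ?G"
    by (rule integrable_mom_integrand[OF L z b Bessel(1)[OF L p2(1)] Bessel(1)[OF L p2(2)]])
  show ?thesis unfolding T_L_lattice[OF L z B Bb b psi mu mom]
  proof (intro sum.cong refl)
    fix c assume c: "c \<in> reps n"
    have fD: "finite (free_idx n c)" unfolding free_idx_def by simp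
    have nD: "n \<in> free_idx n c" using reps_props(1)[OF c] by (auto simp: free_idx_def)
    have "of_real ((L ^ CARD('d)) ^ card (c ` {..<n})) * (LINT x|PiM {..<Suc n} (\<lambda>_. latm L). conserve n c x * ?G x)
      = (LINT x|PiM (free_idx n c) (\<lambda>_. latm L). ?G (ext_mom n c x))"
      by (rule integral_conserve[OF L c G]) (rule mom_integrand_cong)
    also have "\<dots> = (LINT x|PiM (free_idx n c) (\<lambda>_. lborel). ?G (ext_mom n c (\<lambda>j\<in>free_idx n c. rnd L (x j))))"
      by (rule integral_PiM_rnd[OF L fD])
    also have "\<dots> = (LINT x|PiM (free_idx n c) (\<lambda>_. lborel). cnj (fcoef L \<psi>1 (rnd L (x n))) * fcoef L \<psi>2 (rnd L (x n)) *
        ((\<Prod>j<n. bL L B (ext_mom n c (\<lambda>j. rnd L (x j)) j)) *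
          resprodR z n (dual_pt L (rnd L (x n))) (ext_mom n c (\<lambda>j. dual_pt L (rnd L (x j))))))"
    proof (intro Bochner_Integration.integral_cong refl)
      fix x :: "nat \<Rightarrow> real^'d"
      have "?G (ext_mom n c (\<lambda>j\<in>free_idx n c. rnd L (x j))) = ?G (ext_mom n c (\<lambda>j. rnd L (x j)))"
        by (rule mom_integrand_cong, rule ext_mom_cong) auto
      also have "ext_mom n c (\<lambda>j. rnd L (x j)) n = rnd L (x n)"
        using nD by (simp add: ext_mom_def free_idx_def)
      then have "?G (ext_mom n c (\<lambda>j. rnd L (x j))) = (\<Prod>j<n. bL L B (ext_mom n c (\<lambda>j. rnd L (x j)) j)) *
         (resprodR z n (dual_pt L (rnd L (x n))) (ext_mom n c (\<lambda>j. dual_pt L (rnd L (x j)))) * cnj (fcoef L \<psi>1 (rnd L (x n))) * fcoef L \<psi>2 (rnd L (x n)))"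
        by (simp add: mom_integrand_def sum_ext_mom[OF c] resprod_dual dual_pt_ext_mom)
      finally show "?G (ext_mom n c (\<lambda>j\<in>free_idx n c. rnd L (x j))) = cnj (fcoef L \<psi>1 (rnd L (x n))) * fcoef L \<psi>2 (rnd L (x n)) *
        ((\<Prod>j<n. bL L B (ext_mom n c (\<lambda>j. rnd L (x j)) j)) *
          resprodR z n (dual_pt L (rnd L (x n))) (ext_mom n c (\<lambda>j. dual_pt L (rnd L (x j)))))"
        by (simp only: mult_ac)
    qed
    finally show "mom_weight \<mu> n c * of_real ((L ^ CARD('d)) ^ card (c ` {..<n})) * (LINT x|PiM {..<Suc n} (\<lambda>_. latm L). conserve n c x * ?G x)
       = mom_weight \<mu> n c * (LINT x|PiM (free_idx n c) (\<lambda>_. lborel). cnj (fcoef L \<psi>1 (rnd L (x n))) * fcoef L \<psi>2 (rnd L (x n)) *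
        ((\<Prod>j<n. bL L B (ext_mom n c (\<lambda>j. rnd L (x j)) j)) *
          resprodR z n (dual_pt L (rnd L (x n))) (ext_mom n c (\<lambda>j. dual_pt L (rnd L (x j))))))"
      by (simp only: mult.assoc)
  qed
qed

section \<open>Uniform decay of the Fourier coefficients of the potential\<close>

text \<open>An integrable product majorant on momentum space, with the one inverse square per
  coordinate that two integrations by parts in this coordinate yield.\<close>

definition decay :: "real^'d \<Rightarrow> real" where
  "decay x = (\<Prod>i\<in>UNIV. inverse (1 + (x $ i)\<^sup>2))"

lemma integrable_inverse_1_plus_sq: "integrable lborel (\<lambda>t::real. inverse (1 + t\<^sup>2))"
  using integrable_inverse_1_plus_square by (simp add: set_integrable_def einterval_def)

lemma integrable_decay: "integrable lborel (decay :: real^'d \<Rightarrow> real)"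
  unfolding decay_def[abs_def] by (rule integrable_vec_prod[OF integrable_inverse_1_plus_sq])

lemma decay_pos: "decay x > 0"
  unfolding decay_def by (intro prod_pos) (auto intro: add_pos_nonneg)

text \<open>Each coordinate is bounded by the norm, so every factor is at least
  \<open>(1 + norm x)^(-2)\<close>. A Schwartz bound of order twice the dimension thus turns into an
  integrable majorant.\<close>

lemma decay_ge: "inverse ((1 + norm x) ^ (2 * CARD('d))) \<le> decay (x :: real^'d)"
proof -
  have "(\<Prod>i\<in>(UNIV::'d set). inverse ((1 + norm x)\<^sup>2)) \<le> decay x"
    unfolding decay_def
  proof (intro prod_mono conjI)
    fix i
    have "(x $ i)\<^sup>2 \<le> (norm x)\<^sup>2" using component_le_norm_cart[of x i] by (metis abs_le_square_iff abs_norm_cancel)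
    moreover have "(1 + norm x)\<^sup>2 = 1 + (norm x)\<^sup>2 + 2 * norm x" by (simp add: power2_sum)
    ultimately have "1 + (x $ i)\<^sup>2 \<le> (1 + norm x)\<^sup>2" using norm_ge_zero[of x] by linarith
    then show "inverse ((1 + norm x)\<^sup>2) \<le> inverse (1 + (x $ i)\<^sup>2)"
      by (intro le_imp_inverse_le) (auto intro: add_pos_nonneg)
  qed auto
  then show ?thesis by (simp add: power_mult power_inverse)
qed

lemma schwartz_pderivs:
  fixes B :: "real^'d \<Rightarrow> real"
  assumes B: "schwartz B" and vs: "set vs \<subseteq> Basis"
  shows "pderivs vs B differentiable (at x)" and "continuous_on UNIV (pderivs vs B)"
    and "\<exists>C\<ge>0. \<forall>x. \<bar>pderivs vs B x\<bar> \<le> C * decay x" and "integrable lborel (pderivs vs B)"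
proof -
  show d: "pderivs vs B differentiable (at x)" for x using B vs by (auto simp: schwartz_def)
  show c: "continuous_on UNIV (pderivs vs B)"
    using d differentiable_imp_continuous_within by (auto simp: continuous_on_eq_continuous_at)
  from B vs obtain C where C: "\<And>x. (1 + norm x) ^ (2 * CARD('d)) * \<bar>pderivs vs B x\<bar> \<le> C"
    unfolding schwartz_def by blast
  have C0: "C \<ge> 0" using C[of 0] by (auto intro: order_trans[of 0 "\<bar>pderivs vs B 0\<bar>"])
  have "\<bar>pderivs vs B x\<bar> \<le> C * decay x" for x
  proof -
    have p: "(1 + norm x) ^ (2 * CARD('d)) > 0" by (intro zero_less_power add_pos_nonneg) auto
    have "\<bar>pderivs vs B x\<bar> \<le> C * inverse ((1 + norm x) ^ (2 * CARD('d)))"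
      using C[of x] p by (simp add: field_simps)
    also have "\<dots> \<le> C * decay x" by (intro mult_left_mono decay_ge C0)
    finally show ?thesis .
  qed
  with C0 show e: "\<exists>C\<ge>0. \<forall>x. \<bar>pderivs vs B x\<bar> \<le> C * decay x" by blast
  then obtain C' where C': "\<forall>x. \<bar>pderivs vs B x\<bar> \<le> C' * decay x" by blast
  show "integrable lborel (pderivs vs B)"
  proof (rule Bochner_Integration.integrable_bound)
    show "integrable lborel (\<lambda>x. C' * decay x)" using integrable_decay by auto
    show "pderivs vs B \<in> borel_measurable lborel" using c by (simp add: borel_measurable_continuous_onI)
    show "AE x in lborel. norm (pderivs vs B x) \<le> norm (C' * decay x)"
      using C' by (intro AE_I2) (auto intro: order_trans[OF _ abs_ge_self])
  qed
qed

lemma upd_line: "upd x i t = upd x i 0 + t *\<^sub>R axis i 1"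
  by (simp add: vec_eq_iff axis_def)

lemma frechet_line_derivative:
  fixes h :: "real^'d \<Rightarrow> real"
  assumes "h differentiable (at (y + t *\<^sub>R v))"
  shows "((\<lambda>s. h (y + s *\<^sub>R v)) has_real_derivative frechet_derivative h (at (y + t *\<^sub>R v)) v) (at t)"
proof -
  let ?D = "frechet_derivative h (at (y + t *\<^sub>R v))"
  have D: "(h has_derivative ?D) (at (y + t *\<^sub>R v))" using assms frechet_derivative_works by blast
  have "((\<lambda>s. y + s *\<^sub>R v) has_derivative (\<lambda>s. s *\<^sub>R v)) (at t)" by (auto intro!: derivative_eq_intros)
  from has_derivative_compose[OF this D] have "((\<lambda>s. h (y + s *\<^sub>R v)) has_derivative (\<lambda>s. ?D (s *\<^sub>R v))) (at t)" .
  moreover have "?D (s *\<^sub>R v) = s * ?D v" for s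
    using linear_frechet_derivative[OF assms] by (simp add: linear_scale)
  ultimately show ?thesis by (simp add: has_field_derivative_def mult_commute_abs)
qed

lemma pderivs_line:
  fixes B :: "real^'d \<Rightarrow> real"
  assumes "schwartz B" "set vs \<subseteq> Basis"
  shows "((\<lambda>s. pderivs vs B (upd x i s)) has_real_derivative pderivs (axis i 1 # vs) B (upd x i t)) (at t)"
  using frechet_line_derivative[of "pderivs vs B" "upd x i 0" t "axis i 1"] schwartz_pderivs(1)[OF assms]
  by (simp add: upd_line[symmetric])

text \<open>The values agree on the two faces normal to direction \<open>i\<close>, that is, the
  periodization is continuous across them. Agreement of derivatives is not asked for.\<close>

definition face_sym :: "real \<Rightarrow> 'd \<Rightarrow> (real^'d \<Rightarrow> real) \<Rightarrow> bool" where
  "face_sym a i h \<longleftrightarrow> (\<forall>x. h (upd x i a) = h (upd x i (- a)))"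

text \<open>A derivative in a direction \<open>j \<noteq> i\<close> is tangential to the faces, so
  it only sees values that agree.\<close>

lemma face_sym_pderiv:
  fixes B :: "real^'d \<Rightarrow> real"
  assumes B: "schwartz B" "set vs \<subseteq> Basis" and s: "face_sym a i (pderivs vs B)" and ij: "i \<noteq> j"
  shows "face_sym a i (pderivs (axis j 1 # vs) B)"
  unfolding face_sym_def
proof
  fix x
  let ?h = "pderivs vs B"
  have D: "((\<lambda>s. ?h (upd x i b + s *\<^sub>R axis j 1)) has_real_derivative pderivs (axis j 1 # vs) B (upd x i b)) (at 0)" for b
    using frechet_line_derivative[of ?h "upd x i b" 0 "axis j 1"] schwartz_pderivs(1)[OF B] by simp
  have "upd x i b + s *\<^sub>R axis j 1 = upd (x + s *\<^sub>R axis j 1) i b" for b s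
    using ij by (auto simp: vec_eq_iff axis_def)
  then have "(\<lambda>s. ?h (upd x i a + s *\<^sub>R axis j 1)) = (\<lambda>s. ?h (upd x i (- a) + s *\<^sub>R axis j 1))"
    using s by (auto simp: face_sym_def)
  with D[of a] D[of "- a"] show "pderivs (axis j 1 # vs) B (upd x i a) = pderivs (axis j 1 # vs) B (upd x i (- a))"
    using DERIV_unique by metis
qed

text \<open>\<open>kap\<close> is the second antiderivative of the character that vanishes at both ends of the interval; its
  first antiderivative is periodic, so integrating by parts twice against a function with equal
  boundary values produces no boundary terms.\<close>
definition kap :: "real \<Rightarrow> int \<Rightarrow> real \<Rightarrow> complex" where
  "kap L k t = (cis (- (2 * pi * k / L) * t) - cis (- (2 * pi * k / L) * (L / 2))) / of_real (- (2 * pi * k / L)\<^sup>2)"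

lemma has_vector_derivative_cis: "((\<lambda>t. cis (w * t)) has_vector_derivative \<i> * of_real w * cis (w * t)) (at t within S)"
proof -
  have "((\<lambda>z. exp (\<i> * of_real w * z)) has_field_derivative \<i> * of_real w * exp (\<i> * of_real w * of_real t)) (at (of_real t))"
    by (auto intro!: derivative_eq_intros)
  from has_vector_derivative_real_field[OF this] show ?thesis by (simp add: cis_conv_exp mult.assoc)
qed

lemma cis_ends: assumes "L > 0" shows "cis (- (2 * pi * of_int k / L) * (L / 2)) = cis (- (2 * pi * of_int k / L) * (- (L / 2)))"
proof -
  have 1: "- (2 * pi * of_int k / L) * (L / 2) = - (pi * of_int k)" "- (2 * pi * of_int k / L) * (- (L / 2)) = pi * of_int k"
    using assms by (auto simp: field_simps)
  show ?thesis unfolding 1 by (auto simp: complex_eq_iff mult.commute)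
qed

lemma continuous_on_cis_mult: "continuous_on S (\<lambda>t. cis (w * t))"
  unfolding cis_conv_exp by (intro continuous_intros)

lemma kap_borel [measurable]: "kap L k \<in> borel_measurable borel"
  unfolding kap_def[abs_def] by measurable

lemma norm_kap: assumes "L > 0" "k \<noteq> 0" shows "cmod (kap L k t) \<le> 2 / (2 * pi * of_int k / L)\<^sup>2"
proof -
  have "cmod (cis (- (2 * pi * k / L) * t) - cis (- (2 * pi * k / L) * (L / 2))) \<le> 2"
    by (rule order_trans[OF norm_triangle_ineq4]) simp
  then show ?thesis unfolding kap_def norm_divide
    by (simp add: norm_power divide_right_mono del: of_real_power flip: of_real_minus)
qed

lemma integral_by_parts_kap:
  fixes h h1 h2 :: "real \<Rightarrow> real"
  assumes L: "L > 0" and k: "k \<noteq> 0"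
    and D1: "\<And>t. (h has_real_derivative h1 t) (at t)" and D2: "\<And>t. (h1 has_real_derivative h2 t) (at t)"
    and c2: "continuous_on UNIV h2" and ends: "h (L / 2) = h (- (L / 2))"
  shows "(LINT t|lborel. indicator {-L/2..<L/2} t *\<^sub>R (of_real (h t) * cis (- (2 * pi * of_int k / L) * t)))
     = (LINT t|lborel. indicator {-L/2..<L/2} t *\<^sub>R (of_real (h2 t) * kap L k t))"
proof -
  define w where "w = - (2 * pi * of_int k / L)"
  have w: "w \<noteq> 0" using L k by (simp add: w_def)
  define K where "K t = cis (w * t) / (\<i> * of_real w)" for t
  define G where "G = kap L k"
  have G: "G t = (cis (w * t) - cis (w * (L / 2))) / of_real (- w\<^sup>2)" for t by (simp add: G_def kap_def w_def)
  have dK: "(K has_vector_derivative cis (w * t)) (at t within S)" for t S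
    using has_vector_derivative_divide[OF has_vector_derivative_cis[of w t S], of "\<i> * of_real w"] w by (simp add: K_def[abs_def])
  have dG: "(G has_vector_derivative K t) (at t within S)" for t S
  proof -
    have "((\<lambda>t. (cis (w * t) - cis (w * (L / 2))) / of_real (- w\<^sup>2)) has_vector_derivative (\<i> * of_real w * cis (w * t) - 0) / of_real (- w\<^sup>2)) (at t within S)"
      by (intro has_vector_derivative_divide has_vector_derivative_diff has_vector_derivative_cis has_vector_derivative_const)
    also have "(\<i> * of_real w * cis (w * t) - 0) / of_real (- w\<^sup>2) = K t"
      using w by (simp add: K_def power2_eq_square divide_simps) (simp add: mult_ac)
    finally show ?thesis unfolding G[abs_def] .
  qed
  have dh: "((\<lambda>t. complex_of_real (h t)) has_vector_derivative of_real (h1 t)) (at t within S)"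
    and dh1: "((\<lambda>t. complex_of_real (h1 t)) has_vector_derivative of_real (h2 t)) (at t within S)" for t S
    using D1 D2 by (auto intro!: has_vector_derivative_of_real intro: has_field_derivative_at_within)
  \<comment> \<open>An antiderivative of the difference of the two integrands. At both ends
    \<open>G\<close> vanishes and \<open>K\<close> takes the same value, so only the end values of
    \<open>h\<close> matter, and these agree.\<close>
  define \<Phi> where "\<Phi> t = of_real (h t) * K t - of_real (h1 t) * G t" for t
  have d: "(\<Phi> has_vector_derivative (of_real (h t) * cis (w * t) - of_real (h2 t) * G t)) (at t within S)" for t S
    unfolding \<Phi>_def
    by (rule has_vector_derivative_eq_rhs, rule has_vector_derivative_diff, (rule has_vector_derivative_mult dh dh1 dK dG)+) (simp add: algebra_simps)
  have ch: "continuous_on S h" "continuous_on S h1" for S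
    using D1 D2 by (auto intro!: continuous_at_imp_continuous_on DERIV_isCont)
  have cG: "continuous_on S G" for S unfolding G[abs_def] by (intro continuous_intros continuous_on_cis_mult) (use w in auto)
  have cont: "continuous_on {-L/2..L/2} (\<lambda>t. of_real (h t) * cis (w * t) - of_real (h2 t) * G t)"
    by (intro continuous_intros continuous_on_cis_mult ch cG continuous_on_subset[OF c2]) auto
  have "has_bochner_integral lborel (\<lambda>t. indicator {-L/2..L/2} t *\<^sub>R (of_real (h t) * cis (w * t) - of_real (h2 t) * G t)) (\<Phi> (L/2) - \<Phi> (-L/2))"
    by (rule has_bochner_integral_FTC_Icc) (use L d cont in auto)
  moreover have "\<Phi> (L/2) - \<Phi> (-L/2) = 0"
    using ends cis_ends[OF L, of k] by (simp add: \<Phi>_def K_def G flip: w_def)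
  ultimately have Z: "(LINT t|lborel. indicator {-L/2..L/2} t *\<^sub>R (of_real (h t) * cis (w * t) - of_real (h2 t) * G t)) = 0"
    by (simp add: has_bochner_integral_iff)
  have i1: "integrable lborel (\<lambda>t. indicator {-L/2..L/2} t *\<^sub>R (of_real (h t) * cis (w * t)))"
    by (rule borel_integrable_compact[OF compact_Icc]) (intro continuous_intros continuous_on_cis_mult ch)
  have i2: "integrable lborel (\<lambda>t. indicator {-L/2..L/2} t *\<^sub>R (of_real (h2 t) * G t))"
    by (rule borel_integrable_compact[OF compact_Icc]) (intro continuous_intros cG continuous_on_subset[OF c2], auto)
  have "(LINT t|lborel. indicator {-L/2..L/2} t *\<^sub>R (of_real (h t) * cis (w * t))) = (LINT t|lborel. indicator {-L/2..L/2} t *\<^sub>R (of_real (h2 t) * G t))"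
    using Z i1 i2 by (simp add: scaleR_diff_right)
  moreover have hm [measurable]: "h \<in> borel_measurable borel" "h2 \<in> borel_measurable borel"
    using ch c2 by (auto intro: borel_measurable_continuous_onI)
  moreover have "(LINT t|lborel. indicator {-L/2..L/2} t *\<^sub>R f t) = (LINT t|lborel. indicator {-L/2..<L/2} t *\<^sub>R f t)"
    if [measurable]: "f \<in> borel_measurable borel" for f :: "real \<Rightarrow> complex"
  proof (rule integral_cong_AE)
    show "AE t in lborel. indicator {-L/2..L/2} t *\<^sub>R f t = indicator {-L/2..<L/2} t *\<^sub>R f t"
      using AE_lborel_singleton[of "L/2"] by eventually_elim (auto simp: indicator_def)
  qed measurable
  ultimately show ?thesis unfolding w_def[symmetric] G_def by simp
qed

definition twice :: "'d list \<Rightarrow> (real^'d) list" where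
  "twice is = concat (map (\<lambda>i. [axis i 1, axis i 1]) is)"

lemma twice_simps: "twice [] = []" "twice (i # is) = axis i 1 # axis i 1 # twice is"
  by (simp_all add: twice_def)

lemma twice_Basis: "set (twice is) \<subseteq> Basis"
  by (induction "is") (auto simp: twice_simps Basis_vec_range)

lemma face_sym_twice:
  fixes B :: "real^'d \<Rightarrow> real"
  assumes B: "schwartz B" and s: "face_sym a i B" and i: "i \<notin> set is"
  shows "face_sym a i (pderivs (twice is) B)"
  using i
proof (induction "is")
  case (Cons j "is")
  then have ij: "i \<noteq> j" and IH: "face_sym a i (pderivs (twice is) B)" by auto
  have 1: "face_sym a i (pderivs (axis j 1 # twice is) B)" by (rule face_sym_pderiv[OF B twice_Basis IH ij])
  have "set (axis j 1 # twice is) \<subseteq> (Basis :: (real^'d) set)" using twice_Basis by (auto simp: Basis_vec_range)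
  from face_sym_pderiv[OF B this 1 ij] show ?case by (simp add: twice_simps)
qed (use s in \<open>simp add: twice_simps\<close>)

text \<open>The set \<open>S\<close> records the coordinates in which the double integration by
  parts has been done: there \<open>kap\<close> has replaced the character.\<close>

definition coord_fac :: "real \<Rightarrow> int^'d \<Rightarrow> 'd set \<Rightarrow> 'd \<Rightarrow> real \<Rightarrow> complex" where
  "coord_fac L k S i t = indicator {-L/2..<L/2} t *\<^sub>R (if i \<in> S then kap L (k $ i) t else cis (- (2 * pi * of_int (k $ i) / L) * t))"

lemma coord_fac_borel [measurable]: "coord_fac L k S i \<in> borel_measurable borel"
  unfolding coord_fac_def[abs_def] by (cases "i \<in> S") auto

lemma norm_coord_fac:
  assumes "L > 0" "\<And>i. i \<in> S \<Longrightarrow> k $ i \<noteq> 0"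
  shows "cmod (coord_fac L k S i t) \<le> (if i \<in> S then 2 / (2 * pi * of_int (k $ i) / L)\<^sup>2 else 1)"
  using norm_kap[OF assms(1), of "k $ i" t] assms(2)[of i] by (auto simp: coord_fac_def indicator_def)

lemma prod_coord_fac_borel [measurable]: "(\<lambda>x::real^'d. \<Prod>i\<in>A. coord_fac L k S i (x $ i)) \<in> borel_measurable borel"
  by measurable

lemma norm_prod_coord_fac:
  assumes "L > 0" "\<And>i. i \<in> S \<Longrightarrow> k $ i \<noteq> 0"
  shows "cmod (\<Prod>i\<in>UNIV. coord_fac L k S i (x $ i)) \<le> (\<Prod>i\<in>UNIV. if i \<in> S then 2 / (2 * pi * of_int (k $ i) / L)\<^sup>2 else 1)"
  unfolding prod_norm[symmetric] by (intro prod_mono conjI norm_ge_zero norm_coord_fac assms)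

text \<open>One double integration by parts per listed coordinate, by induction. Distinctness
  matters: the agreement of face values in direction \<open>i\<close> is inherited from derivatives
  in other directions only.\<close>

lemma bL_by_parts:
  fixes B :: "real^'d \<Rightarrow> real"
  assumes L: "L > 0" and B: "schwartz B" and s: "\<And>i. face_sym (L / 2) i B"
    and d: "distinct is" and k: "\<And>i. i \<in> set is \<Longrightarrow> k $ i \<noteq> 0"
  shows "bL L B k = (LINT x|lborel. of_real (pderivs (twice is) B x) * (\<Prod>i\<in>UNIV. coord_fac L k (set is) i (x $ i)))"
  using d k
proof (induction "is")
  case Nil
  have Bm: "B \<in> borel_measurable borel" using schwartz_pderivs(2)[OF B, of "[]"] by (simp add: borel_measurable_continuous_onI)
  have "bL L B k = (LINT x|lborel. indicator (box_L L) x *\<^sub>R (ek L (-k) x * of_real (B x)))"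
    unfolding bL_def fcoef_ek by (rule integral_boxm) (use Bm in measurable)
  also have "\<dots> = (LINT x|lborel. of_real (B x) * (\<Prod>i\<in>UNIV. coord_fac L k {} i (x $ i)))"
    unfolding indicator_box_L ek_prod coord_fac_def
    by (intro Bochner_Integration.integral_cong refl) (simp add: scaleR_conv_of_real prod.distrib mult_ac)
  finally show ?case by (simp add: twice_simps)
next
  case (Cons i "is")
  let ?h = "pderivs (twice is) B" and ?h1 = "pderivs (axis i 1 # twice is) B" and ?h2 = "pderivs (twice (i # is)) B"
  have i: "i \<notin> set is" "distinct is" using Cons.prems by auto
  have ki: "k $ i \<noteq> 0" "\<And>j. j \<in> set is \<Longrightarrow> k $ j \<noteq> 0" using Cons.prems by auto
  have b1: "set (axis i 1 # twice is) \<subseteq> (Basis :: (real^'d) set)" using twice_Basis by (auto simp: Basis_vec_range)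
  have int: "integrable lborel (\<lambda>x. of_real (pderivs (twice js) B x) * (\<Prod>i\<in>UNIV. coord_fac L k (set js) i (x $ i)))"
    if "\<And>j. j \<in> set js \<Longrightarrow> k $ j \<noteq> 0" for js
    by (rule integrable_mult_bounded[OF _ _ AE_I2[OF norm_prod_coord_fac[OF L that]]])
       (use schwartz_pderivs(4)[OF B twice_Basis] in auto)
  have "bL L B k = (LINT x|lborel. of_real (?h x) * (\<Prod>i\<in>UNIV. coord_fac L k (set is) i (x $ i)))"
    by (rule Cons.IH[OF i(2) ki(2)])
  also have "\<dots> = (LINT x|lborel. of_real (?h2 x) * (\<Prod>j\<in>UNIV. coord_fac L k (set (i # is)) j (x $ j)))"
  proof (rule integral_eq_along_line[where i = i])
    show "integrable lborel (\<lambda>x. of_real (?h x) * (\<Prod>i\<in>UNIV. coord_fac L k (set is) i (x $ i)))"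
      by (rule int) (rule ki(2))
    show "integrable lborel (\<lambda>x. of_real (?h2 x) * (\<Prod>j\<in>UNIV. coord_fac L k (set (i # is)) j (x $ j)))"
      by (rule int) (rule Cons.prems(2))
    fix x :: "real^'d"
    define P where "P = (\<Prod>j\<in>UNIV - {i}. coord_fac L k (set is) j (x $ j))"
    have split: "(\<Prod>j\<in>UNIV. coord_fac L k S j (upd x i t $ j)) = coord_fac L k S i t * P"
      if "S - {i} = set is" for S t
    proof -
      have "(\<Prod>j\<in>UNIV. coord_fac L k S j (upd x i t $ j)) = coord_fac L k S i t * (\<Prod>j\<in>UNIV - {i}. coord_fac L k S j (upd x i t $ j))"
        by (subst prod.remove[of _ i]) auto
      also have "(\<Prod>j\<in>UNIV - {i}. coord_fac L k S j (upd x i t $ j)) = P"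
        unfolding P_def using that by (intro prod.cong refl) (auto simp: coord_fac_def)
      finally show ?thesis .
    qed
    have "(LINT t|lborel. of_real (?h (upd x i t)) * (\<Prod>j\<in>UNIV. coord_fac L k (set is) j (upd x i t $ j)))
       = (LINT t|lborel. indicator {-L/2..<L/2} t *\<^sub>R (of_real (?h (upd x i t)) * cis (- (2 * pi * of_int (k $ i) / L) * t)) * P)"
      using i(1) by (subst split) (auto simp: coord_fac_def mult_ac intro!: Bochner_Integration.integral_cong)
    also have "\<dots> = (LINT t|lborel. indicator {-L/2..<L/2} t *\<^sub>R (of_real (?h (upd x i t)) * cis (- (2 * pi * of_int (k $ i) / L) * t))) * P"
      by (rule integral_mult_left_zero)
    also have "(LINT t|lborel. indicator {-L/2..<L/2} t *\<^sub>R (of_real (?h (upd x i t)) * cis (- (2 * pi * of_int (k $ i) / L) * t)))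
        = (LINT t|lborel. indicator {-L/2..<L/2} t *\<^sub>R (of_real (?h2 (upd x i t)) * kap L (k $ i) t))"
    proof (rule integral_by_parts_kap[OF L ki(1)])
      show "((\<lambda>s. ?h (upd x i s)) has_real_derivative ?h1 (upd x i t)) (at t)" for t
        by (rule pderivs_line[OF B twice_Basis])
      show "((\<lambda>s. ?h1 (upd x i s)) has_real_derivative ?h2 (upd x i t)) (at t)" for t
        unfolding twice_simps by (rule pderivs_line[OF B b1])
      have "continuous_on UNIV (\<lambda>t. upd x i t)"
        by (subst upd_line) (intro continuous_intros)
      then show "continuous_on UNIV (\<lambda>t. ?h2 (upd x i t))"
        by (rule continuous_on_compose2[OF schwartz_pderivs(2)[OF B twice_Basis]]) auto
      show "?h (upd x i (L / 2)) = ?h (upd x i (- (L / 2)))"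
        using face_sym_twice[OF B s i(1)] by (simp add: face_sym_def)
    qed
    also have "\<dots> * P = (LINT t|lborel. indicator {-L/2..<L/2} t *\<^sub>R (of_real (?h2 (upd x i t)) * kap L (k $ i) t) * P)"
      by (rule integral_mult_left_zero[symmetric])
    also have "\<dots> = (LINT t|lborel. of_real (?h2 (upd x i t)) * (\<Prod>j\<in>UNIV. coord_fac L k (set (i # is)) j (upd x i t $ j)))"
      using i(1) by (subst split) (auto simp: coord_fac_def mult_ac intro!: Bochner_Integration.integral_cong)
    finally show "(LINT t|lborel. of_real (?h (upd x i t)) * (\<Prod>j\<in>UNIV. coord_fac L k (set is) j (upd x i t $ j)))
       = (LINT t|lborel. of_real (?h2 (upd x i t)) * (\<Prod>j\<in>UNIV. coord_fac L k (set (i # is)) j (upd x i t $ j)))" .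
  qed
  finally show ?case .
qed

lemma norm_bL_le:
  fixes B :: "real^'d \<Rightarrow> real"
  assumes L: "L > 0" and B: "schwartz B" and s: "\<And>i. face_sym (L / 2) i B"
    and d: "distinct is" and k: "\<And>i. i \<in> set is \<Longrightarrow> k $ i \<noteq> 0"
  shows "cmod (bL L B k) \<le> (LINT x|lborel. \<bar>pderivs (twice is) B x\<bar>) * (\<Prod>i\<in>UNIV. if i \<in> set is then 2 / (2 * pi * of_int (k $ i) / L)\<^sup>2 else 1)"
proof -
  let ?Q = "\<Prod>i\<in>UNIV. if i \<in> set is then 2 / (2 * pi * of_int (k $ i) / L)\<^sup>2 else 1"
  have int: "integrable lborel (\<lambda>x. of_real (pderivs (twice is) B x) * (\<Prod>i\<in>UNIV. coord_fac L k (set is) i (x $ i)))"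
    by (rule integrable_mult_bounded[OF _ _ AE_I2[OF norm_prod_coord_fac[OF L k]]])
       (use schwartz_pderivs(4)[OF B twice_Basis] in auto)
  have "cmod (bL L B k) \<le> (LINT x|lborel. cmod (of_real (pderivs (twice is) B x) * (\<Prod>i\<in>UNIV. coord_fac L k (set is) i (x $ i))))"
  proof -
    have "bL L B k = (LINT x|lborel. of_real (pderivs (twice is) B x) * (\<Prod>i\<in>UNIV. coord_fac L k (set is) i (x $ i)))"
      by (rule bL_by_parts) (use L B s d k in auto)
    then show ?thesis by (simp only: integral_norm_bound)
  qed
  also have "\<dots> \<le> (LINT x|lborel. \<bar>pderivs (twice is) B x\<bar> * ?Q)"
  proof (rule integral_mono)
    show "integrable lborel (\<lambda>x. cmod (of_real (pderivs (twice is) B x) * (\<Prod>i\<in>UNIV. coord_fac L k (set is) i (x $ i))))"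
      by (rule integrable_norm[OF int])
    show "integrable lborel (\<lambda>x. \<bar>pderivs (twice is) B x\<bar> * ?Q)"
      using schwartz_pderivs(4)[OF B twice_Basis] by auto
    show "cmod (of_real (pderivs (twice is) B x) * (\<Prod>i\<in>UNIV. coord_fac L k (set is) i (x $ i))) \<le> \<bar>pderivs (twice is) B x\<bar> * ?Q" for x
      unfolding norm_mult norm_of_real by (intro mult_left_mono norm_prod_coord_fac[OF L k]) auto
  qed
  also have "\<dots> = (LINT x|lborel. \<bar>pderivs (twice is) B x\<bar>) * ?Q" by (rule integral_mult_left_zero)
  finally show ?thesis .
qed

text \<open>A compactly supported \<open>B\<close> vanishes on all faces of a large box, and a
  reflection-invariant one takes equal values on opposite faces of any box.\<close>

lemma face_sym_of_hyp:
  fixes B :: "real^'d \<Rightarrow> real"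
  assumes "(\<exists>R. \<forall>x. R < norm x \<longrightarrow> B x = 0) \<or> (\<forall>j x. B (\<chi> i. if i = j then - (x $ i) else x $ i) = B x)"
  shows "\<exists>L0\<ge>1. \<forall>L\<ge>L0. \<forall>i. face_sym (L / 2) i B"
  using assms
proof
  assume "\<exists>R. \<forall>x. R < norm x \<longrightarrow> B x = 0"
  then obtain R where R: "\<And>x. R < norm x \<Longrightarrow> B x = 0" by blast
  show ?thesis
  proof (intro exI[of _ "2 * \<bar>R\<bar> + 1"] conjI allI impI)
    fix L i assume L: "2 * \<bar>R\<bar> + 1 \<le> L"
    have "R < norm (upd x i b)" if "\<bar>b\<bar> = L / 2" for x :: "real^'d" and b
      using component_le_norm_cart[of "upd x i b" i] that L by simp
    then have "B (upd x i b) = 0" if "\<bar>b\<bar> = L / 2" for x b using R that by blast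
    then show "face_sym (L / 2) i B" using L by (simp add: face_sym_def)
  qed simp
next
  assume s: "\<forall>j x. B (\<chi> i. if i = j then - (x $ i) else x $ i) = B x"
  have "B (upd x i (- a)) = B (upd x i a)" for x i a
  proof -
    have "upd x i (- a) = (\<chi> l. if l = i then - (upd x i a $ l) else upd x i a $ l)" by (simp add: vec_eq_iff)
    then show ?thesis using s by metis
  qed
  then show ?thesis by (intro exI[of _ 1]) (simp add: face_sym_def)
qed

text \<open>Integrate by parts exactly in the coordinates where the lattice momentum has modulus at
  least 1, and use the trivial bound in the others. There are finitely many sets of coordinates, so
  the constant does not depend on \<open>L\<close> or on the momentum.\<close>

lemma bL_decay:
  fixes B :: "real^'d \<Rightarrow> real"
  assumes B: "schwartz B"
    and hyp: "(\<exists>R. \<forall>x. R < norm x \<longrightarrow> B x = 0) \<or> (\<forall>j x. B (\<chi> i. if i = j then - (x $ i) else x $ i) = B x)"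
  obtains C L0 where "C \<ge> 0" "L0 \<ge> 1" "\<And>L x. L \<ge> L0 \<Longrightarrow> cmod (bL L B (rnd L x)) \<le> C * decay x"
proof -
  obtain L0 where L0: "L0 \<ge> 1" "\<And>L i. L \<ge> L0 \<Longrightarrow> face_sym (L / 2) i B" using face_sym_of_hyp[OF hyp] by blast
  define lst where "lst S = (SOME xs. set xs = S \<and> distinct xs)" for S :: "'d set"
  have lst: "set (lst S) = S" "distinct (lst S)" for S
    using someI_ex[OF finite_distinct_list[of S]] by (auto simp: lst_def)
  define I where "I S = (LINT x|lborel. \<bar>pderivs (twice (lst S)) B x\<bar>)" for S
  have I0: "I S \<ge> 0" for S by (simp add: I_def)
  \<comment> \<open>The 5 per coordinate pays for replacing the lattice momentum \<open>u\<close> by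
    \<open>x\<close>, at distance at most 1: \<open>1 + x^2 \<le> 5 * u^2\<close> if
    \<open>|u| \<ge> 1\<close>, and \<open>1 + x^2 \<le> 5\<close> otherwise.\<close>
  define C where "C = (\<Sum>S\<in>UNIV. I S) * 5 ^ CARD('d)"
  show ?thesis
  proof (rule that)
    show "C \<ge> 0" unfolding C_def by (intro mult_nonneg_nonneg sum_nonneg I0) auto
    show "L0 \<ge> 1" by (rule L0)
    fix L and x :: "real^'d" assume L: "L \<ge> L0"
    then have L1: "L \<ge> 1" using L0 by linarith
    let ?k = "rnd L x"
    define u where "u i = of_int (?k $ i) / L" for i
    define S where "S = {i. \<bar>u i\<bar> \<ge> 1}"
    have "cmod (bL L B ?k) \<le> I S * (\<Prod>i\<in>UNIV. if i \<in> set (lst S) then 2 / (2 * pi * of_int (?k $ i) / L)\<^sup>2 else 1)"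
      unfolding I_def by (rule norm_bL_le) (use L1 L0(2)[OF L] B lst in \<open>auto simp: S_def u_def\<close>)
    also have "\<dots> \<le> I S * (\<Prod>i\<in>UNIV. 5 * inverse (1 + (x $ i)\<^sup>2))"
    proof (intro mult_left_mono prod_mono I0 conjI)
      fix i
      have ux: "\<bar>u i - x $ i\<bar> \<le> 1"
        using dual_pt_rnd_close[of L x i] L1 by (simp add: u_def dual_pt_def) (smt (verit) divide_le_eq_1)
      show "(if i \<in> set (lst S) then 2 / (2 * pi * of_int (?k $ i) / L)\<^sup>2 else 1) \<le> 5 * inverse (1 + (x $ i)\<^sup>2)"
      proof (cases "i \<in> S")
        case True
        then have u1: "\<bar>u i\<bar> \<ge> 1" by (simp add: S_def)
        then have "\<bar>x $ i\<bar> \<le> 2 * \<bar>u i\<bar>" using ux by linarith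
        then have "(x $ i)\<^sup>2 \<le> (2 * \<bar>u i\<bar>)\<^sup>2" by (metis abs_ge_zero power2_abs power_mono)
        moreover have "1 \<le> (u i)\<^sup>2" using u1 by (metis one_le_power power2_abs)
        ultimately have le: "1 + (x $ i)\<^sup>2 \<le> 5 * (u i)\<^sup>2" by (simp add: power_mult_distrib)
        have "2 / (2 * pi * of_int (?k $ i) / L)\<^sup>2 = 2 / (2 * pi)\<^sup>2 * (1 / (u i)\<^sup>2)"
          by (simp add: u_def power_mult_distrib power_divide)
        also have "\<dots> \<le> 1 * (1 / (u i)\<^sup>2)"
        proof (rule mult_right_mono)
          have "(2 * pi)\<^sup>2 \<ge> 2\<^sup>2" using pi_ge_two by (intro power_mono) auto
          then show "2 / (2 * pi)\<^sup>2 \<le> 1" by (simp add: divide_le_eq)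
        qed simp
        also have "\<dots> \<le> 5 * inverse (1 + (x $ i)\<^sup>2)"
        proof -
          have "1 + (x $ i)\<^sup>2 > 0" by (auto intro: add_pos_nonneg)
          moreover have "(u i)\<^sup>2 > 0" using u1 by auto
          ultimately show ?thesis using le by (simp add: field_simps)
        qed
        finally show ?thesis using True by (simp add: lst)
      next
        case False
        then have "\<bar>x $ i\<bar> \<le> 2" using ux by (auto simp: S_def)
        then have "(x $ i)\<^sup>2 \<le> 2\<^sup>2" by (metis abs_ge_zero power2_abs power_mono)
        then have "1 \<le> 5 * inverse (1 + (x $ i)\<^sup>2)" by (simp add: field_simps add_pos_nonneg)
        then show ?thesis using False by (simp add: lst)
      qed
    qed auto
    also have "\<dots> = I S * 5 ^ CARD('d) * decay x"
      by (simp add: prod.distrib decay_def)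
    also have "\<dots> \<le> C * decay x"
      unfolding C_def using member_le_sum[of S UNIV I] I0 decay_pos[of x]
      by (intro mult_right_mono) (auto simp: less_imp_le)
    finally show "cmod (bL L B ?k) \<le> C * decay x" .
  qed
qed

lemma integrable_bL:
  fixes B :: "real^'d \<Rightarrow> real"
  assumes L: "L > 0" and C: "\<And>x. cmod (bL L B (rnd L x)) \<le> C * decay x"
  shows "integrable (latm L) (bL L B)"
proof -
  have "integrable lborel (\<lambda>x. bL L B (rnd L x))"
  proof (rule Bochner_Integration.integrable_bound)
    show "integrable lborel (\<lambda>x::real^'d. C * decay x)" using integrable_decay by auto
    show "(\<lambda>x. bL L B (rnd L x)) \<in> borel_measurable lborel"
      by (rule measurable_compose[OF rnd_measurable]) simp
    show "AE x in lborel. cmod (bL L B (rnd L x)) \<le> norm (C * decay x)"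
      using C by (intro AE_I2) (auto intro: order_trans[OF _ abs_ge_self])
  qed
  then have "integrable (distr lborel (latm L) (rnd L)) (bL L B)"
    by (subst integrable_distr_eq) auto
  then show ?thesis unfolding distr_rnd[OF L] .
qed

section \<open>Convergence of the Fourier coefficients\<close>

text \<open>Dominated convergence with majorant \<open>|B|\<close>: a fixed \<open>x\<close> lies in
  the box eventually, and the lattice momenta converge.\<close>

lemma bL_tendsto_ft:
  fixes B :: "real^'d \<Rightarrow> real"
  assumes B: "integrable lborel B" and k: "((\<lambda>L. dual_pt L (k L)) \<longlongrightarrow> p) at_top"
  shows "((\<lambda>L. bL L B (k L)) \<longlongrightarrow> ft (\<lambda>x. of_real (B x)) p) at_top"
proof -
  have [measurable]: "B \<in> borel_measurable borel" using B by auto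
  have bL: "bL L B l = (LINT x|lborel. indicator (box_L L) x *\<^sub>R (ek L (-l) x * of_real (B x)))" for L l
    unfolding bL_def fcoef_ek by (rule integral_boxm) measurable
  have ft: "ft (\<lambda>x. of_real (B x)) p = (LINT x|lborel. cis (- 2 * pi * (p \<bullet> x)) * of_real (B x))"
    unfolding ft_def by (rule integral_completion) measurable
  show ?thesis unfolding bL ft
  proof (rule integral_dominated_convergence_at_top[where w = "\<lambda>x. \<bar>B x\<bar>"])
    show "integrable lborel (\<lambda>x. \<bar>B x\<bar>)" using B by auto
    show "\<forall>\<^sub>F L in at_top. AE x in lborel. norm (indicat_real (box_L L) x *\<^sub>R (ek L (- k L) x * complex_of_real (B x))) \<le> \<bar>B x\<bar>"
      by (intro always_eventually allI AE_I2) (auto simp: norm_mult indicator_def)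
    show "AE x in lborel. ((\<lambda>L. indicat_real (box_L L) x *\<^sub>R (ek L (- k L) x * complex_of_real (B x))) \<longlongrightarrow> cis (- 2 * pi * (p \<bullet> x)) * complex_of_real (B x)) at_top"
    proof (rule AE_I2)
      fix x :: "real^'d"
      have "((\<lambda>L. cis (- 2 * pi * (dual_pt L (k L) \<bullet> x)) * complex_of_real (B x)) \<longlongrightarrow> cis (- 2 * pi * (p \<bullet> x)) * complex_of_real (B x)) at_top"
        unfolding cis_conv_exp by (intro tendsto_intros k)
      moreover have "\<forall>\<^sub>F L in at_top. cis (- 2 * pi * (dual_pt L (k L) \<bullet> x)) * complex_of_real (B x) = indicat_real (box_L L) x *\<^sub>R (ek L (- k L) x * complex_of_real (B x))"
        using eventually_gt_at_top[of "2 * norm x"]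
      proof eventually_elim
        case (elim L)
        have "x \<in> box_L L" unfolding box_L_iff
        proof
          fix i show "x $ i \<in> {-L/2..<L/2}" using component_le_norm_cart[of x i] elim by auto
        qed
        then show ?case by (simp add: ek_def dual_pt_uminus)
      qed
      ultimately show "((\<lambda>L. indicat_real (box_L L) x *\<^sub>R (ek L (- k L) x * complex_of_real (B x))) \<longlongrightarrow> cis (- 2 * pi * (p \<bullet> x)) * complex_of_real (B x)) at_top"
        by (rule Lim_transform_eventually)
    qed
  qed measurable
qed

lemma lebesgue_cis_inner: "(\<lambda>x::real^'d. cis (c * (k \<bullet> x))) \<in> borel_measurable lebesgue"
proof -
  have "(\<lambda>x::real^'d. c * (k \<bullet> x)) \<in> borel_measurable borel"
    by (intro borel_measurable_continuous_onI continuous_intros)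
  then have "(\<lambda>x::real^'d. cis (c * (k \<bullet> x))) \<in> borel_measurable borel" by (rule cis_borel)
  then show ?thesis by (simp add: measurable_completion)
qed

lemma continuous_ft:
  fixes f :: "real^'d \<Rightarrow> complex"
  assumes f: "integrable lebesgue f" shows "continuous_on UNIV (ft f)"
proof (rule continuous_at_imp_continuous_on, intro ballI continuous_at_sequentiallyI)
  fix p :: "real^'d" and u assume u: "u \<longlonglongrightarrow> p"
  have fm: "f \<in> borel_measurable lebesgue" using f by auto
  show "(\<lambda>n. ft f (u n)) \<longlonglongrightarrow> ft f p"
    unfolding ft_def
  proof (rule integral_dominated_convergence[where w = "\<lambda>x. cmod (f x)"])
    show "(\<lambda>x. cis (- 2 * pi * (p \<bullet> x)) * f x) \<in> borel_measurable lebesgue" by (rule borel_measurable_times[OF lebesgue_cis_inner fm])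
    show "(\<lambda>x. cis (- 2 * pi * (u n \<bullet> x)) * f x) \<in> borel_measurable lebesgue" for n by (rule borel_measurable_times[OF lebesgue_cis_inner fm])
    show "integrable lebesgue (\<lambda>x. cmod (f x))" using f by auto
    show "AE x in lebesgue. (\<lambda>n. cis (- 2 * pi * (u n \<bullet> x)) * f x) \<longlonglongrightarrow> cis (- 2 * pi * (p \<bullet> x)) * f x"
      unfolding cis_conv_exp by (intro AE_I2 tendsto_intros u)
    show "AE x in lebesgue. cmod (cis (- 2 * pi * (u n \<bullet> x)) * f x) \<le> cmod (f x)" for n
      by (intro AE_I2) (simp add: norm_mult)
  qed
qed

lemma ft_borel: "integrable lebesgue f \<Longrightarrow> ft f \<in> borel_measurable borel"
  by (rule borel_measurable_continuous_onI[OF continuous_ft])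

section \<open>Mean-square convergence of the lattice samples of the wave functions\<close>

lemma cmod_one_minus_cis: "cmod (1 - cis t) \<le> \<bar>t\<bar>"
  using iexp_approx1[of t 0] by (simp add: norm_minus_commute cis_conv_exp)

text \<open>A squared \<open>L2\<close> norm with values in the extended reals, so that differences
  can be estimated before their square integrability is known.\<close>

definition sqn :: "(real^'d \<Rightarrow> complex) \<Rightarrow> ennreal" where
  "sqn f = (\<integral>\<^sup>+x. ennreal ((cmod (f x))\<^sup>2) \<partial>lborel)"

lemma sqn_add:
  assumes [measurable]: "f \<in> borel_measurable borel" "g \<in> borel_measurable borel"
  shows "sqn (\<lambda>x. f x + g x) \<le> 2 * sqn f + 2 * sqn g"
proof -
  have "sqn (\<lambda>x. f x + g x) \<le> (\<integral>\<^sup>+x. 2 * ennreal ((cmod (f x))\<^sup>2) + 2 * ennreal ((cmod (g x))\<^sup>2) \<partial>lborel)"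
    unfolding sqn_def
  proof (rule nn_integral_mono)
    fix x
    have "ennreal ((cmod (f x + g x))\<^sup>2) \<le> ennreal (2 * (cmod (f x))\<^sup>2 + 2 * (cmod (g x))\<^sup>2)"
      by (rule ennreal_leI[OF cmod_add_sq])
    then show "ennreal ((cmod (f x + g x))\<^sup>2) \<le> 2 * ennreal ((cmod (f x))\<^sup>2) + 2 * ennreal ((cmod (g x))\<^sup>2)"
      by (simp add: ennreal_plus ennreal_mult)
  qed
  also have "\<dots> = 2 * sqn f + 2 * sqn g"
    unfolding sqn_def by (simp add: nn_integral_add nn_integral_cmult)
  finally show ?thesis .
qed

lemma sqn_fcoef_rnd:
  fixes f :: "real^'d \<Rightarrow> complex"
  assumes L: "L > 0" and f: "in_L2_box L f"
  shows "sqn (\<lambda>p. fcoef L f (rnd L p)) = ennreal (LINT x|boxm L. (cmod (f x))\<^sup>2)"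
proof -
  have "sqn (\<lambda>p. fcoef L f (rnd L p)) = (\<integral>\<^sup>+k. ennreal ((cmod (fcoef L f k))\<^sup>2) \<partial>distr lborel (latm L) (rnd L))"
    unfolding sqn_def by (rule nn_integral_distr[symmetric]) auto
  also have "\<dots> = ennreal (LINT k|latm L. (cmod (fcoef L f k))\<^sup>2)"
    unfolding distr_rnd[OF L] by (rule nn_integral_eq_integral[OF Bessel(1)[OF L f]]) auto
  finally show ?thesis unfolding Parseval_norm[OF L f] .
qed

text \<open>Tonelli for the decomposition of momentum space into cells: every momentum is a lattice
  point plus an offset \<open>q\<close> in the cell at the origin.\<close>

lemma nn_integral_cells:
  fixes F :: "real^'d \<Rightarrow> ennreal"
  assumes L: "L > 0" and [measurable]: "F \<in> borel_measurable borel"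
  shows "(\<integral>\<^sup>+p. F p \<partial>lborel) = (\<integral>\<^sup>+q. indicator (rnd L -` {0}) q * (\<integral>\<^sup>+k. F (dual_pt L k + q) \<partial>count_space UNIV) \<partial>lborel)"
proof -
  have cell [measurable]: "rnd L -` {k::int^'d} \<in> sets borel" for k by (rule rnd_vimage_borel)
  have "(\<integral>\<^sup>+p. F p \<partial>lborel) = (\<integral>\<^sup>+p. (\<integral>\<^sup>+k. F p * indicator (rnd L -` {k}) p \<partial>count_space UNIV) \<partial>lborel)"
  proof (rule nn_integral_cong)
    fix p :: "real^'d"
    have "(\<integral>\<^sup>+k. F p * indicator (rnd L -` {k}) p \<partial>count_space UNIV) = (\<integral>\<^sup>+k. F p * indicator {rnd L p} k \<partial>count_space UNIV)"
      by (intro nn_integral_cong) (auto simp: indicator_def)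
    also have "\<dots> = F p" by (subst nn_integral_cmult) auto
    finally show "F p = (\<integral>\<^sup>+k. F p * indicator (rnd L -` {k}) p \<partial>count_space UNIV)" ..
  qed
  also have "\<dots> = (\<integral>\<^sup>+k. (\<integral>\<^sup>+p. F p * indicator (rnd L -` {k}) p \<partial>lborel) \<partial>count_space UNIV)"
    by (rule nn_integral_count_space_nn_integral) (auto simp: measurable_lborel1)
  also have "\<dots> = (\<integral>\<^sup>+k. (\<integral>\<^sup>+q. indicator (rnd L -` {0}) q * F (dual_pt L k + q) \<partial>lborel) \<partial>count_space UNIV)"
  proof (rule nn_integral_cong)
    fix k :: "int^'d"
    have "(\<integral>\<^sup>+p. F p * indicator (rnd L -` {k}) p \<partial>lborel) = (\<integral>\<^sup>+p. F p * indicator (rnd L -` {k}) p \<partial>distr lborel borel ((+) (dual_pt L k)))"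
      by (simp only: lborel_distr_plus)
    also have "\<dots> = (\<integral>\<^sup>+q. F (dual_pt L k + q) * indicator (rnd L -` {k}) (dual_pt L k + q) \<partial>lborel)"
      by (rule nn_integral_distr) auto
    also have "\<dots> = (\<integral>\<^sup>+q. indicator (rnd L -` {0}) q * F (dual_pt L k + q) \<partial>lborel)"
    proof (rule nn_integral_cong)
      fix q :: "real^'d"
      have "rnd L (dual_pt L k + q) = k + rnd L q"
        using L by (auto simp: rnd_def dual_pt_def vec_eq_iff distrib_left)
      then show "F (dual_pt L k + q) * indicator (rnd L -` {k}) (dual_pt L k + q) = indicator (rnd L -` {0}) q * F (dual_pt L k + q)"
        by (auto simp: indicator_def)
    qed
    finally show "(\<integral>\<^sup>+p. F p * indicator (rnd L -` {k}) p \<partial>lborel) = (\<integral>\<^sup>+q. indicator (rnd L -` {0}) q * F (dual_pt L k + q) \<partial>lborel)" .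
  qed
  also have "\<dots> = (\<integral>\<^sup>+q. (\<integral>\<^sup>+k. indicator (rnd L -` {0}) q * F (dual_pt L k + q) \<partial>count_space UNIV) \<partial>lborel)"
    by (rule nn_integral_count_space_nn_integral[symmetric]) (auto simp: measurable_lborel1)
  also have "\<dots> = (\<integral>\<^sup>+q. indicator (rnd L -` {0}) q * (\<integral>\<^sup>+k. F (dual_pt L k + q) \<partial>count_space UNIV) \<partial>lborel)"
    by (intro nn_integral_cong nn_integral_cmult) auto
  finally show ?thesis .
qed

text \<open>The offset \<open>q\<close> is absorbed into a phase, so the samples of the transform on
  a shifted lattice are again Fourier coefficients on the box, to which Parseval applies.\<close>

lemma ft_eq_fcoef:
  fixes \<phi> :: "real^'d \<Rightarrow> complex"
  assumes supp: "\<And>x. x \<notin> box_L L \<Longrightarrow> \<phi> x = 0"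
  shows "ft \<phi> (dual_pt L k + q) = fcoef L (\<lambda>x. cis (- 2 * pi * (q \<bullet> x)) * \<phi> x) k"
proof -
  have "fcoef L (\<lambda>x. cis (- 2 * pi * (q \<bullet> x)) * \<phi> x) k = (LINT x|lebesgue. indicator (box_L L) x *\<^sub>R (cis (- 2 * pi * (dual_pt L k \<bullet> x)) * (cis (- 2 * pi * (q \<bullet> x)) * \<phi> x)))"
    unfolding fcoef_def by (rule integral_restrict_space) simp
  also have "\<dots> = ft \<phi> (dual_pt L k + q)"
    unfolding ft_def
    by (intro Bochner_Integration.integral_cong refl)
       (use supp in \<open>auto simp: indicator_def inner_add_left distrib_left cis_mult mult.assoc[symmetric]\<close>)
  finally show ?thesis ..
qed

lemma ball_subset_box_L:
  assumes "x \<in> cball 0 R" "L > 2 * R" shows "x \<in> box_L L"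
  unfolding box_L_iff
proof
  fix i show "x $ i \<in> {-L/2..<L/2}" using assms component_le_norm_cart[of x i] by auto
qed

text \<open>Averaging the torus Parseval identity for \<open>\<phi>\<close> times a phase over one cell of the dual lattice compares
  the Fourier transform with its lattice samples.\<close>
lemma sqn_ft_diff:
  fixes \<phi> :: "real^'d \<Rightarrow> complex"
  assumes \<phi>: "in_L2 \<phi>" "integrable lebesgue \<phi>" and supp: "\<And>x. x \<notin> cball 0 R \<Longrightarrow> \<phi> x = 0" and R: "R \<ge> 0" and L: "L > 2 * R" "L > 0"
  shows "sqn (\<lambda>p. fcoef L \<phi> (rnd L p) - ft \<phi> p) \<le> ennreal ((2 * pi * R * CARD('d) / L)\<^sup>2 * (LINT x|lebesgue. (cmod (\<phi> x))\<^sup>2))"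
proof -
  let ?M = "LINT x|lebesgue. (cmod (\<phi> x))\<^sup>2"
  let ?c = "2 * pi * R * CARD('d) / L"
  have [measurable]: "ft \<phi> \<in> borel_measurable borel" by (rule ft_borel[OF \<phi>(2)])
  have rm [measurable]: "(\<lambda>p. fcoef L \<phi> (rnd L p)) \<in> borel_measurable borel"
  proof -
    have "(\<lambda>p. fcoef L \<phi> (rnd L p)) \<in> borel_measurable lborel" by (rule measurable_compose[OF rnd_measurable]) simp
    then show ?thesis by simp
  qed
  have suppL: "\<phi> x = 0" if "x \<notin> box_L L" for x using supp ball_subset_box_L[OF _ L(1)] that by blast
  have \<phi>b: "in_L2_box L \<phi>" by (rule in_L2_imp_box[OF \<phi>(1)])
  have inner: "(\<integral>\<^sup>+k. ennreal ((cmod (fcoef L \<phi> (rnd L (dual_pt L k + q)) - ft \<phi> (dual_pt L k + q)))\<^sup>2) \<partial>count_space UNIV)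
     \<le> ennreal (L ^ CARD('d)) * ennreal (?c\<^sup>2 * ?M)" if q: "rnd L q = 0" for q :: "real^'d"
  proof -
    \<comment> \<open>Its coefficients are the differences to be estimated. On the support of
      \<open>\<phi>\<close> the phase deviates from 1 by at most \<open>2 * pi * |q| * R\<close>,
      and \<open>q\<close> has length of order \<open>1 / L\<close>.\<close>
    define h where "h x = (1 - cis (- 2 * pi * (q \<bullet> x))) * \<phi> x" for x
    have "norm q \<le> (\<Sum>i\<in>UNIV. \<bar>q $ i\<bar>)" by (rule norm_le_l1_cart)
    also have "\<dots> \<le> (\<Sum>i\<in>(UNIV::'d set). 1 / L)"
    proof (rule sum_mono)
      fix i show "\<bar>q $ i\<bar> \<le> 1 / L" using dual_pt_rnd_close[OF L(2), of q i] unfolding q by simp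
    qed
    finally have nq: "norm q \<le> CARD('d) / L" by simp
    have hb: "cmod (h x) \<le> ?c * cmod (\<phi> x)" for x
    proof (cases "x \<in> cball 0 R")
      case True
      have "cmod (1 - cis (- 2 * pi * (q \<bullet> x))) \<le> \<bar>- 2 * pi * (q \<bullet> x)\<bar>" by (rule cmod_one_minus_cis)
      also have "\<dots> = 2 * pi * \<bar>q \<bullet> x\<bar>" by (simp add: abs_mult)
      also have "\<dots> \<le> 2 * pi * (norm q * norm x)" by (intro mult_left_mono Cauchy_Schwarz_ineq2) auto
      also have "\<dots> \<le> 2 * pi * ((CARD('d) / L) * R)" using True R L(2) by (intro mult_left_mono mult_mono nq) auto
      finally show ?thesis unfolding norm_mult h_def by (intro mult_right_mono) (auto simp: field_simps)
    qed (simp add: supp h_def)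
    have hb2: "(cmod (h x))\<^sup>2 \<le> ?c\<^sup>2 * (cmod (\<phi> x))\<^sup>2" for x
    proof -
      have "(cmod (h x))\<^sup>2 \<le> (?c * cmod (\<phi> x))\<^sup>2" by (rule power_mono[OF hb norm_ge_zero])
      also have "\<dots> = ?c\<^sup>2 * (cmod (\<phi> x))\<^sup>2" by (rule power_mult_distrib)
      finally show ?thesis .
    qed
    have hm: "h \<in> borel_measurable lebesgue" using \<phi>(1) unfolding in_L2_def h_def[abs_def]
      by (intro borel_measurable_times borel_measurable_diff borel_measurable_const lebesgue_cis_inner) auto
    have h2i: "integrable lebesgue (\<lambda>x. (cmod (h x))\<^sup>2)"
    proof (rule Bochner_Integration.integrable_bound)
      show "integrable lebesgue (\<lambda>x. ?c\<^sup>2 * (cmod (\<phi> x))\<^sup>2)" using \<phi>(1) by (auto simp: in_L2_def)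
      show "AE x in lebesgue. norm ((cmod (h x))\<^sup>2) \<le> norm (?c\<^sup>2 * (cmod (\<phi> x))\<^sup>2)"
        by (rule AE_I2, simp only: real_norm_def abs_power2) (rule order_trans[OF hb2 abs_ge_self])
    qed (intro borel_measurable_power measurable_compose[OF hm] borel_measurable_norm measurable_ident)
    have hL2: "in_L2_box L h" by (rule in_L2_imp_box) (unfold in_L2_def, rule conjI[OF hm h2i])
    have i1: "integrable (boxm L) \<phi>" by (rule in_L2_box_integrable[OF L(2) \<phi>b])
    have i2: "integrable (boxm L) (\<lambda>x. (-1) * (cis (- 2 * pi * (q \<bullet> x)) * \<phi> x))"
    proof (intro Bochner_Integration.integrable_mult_right)
      have "integrable (boxm L) (\<lambda>x. \<phi> x * cis (- 2 * pi * (q \<bullet> x)))"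
        by (rule integrable_mult_bounded[OF i1, where C = 1], rule measurable_restrict_space1[OF lebesgue_cis_inner]) simp
      then show "integrable (boxm L) (\<lambda>x. cis (- 2 * pi * (q \<bullet> x)) * \<phi> x)" by (simp add: mult.commute)
    qed
    have eq: "fcoef L \<phi> (rnd L (dual_pt L k + q)) - ft \<phi> (dual_pt L k + q) = fcoef L h k" for k
    proof -
      have "rnd L (dual_pt L k + q) = k + rnd L q"
        using L by (auto simp: rnd_def dual_pt_def vec_eq_iff distrib_left)
      then have "fcoef L \<phi> (rnd L (dual_pt L k + q)) - ft \<phi> (dual_pt L k + q) = fcoef L \<phi> k + (-1) * fcoef L (\<lambda>x. cis (- 2 * pi * (q \<bullet> x)) * \<phi> x) k"
        using q by (simp add: ft_eq_fcoef[OF suppL])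
      also have "\<dots> = fcoef L (\<lambda>x. \<phi> x + (-1) * (cis (- 2 * pi * (q \<bullet> x)) * \<phi> x)) k"
        unfolding fcoef_add[OF i1 i2] fcoef_scale ..
      finally show ?thesis by (simp add: ring_distribs h_def[abs_def])
    qed
    have "(LINT x|boxm L. (cmod (h x))\<^sup>2) \<le> ?c\<^sup>2 * ?M"
    proof -
      have "(LINT x|boxm L. (cmod (h x))\<^sup>2) = (LINT x|lebesgue. indicator (box_L L) x *\<^sub>R (cmod (h x))\<^sup>2)"
        by (rule integral_restrict_space) simp
      also have "\<dots> \<le> (LINT x|lebesgue. ?c\<^sup>2 * (cmod (\<phi> x))\<^sup>2)"
      proof (rule integral_mono)
        show "integrable lebesgue (\<lambda>x. indicator (box_L L) x *\<^sub>R (cmod (h x))\<^sup>2)"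
          using hL2 by (simp add: in_L2_box_def integrable_boxm_iff)
        show "integrable lebesgue (\<lambda>x. ?c\<^sup>2 * (cmod (\<phi> x))\<^sup>2)" using \<phi>(1) by (auto simp: in_L2_def)
        show "indicator (box_L L) x *\<^sub>R (cmod (h x))\<^sup>2 \<le> ?c\<^sup>2 * (cmod (\<phi> x))\<^sup>2" for x
          using hb2[of x] by (simp add: indicator_def)
      qed
      finally show ?thesis by simp
    qed
    then have "(\<integral>\<^sup>+k. ennreal ((cmod (fcoef L h k))\<^sup>2) \<partial>latm L) \<le> ennreal (?c\<^sup>2 * ?M)"
      by (subst nn_integral_eq_integral[OF Bessel(1)[OF L(2) hL2]]) (auto simp: Parseval_norm[OF L(2) hL2, symmetric] intro: ennreal_leI)
    then have le: "ennreal (L ^ CARD('d)) * (\<integral>\<^sup>+k. ennreal ((cmod (fcoef L h k))\<^sup>2) \<partial>latm L) \<le> ennreal (L ^ CARD('d)) * ennreal (?c\<^sup>2 * ?M)"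
      by (intro mult_left_mono) auto
    have "(\<integral>\<^sup>+k. ennreal ((cmod (fcoef L h k))\<^sup>2) \<partial>count_space UNIV) = ennreal (L ^ CARD('d)) * (\<integral>\<^sup>+k. ennreal ((cmod (fcoef L h k))\<^sup>2) \<partial>latm L)"
    proof -
      have "(\<integral>\<^sup>+k. ennreal ((cmod (fcoef L h k))\<^sup>2) \<partial>latm L) = (\<integral>\<^sup>+k. ennreal (1 / L ^ CARD('d)) * ennreal ((cmod (fcoef L h k))\<^sup>2) \<partial>count_space UNIV)"
        unfolding latm_def by (rule nn_integral_density) auto
      also have "\<dots> = ennreal (1 / L ^ CARD('d)) * (\<integral>\<^sup>+k. ennreal ((cmod (fcoef L h k))\<^sup>2) \<partial>count_space UNIV)"
        by (rule nn_integral_cmult) simp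
      finally show ?thesis using L by (simp add: mult.assoc[symmetric] ennreal_mult[symmetric])
    qed
    with le show ?thesis unfolding eq by simp
  qed
  have "sqn (\<lambda>p. fcoef L \<phi> (rnd L p) - ft \<phi> p) = (\<integral>\<^sup>+q. indicator (rnd L -` {0}) q * (\<integral>\<^sup>+k. ennreal ((cmod (fcoef L \<phi> (rnd L (dual_pt L k + q)) - ft \<phi> (dual_pt L k + q)))\<^sup>2) \<partial>count_space UNIV) \<partial>lborel)"
    unfolding sqn_def by (rule nn_integral_cells[OF L(2)]) measurable
  also have "\<dots> \<le> (\<integral>\<^sup>+q. indicator (rnd L -` {0::int^'d}) q * (ennreal (L ^ CARD('d)) * ennreal (?c\<^sup>2 * ?M)) \<partial>lborel)"
  proof (rule nn_integral_mono)
    fix q :: "real^'d"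
    show "indicator (rnd L -` {0}) q * (\<integral>\<^sup>+k. ennreal ((cmod (fcoef L \<phi> (rnd L (dual_pt L k + q)) - ft \<phi> (dual_pt L k + q)))\<^sup>2) \<partial>count_space UNIV)
      \<le> indicator (rnd L -` {0}) q * (ennreal (L ^ CARD('d)) * ennreal (?c\<^sup>2 * ?M))"
      using inner[of q] by (cases "rnd L q = 0") auto
  qed
  also have "\<dots> = emeasure lborel (rnd L -` {0::int^'d}) * (ennreal (L ^ CARD('d)) * ennreal (?c\<^sup>2 * ?M))"
  proof -
    have s: "rnd L -` {0::int^'d} \<in> sets lborel" unfolding sets_lborel by (rule rnd_vimage_borel)
    show ?thesis by (subst nn_integral_multc[OF borel_measurable_indicator[OF s]]) (simp only: nn_integral_indicator[OF s])
  qed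
  also have "emeasure lborel (rnd L -` {0::int^'d}) = ennreal (1 / L ^ CARD('d))"
  proof -
    have "emeasure (distr lborel (latm L) (rnd L)) {0::int^'d} = emeasure lborel (rnd L -` {0::int^'d})"
      by (subst emeasure_distr) auto
    then show ?thesis unfolding distr_rnd[OF L(2)] emeasure_latm_singleton by (rule sym)
  qed
  also have "ennreal (1 / L ^ CARD('d)) * (ennreal (L ^ CARD('d)) * ennreal (?c\<^sup>2 * ?M)) = ennreal (?c\<^sup>2 * ?M)"
    using L by (simp add: mult.assoc[symmetric] ennreal_mult[symmetric])
  finally show ?thesis .
qed

lemma sqn_cong_AE: "(AE x in lborel. f x = g x) \<Longrightarrow> sqn f = sqn g"
  unfolding sqn_def by (rule nn_integral_cong_AE) (auto elim!: eventually_mono)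

lemma sqn_le_imp: "sqn f \<le> ennreal e \<Longrightarrow> sqn f < \<infinity>"
  using le_less_trans by fastforce

lemma sqn_of_in_L2:
  assumes "in_L2 f" shows "sqn f = ennreal (LINT x|lebesgue. (cmod (f x))\<^sup>2)"
proof -
  have i: "integrable lebesgue (\<lambda>x. (cmod (f x))\<^sup>2)" using assms by (simp add: in_L2_def)
  have "sqn f = (\<integral>\<^sup>+x. ennreal ((cmod (f x))\<^sup>2) \<partial>lebesgue)" unfolding sqn_def by (rule nn_integral_completion[symmetric])
  also have "\<dots> = ennreal (LINT x|lebesgue. (cmod (f x))\<^sup>2)" by (rule nn_integral_eq_integral[OF i]) auto
  finally show ?thesis .
qed

lemma sqn_fcoef_rnd_le:
  fixes f :: "real^'d \<Rightarrow> complex"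
  assumes L: "L > 0" and f: "in_L2 f"
  shows "sqn (\<lambda>p. fcoef L f (rnd L p)) \<le> sqn f"
proof -
  have i: "integrable lebesgue (\<lambda>x. (cmod (f x))\<^sup>2)" using f by (simp add: in_L2_def)
  have "(LINT x|boxm L. (cmod (f x))\<^sup>2) = (LINT x|lebesgue. indicator (box_L L) x *\<^sub>R (cmod (f x))\<^sup>2)"
    by (rule integral_restrict_space) simp
  also have "\<dots> \<le> (LINT x|lebesgue. (cmod (f x))\<^sup>2)"
    by (rule integral_mono[OF integrable_mult_indicator[OF box_L_lebesgue i] i]) (simp add: indicator_def)
  finally show ?thesis unfolding sqn_fcoef_rnd[OF L in_L2_imp_box[OF f]] sqn_of_in_L2[OF f] by (rule ennreal_leI)
qed

lemma in_L2_truncate: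
  fixes f :: "real^'d \<Rightarrow> complex"
  assumes f: "in_L2 f"
  shows "in_L2 (\<lambda>x. indicator (cball 0 R) x * f x)" "integrable lebesgue (\<lambda>x. indicator (cball 0 R) x * f x)"
    "in_L2 (\<lambda>x. f x - indicator (cball 0 R) x * f x)"
proof -
  have m: "f \<in> borel_measurable lebesgue" and i: "integrable lebesgue (\<lambda>x. (cmod (f x))\<^sup>2)" using f by (auto simp: in_L2_def)
  have ind: "indicator (cball 0 R) \<in> borel_measurable (lebesgue :: (real^'d) measure)" 
    by (rule borel_measurable_indicator) auto
  have indc: "(\<lambda>x. indicator (cball 0 R) x :: complex) \<in> borel_measurable (lebesgue :: (real^'d) measure)"
    by (rule borel_measurable_indicator) auto
  have m1: "(\<lambda>x. indicator (cball 0 R) x * f x) \<in> borel_measurable lebesgue" by (rule borel_measurable_times[OF indc m])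
  have i1: "integrable lebesgue (\<lambda>x. (cmod (indicator (cball 0 R) x * f x))\<^sup>2)"
  proof -
    have "integrable lebesgue (\<lambda>x. indicator (cball 0 R) x *\<^sub>R (cmod (f x))\<^sup>2)" by (rule integrable_mult_indicator[OF _ i]) simp
    moreover have "(\<lambda>x. indicator (cball 0 R) x *\<^sub>R (cmod (f x))\<^sup>2) = (\<lambda>x. (cmod (indicator (cball 0 R) x * f x))\<^sup>2)" by (auto simp: indicator_def)
    ultimately show ?thesis by simp
  qed
  show 1: "in_L2 (\<lambda>x. indicator (cball 0 R) x * f x)" using m1 i1 by (simp add: in_L2_def)
  have i3: "integrable lebesgue (\<lambda>x. (cmod (f x - indicator (cball 0 R) x * f x))\<^sup>2)"
  proof -
    have "integrable lebesgue (\<lambda>x. indicator (- cball 0 R) x *\<^sub>R (cmod (f x))\<^sup>2)" by (rule integrable_mult_indicator[OF _ i]) auto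
    moreover have "(\<lambda>x. indicator (- cball 0 R) x *\<^sub>R (cmod (f x))\<^sup>2) = (\<lambda>x. (cmod (f x - indicator (cball 0 R) x * f x))\<^sup>2)" by (auto simp: indicator_def)
    ultimately show ?thesis by simp
  qed
  show "in_L2 (\<lambda>x. f x - indicator (cball 0 R) x * f x)"
    using borel_measurable_diff[OF m m1] i3 by (simp add: in_L2_def)
  have c: "integrable lebesgue (indicator (cball (0::real^'d) R) :: _ \<Rightarrow> complex)"
  proof -
    have "integrable lebesgue (indicator (cball (0::real^'d) R) :: _ \<Rightarrow> real)"
      using emeasure_bounded_finite[OF bounded_cball, of "0::real^'d" R] by (intro integrable_real_indicator) auto
    from integrable_of_real[OF this, where 'a = complex] show ?thesis by (simp add: of_real_indicator)
  qed
  have ci: "integrable lebesgue (\<lambda>x. (cmod (indicator (cball (0::real^'d) R) x))\<^sup>2)"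
  proof -
    have "(\<lambda>x. (cmod (indicator (cball (0::real^'d) R) x))\<^sup>2) = (\<lambda>x. cmod (indicator (cball (0::real^'d) R) x))" by (auto simp: indicator_def)
    then show ?thesis using integrable_norm[OF c] by simp
  qed
  show "integrable lebesgue (\<lambda>x. indicator (cball 0 R) x * f x)"
    by (rule integrable_mult_L2[OF indc m ci i])
qed

text \<open>Truncate \<open>\<psi>\<close> to a ball, where \<open>sqn_ft_diff\<close> applies. The
  truncation error of the samples is controlled uniformly in \<open>L\<close> by Parseval, and that
  of the transform by the defining limit of \<open>is_ft_L2\<close>.\<close>

lemma fcoef_rnd_L2_limit:
  fixes \<psi> g :: "real^'d \<Rightarrow> complex"
  assumes \<psi>: "in_L2 \<psi>" and ft: "is_ft_L2 \<psi> g0" and g [measurable]: "g \<in> borel_measurable borel" and ae: "AE x in lborel. g0 x = g x"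
    and e: "e > 0"
  shows "\<forall>\<^sub>F L in at_top. sqn (\<lambda>p. fcoef L \<psi> (rnd L p) - g p) \<le> ennreal e"
proof -
  let ?\<phi> = "\<lambda>R x. indicator (cball 0 R) x * \<psi> x"
  \<comment> \<open>Two applications of \<open>sqn_add\<close> attach the weights 2, 4 and 4 to the
    three errors.\<close>
  define d where "d = e / 10"
  have d: "d > 0" using e by (simp add: d_def)
  have g0: "in_L2 g0" using ft by (simp add: is_ft_L2_def)
  have i: "integrable lebesgue (\<lambda>x. (cmod (\<psi> x))\<^sup>2)" using \<psi> by (simp add: in_L2_def)
  have lim1: "((\<lambda>R. LINT x|lebesgue. (cmod (\<psi> x - ?\<phi> R x))\<^sup>2) \<longlongrightarrow> (LINT x|(lebesgue :: (real^'d) measure). 0)) at_top"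
  proof (rule integral_dominated_convergence_at_top[where w = "\<lambda>x. (cmod (\<psi> x))\<^sup>2"])
    show "(\<lambda>x. (cmod (\<psi> x - ?\<phi> R x))\<^sup>2) \<in> borel_measurable lebesgue" for R
      using in_L2_truncate(3)[OF \<psi>, of R] by (auto simp: in_L2_def)
    show "\<forall>\<^sub>F R in at_top. AE x in lebesgue. norm ((cmod (\<psi> x - ?\<phi> R x))\<^sup>2) \<le> (cmod (\<psi> x))\<^sup>2"
      by (intro always_eventually allI AE_I2) (auto simp: indicator_def)
    show "AE x in lebesgue. ((\<lambda>R. (cmod (\<psi> x - ?\<phi> R x))\<^sup>2) \<longlongrightarrow> 0) at_top"
    proof (rule AE_I2, rule tendsto_eventually)
      fix x :: "real^'d"
      show "\<forall>\<^sub>F R in at_top. (cmod (\<psi> x - ?\<phi> R x))\<^sup>2 = 0"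
        using eventually_ge_at_top[of "norm x"] by eventually_elim (simp add: indicator_def)
    qed
  qed (use i in auto)
  then have ev1: "\<forall>\<^sub>F R in at_top. (LINT x|lebesgue. (cmod (\<psi> x - ?\<phi> R x))\<^sup>2) < d"
    using d by (intro order_tendstoD(2)) auto
  have "((\<lambda>R. (norm_L2 (\<lambda>k. ft (?\<phi> R) k - g0 k))\<^sup>2) \<longlongrightarrow> 0\<^sup>2) at_top"
    using ft unfolding is_ft_L2_def by (intro tendsto_power) auto
  then have ev2: "\<forall>\<^sub>F R in at_top. (norm_L2 (\<lambda>k. ft (?\<phi> R) k - g0 k))\<^sup>2 < d"
    using d by (intro order_tendstoD(2)) auto
  obtain R where R: "R \<ge> 0" "(LINT x|lebesgue. (cmod (\<psi> x - ?\<phi> R x))\<^sup>2) < d" "(norm_L2 (\<lambda>k. ft (?\<phi> R) k - g0 k))\<^sup>2 < d"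
    using eventually_happens'[OF _ eventually_conj[OF eventually_ge_at_top[of 0] eventually_conj[OF ev1 ev2]]] by auto
  have \<phi>: "in_L2 (?\<phi> R)" "integrable lebesgue (?\<phi> R)" "in_L2 (\<lambda>x. \<psi> x - ?\<phi> R x)" by (rule in_L2_truncate[OF \<psi>])+
  have [measurable]: "ft (?\<phi> R) \<in> borel_measurable borel" by (rule ft_borel[OF \<phi>(2)])
  have rm [measurable]: "(\<lambda>p. fcoef L f (rnd L p)) \<in> borel_measurable borel" for L and f :: "real^'d \<Rightarrow> complex"
  proof -
    have "(\<lambda>p. fcoef L f (rnd L p)) \<in> borel_measurable lborel" by (rule measurable_compose[OF rnd_measurable]) simp
    then show ?thesis by simp
  qed
  let ?M = "LINT x|lebesgue. (cmod (?\<phi> R x))\<^sup>2"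
  have diff: "sqn (\<lambda>p. fcoef L (?\<phi> R) (rnd L p) - ft (?\<phi> R) p) \<le> ennreal ((2 * pi * R * CARD('d) / L)\<^sup>2 * ?M)" if "L > 2 * R" "L > 0" for L
    by (rule sqn_ft_diff[OF \<phi>(1,2) _ R(1) that]) simp
  \<comment> \<open>The Bochner integral in \<open>norm_L2\<close> is 0 for a function that is not
    square integrable, so a small value says nothing until finiteness is known. It follows by
    comparison with the samples for one box size.\<close>
  have fin_ft: "sqn (ft (?\<phi> R)) < \<infinity>"
  proof -
    let ?L = "2 * R + 1"
    have L: "?L > 2 * R" "?L > 0" using R by auto
    have 1: "sqn (\<lambda>p. ft (?\<phi> R) p - fcoef ?L (?\<phi> R) (rnd ?L p)) < \<infinity>"
      using sqn_le_imp[OF diff[OF L]] by (simp add: sqn_def norm_minus_commute)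
    have 2: "sqn (\<lambda>p. fcoef ?L (?\<phi> R) (rnd ?L p)) < \<infinity>"
      using sqn_fcoef_rnd_le[OF L(2) \<phi>(1)] unfolding sqn_of_in_L2[OF \<phi>(1)] by (rule sqn_le_imp)
    have "sqn (\<lambda>p. (ft (?\<phi> R) p - fcoef ?L (?\<phi> R) (rnd ?L p)) + fcoef ?L (?\<phi> R) (rnd ?L p)) \<le> 2 * sqn (\<lambda>p. ft (?\<phi> R) p - fcoef ?L (?\<phi> R) (rnd ?L p)) + 2 * sqn (\<lambda>p. fcoef ?L (?\<phi> R) (rnd ?L p))"
      by (rule sqn_add) measurable
    also have "\<dots> < \<infinity>" using 1 2 by (simp add: ennreal_mult_less_top)
    finally show ?thesis by simp
  qed
  have fin_g: "sqn g < \<infinity>" using sqn_cong_AE[OF ae] sqn_of_in_L2[OF g0] by (metis ennreal_less_top infinity_ennreal_def)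
  have ftg: "sqn (\<lambda>p. ft (?\<phi> R) p - g p) \<le> ennreal d"
  proof -
    have "sqn (\<lambda>p. ft (?\<phi> R) p + (- g p)) \<le> 2 * sqn (ft (?\<phi> R)) + 2 * sqn (\<lambda>p. - g p)" by (rule sqn_add) measurable
    also have "\<dots> < \<infinity>" using fin_ft fin_g by (simp add: ennreal_mult_less_top sqn_def)
    finally have fin: "sqn (\<lambda>p. ft (?\<phi> R) p - g p) < \<infinity>" by simp
    have int: "integrable lborel (\<lambda>p. (cmod (ft (?\<phi> R) p - g p))\<^sup>2)"
      by (rule integrableI_bounded) (use fin in \<open>auto simp: sqn_def\<close>)
    have "norm_L2 (\<lambda>k. ft (?\<phi> R) k - g0 k) = sqrt (LINT x|lebesgue. (cmod (ft (?\<phi> R) x - g x))\<^sup>2)"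
    proof -
      have "(LINT x|lebesgue. (cmod (ft (?\<phi> R) x - g0 x))\<^sup>2) = (LINT x|lebesgue. (cmod (ft (?\<phi> R) x - g x))\<^sup>2)"
      proof (rule integral_cong_AE)
        show "AE x in lebesgue. (cmod (ft (?\<phi> R) x - g0 x))\<^sup>2 = (cmod (ft (?\<phi> R) x - g x))\<^sup>2"
          unfolding AE_completion_iff using ae by eventually_elim simp
        have sqm: "(\<lambda>z::complex. (cmod z)\<^sup>2) \<in> borel_measurable borel" by measurable
        have gm: "g0 \<in> borel_measurable lebesgue" using g0 by (simp add: in_L2_def)
        have fm: "ft (?\<phi> R) \<in> borel_measurable lebesgue" "g \<in> borel_measurable lebesgue" by (rule measurable_completion, simp)+
        show "(\<lambda>x. (cmod (ft (?\<phi> R) x - g0 x))\<^sup>2) \<in> borel_measurable lebesgue"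
          by (rule measurable_compose[OF borel_measurable_diff[OF fm(1) gm] sqm])
        show "(\<lambda>x. (cmod (ft (?\<phi> R) x - g x))\<^sup>2) \<in> borel_measurable lebesgue"
          by (rule measurable_compose[OF borel_measurable_diff[OF fm] sqm])
      qed
      then show ?thesis by (simp add: norm_L2_def)
    qed
    then have "(LINT x|lebesgue. (cmod (ft (?\<phi> R) x - g x))\<^sup>2) \<le> d"
      using R(3) by (simp add: Bochner_Integration.integral_nonneg)
    moreover have "(LINT x|lebesgue. (cmod (ft (?\<phi> R) x - g x))\<^sup>2) = (LINT x|lborel. (cmod (ft (?\<phi> R) x - g x))\<^sup>2)"
      by (rule integral_completion) measurable
    moreover have "sqn (\<lambda>p. ft (?\<phi> R) p - g p) = ennreal (LINT x|lborel. (cmod (ft (?\<phi> R) x - g x))\<^sup>2)"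
      unfolding sqn_def by (rule nn_integral_eq_integral[OF int]) auto
    ultimately show ?thesis by (simp add: ennreal_leI)
  qed
  have psid: "sqn (\<lambda>p. fcoef L \<psi> (rnd L p) - fcoef L (?\<phi> R) (rnd L p)) \<le> ennreal d" if L: "L > 0" for L
  proof -
    have i1: "integrable (boxm L) \<psi>" "integrable (boxm L) (\<lambda>x. (-1) * ?\<phi> R x)"
      using in_L2_box_integrable[OF L in_L2_imp_box[OF \<psi>]] in_L2_box_integrable[OF L in_L2_imp_box[OF \<phi>(1)]]
      by auto
    have "fcoef L \<psi> k - fcoef L (?\<phi> R) k = fcoef L (\<lambda>x. \<psi> x - ?\<phi> R x) k" for k
      using fcoef_add[OF i1, of k] fcoef_scale[of L "-1" "?\<phi> R" k] by simp
    then have "sqn (\<lambda>p. fcoef L \<psi> (rnd L p) - fcoef L (?\<phi> R) (rnd L p)) \<le> sqn (\<lambda>x. \<psi> x - ?\<phi> R x)"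
      using sqn_fcoef_rnd_le[OF L \<phi>(3)] by simp
    also have "\<dots> \<le> ennreal d" unfolding sqn_of_in_L2[OF \<phi>(3)] using R(2) by (intro ennreal_leI) simp
    finally show ?thesis .
  qed
  have "((\<lambda>L. (2 * pi * R * CARD('d) / L)\<^sup>2 * ?M) \<longlongrightarrow> 0\<^sup>2 * ?M) at_top"
    by (intro tendsto_intros tendsto_divide_0[OF tendsto_const] filterlim_at_top_imp_at_infinity filterlim_ident)
  then have ev3: "\<forall>\<^sub>F L in at_top. (2 * pi * R * CARD('d) / L)\<^sup>2 * ?M < d"
    using d by (intro order_tendstoD(2)) auto
  show ?thesis
    using ev3 eventually_gt_at_top[of "2 * R"] eventually_gt_at_top[of 0]
  proof eventually_elim
    case (elim L)
    let ?a = "\<lambda>p. fcoef L \<psi> (rnd L p) - fcoef L (?\<phi> R) (rnd L p)"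
    let ?b = "\<lambda>p. fcoef L (?\<phi> R) (rnd L p) - ft (?\<phi> R) p" and ?c = "\<lambda>p. ft (?\<phi> R) p - g p"
    have "sqn ?b \<le> ennreal d" using diff[OF elim(2,3)] elim(1) by (meson ennreal_leI less_imp_le order_trans)
    have "sqn (\<lambda>p. ?a p + (?b p + ?c p)) \<le> 2 * sqn ?a + 2 * sqn (\<lambda>p. ?b p + ?c p)"
      by (rule sqn_add) measurable
    also have "\<dots> \<le> 2 * sqn ?a + 2 * (2 * sqn ?b + 2 * sqn ?c)"
      by (intro add_left_mono mult_left_mono sqn_add) auto
    also have "\<dots> \<le> 2 * ennreal d + 2 * (2 * ennreal d + 2 * ennreal d)"
      by (intro add_mono mult_left_mono psid elim ftg \<open>sqn ?b \<le> ennreal d\<close>) auto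
    also have "\<dots> \<le> ennreal e"
    proof -
      have "2 * ennreal d + 2 * (2 * ennreal d + 2 * ennreal d) = ennreal (2 * d + 2 * (2 * d + 2 * d))"
        using d by (simp only: ennreal_plus ennreal_mult ennreal_numeral mult_nonneg_nonneg zero_le_numeral less_imp_le add_nonneg_nonneg)
      also have "\<dots> = ennreal e" by (simp add: d_def)
      finally show ?thesis by simp
    qed
    finally show ?case by simp
  qed
qed

lemma integrable_sq_of_sqn:
  assumes [measurable]: "f \<in> borel_measurable borel" and "sqn f < \<infinity>"
  shows "integrable lborel (\<lambda>x. (cmod (f x))\<^sup>2)"
  by (rule integrableI_bounded) (use assms(2) in \<open>auto simp: sqn_def\<close>)

lemma mult_le_weighted_sq: "d > 0 \<Longrightarrow> a * b \<le> a\<^sup>2 / d + d * b\<^sup>2" for a b d :: real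
proof -
  assume d: "d > 0"
  have "0 \<le> (a - d * b)\<^sup>2 + a\<^sup>2 + (d * b)\<^sup>2" by (intro add_nonneg_nonneg) auto
  then have "d * (a * b) \<le> a\<^sup>2 + d\<^sup>2 * b\<^sup>2" by (simp add: power2_eq_square algebra_simps)
  then show ?thesis using d by (simp add: field_simps power2_eq_square)
qed

lemma le_sqn_real:
  assumes [measurable]: "f \<in> borel_measurable borel" and "sqn f \<le> ennreal e" "e \<ge> 0"
  shows "(LINT p|lborel. (cmod (f p))\<^sup>2) \<le> e"
proof -
  have i: "integrable lborel (\<lambda>x. (cmod (f x))\<^sup>2)" by (rule integrable_sq_of_sqn) (use assms sqn_le_imp in auto)
  have "ennreal (LINT p|lborel. (cmod (f p))\<^sup>2) \<le> ennreal e"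
    using assms(2) unfolding sqn_def by (subst (asm) nn_integral_eq_integral[OF i]) auto
  then show ?thesis using assms(3) by (simp add: ennreal_le_iff)
qed

text \<open>The difference of the products splits into two terms, each pairing a small factor with
  one bounded in \<open>L2\<close>; a weighted quadratic inequality takes the place of
  Cauchy-Schwarz.\<close>

lemma product_L1_limit:
  fixes s1 s2 :: "real \<Rightarrow> real^'d \<Rightarrow> complex" and g1 g2 :: "real^'d \<Rightarrow> complex"
  assumes m [measurable]: "\<And>L. s1 L \<in> borel_measurable borel" "\<And>L. s2 L \<in> borel_measurable borel" "g1 \<in> borel_measurable borel" "g2 \<in> borel_measurable borel"
    and g: "sqn g1 < \<infinity>" "sqn g2 < \<infinity>" and K: "\<And>L. L > 0 \<Longrightarrow> sqn (s1 L) \<le> ennreal K" "\<And>L. L > 0 \<Longrightarrow> sqn (s2 L) \<le> ennreal K" "K \<ge> 0"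
    and lim: "\<And>e. e > 0 \<Longrightarrow> \<forall>\<^sub>F L in at_top. sqn (\<lambda>p. s1 L p - g1 p) \<le> ennreal e" "\<And>e. e > 0 \<Longrightarrow> \<forall>\<^sub>F L in at_top. sqn (\<lambda>p. s2 L p - g2 p) \<le> ennreal e"
  shows "integrable lborel (\<lambda>p. cnj (g1 p) * g2 p)" "\<And>L. L > 0 \<Longrightarrow> integrable lborel (\<lambda>p. cnj (s1 L p) * s2 L p)"
    "((\<lambda>L. LINT p|lborel. cmod (cnj (s1 L p) * s2 L p - cnj (g1 p) * g2 p)) \<longlongrightarrow> 0) at_top"
proof -
  have cm: "(\<lambda>p. cnj (f p)) \<in> borel_measurable lborel" if "f \<in> borel_measurable borel" for f :: "real^'d \<Rightarrow> complex"
    using measurable_compose[OF that borel_measurable_cnj] by simp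
  have sq: "integrable lborel (\<lambda>x. (cmod (cnj (f x)))\<^sup>2)" if "f \<in> borel_measurable borel" "sqn f < \<infinity>" for f :: "real^'d \<Rightarrow> complex"
    using integrable_sq_of_sqn[OF that] by simp
  have sK: "sqn (s1 L) < \<infinity>" "sqn (s2 L) < \<infinity>" if "L > 0" for L using K(1,2)[OF that] sqn_le_imp by blast+
  show gi: "integrable lborel (\<lambda>p. cnj (g1 p) * g2 p)"
    by (rule integrable_mult_L2[OF cm _ sq integrable_sq_of_sqn]) (use g m in auto)
  show si: "integrable lborel (\<lambda>p. cnj (s1 L p) * s2 L p)" if "L > 0" for L
    by (rule integrable_mult_L2[OF cm _ sq integrable_sq_of_sqn]) (use sK[OF that] m in auto)
  define G where "G = (LINT p|lborel. (cmod (g1 p))\<^sup>2)"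
  have gsq: "integrable lborel (\<lambda>p. (cmod (g1 p))\<^sup>2)" by (rule integrable_sq_of_sqn[OF m(3) g(1)])
  define Q where "Q = K + G + 1"
  have G0: "G \<ge> 0" by (simp add: G_def)
  have Q: "Q > 0" "K \<le> Q" "G \<le> Q" using G0 K(3) by (auto simp: Q_def)
  have main: "\<forall>\<^sub>F L in at_top. (LINT p|lborel. cmod (cnj (s1 L p) * s2 L p - cnj (g1 p) * g2 p)) \<le> e" if e: "e > 0" for e
  proof -
    \<comment> \<open>With squared errors at most \<open>d * e / 4\<close> and squared norms at most
      \<open>Q\<close>, each of the four resulting terms is at most \<open>e / 4\<close>.\<close>
    define d where "d = e / (4 * Q)"
    have d: "d > 0" using e Q by (simp add: d_def)
    have de: "d * e / 4 > 0" using d e by simp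
    show ?thesis
      using lim(1)[OF de] lim(2)[OF de] eventually_gt_at_top[of 0]
    proof eventually_elim
      case (elim L)
      let ?a = "\<lambda>p. s1 L p - g1 p" and ?b = "\<lambda>p. s2 L p - g2 p"
      have m': "?a \<in> borel_measurable borel" "?b \<in> borel_measurable borel" by measurable
      have ia: "integrable lborel (\<lambda>p. (cmod (?a p))\<^sup>2)" and ib: "integrable lborel (\<lambda>p. (cmod (?b p))\<^sup>2)"
        by (rule integrable_sq_of_sqn[OF m'(1) sqn_le_imp[OF elim(1)]], rule integrable_sq_of_sqn[OF m'(2) sqn_le_imp[OF elim(2)]])
      have is2: "integrable lborel (\<lambda>p. (cmod (s2 L p))\<^sup>2)" by (rule integrable_sq_of_sqn[OF m(2) sK(2)[OF elim(3)]])
      have "(LINT p|lborel. cmod (cnj (s1 L p) * s2 L p - cnj (g1 p) * g2 p))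
         \<le> (LINT p|lborel. ((cmod (?a p))\<^sup>2 / d + d * (cmod (s2 L p))\<^sup>2) + ((cmod (?b p))\<^sup>2 / d + d * (cmod (g1 p))\<^sup>2))"
      proof (rule integral_mono)
        show "integrable lborel (\<lambda>p. cmod (cnj (s1 L p) * s2 L p - cnj (g1 p) * g2 p))"
          using si[OF elim(3)] gi by auto
        show "integrable lborel (\<lambda>p. ((cmod (?a p))\<^sup>2 / d + d * (cmod (s2 L p))\<^sup>2) + ((cmod (?b p))\<^sup>2 / d + d * (cmod (g1 p))\<^sup>2))"
          using ia ib is2 gsq by auto
        fix p
        have "cnj (s1 L p) * s2 L p - cnj (g1 p) * g2 p = cnj (?a p) * s2 L p + ?b p * cnj (g1 p)" by (simp add: algebra_simps)
        then have "cmod (cnj (s1 L p) * s2 L p - cnj (g1 p) * g2 p) \<le> cmod (?a p) * cmod (s2 L p) + cmod (?b p) * cmod (g1 p)"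
          by (metis norm_triangle_ineq norm_mult complex_mod_cnj)
        also have "\<dots> \<le> ((cmod (?a p))\<^sup>2 / d + d * (cmod (s2 L p))\<^sup>2) + ((cmod (?b p))\<^sup>2 / d + d * (cmod (g1 p))\<^sup>2)"
          by (intro add_mono mult_le_weighted_sq d)
        finally show "cmod (cnj (s1 L p) * s2 L p - cnj (g1 p) * g2 p) \<le> \<dots>" .
      qed
      also have "\<dots> = ((LINT p|lborel. (cmod (?a p))\<^sup>2) / d + d * (LINT p|lborel. (cmod (s2 L p))\<^sup>2)) + ((LINT p|lborel. (cmod (?b p))\<^sup>2) / d + d * G)"
        using ia ib is2 gsq by (simp add: G_def)
      also have "\<dots> \<le> ((d * e / 4) / d + d * Q) + ((d * e / 4) / d + d * Q)"
        using le_sqn_real[OF m'(1) elim(1)] le_sqn_real[OF m'(2) elim(2)] le_sqn_real[OF m(2) K(2)[OF elim(3)] K(3)] d de Q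
        by (intro add_mono divide_right_mono mult_left_mono) (auto intro: order_trans)
      also have "\<dots> = e" using d Q by (simp add: d_def field_simps)
      finally show ?case .
    qed
  qed
  show "((\<lambda>L. LINT p|lborel. cmod (cnj (s1 L p) * s2 L p - cnj (g1 p) * g2 p)) \<longlongrightarrow> 0) at_top"
  proof (rule tendstoI)
    fix e :: real assume "e > 0"
    then have "e / 2 > 0" by simp
    from main[OF this] show "\<forall>\<^sub>F L in at_top. dist (LINT p|lborel. cmod (cnj (s1 L p) * s2 L p - cnj (g1 p) * g2 p)) 0 < e"
      by eventually_elim (use \<open>e > 0\<close> in \<open>simp add: Bochner_Integration.integral_nonneg\<close>)
  qed
qed

section \<open>Passage to the limit for each partition\<close>

lemma free_idx_insert:
  assumes c: "c \<in> reps n"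
  shows "free_idx n c = insert n ({..<n} - c ` {..<n})" "n \<notin> {..<n} - c ` {..<n}"
  using reps_props(1)[OF c] by (auto simp: free_idx_def)

lemma ext_mom_measurable:
  assumes c: "c \<in> reps n" and j: "j \<le> n"
  shows "(\<lambda>x. ext_mom n c x j) \<in> borel_measurable (PiM (free_idx n c) (\<lambda>_. lborel :: (real^'d) measure))"
proof -
  have comp: "(\<lambda>x. x i) \<in> borel_measurable (PiM (free_idx n c) (\<lambda>_. lborel :: (real^'d) measure))" if "i \<in> free_idx n c" for i
    using measurable_component_singleton[OF that, of "\<lambda>_. lborel :: (real^'d) measure"] by (simp add: measurable_lborel1)
  show ?thesis
  proof (cases "j \<in> c ` {..<n}")
    case True
    have "(\<lambda>x. - (\<Sum>i | i < n \<and> i \<notin> c ` {..<n} \<and> c i = j. x i)) \<in> borel_measurable (PiM (free_idx n c) (\<lambda>_. lborel :: (real^'d) measure))"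
      by (intro borel_measurable_uminus borel_measurable_sum comp) (simp add: free_idx_def)
    then show ?thesis using True by (simp add: ext_mom_def)
  next
    case False
    then have "j \<in> free_idx n c" using j by (simp add: free_idx_def)
    from comp[OF this] False show ?thesis by (simp add: ext_mom_def)
  qed
qed

lemma continuous_nu: "continuous_on S nu" unfolding nu_def by (intro continuous_intros) simp

lemma nu_borel [measurable]: "nu \<in> borel_measurable borel"
  by (rule borel_measurable_continuous_onI[OF continuous_nu])

lemma resprodR_measurable:
  assumes "p \<in> borel_measurable M" "\<And>j. j < n \<Longrightarrow> (\<lambda>x. u x j) \<in> borel_measurable M"
  shows "(\<lambda>x. resprodR z n (p x) (u x)) \<in> borel_measurable M"
  unfolding resprodR_def
proof (intro borel_measurable_prod borel_measurable_divide borel_measurable_const borel_measurable_diff)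
  fix j
  have "(\<lambda>x. p x - (\<Sum>i = j..<n. u x i)) \<in> borel_measurable M"
    by (intro borel_measurable_diff borel_measurable_sum assms) auto
  from measurable_compose[OF this nu_borel]
  show "(\<lambda>x. complex_of_real (nu (p x - (\<Sum>i = j..<n. u x i)))) \<in> borel_measurable M" by simp
qed

text \<open>The infinite-volume contribution of the partition \<open>c\<close>, without its moments;
  \<open>b\<close> is the transform of the potential and \<open>g1\<close>, \<open>g2\<close> are
  those of the wave functions.\<close>

definition T_term :: "(real^'d \<Rightarrow> complex) \<Rightarrow> (real^'d \<Rightarrow> complex) \<Rightarrow> (real^'d \<Rightarrow> complex) \<Rightarrow> nat \<Rightarrow> complex \<Rightarrow> (nat \<Rightarrow> nat) \<Rightarrow> complex" where
  "T_term b g1 g2 n z c = (LINT x|PiM (free_idx n c) (\<lambda>_. lborel). cnj (g1 (x n)) * g2 (x n) *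
     ((\<Prod>j<n. b (ext_mom n c x j)) * resprodR z n (x n) (ext_mom n c x)))"

lemma decay_le_1: "decay x \<le> 1"
  unfolding decay_def by (rule prod_le_1) (auto intro: inverse_le_1_iff[THEN iffD2] simp: field_simps add_pos_nonneg)

lemma rnd_dual_pt: "L > 0 \<Longrightarrow> rnd L (dual_pt L k) = k"
  by (simp add: rnd_def dual_pt_def vec_eq_iff)

lemma tendsto_ext_mom:
  fixes u :: "real \<Rightarrow> nat \<Rightarrow> 'a::real_normed_vector"
  assumes "\<And>i. ((\<lambda>L. u L i) \<longlongrightarrow> x i) F"
  shows "((\<lambda>L. ext_mom n c (u L) j) \<longlongrightarrow> ext_mom n c x j) F"
  unfolding ext_mom_def by (auto intro!: tendsto_intros assms)

lemma tendsto_resprodR: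
  assumes z: "Im z \<noteq> 0" and p: "(p \<longlongrightarrow> p0) F" and u: "\<And>j. ((\<lambda>L. u L j) \<longlongrightarrow> u0 j) F"
  shows "((\<lambda>L. resprodR z n (p L) (u L)) \<longlongrightarrow> resprodR z n p0 u0) F"
proof -
  have nu: "((\<lambda>L. nu (f L)) \<longlongrightarrow> nu l) F" if "(f \<longlongrightarrow> l) F" for f and l :: "real^'b"
    unfolding nu_def by (intro tendsto_intros that) simp
  have ne: "of_real t - z \<noteq> 0" for t :: real
  proof
    assume "of_real t - z = 0"
    then have "Im (of_real t - z) = 0" by simp
    then show False using z by simp
  qed
  show ?thesis unfolding resprodR_def
    by (intro tendsto_intros nu p u ne)
qed

lemma bL_bounded:
  fixes B :: "real^'d \<Rightarrow> real"
  assumes L: "L > 0" and C: "\<And>x. cmod (bL L B (rnd L x)) \<le> C * decay x" and C0: "C \<ge> 0"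
  shows "cmod (bL L B k) \<le> C"
proof -
  have "cmod (bL L B k) \<le> C * decay (dual_pt L k :: real^'d)" using C[of "dual_pt L k"] by (simp add: rnd_dual_pt[OF L])
  also have "\<dots> \<le> C * 1" by (intro mult_left_mono decay_le_1 C0)
  finally show ?thesis by simp
qed

text \<open>Everything except the wave functions is gathered here: these factors converge pointwise,
  whereas the samples of the wave functions are controlled in \<open>L2\<close>.\<close>

definition lat_kernel :: "real \<Rightarrow> (real^'d \<Rightarrow> real) \<Rightarrow> nat \<Rightarrow> complex \<Rightarrow> (nat \<Rightarrow> nat) \<Rightarrow> (nat \<Rightarrow> real^'d) \<Rightarrow> complex" where
  "lat_kernel L B n z c x = (\<Prod>j<n. bL L B (ext_mom n c (\<lambda>j. rnd L (x j)) j)) *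
     resprodR z n (dual_pt L (rnd L (x n))) (ext_mom n c (\<lambda>j. dual_pt L (rnd L (x j))))"

definition lim_kernel :: "(real^'d \<Rightarrow> complex) \<Rightarrow> nat \<Rightarrow> complex \<Rightarrow> (nat \<Rightarrow> nat) \<Rightarrow> (nat \<Rightarrow> real^'d) \<Rightarrow> complex" where
  "lim_kernel b n z c x = (\<Prod>j<n. b (ext_mom n c x j)) * resprodR z n (x n) (ext_mom n c x)"

lemma lat_kernel_measurable:
  assumes c: "c \<in> reps n"
  shows "lat_kernel L B n z c \<in> borel_measurable (PiM (free_idx n c) (\<lambda>_. lborel))"
proof -
  let ?D = "free_idx n c"
  let ?H = "\<lambda>k. (\<Prod>j<n. bL L B (ext_mom n c k j)) * resprodR z n (dual_pt L (k n)) (ext_mom n c (\<lambda>j. dual_pt L (k j)))"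
  have nD: "n \<in> ?D" using free_idx_insert[OF c] by simp
  have "lat_kernel L B n z c x = ?H (\<lambda>j\<in>?D. rnd L (x j))" for x
  proof -
    have "(\<Prod>j<n. bL L B (ext_mom n c (\<lambda>j. rnd L (x j)) j)) = (\<Prod>j<n. bL L B (ext_mom n c (\<lambda>j\<in>?D. rnd L (x j)) j))"
      by (intro prod.cong refl arg_cong[where f = "bL L B"] ext_mom_cong) auto
    moreover have "resprodR z n (dual_pt L (rnd L (x n))) (ext_mom n c (\<lambda>j. dual_pt L (rnd L (x j))))
       = resprodR z n (dual_pt L (rnd L (x n))) (ext_mom n c (\<lambda>j. dual_pt L ((\<lambda>j\<in>?D. rnd L (x j)) j)))"
      by (intro resprodR_cong ext_mom_cong) auto
    ultimately show ?thesis using nD by (simp add: lat_kernel_def)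
  qed
  then have "lat_kernel L B n z c = (\<lambda>x. ?H (\<lambda>j\<in>?D. rnd L (x j)))" by (rule ext)
  also have "\<dots> \<in> borel_measurable (PiM ?D (\<lambda>_. lborel))"
    by (rule measurable_PiM_rnd) (simp add: free_idx_def)
  finally show ?thesis .
qed

lemma lim_kernel_measurable:
  assumes c: "c \<in> reps n" and b: "b \<in> borel_measurable borel"
  shows "lim_kernel b n z c \<in> borel_measurable (PiM (free_idx n c) (\<lambda>_. lborel))"
proof -
  have n: "(\<lambda>x. x n) \<in> borel_measurable (PiM (free_idx n c) (\<lambda>_. lborel :: (real^'a) measure))"
    using measurable_component_singleton[of n "free_idx n c" "\<lambda>_. lborel :: (real^'a) measure"] free_idx_insert[OF c] by (simp add: measurable_lborel1)
  show ?thesis unfolding lim_kernel_def[abs_def]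
    by (intro borel_measurable_times borel_measurable_prod resprodR_measurable n ext_mom_measurable[OF c] measurable_compose[OF _ b]) auto
qed

text \<open>Coefficients at dependent transfers are bounded by \<open>C\<close>, those at
  integration variables supply the integrable factor \<open>decay\<close>, and the resolvents are
  bounded off the real axis. The bound leaves the outgoing momentum \<open>x n\<close> to the wave
  functions.\<close>

lemma lat_kernel_bound:
  fixes B :: "real^'d \<Rightarrow> real"
  assumes c: "c \<in> reps n" and L: "L > 0" and z: "Im z \<noteq> 0" and C: "\<And>x. cmod (bL L B (rnd L x)) \<le> C * decay x" and C0: "C \<ge> 0"
  shows "cmod (lat_kernel L B n z c x) \<le> C ^ n * (1 / \<bar>Im z\<bar>) ^ (n + 1) * (\<Prod>j\<in>{..<n} - c ` {..<n}. decay (x j))"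
proof -
  let ?R = "c ` {..<n}"
  have "(\<Prod>j<n. cmod (bL L B (ext_mom n c (\<lambda>j. rnd L (x j)) j))) \<le> (\<Prod>j<n. C * (if j \<in> ?R then 1 else decay (x j)))"
  proof (intro prod_mono conjI norm_ge_zero)
    fix j
    show "cmod (bL L B (ext_mom n c (\<lambda>j. rnd L (x j)) j)) \<le> C * (if j \<in> ?R then 1 else decay (x j))"
    proof (cases "j \<in> ?R")
      case True then show ?thesis using bL_bounded[OF L C C0] by simp
    next
      case False then show ?thesis using C by (simp add: ext_mom_def)
    qed
  qed
  also have "\<dots> = C ^ n * (\<Prod>j\<in>{..<n} - ?R. decay (x j))"
  proof -
    have "(\<Prod>j<n. if j \<in> ?R then 1 else decay (x j)) = (\<Prod>j\<in>{..<n} - ?R. decay (x j))"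
      by (rule prod.mono_neutral_cong_right) auto
    then show ?thesis by (simp add: prod.distrib)
  qed
  finally have 1: "(\<Prod>j<n. cmod (bL L B (ext_mom n c (\<lambda>j. rnd L (x j)) j))) \<le> \<dots>" .
  have "cmod (lat_kernel L B n z c x) \<le> (C ^ n * (\<Prod>j\<in>{..<n} - ?R. decay (x j))) * (1 / \<bar>Im z\<bar>) ^ (n + 1)"
    unfolding lat_kernel_def norm_mult prod_norm[symmetric]
    by (intro mult_mono 1 resprodR_bound z mult_nonneg_nonneg prod_nonneg zero_le_power C0) (auto intro: less_imp_le[OF decay_pos])
  then show ?thesis by (simp add: mult_ac)
qed

lemma lat_kernel_tendsto:
  fixes B :: "real^'d \<Rightarrow> real"
  assumes B: "integrable lborel B" and z: "Im z \<noteq> 0"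
  shows "((\<lambda>L. lat_kernel L B n z c x) \<longlongrightarrow> lim_kernel (ft (\<lambda>x. of_real (B x))) n z c x) at_top"
  unfolding lat_kernel_def lim_kernel_def
proof (intro tendsto_mult tendsto_prod tendsto_resprodR z dual_pt_rnd_tendsto)
  show "((\<lambda>L. ext_mom n c (\<lambda>j. dual_pt L (rnd L (x j))) j) \<longlongrightarrow> ext_mom n c x j) at_top" for j
    by (rule tendsto_ext_mom) (rule dual_pt_rnd_tendsto)
  then show "((\<lambda>L. bL L B (ext_mom n c (\<lambda>j. rnd L (x j)) j)) \<longlongrightarrow> ft (\<lambda>x. complex_of_real (B x)) (ext_mom n c x j)) at_top" for j
    by (intro bL_tendsto_ft B) (simp add: dual_pt_ext_mom)
qed

text \<open>Two modes of convergence are combined. The product of the wave functions converges in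
  \<open>L1\<close> of the outgoing momentum, against a kernel bounded uniformly in that variable
  (\<open>t1\<close>). With the limit product held fixed, the kernel converges pointwise under a
  fixed majorant (\<open>t2\<close>).\<close>

lemma T_L_limit:
  fixes B :: "real^'d \<Rightarrow> real"
  assumes z: "Im z \<noteq> 0" and B: "schwartz B"
    and hyp: "(\<exists>R. \<forall>x. R < norm x \<longrightarrow> B x = 0) \<or> (\<forall>j x. B (\<chi> i. if i = j then - (x $ i) else x $ i) = B x)"
    and mu: "prob_space \<mu>" and mom: "\<And>k::nat. integrable \<mu> (\<lambda>v. v ^ k)"
    and psi: "in_L2 \<psi>1" "in_L2 \<psi>2" and ft1: "is_ft_L2 \<psi>1 g01" "is_ft_L2 \<psi>2 g02"
    and g [measurable]: "g1 \<in> borel_measurable borel" "g2 \<in> borel_measurable borel"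
    and ae: "AE x in lborel. g01 x = g1 x" "AE x in lborel. g02 x = g2 x"
  shows "((\<lambda>L. T_L \<mu> B n L z \<psi>1 \<psi>2) \<longlongrightarrow> (\<Sum>c\<in>reps n. mom_weight \<mu> n c * T_term (ft (\<lambda>x. of_real (B x))) g1 g2 n z c)) at_top"
proof -
  have Bc: "continuous_on UNIV B" and Bi: "integrable lborel B"
    using schwartz_pderivs(2,4)[OF B, of "[]"] by auto
  have Bm: "B \<in> borel_measurable borel" using Bc by (rule borel_measurable_continuous_onI)
  obtain CB where CB: "\<And>x. \<bar>B x\<bar> \<le> CB"
  proof -
    obtain C where C: "C \<ge> 0" "\<And>x. \<bar>B x\<bar> \<le> C * decay x" using schwartz_pderivs(3)[OF B, of "[]"] by auto
    have "\<bar>B x\<bar> \<le> C" for x using C(2)[of x] mult_left_mono[OF decay_le_1[of x] C(1)] by simp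
    then show ?thesis by (rule that)
  qed
  obtain C L0 where C: "C \<ge> 0" "L0 \<ge> 1" "\<And>L x. L \<ge> L0 \<Longrightarrow> cmod (bL L B (rnd L x)) \<le> C * decay x"
    using bL_decay[OF B hyp] by blast
  let ?b = "ft (\<lambda>x. complex_of_real (B x))"
  have Bil: "integrable lebesgue (\<lambda>x. complex_of_real (B x))"
    using Bi Bm by (subst integrable_completion) auto
  have bm: "?b \<in> borel_measurable borel" by (rule ft_borel[OF Bil])
  define s where "s \<psi> L p = fcoef L \<psi> (rnd L p)" for \<psi> L and p :: "real^'d"
  have sm: "s \<psi> L \<in> borel_measurable borel" for \<psi> L
  proof -
    have "(\<lambda>p. fcoef L \<psi> (rnd L p)) \<in> borel_measurable lborel" by (rule measurable_compose[OF rnd_measurable]) simp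
    then show ?thesis by (simp add: s_def[abs_def])
  qed
  have g0: "in_L2 g01" "in_L2 g02" using ft1 by (auto simp: is_ft_L2_def)
  have gs: "sqn g1 < \<infinity>" "sqn g2 < \<infinity>"
    using sqn_cong_AE[OF ae(1)] sqn_cong_AE[OF ae(2)] sqn_of_in_L2[OF g0(1)] sqn_of_in_L2[OF g0(2)]
    by (metis ennreal_less_top infinity_ennreal_def)+
  define K where "K = max (LINT x|lebesgue. (cmod (\<psi>1 x))\<^sup>2) (LINT x|lebesgue. (cmod (\<psi>2 x))\<^sup>2)"
  have K0: "K \<ge> 0" by (auto simp: K_def le_max_iff_disj)
  have sK: "sqn (s \<psi>1 L) \<le> ennreal K" "sqn (s \<psi>2 L) \<le> ennreal K" if "L > 0" for L
  proof -
    have "sqn (s \<psi>1 L) \<le> ennreal (LINT x|lebesgue. (cmod (\<psi>1 x))\<^sup>2)" "sqn (s \<psi>2 L) \<le> ennreal (LINT x|lebesgue. (cmod (\<psi>2 x))\<^sup>2)"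
      using sqn_fcoef_rnd_le[OF that psi(1)] sqn_fcoef_rnd_le[OF that psi(2)]
      unfolding sqn_of_in_L2[OF psi(1)] sqn_of_in_L2[OF psi(2)] s_def[abs_def] by simp_all
    from order_trans[OF this(1) ennreal_leI] order_trans[OF this(2) ennreal_leI]
    show "sqn (s \<psi>1 L) \<le> ennreal K" "sqn (s \<psi>2 L) \<le> ennreal K" unfolding K_def by auto
  qed
  have sl: "\<forall>\<^sub>F L in at_top. sqn (\<lambda>p. s \<psi>1 L p - g1 p) \<le> ennreal e" "\<forall>\<^sub>F L in at_top. sqn (\<lambda>p. s \<psi>2 L p - g2 p) \<le> ennreal e" if "e > 0" for e
    unfolding s_def using fcoef_rnd_L2_limit[OF psi(1) ft1(1) g(1) ae(1) that] fcoef_rnd_L2_limit[OF psi(2) ft1(2) g(2) ae(2) that] by auto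
  let ?a = "\<lambda>L p. cnj (s \<psi>1 L p) * s \<psi>2 L p" and ?g = "\<lambda>p. cnj (g1 p) * g2 p"
  have PL: "integrable lborel ?g" "\<And>L. L > 0 \<Longrightarrow> integrable lborel (?a L)" "((\<lambda>L. LINT p|lborel. cmod (?a L p - ?g p)) \<longlongrightarrow> 0) at_top"
    by (rule product_L1_limit[where ?s1.0 = "s \<psi>1" and ?s2.0 = "s \<psi>2" and K = K and ?g1.0 = g1 and ?g2.0 = g2]; (rule sm g gs K0 | erule sK sl | assumption))+
  have lim: "((\<lambda>L. LINT x|PiM (free_idx n c) (\<lambda>_. lborel). ?a L (x n) * lat_kernel L B n z c x) \<longlongrightarrow> T_term ?b g1 g2 n z c) at_top"
    if c: "c \<in> reps n" for c
  proof -
    interpret product_sigma_finite "\<lambda>_::nat. lborel :: (real^'d) measure" ..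
    let ?E = "{..<n} - c ` {..<n}" and ?D = "free_idx n c"
    note D = free_idx_insert[OF c]
    have fE: "finite ?E" and fD: "finite ?D" by (auto simp: free_idx_def)
    have nD: "n \<in> ?D" using D by simp
    let ?M = "PiM ?D (\<lambda>_. lborel :: (real^'d) measure)"
    define Z where "Z = C ^ n * (1 / \<bar>Im z\<bar>) ^ (n + 1)"
    have kb: "cmod (lat_kernel L B n z c x) \<le> Z * (\<Prod>j\<in>?E. decay (x j))" if "L \<ge> L0" for L x
      unfolding Z_def using C that by (intro lat_kernel_bound c z) auto
    have proj: "(\<lambda>x. f (x n)) \<in> borel_measurable ?M" if "f \<in> borel_measurable borel" for f :: "real^'d \<Rightarrow> complex"
      using measurable_component_singleton[OF nD, of "\<lambda>_. lborel :: (real^'d) measure"] that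
      by (intro measurable_compose[of "\<lambda>x. x n" ?M borel f]) (simp_all add: measurable_lborel1)
    have dom: "integrable ?M (\<lambda>x. f (x n) * (\<Prod>j\<in>?E. decay (x j)))"
      and domI: "(LINT x|?M. f (x n) * (\<Prod>j\<in>?E. decay (x j))) = (LINT p|lborel. f p) * (\<Prod>j\<in>?E. LINT p|lborel. decay (p :: real^'d))"
      if "integrable lborel f" for f :: "real^'d \<Rightarrow> real"
    proof -
      define F where "F j = (if j = n then f else decay)" for j
      have Fi: "integrable lborel (F j)" for j using that by (simp add: F_def integrable_decay)
      have e: "(\<Prod>j\<in>?D. F j (x j)) = f (x n) * (\<Prod>j\<in>?E. decay (x j))" for x
      proof -
        have "(\<Prod>j\<in>?E. F j (x j)) = (\<Prod>j\<in>?E. decay (x j))" by (intro prod.cong refl) (auto simp: F_def)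
        then show ?thesis unfolding D(1) prod.insert[OF fE D(2)] by (simp add: F_def)
      qed
      show "integrable ?M (\<lambda>x. f (x n) * (\<Prod>j\<in>?E. decay (x j)))"
        unfolding e[symmetric] by (rule product_integrable_prod[OF fD Fi])
      have "(LINT x|?M. f (x n) * (\<Prod>j\<in>?E. decay (x j))) = (\<Prod>j\<in>?D. LINT p|lborel. F j p)"
        unfolding e[symmetric] by (rule product_integral_prod[OF fD Fi])
      also have "\<dots> = (LINT p|lborel. f p) * (\<Prod>j\<in>?E. LINT p|lborel. decay (p :: real^'d))"
      proof -
        have "(\<Prod>j\<in>?E. LINT p|lborel. F j p) = (\<Prod>j\<in>?E. LINT p|lborel. decay (p :: real^'d))" by (intro prod.cong refl) (auto simp: F_def)
        then show ?thesis unfolding D(1) prod.insert[OF fE D(2)] by (simp add: F_def)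
      qed
      finally show "(LINT x|?M. f (x n) * (\<Prod>j\<in>?E. decay (x j))) = \<dots>" .
    qed
    have dom_int: "integrable ?M (\<lambda>x. f (x n) * lat_kernel L B n z c x)"
      and dom_le: "cmod (LINT x|?M. f (x n) * lat_kernel L B n z c x) \<le> (LINT p|lborel. cmod (f p)) * (\<Prod>j\<in>?E. LINT p|lborel. decay (p :: real^'d)) * Z"
      if L: "L \<ge> L0" and f: "integrable lborel f" for f :: "real^'d \<Rightarrow> complex" and L
    proof -
      have fm: "f \<in> borel_measurable borel" using f by auto
      have fn: "integrable lborel (\<lambda>p. cmod (f p))" using f by auto
      have le: "cmod (f (x n) * lat_kernel L B n z c x) \<le> cmod (f (x n)) * (\<Prod>j\<in>?E. decay (x j)) * Z" for x
        unfolding norm_mult using mult_left_mono[OF kb[OF L, of x] norm_ge_zero[of "f (x n)"]] by (simp add: mult_ac)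
      have di: "integrable ?M (\<lambda>x. cmod (f (x n)) * (\<Prod>j\<in>?E. decay (x j)) * Z)" using dom[OF fn] by auto
      show 1: "integrable ?M (\<lambda>x. f (x n) * lat_kernel L B n z c x)"
      proof (rule Bochner_Integration.integrable_bound[OF di])
        show "(\<lambda>x. f (x n) * lat_kernel L B n z c x) \<in> borel_measurable ?M"
          by (intro borel_measurable_times proj fm lat_kernel_measurable c)
        show "AE x in ?M. cmod (f (x n) * lat_kernel L B n z c x) \<le> norm (cmod (f (x n)) * (\<Prod>j\<in>?E. decay (x j)) * Z)"
          by (rule AE_I2, rule order_trans[OF le]) simp
      qed
      have "cmod (LINT x|?M. f (x n) * lat_kernel L B n z c x) \<le> (LINT x|?M. cmod (f (x n) * lat_kernel L B n z c x))"
        by (rule integral_norm_bound)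
      also have "\<dots> \<le> (LINT x|?M. cmod (f (x n)) * (\<Prod>j\<in>?E. decay (x j)) * Z)"
        by (rule integral_mono[OF integrable_norm[OF 1] di le])
      also have "\<dots> = (LINT p|lborel. cmod (f p)) * (\<Prod>j\<in>?E. LINT p|lborel. decay (p :: real^'d)) * Z"
        using domI[OF fn] by simp
      finally show "cmod (LINT x|?M. f (x n) * lat_kernel L B n z c x) \<le> \<dots>" .
    qed
    have gi: "integrable lborel ?g" by (rule PL(1))
    have gm: "?g \<in> borel_measurable borel" using gi by auto
    have t1: "((\<lambda>L. LINT x|?M. (?a L (x n) - ?g (x n)) * lat_kernel L B n z c x) \<longlongrightarrow> 0) at_top"
    proof (rule Lim_null_comparison)
      show "\<forall>\<^sub>F L in at_top. norm (LINT x|?M. (?a L (x n) - ?g (x n)) * lat_kernel L B n z c x)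
        \<le> (LINT p|lborel. cmod (?a L p - ?g p)) * (\<Prod>j\<in>?E. LINT p|lborel. decay (p :: real^'d)) * Z"
        using eventually_ge_at_top[of L0]
      proof eventually_elim
        case (elim L)
        have "L > 0" using elim C(2) by simp
        then show ?case using dom_le[OF elim Bochner_Integration.integrable_diff[OF PL(2) gi]] by simp
      qed
      show "((\<lambda>L. (LINT p|lborel. cmod (?a L p - ?g p)) * (\<Prod>j\<in>?E. LINT p|lborel. decay (p :: real^'d)) * Z) \<longlongrightarrow> 0) at_top"
        by (intro tendsto_mult_left_zero PL(3))
    qed
    have t2: "((\<lambda>L. LINT x|?M. ?g (x n) * lat_kernel L B n z c x) \<longlongrightarrow> T_term ?b g1 g2 n z c) at_top"
      unfolding T_term_def lim_kernel_def[symmetric]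
    proof (rule integral_dominated_convergence_at_top[where w = "\<lambda>x. cmod (?g (x n)) * (\<Prod>j\<in>?E. decay (x j)) * Z"])
      show "(\<lambda>x. ?g (x n) * lim_kernel ?b n z c x) \<in> borel_measurable ?M"
        by (intro borel_measurable_times[OF proj[OF gm]] lim_kernel_measurable c bm)
      show "(\<lambda>x. ?g (x n) * lat_kernel L B n z c x) \<in> borel_measurable ?M" for L
        by (intro borel_measurable_times[OF proj[OF gm]] lat_kernel_measurable c)
      show "integrable ?M (\<lambda>x. cmod (?g (x n)) * (\<Prod>j\<in>?E. decay (x j)) * Z)" 
        using dom[OF integrable_norm[OF gi]] by auto
      show "\<forall>\<^sub>F L in at_top. AE x in ?M. norm (?g (x n) * lat_kernel L B n z c x) \<le> cmod (?g (x n)) * (\<Prod>j\<in>?E. decay (x j)) * Z"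
        using eventually_ge_at_top[of L0]
      proof eventually_elim
        case (elim L)
        show ?case
        proof (rule AE_I2)
          fix x
          show "norm (?g (x n) * lat_kernel L B n z c x) \<le> cmod (?g (x n)) * (\<Prod>j\<in>?E. decay (x j)) * Z"
            unfolding norm_mult[of "?g (x n)"] using mult_left_mono[OF kb[OF elim, of x] norm_ge_zero[of "?g (x n)"]] by (simp add: mult_ac)
        qed
      qed
      show "AE x in ?M. ((\<lambda>L. ?g (x n) * lat_kernel L B n z c x) \<longlongrightarrow> ?g (x n) * lim_kernel ?b n z c x) at_top"
        by (intro AE_I2 tendsto_mult tendsto_const lat_kernel_tendsto Bi z)
    qed
    have "\<forall>\<^sub>F L in at_top. (LINT x|?M. (?a L (x n) - ?g (x n)) * lat_kernel L B n z c x) + (LINT x|?M. ?g (x n) * lat_kernel L B n z c x)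
       = (LINT x|?M. ?a L (x n) * lat_kernel L B n z c x)"
      using eventually_ge_at_top[of L0]
    proof eventually_elim
      case (elim L)
      have L: "L > 0" using elim C(2) by simp
      have "(LINT x|?M. (?a L (x n) - ?g (x n)) * lat_kernel L B n z c x) = (LINT x|?M. ?a L (x n) * lat_kernel L B n z c x) - (LINT x|?M. ?g (x n) * lat_kernel L B n z c x)"
        unfolding left_diff_distrib by (rule Bochner_Integration.integral_diff[OF dom_int[OF elim PL(2)[OF L]] dom_int[OF elim gi]])
      then show ?case by simp
    qed
    with tendsto_add[OF t1 t2] show ?thesis by (simp add: tendsto_cong)
  qed
  have "((\<lambda>L. \<Sum>c\<in>reps n. mom_weight \<mu> n c * (LINT x|PiM (free_idx n c) (\<lambda>_. lborel). ?a L (x n) * lat_kernel L B n z c x))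
     \<longlongrightarrow> (\<Sum>c\<in>reps n. mom_weight \<mu> n c * T_term ?b g1 g2 n z c)) at_top"
    by (intro tendsto_sum tendsto_mult tendsto_const lim)
  moreover have "\<forall>\<^sub>F L in at_top. (\<Sum>c\<in>reps n. mom_weight \<mu> n c * (LINT x|PiM (free_idx n c) (\<lambda>_. lborel). ?a L (x n) * lat_kernel L B n z c x)) = T_L \<mu> B n L z \<psi>1 \<psi>2"
    using eventually_ge_at_top[of L0]
  proof eventually_elim
    case (elim L)
    have L: "L > 0" using elim C(2) by simp
    show ?case unfolding T_L_integral[OF L z Bm CB integrable_bL[OF L C(3)[OF elim]] psi mu mom] lat_kernel_def s_def ..
  qed
  ultimately show ?thesis by (rule Lim_transform_eventually)
qed

section \<open>Dilation analyticity\<close>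

lemma eventually_at_within_mem: "\<forall>\<^sub>F w in at z within U. w \<in> U \<and> w \<noteq> z"
  by (simp add: eventually_at_filter)

text \<open>Differentiating one slot at a time: the increment of the new slot splits into its derivative plus
  an error that the bound of \<open>\<Phi>\<close> absorbs.\<close>
lemma multilinear_holomorphic:
  fixes \<Phi> :: "('i \<Rightarrow> 'x \<Rightarrow> complex) \<Rightarrow> complex" and A :: "'i \<Rightarrow> complex \<Rightarrow> 'x \<Rightarrow> complex"
  assumes I: "finite I"
    and memc: "\<And>i f g c. i \<in> I \<Longrightarrow> mem i f \<Longrightarrow> mem i g \<Longrightarrow> mem i (\<lambda>x. f x + c * g x)"
    and nrm0: "\<And>i f. i \<in> I \<Longrightarrow> mem i f \<Longrightarrow> nrm i f \<ge> 0"
    and nrmc: "\<And>i f g c. i \<in> I \<Longrightarrow> mem i f \<Longrightarrow> mem i g \<Longrightarrow> nrm i (\<lambda>x. f x + c * g x) \<le> 2 * (nrm i f + cmod c * nrm i g)"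
    and lin: "\<And>i F f g c. i \<in> I \<Longrightarrow> (\<And>j. j \<in> I \<Longrightarrow> mem j (F j)) \<Longrightarrow> mem i f \<Longrightarrow> mem i g \<Longrightarrow>
       \<Phi> (F(i := (\<lambda>x. f x + c * g x))) = \<Phi> (F(i := f)) + c * \<Phi> (F(i := g))"
    and bound: "\<And>F. (\<And>j. j \<in> I \<Longrightarrow> mem j (F j)) \<Longrightarrow> cmod (\<Phi> F) \<le> C * (\<Prod>j\<in>I. nrm j (F j))"
    and dep: "\<And>F F'. (\<And>j. j \<in> I \<Longrightarrow> F j = F' j) \<Longrightarrow> \<Phi> F = \<Phi> F'"
    and ana: "\<And>i. i \<in> I \<Longrightarrow> analytic_into (mem i) (nrm i) U (A i)"
  shows "(\<lambda>z. \<Phi> (\<lambda>i. A i z)) holomorphic_on U"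
proof -
  have memA: "mem i (A i z)" if "i \<in> I" "z \<in> U" for i z using ana[OF that(1)] that(2) by (simp add: analytic_into_def)
  have der: "\<exists>G. mem i G \<and> ((\<lambda>w. nrm i (\<lambda>x. (A i w x - A i z x) / (w - z) - G x)) \<longlongrightarrow> 0) (at z within U)" if "i \<in> I" "z \<in> U" for i z
    using ana[OF that(1)] that(2) by (simp add: analytic_into_def)
  have memE: "mem i (\<lambda>x. (A i w x - A i z x) / (w - z) - G x)" if "i \<in> I" "z \<in> U" "w \<in> U" "mem i G" for i z w G
  proof -
    have "mem i (\<lambda>x. A i w x + (-1) * A i w x)" by (rule memc[OF that(1) memA memA]) (use that in auto)
    from memc[OF that(1) this that(4), of "-1"] have n: "mem i (\<lambda>x. - G x)" by simp
    have "mem i (\<lambda>x. A i w x + (-1) * A i z x)" by (rule memc[OF that(1) memA memA]) (use that in auto)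
    from memc[OF that(1) n this, of "1 / (w - z)"] show ?thesis by (simp add: diff_divide_distrib)
  qed
  \<comment> \<open>The slots treated earlier move with \<open>w\<close> while the error of the new
    slot tends to zero, so their norms have to stay bounded near \<open>z\<close>.\<close>
  have loc: "\<exists>M>0. \<forall>\<^sub>F w in at z within U. nrm i (A i w) \<le> M" if i: "i \<in> I" and z: "z \<in> U" for i z
  proof -
    obtain G where G: "mem i G" "((\<lambda>w. nrm i (\<lambda>x. (A i w x - A i z x) / (w - z) - G x)) \<longlongrightarrow> 0) (at z within U)"
      using der[OF i z] by blast
    define M where "M = 2 * (nrm i (A i z) + 2 * (nrm i G + 1)) + 1"
    have ev: "\<forall>\<^sub>F w in at z within U. nrm i (\<lambda>x. (A i w x - A i z x) / (w - z) - G x) < 1"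
      using order_tendstoD(2)[OF G(2), of 1] by simp
    have "\<forall>\<^sub>F w in at z within U. nrm i (A i w) \<le> M"
      using ev eventually_at_ball[OF zero_less_one, of z U] eventually_at_within_mem
    proof eventually_elim
      case (elim w)
      then have w: "w \<in> U" "w \<noteq> z" "cmod (w - z) \<le> 1" by (auto simp: dist_norm norm_minus_commute)
      let ?E = "\<lambda>x. (A i w x - A i z x) / (w - z) - G x"
      have mE: "mem i ?E" by (rule memE[OF i z w(1) G(1)])
      have mGE: "mem i (\<lambda>x. G x + 1 * ?E x)" by (rule memc[OF i G(1) mE])
      have "A i w = (\<lambda>x. A i z x + (w - z) * (G x + 1 * ?E x))" using w(2) by (auto simp: fun_eq_iff field_simps)
      then have "nrm i (A i w) \<le> 2 * (nrm i (A i z) + cmod (w - z) * nrm i (\<lambda>x. G x + 1 * ?E x))"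
        using nrmc[OF i memA[OF i z] mGE, of "w - z"] by simp
      also have "\<dots> \<le> 2 * (nrm i (A i z) + 1 * nrm i (\<lambda>x. G x + 1 * ?E x))"
        using w(3) nrm0[OF i mGE] by (intro mult_left_mono add_left_mono mult_right_mono) auto
      also have "\<dots> \<le> 2 * (nrm i (A i z) + 1 * (2 * (nrm i G + cmod 1 * nrm i ?E)))"
        by (intro mult_left_mono add_left_mono nrmc[OF i G(1) mE]) auto
      also have "\<dots> \<le> M" using elim(1) by (simp add: M_def)
      finally show ?case .
    qed
    moreover have "M > 0" using nrm0[OF i memA[OF i z]] nrm0[OF i G(1)] by (simp add: M_def)
    ultimately show ?thesis by blast
  qed
  have step: "(\<lambda>z. \<Phi> (\<lambda>i. if i \<in> J then A i z else H i)) field_differentiable (at z0 within U)"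
    if "J \<subseteq> I" "\<And>i. i \<in> I - J \<Longrightarrow> mem i (H i)" "z0 \<in> U" for J H z0
    using finite_subset[OF that(1) I] that
  proof (induction J arbitrary: H rule: finite_induct)
    case empty
    then show ?case by (simp add: field_differentiable_const)
  next
    case (insert a J)
    have a: "a \<in> I" "a \<notin> J" and J: "J \<subseteq> I" and z0: "z0 \<in> U" using insert by auto
    define \<Psi> where "\<Psi> z f = \<Phi> (\<lambda>i. if i \<in> J then A i z else (H(a := f)) i)" for z f
    have eq: "\<Phi> (\<lambda>i. if i \<in> insert a J then A i z else H i) = \<Psi> z (A a z)" for z
      unfolding \<Psi>_def by (rule dep) auto
    obtain G where G: "mem a G" "((\<lambda>w. nrm a (\<lambda>x. (A a w x - A a z0 x) / (w - z0) - G x)) \<longlongrightarrow> 0) (at z0 within U)"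
      using der[OF a(1) z0] by blast
    have fd: "(\<lambda>z. \<Psi> z f) field_differentiable (at z0 within U)" if "mem a f" for f
      unfolding \<Psi>_def by (rule insert.IH[OF J _ z0]) (use that insert.prems in auto)
    let ?E = "\<lambda>w x. (A a w x - A a z0 x) / (w - z0) - G x"
    have memF: "mem j (if j \<in> J then A j z else (H(a := f)) j)" if "j \<in> I" "mem a f" "z \<in> U" for j f z
    proof (cases "j \<in> J")
      case True
      then show ?thesis using memA[OF that(1,3)] by simp
    next
      case False
      show ?thesis
      proof (cases "j = a")
        case True
        then show ?thesis using that(2) \<open>j \<notin> J\<close> by simp
      next
        case False
        have "mem j (H j)" by (rule insert.prems(2)) (use that(1) False \<open>j \<notin> J\<close> in auto)
        then show ?thesis using False \<open>j \<notin> J\<close> by simp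
      qed
    qed
    have lin': "\<Psi> z (\<lambda>x. f x + c * g x) = \<Psi> z f + c * \<Psi> z g" if "mem a f" "mem a g" "z \<in> U" for z f g c
    proof -
      let ?F = "\<lambda>i. if i \<in> J then A i z else (H(a := f)) i"
      have Pe: "\<Psi> z h = \<Phi> (?F(a := h))" for h
        unfolding \<Psi>_def by (rule arg_cong[where f = \<Phi>]) (use a(2) in \<open>auto simp: fun_eq_iff\<close>)
      show ?thesis unfolding Pe by (rule lin[OF a(1) memF[OF _ \<open>mem a f\<close> \<open>z \<in> U\<close>] that(1,2)])
    qed
    have split: "(\<Psi> w (A a w) - \<Psi> z0 (A a z0)) / (w - z0) = (\<Psi> w (A a z0) - \<Psi> z0 (A a z0)) / (w - z0) + \<Psi> w G + \<Psi> w (?E w)"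
      if w: "w \<in> U" "w \<noteq> z0" for w
    proof -
      have mE: "mem a (?E w)" by (rule memE[OF a(1) z0 w(1) G(1)])
      have mGE: "mem a (\<lambda>x. G x + 1 * ?E w x)" by (rule memc[OF a(1) G(1) mE])
      have "A a w = (\<lambda>x. A a z0 x + (w - z0) * (G x + 1 * ?E w x))" using w(2) by (auto simp: fun_eq_iff field_simps)
      then have "\<Psi> w (A a w) = \<Psi> w (\<lambda>x. A a z0 x + (w - z0) * (G x + 1 * ?E w x))" by simp
      also have "\<dots> = \<Psi> w (A a z0) + (w - z0) * (\<Psi> w G + 1 * \<Psi> w (?E w))"
        unfolding lin'[OF memA[OF a(1) z0] mGE w(1)] lin'[OF G(1) mE w(1)] ..
      finally show ?thesis using w(2) by (simp add: field_simps)
    qed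
    obtain D where D: "((\<lambda>w. (\<Psi> w (A a z0) - \<Psi> z0 (A a z0)) / (w - z0)) \<longlongrightarrow> D) (at z0 within U)"
      using fd[OF memA[OF a(1) z0]] unfolding field_differentiable_def has_field_derivative_iff by blast
    have cG: "((\<lambda>w. \<Psi> w G) \<longlongrightarrow> \<Psi> z0 G) (at z0 within U)"
      using field_differentiable_imp_continuous_at[OF fd[OF G(1)]] by (simp add: continuous_within)
    have cE: "((\<lambda>w. \<Psi> w (?E w)) \<longlongrightarrow> 0) (at z0 within U)"
    proof -
      have "\<forall>i\<in>J. \<exists>M>0. \<forall>\<^sub>F w in at z0 within U. nrm i (A i w) \<le> M" using loc[OF _ z0] J by blast
      then obtain M where M: "\<And>i. i \<in> J \<Longrightarrow> M i > 0" "\<And>i. i \<in> J \<Longrightarrow> \<forall>\<^sub>F w in at z0 within U. nrm i (A i w) \<le> M i" by metis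
      define K where "K = \<bar>C\<bar> * ((\<Prod>i\<in>J. M i) * (\<Prod>i\<in>I - insert a J. nrm i (H i)))"
      have fJ: "finite J" using finite_subset[OF J I] .
      have ev: "\<forall>\<^sub>F w in at z0 within U. \<forall>i\<in>J. nrm i (A i w) \<le> M i"
        using M(2) fJ by (simp add: eventually_ball_finite)
      show ?thesis
      proof (rule Lim_null_comparison)
        show "((\<lambda>w. K * nrm a (?E w)) \<longlongrightarrow> 0) (at z0 within U)" by (intro tendsto_mult_right_zero G(2))
        show "\<forall>\<^sub>F w in at z0 within U. norm (\<Psi> w (?E w)) \<le> K * nrm a (?E w)"
          using ev eventually_at_within_mem
        proof eventually_elim
          case (elim w)
          then have w: "w \<in> U" by auto
          have mE: "mem a (?E w)" by (rule memE[OF a(1) z0 w G(1)])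
          let ?F = "\<lambda>i. if i \<in> J then A i w else (H(a := ?E w)) i"
          have "norm (\<Psi> w (?E w)) \<le> C * (\<Prod>j\<in>I. nrm j (?F j))"
            unfolding \<Psi>_def by (rule bound, rule memF[OF _ mE w])
          also have "\<dots> \<le> \<bar>C\<bar> * (\<Prod>j\<in>I. nrm j (?F j))"
            by (intro mult_right_mono prod_nonneg ballI nrm0 memF[OF _ mE w]) auto
          also have "(\<Prod>j\<in>I. nrm j (?F j)) = (\<Prod>j\<in>J. nrm j (A j w)) * (\<Prod>j\<in>I - insert a J. nrm j (H j)) * nrm a (?E w)"
          proof -
            have pr: "prod P I = P a * (prod P J * prod P (I - insert a J))" for P :: "'i \<Rightarrow> real"
            proof -
              have "I - {a} = J \<union> (I - insert a J)" using a J by auto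
              moreover have "prod P (J \<union> (I - insert a J)) = prod P J * prod P (I - insert a J)"
                by (rule prod.union_disjoint) (use I fJ in auto)
              ultimately show ?thesis using prod.remove[OF I a(1), of P] by simp
            qed
            have "(\<Prod>j\<in>I. nrm j (?F j)) = nrm a (?F a) * ((\<Prod>j\<in>J. nrm j (?F j)) * (\<Prod>j\<in>I - insert a J. nrm j (?F j)))"
              by (rule pr)
            also have "(\<Prod>j\<in>J. nrm j (?F j)) = (\<Prod>j\<in>J. nrm j (A j w))" by (intro prod.cong) auto
            also have "(\<Prod>j\<in>I - insert a J. nrm j (?F j)) = (\<Prod>j\<in>I - insert a J. nrm j (H j))" by (intro prod.cong) auto
            finally show ?thesis using a(2) by (simp add: mult_ac)
          qed
          also have "\<bar>C\<bar> * ((\<Prod>j\<in>J. nrm j (A j w)) * (\<Prod>j\<in>I - insert a J. nrm j (H j)) * nrm a (?E w))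
             \<le> \<bar>C\<bar> * ((\<Prod>j\<in>J. M j) * (\<Prod>j\<in>I - insert a J. nrm j (H j)) * nrm a (?E w))"
          proof (intro mult_left_mono mult_right_mono)
            show "(\<Prod>j\<in>J. nrm j (A j w)) \<le> (\<Prod>j\<in>J. M j)"
              using elim(1) nrm0 memA[OF _ w] J by (intro prod_mono) auto
            show "0 \<le> (\<Prod>j\<in>I - insert a J. nrm j (H j))" by (intro prod_nonneg) (use nrm0 insert.prems(2) in auto)
            show "0 \<le> nrm a (?E w)" by (rule nrm0[OF a(1) mE])
          qed auto
          also have "\<dots> = K * nrm a (?E w)" by (simp add: K_def mult_ac)
          finally show ?case .
        qed
      qed
    qed
    have "((\<lambda>w. (\<Psi> w (A a w) - \<Psi> z0 (A a z0)) / (w - z0)) \<longlongrightarrow> D + \<Psi> z0 G + 0) (at z0 within U)"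
    proof (rule Lim_transform_eventually[OF tendsto_add[OF tendsto_add[OF D cG] cE]])
      show "\<forall>\<^sub>F w in at z0 within U. (\<Psi> w (A a z0) - \<Psi> z0 (A a z0)) / (w - z0) + \<Psi> w G + \<Psi> w (?E w) = (\<Psi> w (A a w) - \<Psi> z0 (A a z0)) / (w - z0)"
        using eventually_at_within_mem by eventually_elim (use split in auto)
    qed
    then show ?case unfolding eq field_differentiable_def has_field_derivative_iff by blast
  qed
  show ?thesis unfolding holomorphic_on_def
  proof
    fix z0 assume z0: "z0 \<in> U"
    have "(\<lambda>z. \<Phi> (\<lambda>i. if i \<in> I then A i z else (\<lambda>_. 0))) field_differentiable (at z0 within U)"
      by (rule step) (use z0 in auto)
    also have "(\<lambda>z. \<Phi> (\<lambda>i. if i \<in> I then A i z else (\<lambda>_. 0))) = (\<lambda>z. \<Phi> (\<lambda>i. A i z))"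
      by (intro ext dep) auto
    finally show "(\<lambda>z. \<Phi> (\<lambda>i. A i z)) field_differentiable (at z0 within U)" .
  qed
qed

section \<open>Analytic families with Borel values in \<open>L1\<close>, \<open>L2\<close> and
  \<open>L\<infinity>\<close>\<close>

lemma analytic_into_subset: "analytic_into mem nrm D F \<Longrightarrow> D' \<subseteq> D \<Longrightarrow> analytic_into mem nrm D' F"
  unfolding analytic_into_def by (meson subsetD tendsto_within_subset)

text \<open>Each difference quotient involves two values of the family and one derivative, so
  replacing all of these on null sets leaves its norm unchanged. Null sets for different parameters
  never have to be united.\<close>

lemma analytic_into_borel:
  fixes F :: "complex \<Rightarrow> real^'d \<Rightarrow> complex"
  assumes F: "analytic_into mem nrm D F"
    and m: "\<And>f. mem f \<Longrightarrow> f \<in> borel_measurable lebesgue"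
    and c: "\<And>f g. mem f \<Longrightarrow> g \<in> borel_measurable borel \<Longrightarrow> (AE x in lborel. f x = g x) \<Longrightarrow> mem g"
    and n: "\<And>f g. f \<in> borel_measurable lebesgue \<Longrightarrow> g \<in> borel_measurable borel \<Longrightarrow> (AE x in lborel. f x = g x) \<Longrightarrow> nrm f = nrm g"
  obtains F' where "\<And>z. z \<in> D \<Longrightarrow> AE x in lborel. F z x = F' z x"
    "analytic_into (\<lambda>f. f \<in> borel_measurable borel \<and> mem f) nrm D F'"
proof -
  have "\<exists>g\<in>borel_measurable borel. AE x in lborel. F z x = g x" if "z \<in> D" for z
    by (rule lebesgue_complex_ex_borel[OF m]) (use F that in \<open>simp add: analytic_into_def\<close>)
  then obtain F' where F': "\<And>z. z \<in> D \<Longrightarrow> F' z \<in> borel_measurable borel" "\<And>z. z \<in> D \<Longrightarrow> AE x in lborel. F z x = F' z x" by metis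
  have mF: "mem (F z)" if "z \<in> D" for z using F that by (simp add: analytic_into_def)
  have "analytic_into (\<lambda>f. f \<in> borel_measurable borel \<and> mem f) nrm D F'"
    unfolding analytic_into_def
  proof (intro conjI ballI)
    fix z assume z: "z \<in> D"
    show "F' z \<in> borel_measurable borel" by (rule F'(1)[OF z])
    show "mem (F' z)" by (rule c[OF mF[OF z] F'(1)[OF z] F'(2)[OF z]])
    obtain G where G: "mem G" "((\<lambda>w. nrm (\<lambda>x. (F w x - F z x) / (w - z) - G x)) \<longlongrightarrow> 0) (at z within D)"
      using F z by (auto simp: analytic_into_def)
    obtain G' where G': "G' \<in> borel_measurable borel" "AE x in lborel. G x = G' x" using lebesgue_complex_ex_borel[OF m[OF G(1)]] by blast
    have "((\<lambda>w. nrm (\<lambda>x. (F' w x - F' z x) / (w - z) - G' x)) \<longlongrightarrow> 0) (at z within D)"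
    proof (rule Lim_transform_eventually[OF G(2)])
      show "\<forall>\<^sub>F w in at z within D. nrm (\<lambda>x. (F w x - F z x) / (w - z) - G x) = nrm (\<lambda>x. (F' w x - F' z x) / (w - z) - G' x)"
        using eventually_at_within_mem
      proof eventually_elim
        case (elim w)
        then have w: "w \<in> D" by auto
        show ?case
        proof (rule n)
          show "(\<lambda>x. (F w x - F z x) / (w - z) - G x) \<in> borel_measurable lebesgue"
            by (intro borel_measurable_diff borel_measurable_divide borel_measurable_const m mF w z G(1))
          show "(\<lambda>x. (F' w x - F' z x) / (w - z) - G' x) \<in> borel_measurable borel"
            by (intro borel_measurable_diff borel_measurable_divide borel_measurable_const F'(1) w z G'(1))
          show "AE x in lborel. (F w x - F z x) / (w - z) - G x = (F' w x - F' z x) / (w - z) - G' x"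
            using F'(2)[OF w] F'(2)[OF z] G'(2) by eventually_elim simp
        qed
      qed
    qed
    then show "\<exists>G. (G \<in> borel_measurable borel \<and> mem G) \<and> ((\<lambda>w. nrm (\<lambda>x. (F' w x - F' z x) / (w - z) - G x)) \<longlongrightarrow> 0) (at z within D)"
      using G'(1) c[OF G(1) G'] by blast
  qed
  with F'(2) show ?thesis by (rule that)
qed

definition bL1 :: "(real^'d \<Rightarrow> complex) \<Rightarrow> bool" where "bL1 f \<longleftrightarrow> f \<in> borel_measurable borel \<and> in_L1 f"
definition bL2 :: "(real^'d \<Rightarrow> complex) \<Rightarrow> bool" where "bL2 f \<longleftrightarrow> f \<in> borel_measurable borel \<and> in_L2 f"
definition bLinf :: "(real^'d \<Rightarrow> complex) \<Rightarrow> bool" where "bLinf f \<longleftrightarrow> f \<in> borel_measurable borel \<and> in_Linf f"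

lemma bL1_iff: "bL1 f \<longleftrightarrow> f \<in> borel_measurable borel \<and> integrable lborel f"
  by (auto simp: bL1_def in_L1_def integrable_completion measurable_lborel1)

lemma norm_L1_borel:
  assumes [measurable]: "f \<in> borel_measurable borel"
  shows "norm_L1 f = (LINT x|lborel. cmod (f x))"
  unfolding norm_L1_def by (rule integral_completion) measurable

lemma bL2_iff: "bL2 f \<longleftrightarrow> f \<in> borel_measurable borel \<and> integrable lborel (\<lambda>x. (cmod (f x))\<^sup>2)"
proof (cases "f \<in> borel_measurable borel")
  case f: True
  have "integrable lebesgue (\<lambda>x. (cmod (f x))\<^sup>2) \<longleftrightarrow> integrable lborel (\<lambda>x. (cmod (f x))\<^sup>2)"
    by (rule integrable_completion) (use f in measurable)
  moreover have "f \<in> borel_measurable lebesgue" using f by (simp add: measurable_completion measurable_lborel1)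
  ultimately show ?thesis using f by (simp add: bL2_def in_L2_def)
qed (simp add: bL2_def)

lemma norm_L2_borel:
  assumes [measurable]: "f \<in> borel_measurable borel"
  shows "norm_L2 f = sqrt (LINT x|lborel. (cmod (f x))\<^sup>2)"
  unfolding norm_L2_def by (simp add: integral_completion)

text \<open>The norm is a cast from the extended reals, which is faithful once the essential
  supremum is known to be finite and nonnegative. Nonnegativity uses that space is not a null
  set.\<close>

lemma in_Linf_AE:
  fixes f :: "real^'d \<Rightarrow> complex"
  assumes "in_Linf f"
  shows "AE x in lborel. cmod (f x) \<le> norm_Linf f" "0 \<le> norm_Linf f"
proof -
  let ?e = "esssup lebesgue (\<lambda>x. ereal (cmod (f x)))"
  have fin: "?e < \<infinity>" using assms by (simp add: in_Linf_def)
  have ae: "AE x in lborel. ereal (cmod (f x)) \<le> ?e"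
    using esssup_AE[where M = lebesgue and f = "\<lambda>x. ereal (cmod (f x))"] by (simp add: AE_completion_iff)
  have "0 \<le> ?e"
  proof (rule ccontr)
    assume neg: "\<not> 0 \<le> ?e"
    have "AE x in (lborel :: (real^'d) measure). False" using ae
    proof eventually_elim
      case (elim x)
      have "0 \<le> ereal (cmod (f x))" by simp
      with elim neg show ?case using order_trans by blast
    qed
    then have "emeasure (lborel :: (real^'d) measure) UNIV = 0" by (simp add: AE_iff_measurable[OF _ refl])
    then show False by simp
  qed
  then obtain r where r: "?e = ereal r" "0 \<le> r" using fin by (cases ?e) auto
  then have n: "norm_Linf f = r" by (simp add: norm_Linf_def)
  show "AE x in lborel. cmod (f x) \<le> norm_Linf f" using ae unfolding r n by simp
  show "0 \<le> norm_Linf f" using r n by simp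
qed

lemma bLinf_I:
  assumes [measurable]: "f \<in> borel_measurable borel" and C: "AE x in lborel. cmod (f x) \<le> C" "0 \<le> C"
  shows "bLinf f" "norm_Linf f \<le> C"
proof -
  let ?e = "esssup lebesgue (\<lambda>x. ereal (cmod (f x)))"
  have fm [measurable]: "f \<in> borel_measurable lebesgue" using assms(1) by (simp add: measurable_completion measurable_lborel1)
  have m: "(\<lambda>x. ereal (cmod (f x))) \<in> borel_measurable lebesgue" by measurable
  have e: "?e \<le> ereal C" by (rule esssup_I[OF m]) (use C in \<open>simp add: AE_completion_iff\<close>)
  then have "?e < \<infinity>" by (rule order_le_less_trans) simp
  then show "bLinf f" using assms(1) fm by (simp add: bLinf_def in_Linf_def)
  show "norm_Linf f \<le> C" unfolding norm_Linf_def using e C(2) by (cases ?e) auto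
qed

lemma bL1_affine:
  assumes "bL1 f" "bL1 g"
  shows "bL1 (\<lambda>x. f x + c * g x)" "norm_L1 f \<ge> 0" "norm_L1 (\<lambda>x. f x + c * g x) \<le> 2 * (norm_L1 f + cmod c * norm_L1 g)"
proof -
  have [measurable]: "f \<in> borel_measurable borel" "g \<in> borel_measurable borel" and i: "integrable lborel f" "integrable lborel g"
    using assms by (auto simp: bL1_iff)
  show "bL1 (\<lambda>x. f x + c * g x)" using i by (auto simp: bL1_iff)
  show "norm_L1 f \<ge> 0" by (simp add: norm_L1_def Bochner_Integration.integral_nonneg)
  have "(LINT x|lborel. cmod (f x + c * g x)) \<le> (LINT x|lborel. cmod (f x) + cmod c * cmod (g x))"
    by (rule integral_mono) (use i in \<open>auto intro: order_trans[OF norm_triangle_ineq] simp: norm_mult\<close>)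
  also have "\<dots> = norm_L1 f + cmod c * norm_L1 g" using i by (simp add: norm_L1_borel)
  also have "\<dots> \<le> 2 * (norm_L1 f + cmod c * norm_L1 g)"
    by (simp add: norm_L1_def Bochner_Integration.integral_nonneg)
  finally show "norm_L1 (\<lambda>x. f x + c * g x) \<le> 2 * (norm_L1 f + cmod c * norm_L1 g)" by (simp add: norm_L1_borel)
qed

text \<open>This turns the pointwise bound for \<open>|a + b|^2\<close> into a triangle inequality
  with an extra factor 2. That slack is harmless, since the norms serve only to express convergence
  and boundedness.\<close>

lemma sqrt_le_affine:
  fixes a b c :: real
  assumes x: "x \<le> 2 * a + 2 * c\<^sup>2 * b" and ab: "0 \<le> a" "0 \<le> b" "0 \<le> c"
  shows "sqrt x \<le> 2 * (sqrt a + c * sqrt b)"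
proof -
  have e: "4 * p\<^sup>2 + 8 * (p * (q * r)) + 4 * (q\<^sup>2 * r\<^sup>2) = (2 * (p + q * r))\<^sup>2" for p q r :: real
    by (simp add: power2_eq_square algebra_simps)
  have "0 \<le> sqrt a * (c * sqrt b)" "0 \<le> c\<^sup>2 * b" using ab by auto
  then have "x \<le> 4 * (sqrt a)\<^sup>2 + 8 * (sqrt a * (c * sqrt b)) + 4 * (c\<^sup>2 * (sqrt b)\<^sup>2)"
    using x ab unfolding real_sqrt_pow2[OF ab(1)] real_sqrt_pow2[OF ab(2)] mult.assoc by linarith
  then have "sqrt x \<le> sqrt ((2 * (sqrt a + c * sqrt b))\<^sup>2)" unfolding e by (rule real_sqrt_le_mono)
  also have "\<dots> = 2 * (sqrt a + c * sqrt b)" by (rule real_sqrt_unique) (use ab in auto)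
  finally show ?thesis .
qed

lemma bL2_affine:
  assumes "bL2 f" "bL2 g"
  shows "bL2 (\<lambda>x. f x + c * g x)" "norm_L2 f \<ge> 0" "norm_L2 (\<lambda>x. f x + c * g x) \<le> 2 * (norm_L2 f + cmod c * norm_L2 g)"
proof -
  have fm [measurable]: "f \<in> borel_measurable borel" "g \<in> borel_measurable borel" and i: "integrable lborel (\<lambda>x. (cmod (f x))\<^sup>2)" "integrable lborel (\<lambda>x. (cmod (g x))\<^sup>2)"
    using assms by (auto simp: bL2_iff)
  have ic: "integrable lborel (\<lambda>x. (cmod (c * g x))\<^sup>2)" by (rule integrable_scale_L2[OF i(2)])
  have sm: "(\<lambda>x. f x + c * g x) \<in> borel_measurable borel" by measurable
  have isum: "integrable lborel (\<lambda>x. (cmod (f x + c * g x))\<^sup>2)" by (rule integrable_add_L2[OF _ _ i(1) ic]) measurable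
  show "bL2 (\<lambda>x. f x + c * g x)" using isum by (auto simp: bL2_iff)
  show "norm_L2 f \<ge> 0" by (simp add: norm_L2_def Bochner_Integration.integral_nonneg)
  define a b where "a = (LINT x|lborel. (cmod (f x))\<^sup>2)" and "b = (LINT x|lborel. (cmod (g x))\<^sup>2)"
  have ab: "a \<ge> 0" "b \<ge> 0" by (auto simp: a_def b_def)
  have n1: "norm_L2 f = sqrt a" unfolding a_def by (rule norm_L2_borel[OF fm(1)])
  have n2: "norm_L2 g = sqrt b" unfolding b_def by (rule norm_L2_borel[OF fm(2)])
  have n3: "norm_L2 (\<lambda>x. f x + c * g x) = sqrt (LINT x|lborel. (cmod (f x + c * g x))\<^sup>2)" by (rule norm_L2_borel[OF sm])
  have "(LINT x|lborel. (cmod (f x + c * g x))\<^sup>2) \<le> (LINT x|lborel. 2 * (cmod (f x))\<^sup>2 + 2 * (cmod c)\<^sup>2 * (cmod (g x))\<^sup>2)"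
  proof (rule integral_mono[OF isum])
    show "integrable lborel (\<lambda>x. 2 * (cmod (f x))\<^sup>2 + 2 * (cmod c)\<^sup>2 * (cmod (g x))\<^sup>2)" using i by auto
    fix x
    have "(cmod (f x + c * g x))\<^sup>2 \<le> (cmod (f x) + cmod c * cmod (g x))\<^sup>2"
      by (intro power_mono order_trans[OF norm_triangle_ineq]) (simp_all add: norm_mult)
    also have "\<dots> \<le> 2 * (cmod (f x))\<^sup>2 + 2 * (cmod c)\<^sup>2 * (cmod (g x))\<^sup>2"
      using sum_squares_bound[of "cmod (f x)" "cmod c * cmod (g x)"] by (simp add: power2_sum power_mult_distrib)
    finally show "(cmod (f x + c * g x))\<^sup>2 \<le> 2 * (cmod (f x))\<^sup>2 + 2 * (cmod c)\<^sup>2 * (cmod (g x))\<^sup>2" .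
  qed
  also have "\<dots> = 2 * a + 2 * (cmod c)\<^sup>2 * b" using i by (simp add: a_def b_def)
  finally have "sqrt (LINT x|lborel. (cmod (f x + c * g x))\<^sup>2) \<le> 2 * (sqrt a + cmod c * sqrt b)"
    by (rule sqrt_le_affine[OF _ ab norm_ge_zero])
  then show "norm_L2 (\<lambda>x. f x + c * g x) \<le> 2 * (norm_L2 f + cmod c * norm_L2 g)"
    unfolding n1 n2 n3 .
qed

lemma bLinf_affine:
  assumes "bLinf f" "bLinf g"
  shows "bLinf (\<lambda>x. f x + c * g x)" "norm_Linf f \<ge> 0" "norm_Linf (\<lambda>x. f x + c * g x) \<le> 2 * (norm_Linf f + cmod c * norm_Linf g)"
proof -
  have [measurable]: "f \<in> borel_measurable borel" "g \<in> borel_measurable borel" and i: "in_Linf f" "in_Linf g"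
    using assms by (auto simp: bLinf_def)
  note f = in_Linf_AE[OF i(1)] and g = in_Linf_AE[OF i(2)]
  have m: "(\<lambda>x. f x + c * g x) \<in> borel_measurable borel" by measurable
  have ae: "AE x in lborel. cmod (f x + c * g x) \<le> norm_Linf f + cmod c * norm_Linf g"
    using f(1) g(1)
  proof eventually_elim
    case (elim x)
    have "cmod (f x + c * g x) \<le> cmod (f x) + cmod c * cmod (g x)" by (rule order_trans[OF norm_triangle_ineq]) (simp add: norm_mult)
    also have "\<dots> \<le> norm_Linf f + cmod c * norm_Linf g" by (intro add_mono mult_left_mono elim) auto
    finally show ?case .
  qed
  have nn: "0 \<le> norm_Linf f + cmod c * norm_Linf g" using f(2) g(2) by simp
  show "bLinf (\<lambda>x. f x + c * g x)" by (rule bLinf_I(1)[OF m ae nn])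
  show "norm_Linf f \<ge> 0" by (rule f(2))
  show "norm_Linf (\<lambda>x. f x + c * g x) \<le> 2 * (norm_Linf f + cmod c * norm_Linf g)"
  proof -
    have dbl: "S \<le> 2 * S" if "0 \<le> S" for S :: real using that by simp
    show ?thesis by (rule order_trans[OF bLinf_I(2)[OF m ae nn] dbl[OF nn]])
  qed
qed

lemma analytic_L1_borel:
  fixes F :: "complex \<Rightarrow> real^'d \<Rightarrow> complex"
  assumes F: "analytic_into in_L1 norm_L1 D F"
  obtains F' where "\<And>z. z \<in> D \<Longrightarrow> AE x in lborel. F z x = F' z x" "analytic_into bL1 norm_L1 D F'"
proof (rule analytic_into_borel[OF F])
  have gm: "g \<in> borel_measurable lebesgue" if "g \<in> borel_measurable borel" for g :: "real^'d \<Rightarrow> complex"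
    using that by (simp add: measurable_completion measurable_lborel1)
  show "f \<in> borel_measurable lebesgue" if "in_L1 f" for f :: "real^'d \<Rightarrow> complex"
    using that by (auto simp: in_L1_def)
  show "in_L1 g" if "in_L1 f" "g \<in> borel_measurable borel" "AE x in lborel. f x = g x" for f g :: "real^'d \<Rightarrow> complex"
  proof -
    have ae: "AE x in lebesgue. f x = g x" using that(3) by (simp add: AE_completion_iff)
    show ?thesis
      unfolding in_L1_def
    proof (rule integrable_cong_AE_imp[OF _ gm[OF that(2)]])
      show "integrable lebesgue f" using that(1) by (simp add: in_L1_def)
      show "AE x in lebesgue. f x = g x" by (rule ae)
    qed
  qed
  show "norm_L1 f = norm_L1 g" if "f \<in> borel_measurable lebesgue" "g \<in> borel_measurable borel" "AE x in lborel. f x = g x" for f g :: "real^'d \<Rightarrow> complex"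
  proof -
    have ae: "AE x in lebesgue. f x = g x" using that(3) by (simp add: AE_completion_iff)
    have [measurable]: "f \<in> borel_measurable lebesgue" "g \<in> borel_measurable lebesgue" using that(1) gm[OF that(2)] by auto
    have m: "(\<lambda>x. cmod (f x)) \<in> borel_measurable lebesgue" "(\<lambda>x. cmod (g x)) \<in> borel_measurable lebesgue" by measurable
    have aen: "AE x in lebesgue. cmod (f x) = cmod (g x)" using ae by eventually_elim simp
    show ?thesis unfolding norm_L1_def by (rule Bochner_Integration.integral_cong_AE[OF m aen])
  qed
qed (auto simp: bL1_def[abs_def])

lemma analytic_L2_borel:
  fixes F :: "complex \<Rightarrow> real^'d \<Rightarrow> complex"
  assumes F: "analytic_into in_L2 norm_L2 D F"
  obtains F' where "\<And>z. z \<in> D \<Longrightarrow> AE x in lborel. F z x = F' z x" "analytic_into bL2 norm_L2 D F'"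
proof (rule analytic_into_borel[OF F])
  have gm: "g \<in> borel_measurable lebesgue" if "g \<in> borel_measurable borel" for g :: "real^'d \<Rightarrow> complex"
    using that by (simp add: measurable_completion measurable_lborel1)
  show "f \<in> borel_measurable lebesgue" if "in_L2 f" for f :: "real^'d \<Rightarrow> complex"
    using that by (auto simp: in_L2_def)
  show "in_L2 g" if "in_L2 f" "g \<in> borel_measurable borel" "AE x in lborel. f x = g x" for f g :: "real^'d \<Rightarrow> complex"
  proof -
    have ae: "AE x in lebesgue. f x = g x" using that(3) by (simp add: AE_completion_iff)
    show ?thesis
    proof -
      have [measurable]: "g \<in> borel_measurable lebesgue" by (rule gm[OF that(2)])
      have m: "(\<lambda>x. (cmod (g x))\<^sup>2) \<in> borel_measurable lebesgue" by measurable
      have "integrable lebesgue (\<lambda>x. (cmod (g x))\<^sup>2)"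
      proof (rule integrable_cong_AE_imp[OF _ m])
        show "integrable lebesgue (\<lambda>x. (cmod (f x))\<^sup>2)" using that(1) by (simp add: in_L2_def)
        show "AE x in lebesgue. (cmod (f x))\<^sup>2 = (cmod (g x))\<^sup>2" using ae by eventually_elim simp
      qed
      then show ?thesis using gm[OF that(2)] by (simp add: in_L2_def)
    qed
  qed
  show "norm_L2 f = norm_L2 g" if "f \<in> borel_measurable lebesgue" "g \<in> borel_measurable borel" "AE x in lborel. f x = g x" for f g :: "real^'d \<Rightarrow> complex"
  proof -
    have ae: "AE x in lebesgue. f x = g x" using that(3) by (simp add: AE_completion_iff)
    have [measurable]: "f \<in> borel_measurable lebesgue" "g \<in> borel_measurable lebesgue" using that(1) gm[OF that(2)] by auto
    have m: "(\<lambda>x. (cmod (f x))\<^sup>2) \<in> borel_measurable lebesgue" "(\<lambda>x. (cmod (g x))\<^sup>2) \<in> borel_measurable lebesgue" by measurable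
    have aen: "AE x in lebesgue. (cmod (f x))\<^sup>2 = (cmod (g x))\<^sup>2" using ae by eventually_elim simp
    show ?thesis unfolding norm_L2_def by (rule arg_cong[where f = sqrt], rule Bochner_Integration.integral_cong_AE[OF m aen])
  qed
qed (auto simp: bL2_def[abs_def])

lemma analytic_Linf_borel:
  fixes F :: "complex \<Rightarrow> real^'d \<Rightarrow> complex"
  assumes F: "analytic_into in_Linf norm_Linf D F"
  obtains F' where "\<And>z. z \<in> D \<Longrightarrow> AE x in lborel. F z x = F' z x" "analytic_into bLinf norm_Linf D F'"
proof (rule analytic_into_borel[OF F])
  have gm: "g \<in> borel_measurable lebesgue" if "g \<in> borel_measurable borel" for g :: "real^'d \<Rightarrow> complex"
    using that by (simp add: measurable_completion measurable_lborel1)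
  show "f \<in> borel_measurable lebesgue" if "in_Linf f" for f :: "real^'d \<Rightarrow> complex"
    using that by (auto simp: in_Linf_def)
  show "in_Linf g" if "in_Linf f" "g \<in> borel_measurable borel" "AE x in lborel. f x = g x" for f g :: "real^'d \<Rightarrow> complex"
  proof -
    have ae: "AE x in lebesgue. f x = g x" using that(3) by (simp add: AE_completion_iff)
    show ?thesis
    proof -
      have "esssup lebesgue (\<lambda>x. ereal (cmod (f x))) = esssup lebesgue (\<lambda>x. ereal (cmod (g x)))"
      proof (rule esssup_AE_cong)
        have [measurable]: "f \<in> borel_measurable lebesgue" "g \<in> borel_measurable lebesgue" using that(1) gm[OF that(2)] by (auto simp: in_Linf_def)
        show "(\<lambda>x. ereal (cmod (f x))) \<in> borel_measurable lebesgue" "(\<lambda>x. ereal (cmod (g x))) \<in> borel_measurable lebesgue" by measurable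
        show "AE x in lebesgue. ereal (cmod (f x)) = ereal (cmod (g x))" using ae by eventually_elim simp
      qed
      then show ?thesis using that(1) gm[OF that(2)] by (simp add: in_Linf_def)
    qed
  qed
  show "norm_Linf f = norm_Linf g" if "f \<in> borel_measurable lebesgue" "g \<in> borel_measurable borel" "AE x in lborel. f x = g x" for f g :: "real^'d \<Rightarrow> complex"
  proof -
    have ae: "AE x in lebesgue. f x = g x" using that(3) by (simp add: AE_completion_iff)
    have [measurable]: "f \<in> borel_measurable lebesgue" "g \<in> borel_measurable lebesgue" using that(1) gm[OF that(2)] by auto
    show ?thesis
      unfolding norm_Linf_def
    proof (rule arg_cong[where f = real_of_ereal], rule esssup_AE_cong)
      show "AE x in lebesgue. ereal (cmod (f x)) = ereal (cmod (g x))" using ae by eventually_elim simp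
    qed measurable
  qed
qed (auto simp: bLinf_def[abs_def])

text \<open>There are two instances. Conjugating both parameter and value keeps a family analytic,
  with conjugated derivative; reversing the sign of the parameter negates the derivative. The map
  \<open>\<rho>'\<close> acts on the derivative.\<close>

lemma analytic_into_transform:
  assumes F: "analytic_into mem nrm D F"
    and s: "\<And>z. z \<in> D' \<Longrightarrow> \<sigma> z \<in> D" "inj \<sigma>" "\<And>z. isCont \<sigma> z"
    and eq: "\<And>w z p q g. (\<rho> p - \<rho> q) / (w - z) - \<rho>' g = \<rho>' ((p - q) / (\<sigma> w - \<sigma> z) - g)"
    and m: "\<And>f. mem f \<Longrightarrow> mem (\<lambda>x. \<rho> (f x))" "\<And>f. mem f \<Longrightarrow> mem (\<lambda>x. \<rho>' (f x))" "\<And>f. nrm (\<lambda>x. \<rho>' (f x)) = nrm f"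
  shows "analytic_into mem nrm D' (\<lambda>z x. \<rho> (F (\<sigma> z) x))"
  unfolding analytic_into_def
proof (intro conjI ballI)
  fix z assume z: "z \<in> D'"
  show "mem (\<lambda>x. \<rho> (F (\<sigma> z) x))" by (rule m(1)) (use F s(1)[OF z] in \<open>simp add: analytic_into_def\<close>)
  obtain G where G: "mem G" "((\<lambda>w. nrm (\<lambda>x. (F w x - F (\<sigma> z) x) / (w - \<sigma> z) - G x)) \<longlongrightarrow> 0) (at (\<sigma> z) within D)"
    using F s(1)[OF z] by (auto simp: analytic_into_def)
  have fl: "filterlim \<sigma> (at (\<sigma> z) within D) (at z within D')"
    unfolding filterlim_at
  proof
    show "\<forall>\<^sub>F w in at z within D'. \<sigma> w \<in> D \<and> \<sigma> w \<noteq> \<sigma> z"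
      using eventually_at_within_mem by eventually_elim (use s(1,2) in \<open>auto dest: injD\<close>)
    show "(\<sigma> \<longlongrightarrow> \<sigma> z) (at z within D')" 
      by (rule tendsto_within_subset[OF s(3)[of z, unfolded isCont_def]]) simp
  qed
  have "((\<lambda>w. nrm (\<lambda>x. (F (\<sigma> w) x - F (\<sigma> z) x) / (\<sigma> w - \<sigma> z) - G x)) \<longlongrightarrow> 0) (at z within D')"
    by (rule filterlim_compose[OF G(2) fl])
  then have "((\<lambda>w. nrm (\<lambda>x. (\<rho> (F (\<sigma> w) x) - \<rho> (F (\<sigma> z) x)) / (w - z) - \<rho>' (G x))) \<longlongrightarrow> 0) (at z within D')"
    unfolding eq m(3) .
  then show "\<exists>G. mem G \<and> ((\<lambda>w. nrm (\<lambda>x. (\<rho> (F (\<sigma> w) x) - \<rho> (F (\<sigma> z) x)) / (w - z) - G x)) \<longlongrightarrow> 0) (at z within D')"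
    using m(2)[OF G(1)] by blast
qed

lemma analytic_into_const: "mem f \<Longrightarrow> mem (\<lambda>_. 0) \<Longrightarrow> nrm (\<lambda>_. 0) = 0 \<Longrightarrow> analytic_into mem nrm D (\<lambda>_. f)"
  unfolding analytic_into_def by (auto intro!: exI[of _ "\<lambda>_. 0"])

section \<open>Resolvents as analytic families of bounded functions\<close>

text \<open>Compactness gives a positive minimum on a bounded part of the ray, and linear growth
  takes over beyond it. The weight \<open>1 + t\<close> is what later absorbs the factor
  \<open>t\<close> that arises when the dilation is differentiated.\<close>

lemma ray_lower_bound:
  assumes a: "a \<noteq> 0" and ne: "\<And>t::real. 0 \<le> t \<Longrightarrow> a * of_real t \<noteq> \<zeta>"
  obtains k where "k > 0" "\<And>t. 0 \<le> t \<Longrightarrow> k * (1 + t) \<le> cmod (a * of_real t - \<zeta>)"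
proof -
  \<comment> \<open>Beyond \<open>T\<close> one has \<open>|a| t \<ge> 2 |\<zeta>| + |a|\<close>, so
    half of the slope \<open>|a|\<close> survives the subtraction of \<open>\<zeta>\<close>.\<close>
  define T where "T = (2 * cmod \<zeta> + cmod a) / cmod a"
  have T: "T \<ge> 0" by (simp add: T_def)
  have "continuous_on {0..T} (\<lambda>t. cmod (a * of_real t - \<zeta>) / (1 + t))"
    by (intro continuous_intros) auto
  from continuous_attains_inf[OF compact_Icc _ this] T
  obtain t0 where t0: "t0 \<in> {0..T}" "\<And>t. t \<in> {0..T} \<Longrightarrow> cmod (a * of_real t0 - \<zeta>) / (1 + t0) \<le> cmod (a * of_real t - \<zeta>) / (1 + t)" by auto
  define k where "k = min (cmod a / 2) (cmod (a * of_real t0 - \<zeta>) / (1 + t0))"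
  have "k > 0" using a ne[of t0] t0(1) by (auto simp: k_def)
  moreover have "k * (1 + t) \<le> cmod (a * of_real t - \<zeta>)" if t: "0 \<le> t" for t
  proof (cases "t \<le> T")
    case True
    have "k \<le> cmod (a * of_real t - \<zeta>) / (1 + t)" using t0(2)[of t] t True by (simp add: k_def min_le_iff_disj)
    then show ?thesis using t by (simp add: pos_le_divide_eq)
  next
    case False
    then have "2 * cmod \<zeta> + cmod a \<le> cmod a * t" using a by (simp add: T_def field_simps)
    moreover have "cmod (a * of_real t) \<le> cmod (a * of_real t - \<zeta>) + cmod \<zeta>" using norm_triangle_ineq[of "a * of_real t - \<zeta>" \<zeta>] by simp
    moreover have "cmod (a * of_real t) = cmod a * t" using t by (simp add: norm_mult)
    ultimately have "cmod a / 2 * (1 + t) \<le> cmod (a * of_real t - \<zeta>)" by (simp add: algebra_simps)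
    moreover have "k * (1 + t) \<le> cmod a / 2 * (1 + t)" unfolding k_def using t by (intro mult_right_mono min.cobounded1) auto
    ultimately show ?thesis by linarith
  qed
  ultimately show ?thesis by (rule that)
qed

text \<open>A first-order remainder estimate uniform in \<open>t\<close>, with coefficient and
  energy moving together: every numerator growing like \<open>1 + t\<close> is paired with an
  unperturbed resolvent \<open>r0\<close>, which decays like its inverse.\<close>

lemma resolvent_difference_quotient:
  fixes a0 aw a' z0 zw z' e :: complex and t k :: real
  assumes t: "0 \<le> t" and k: "0 < k" and lb: "k * (1 + t) \<le> cmod (a0 * of_real t - z0)"
    and sm: "cmod (aw - a0) + cmod (zw - z0) \<le> k / 2" and e: "e \<noteq> 0"
  shows "cmod ((1 / (aw * of_real t - zw) - 1 / (a0 * of_real t - z0)) / e - (- (1 / (a0 * of_real t - z0))\<^sup>2 * (a' * of_real t - z')))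
     \<le> 2 / k^3 * (cmod (aw - a0) + cmod (zw - z0)) * (cmod ((aw - a0) / e) + cmod ((zw - z0) / e))
       + 1 / k\<^sup>2 * (cmod ((aw - a0) / e - a') + cmod ((zw - z0) / e - z'))"
proof -
  define x0 xw where "x0 = a0 * of_real t - z0" and "xw = aw * of_real t - zw"
  define r0 rw where "r0 = 1 / x0" and "rw = 1 / xw"
  define S where "S = cmod (aw - a0) + cmod (zw - z0)"
  define P where "P = cmod ((aw - a0) / e) + cmod ((zw - z0) / e)"
  define P' where "P' = cmod ((aw - a0) / e - a') + cmod ((zw - z0) / e - z')"
  define Q where "Q = (aw - a0) / e * of_real t - (zw - z0) / e"
  define A where "A = a' * of_real t - z'"
  have lin: "cmod (u * of_real t - v) \<le> (cmod u + cmod v) * (1 + t)" for u v :: complex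
  proof -
    have "cmod (u * of_real t - v) \<le> cmod u * t + cmod v" using norm_triangle_ineq4[of "u * of_real t" v] t by (simp add: norm_mult)
    also have "\<dots> \<le> (cmod u + cmod v) * (1 + t)" using t by (simp add: algebra_simps)
    finally show ?thesis .
  qed
  have k1: "k \<le> k * (1 + t)" using k t by simp
  have x0: "k * (1 + t) \<le> cmod x0" using lb by (simp add: x0_def)
  have dx: "xw - x0 = (aw - a0) * of_real t - (zw - z0)" by (simp add: x0_def xw_def algebra_simps)
  have dxn: "cmod (xw - x0) \<le> S * (1 + t)" unfolding dx S_def by (rule lin)
  \<comment> \<open>The smallness assumption costs at most half of the lower bound, so the moved
    denominator stays away from zero uniformly in \<open>t\<close>.\<close>
  have "S * (1 + t) \<le> k / 2 * (1 + t)" using sm t by (intro mult_right_mono) (auto simp: S_def)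
  moreover have "cmod x0 \<le> cmod xw + cmod (xw - x0)" using norm_triangle_ineq4[of xw "xw - x0"] by simp
  ultimately have xw: "k / 2 \<le> cmod xw" using x0 dxn k1 by (simp add: field_simps)
  have "0 < cmod x0" "0 < cmod xw" using x0 xw k k1 by linarith+
  then have nz: "x0 \<noteq> 0" "xw \<noteq> 0" by auto
  have r0t: "cmod r0 * (1 + t) \<le> 1 / k" using x0 k nz t by (simp add: r0_def norm_divide field_simps)
  have r0k: "cmod r0 \<le> 1 / k" using r0t t mult_left_mono[of 1 "1 + t" "cmod r0"] by simp
  have rwk: "cmod rw \<le> 2 / k" using xw k nz by (simp add: rw_def norm_divide field_simps)
  have d: "rw - r0 = - (rw * r0 * (xw - x0))" using nz by (simp add: rw_def r0_def field_simps)
  have dn: "cmod (rw - r0) \<le> 2 / k * (1 / k * S)"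
  proof -
    have "cmod (rw - r0) = cmod rw * (cmod r0 * cmod (xw - x0))" unfolding d by (simp add: norm_mult)
    also have "\<dots> \<le> 2 / k * (cmod r0 * (S * (1 + t)))" using k by (intro mult_mono rwk mult_left_mono dxn) auto
    also have "\<dots> = 2 / k * ((cmod r0 * (1 + t)) * S)" by (simp add: mult_ac)
    also have "\<dots> \<le> 2 / k * (1 / k * S)" using k by (intro mult_left_mono mult_right_mono r0t) (auto simp: S_def)
    finally show ?thesis .
  qed
  have xQ: "(xw - x0) / e = Q" unfolding dx Q_def using e by (simp add: field_simps)
  have "(rw - r0) / e = - (rw * r0 * Q)" unfolding d xQ[symmetric] by simp
  then have E: "(rw - r0) / e - (- r0\<^sup>2 * A) = - (r0 * ((rw - r0) * Q + r0 * (Q - A)))"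
    by (simp add: power2_eq_square algebra_simps)
  have QA: "Q - A = ((aw - a0) / e - a') * of_real t - ((zw - z0) / e - z')" by (simp add: Q_def A_def algebra_simps)
  have "cmod ((rw - r0) / e - (- r0\<^sup>2 * A)) \<le> cmod r0 * (cmod (rw - r0) * cmod Q + cmod r0 * cmod (Q - A))"
    unfolding E norm_minus_cancel norm_mult by (intro mult_left_mono order_trans[OF norm_triangle_ineq]) (simp_all add: norm_mult)
  also have "\<dots> \<le> cmod r0 * (2 / k * (1 / k * S) * (P * (1 + t)) + 1 / k * (P' * (1 + t)))"
  proof (intro mult_left_mono add_mono mult_mono dn r0k)
    show "cmod Q \<le> P * (1 + t)" unfolding Q_def P_def by (rule lin)
    show "cmod (Q - A) \<le> P' * (1 + t)" unfolding QA P'_def by (rule lin)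
  qed (use k in \<open>auto simp: S_def\<close>)
  also have "\<dots> = (cmod r0 * (1 + t)) * (2 / k * (1 / k * S) * P + 1 / k * P')" by (simp add: algebra_simps)
  also have "\<dots> \<le> 1 / k * (2 / k * (1 / k * S) * P + 1 / k * P')"
    using k by (intro mult_right_mono r0t) (auto simp: S_def P_def P'_def)
  also have "\<dots> = 2 / k^3 * S * P + 1 / k\<^sup>2 * P'"
    using k by (simp add: power2_eq_square power3_eq_cube field_simps)
  finally show ?thesis unfolding r0_def rw_def x0_def xw_def A_def S_def P_def P'_def .
qed

text \<open>It is used with a moving dilation at fixed energy and with a moving energy at fixed
  dilation. The derivative is bounded in \<open>p\<close> because the squared resolvent absorbs the
  factor \<open>nu p\<close>.\<close>

lemma resolvent_analytic:
  fixes a \<zeta> a' \<zeta>' :: "complex \<Rightarrow> complex"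
  assumes a0: "\<And>w. w \<in> U \<Longrightarrow> a w \<noteq> 0" and ne: "\<And>w t::real. w \<in> U \<Longrightarrow> 0 \<le> t \<Longrightarrow> a w * of_real t \<noteq> \<zeta> w"
    and da: "\<And>w. w \<in> U \<Longrightarrow> (a has_field_derivative a' w) (at w within U)"
    and dz: "\<And>w. w \<in> U \<Longrightarrow> (\<zeta> has_field_derivative \<zeta>' w) (at w within U)"
  shows "analytic_into bLinf norm_Linf U (\<lambda>w p::real^'d. 1 / (a w * of_real (nu p) - \<zeta> w))"
  unfolding analytic_into_def
proof (intro conjI ballI)
  have nu0: "nu p \<ge> 0" for p :: "real^'d" by (simp add: nu_def)
  fix z assume z: "z \<in> U"
  obtain k where k: "k > 0" "\<And>t. 0 \<le> t \<Longrightarrow> k * (1 + t) \<le> cmod (a z * of_real t - \<zeta> z)"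
    using ray_lower_bound[OF a0[OF z] ne[OF z]] by blast
  have km: "k \<le> k * (1 + t)" if "0 \<le> t" for t using k(1) that by simp
  have rm: "(\<lambda>p::real^'d. 1 / (a w * of_real (nu p) - \<zeta> w)) \<in> borel_measurable borel" for w by measurable
  have r0: "cmod (1 / (a z * of_real (nu p) - \<zeta> z)) * (1 + nu p) \<le> 1 / k" for p :: "real^'d"
  proof -
    have "0 < k * (1 + nu p)" using k(1) nu0[of p] by (intro mult_pos_pos) auto
    then have "0 < cmod (a z * of_real (nu p) - \<zeta> z)" using k(2)[OF nu0[of p]] by linarith
    then show ?thesis using k(2)[OF nu0[of p]] k(1) by (simp add: norm_divide field_simps)
  qed
  have r1: "cmod (1 / (a z * of_real (nu p) - \<zeta> z)) \<le> 1 / k" for p :: "real^'d"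
  proof -
    have "cmod (1 / (a z * of_real (nu p) - \<zeta> z)) * 1 \<le> cmod (1 / (a z * of_real (nu p) - \<zeta> z)) * (1 + nu p)"
      by (intro mult_left_mono) (use nu0[of p] in auto)
    with r0[of p] show ?thesis by simp
  qed
  show "bLinf (\<lambda>p::real^'d. 1 / (a z * of_real (nu p) - \<zeta> z))"
    by (rule bLinf_I(1)[OF rm AE_I2[OF r1]]) (use k(1) in auto)
  let ?G = "\<lambda>p::real^'d. - (1 / (a z * of_real (nu p) - \<zeta> z))\<^sup>2 * (a' z * of_real (nu p) - \<zeta>' z)"
  have Gb: "cmod (?G p) \<le> 1 / k * (1 / k * (cmod (a' z) + cmod (\<zeta>' z)))" for p
  proof -
    have "cmod (a' z * of_real (nu p) - \<zeta>' z) \<le> cmod (a' z) * nu p + cmod (\<zeta>' z)"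
      using norm_triangle_ineq4[of "a' z * of_real (nu p)" "\<zeta>' z"] nu0[of p] by (simp add: norm_mult)
    also have "\<dots> \<le> (1 + nu p) * (cmod (a' z) + cmod (\<zeta>' z))" using nu0[of p] by (simp add: algebra_simps)
    finally have l: "cmod (a' z * of_real (nu p) - \<zeta>' z) \<le> (1 + nu p) * (cmod (a' z) + cmod (\<zeta>' z))" .
    let ?r = "cmod (1 / (a z * of_real (nu p) - \<zeta> z))"
    have "cmod (?G p) = ?r * (?r * cmod (a' z * of_real (nu p) - \<zeta>' z))" by (simp only: norm_mult norm_minus_cancel norm_power power2_eq_square mult.assoc)
    also have "\<dots> \<le> ?r * (?r * ((1 + nu p) * (cmod (a' z) + cmod (\<zeta>' z))))" by (intro mult_left_mono l) auto
    also have "\<dots> = ?r * ((?r * (1 + nu p)) * (cmod (a' z) + cmod (\<zeta>' z)))" by (simp only: mult.assoc)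
    also have "\<dots> \<le> 1 / k * (1 / k * (cmod (a' z) + cmod (\<zeta>' z)))"
      using k(1) nu0[of p] by (intro mult_mono mult_right_mono r0 r1) auto
    finally show ?thesis .
  qed
  have Gm: "?G \<in> borel_measurable borel" by measurable
  have bG: "bLinf ?G" by (rule bLinf_I(1)[OF Gm AE_I2[OF Gb]]) (use k(1) in auto)
  have lG: "((\<lambda>w. norm_Linf (\<lambda>p. (1 / (a w * of_real (nu p) - \<zeta> w) - 1 / (a z * of_real (nu p) - \<zeta> z)) / (w - z) - ?G p)) \<longlongrightarrow> 0) (at z within U)"
  proof (rule Lim_null_comparison)
    let ?S = "\<lambda>w. cmod (a w - a z) + cmod (\<zeta> w - \<zeta> z)"
    let ?h = "\<lambda>w. 2 / k^3 * ?S w * (cmod ((a w - a z) / (w - z)) + cmod ((\<zeta> w - \<zeta> z) / (w - z)))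
       + 1 / k\<^sup>2 * (cmod ((a w - a z) / (w - z) - a' z) + cmod ((\<zeta> w - \<zeta> z) / (w - z) - \<zeta>' z))"
    have ca: "(a \<longlongrightarrow> a z) (at z within U)" using DERIV_continuous[OF da[OF z]] by (simp add: continuous_within)
    have cz: "(\<zeta> \<longlongrightarrow> \<zeta> z) (at z within U)" using DERIV_continuous[OF dz[OF z]] by (simp add: continuous_within)
    have S0: "(?S \<longlongrightarrow> 0) (at z within U)" using ca cz by (auto intro!: tendsto_eq_intros)
    have qa: "((\<lambda>w. (a w - a z) / (w - z)) \<longlongrightarrow> a' z) (at z within U)" using da[OF z] by (simp add: has_field_derivative_iff)
    have qz: "((\<lambda>w. (\<zeta> w - \<zeta> z) / (w - z)) \<longlongrightarrow> \<zeta>' z) (at z within U)" using dz[OF z] by (simp add: has_field_derivative_iff)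
    have "(?h \<longlongrightarrow> 2 / k^3 * 0 * (cmod (a' z) + cmod (\<zeta>' z)) + 1 / k\<^sup>2 * (cmod (a' z - a' z) + cmod (\<zeta>' z - \<zeta>' z))) (at z within U)"
      by (intro tendsto_intros S0 qa qz)
    then show "(?h \<longlongrightarrow> 0) (at z within U)" by simp
    have "\<forall>\<^sub>F w in at z within U. ?S w < k / 2" using order_tendstoD(2)[OF S0, of "k / 2"] k(1) by simp
    then show "\<forall>\<^sub>F w in at z within U. norm (norm_Linf (\<lambda>p::real^'d. (1 / (a w * of_real (nu p) - \<zeta> w) - 1 / (a z * of_real (nu p) - \<zeta> z)) / (w - z) - ?G p)) \<le> ?h w"
      using eventually_at_within_mem
    proof eventually_elim
      case (elim w)
      let ?E = "\<lambda>p::real^'d. (1 / (a w * of_real (nu p) - \<zeta> w) - 1 / (a z * of_real (nu p) - \<zeta> z)) / (w - z) - ?G p"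
      have b: "cmod (?E p) \<le> ?h w" for p
        by (rule resolvent_difference_quotient[OF nu0 k(1) k(2)[OF nu0]]) (use elim in auto)
      have m: "?E \<in> borel_measurable borel" by measurable
      have h0: "0 \<le> ?h w" using k(1) by (intro add_nonneg_nonneg mult_nonneg_nonneg) auto
      note E = bLinf_I[OF m AE_I2[OF b] h0]
      show ?case using E(2) bLinf_affine(2)[OF E(1) E(1)] by simp
    qed
  qed
  show "\<exists>G. bLinf G \<and> ((\<lambda>w. norm_Linf (\<lambda>p::real^'d. (1 / (a w * of_real (nu p) - \<zeta> w) - 1 / (a z * of_real (nu p) - \<zeta> z)) / (w - z) - G p)) \<longlongrightarrow> 0) (at z within U)"
    by (rule exI[of _ ?G], rule conjI[OF bG lG])
qed

section \<open>Evaluating almost everywhere defined factors, and the integral bound\<close>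

text \<open>Members of the function spaces are determined up to null sets, so inserting an argument
  into them is meaningful only if the argument map pulls null sets back to null sets.\<close>

definition nonsing :: "nat set \<Rightarrow> ((nat \<Rightarrow> real^'d) \<Rightarrow> real^'d) \<Rightarrow> bool" where
  "nonsing D a \<longleftrightarrow> a \<in> borel_measurable (PiM D (\<lambda>_. lborel)) \<and>
     (\<forall>N\<in>null_sets lborel. AE x in PiM D (\<lambda>_. lborel). a x \<notin> N)"

lemma AE_lborel_affine:
  fixes N :: "(real^'d) set"
  assumes N: "N \<in> null_sets lborel" and c: "c \<noteq> 0"
  shows "AE y in lborel. t + c *\<^sub>R y \<notin> N"
proof -
  have Ns: "N \<in> sets borel" using N by auto
  have T: "(\<lambda>y. t + c *\<^sub>R y) \<in> measurable lborel borel" by simp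
  have "AE y in lborel. y \<notin> N" by (rule AE_not_in[OF N])
  then have "AE y in density (distr lborel borel (\<lambda>y. t + c *\<^sub>R y)) (\<lambda>_. \<bar>c\<bar> ^ DIM(real^'d)). y \<notin> N"
    by (subst (asm) lborel_affine[OF c, of t])
  then have "AE y in distr lborel borel (\<lambda>y. t + c *\<^sub>R y). y \<notin> N"
    using c by (subst (asm) AE_density) auto
  then show ?thesis using Ns by (subst (asm) AE_distr_iff[OF T]) auto
qed

text \<open>With the other variables fixed, the preimage of a null set under an invertible affine
  map of the variable \<open>l\<close> is null; Tonelli does the rest.\<close>

lemma nonsingI:
  fixes a :: "(nat \<Rightarrow> real^'d) \<Rightarrow> real^'d"
  assumes D: "finite D" "l \<in> D" and a: "a \<in> borel_measurable (PiM D (\<lambda>_. lborel))" and c: "c \<noteq> 0"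
    and eq: "\<And>x y. a (x(l := y)) = r x + c *\<^sub>R y"
  shows "nonsing D a"
  unfolding nonsing_def
proof (intro conjI ballI a)
  fix N :: "(real^'d) set" assume N: "N \<in> null_sets lborel"
  interpret product_sigma_finite "\<lambda>_::nat. lborel :: (real^'d) measure" ..
  have Ns: "N \<in> sets borel" using N by auto
  have m: "(\<lambda>x. indicator N (a x) :: ennreal) \<in> borel_measurable (PiM D (\<lambda>_. lborel))"
    by (rule measurable_compose[OF a borel_measurable_indicator[OF Ns]])
  have Dl: "D = insert l (D - {l})" using D by auto
  have "(\<integral>\<^sup>+ x. indicator N (a x) \<partial>PiM D (\<lambda>_. lborel)) = (\<integral>\<^sup>+ x. (\<integral>\<^sup>+ y. indicator N (a (x(l := y))) \<partial>lborel) \<partial>PiM (D - {l}) (\<lambda>_. lborel))"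
    using product_nn_integral_insert[of "D - {l}" l "\<lambda>x. indicator N (a x)"] D m by (simp add: insert_absorb)
  also have "\<dots> = (\<integral>\<^sup>+ x. 0 \<partial>PiM (D - {l}) (\<lambda>_. lborel :: (real^'d) measure))"
  proof (rule nn_integral_cong)
    fix x
    have "(\<integral>\<^sup>+ y. indicator N (a (x(l := y))) \<partial>lborel) = (\<integral>\<^sup>+ y. 0 \<partial>(lborel :: (real^'d) measure))"
      by (rule nn_integral_cong_AE) (use AE_lborel_affine[OF N c, of "r x"] in \<open>auto simp: eq\<close>)
    then show "(\<integral>\<^sup>+ y. indicator N (a (x(l := y))) \<partial>lborel) = 0" by simp
  qed
  finally have "(\<integral>\<^sup>+ x. indicator N (a x) \<partial>PiM D (\<lambda>_. lborel)) = 0" by simp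
  then have "AE x in PiM D (\<lambda>_. lborel). indicator N (a x) = (0 :: ennreal)" by (subst (asm) nn_integral_0_iff_AE[OF m])
  then show "AE x in PiM D (\<lambda>_. lborel). a x \<notin> N" by eventually_elim (auto split: split_indicator_asm)
qed

lemma nonsing_AE:
  assumes "nonsing D a" "AE y in lborel. P y"
  shows "AE x in PiM D (\<lambda>_. lborel). P (a x)"
proof -
  obtain N where N: "N \<in> null_sets lborel" "{y \<in> space lborel. \<not> P y} \<subseteq> N" using assms(2) by (auto simp: eventually_ae_filter)
  have "AE x in PiM D (\<lambda>_. lborel). a x \<notin> N" using assms(1) N(1) by (simp add: nonsing_def)
  then show ?thesis by eventually_elim (use N(2) in auto)
qed

lemma nonsing_component:
  assumes "finite D" "l \<in> D" shows "nonsing D (\<lambda>x. x l)"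
proof (rule nonsingI[OF assms])
  show "(\<lambda>x. x l) \<in> borel_measurable (PiM D (\<lambda>_. lborel))"
    using measurable_component_singleton[OF assms(2), of "\<lambda>_. lborel"] by (simp add: measurable_lborel1)
  show "(1::real) \<noteq> 0" by simp
  show "(x(l := y)) l = 0 + 1 *\<^sub>R y" for x and y :: "real^'a" by simp
qed

lemma cauchy_schwarz_L2:
  assumes f: "bL2 f" and g: "bL2 g"
  shows "integrable lborel (\<lambda>x. f x * g x)" "(LINT x|lborel. cmod (f x * g x)) \<le> 2 * (norm_L2 f * norm_L2 g)"
proof -
  have m: "f \<in> borel_measurable borel" "g \<in> borel_measurable borel" and i: "integrable lborel (\<lambda>x. (cmod (f x))\<^sup>2)" "integrable lborel (\<lambda>x. (cmod (g x))\<^sup>2)"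
    using f g by (auto simp: bL2_iff)
  show fg: "integrable lborel (\<lambda>x. f x * g x)" by (rule integrable_mult_L2[OF _ _ i]) (use m in auto)
  define X where "X = (LINT x|lborel. cmod (f x * g x))"
  define A B where "A = norm_L2 f" and "B = norm_L2 g"
  have AB: "0 \<le> A" "0 \<le> B" "(LINT x|lborel. (cmod (f x))\<^sup>2) = A\<^sup>2" "(LINT x|lborel. (cmod (g x))\<^sup>2) = B\<^sup>2"
    using bL2_affine(2)[OF f f] bL2_affine(2)[OF g g] by (auto simp: A_def B_def norm_L2_borel[OF m(1)] norm_L2_borel[OF m(2)])
  have w: "X \<le> A\<^sup>2 / d + d * B\<^sup>2" if d: "d > 0" for d
  proof -
    have "X \<le> (LINT x|lborel. (cmod (f x))\<^sup>2 / d + d * (cmod (g x))\<^sup>2)"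
      unfolding X_def
    proof (rule integral_mono)
      show "integrable lborel (\<lambda>x. cmod (f x * g x))" using fg by (rule integrable_norm)
      show "integrable lborel (\<lambda>x. (cmod (f x))\<^sup>2 / d + d * (cmod (g x))\<^sup>2)" using i by auto
      show "cmod (f x * g x) \<le> (cmod (f x))\<^sup>2 / d + d * (cmod (g x))\<^sup>2" for x
        unfolding norm_mult by (rule mult_le_weighted_sq[OF d])
    qed
    also have "\<dots> = A\<^sup>2 / d + d * B\<^sup>2" using i by (simp add: AB)
    finally show ?thesis .
  qed
  have "X \<le> 2 * (A * B) + e" if e: "e > 0" for e
  proof -
    \<comment> \<open>The weight \<open>d = (A + h) / (B + h)\<close> is nearly the optimal one; the
      positive \<open>h\<close> keeps it defined when a norm vanishes and costs at most
      \<open>e\<close>.\<close>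
    define h where "h = e / (A + B + 1)"
    have h: "h > 0" "h * (A + B) \<le> e" using e AB(1,2) by (auto simp: h_def field_simps)
    have p: "A + h > 0" "B + h > 0" using AB h by auto
    have "A * A \<le> (A + h) * A" using AB h by (intro mult_right_mono) auto
    then have "A\<^sup>2 / (A + h) \<le> A" using p by (simp add: pos_divide_le_eq power2_eq_square mult_ac)
    then have "A\<^sup>2 / (A + h) * (B + h) \<le> A * (B + h)" using p by (intro mult_right_mono) auto
    moreover have "B * B \<le> (B + h) * B" using AB h by (intro mult_right_mono) auto
    then have "B\<^sup>2 / (B + h) \<le> B" using p by (simp add: pos_divide_le_eq power2_eq_square mult_ac)
    then have "(A + h) * (B\<^sup>2 / (B + h)) \<le> (A + h) * B" using p by (intro mult_left_mono) auto
    moreover have "X \<le> A\<^sup>2 / ((A + h) / (B + h)) + (A + h) / (B + h) * B\<^sup>2" by (rule w) (use p in auto)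
    ultimately have "X \<le> A * (B + h) + (A + h) * B" by simp
    also have "\<dots> = 2 * (A * B) + h * (A + B)" by (simp add: algebra_simps)
    finally show ?thesis using h(2) by linarith
  qed
  then have "X \<le> 2 * (A * B)" by (rule field_le_epsilon)
  then show "(LINT x|lborel. cmod (f x * g x)) \<le> 2 * (norm_L2 f * norm_L2 g)" by (simp add: X_def A_def B_def)
qed

text \<open>The first component of a slot gives the kind of factor of the momentum integrand: 0 for a wave
  function, 1 for the potential at an integration variable, 2 for the potential at a dependent momentum,
  3 for a resolvent. Each variable meets exactly one integrable factor, so all other factors only need to
  be bounded.\<close>
definition slot_mem :: "nat \<times> nat \<Rightarrow> (real^'d \<Rightarrow> complex) \<Rightarrow> bool" where
  "slot_mem s = (if fst s = 0 then bL2 else if fst s = 1 then bL1 else bLinf)"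

definition slot_nrm :: "nat \<times> nat \<Rightarrow> (real^'d \<Rightarrow> complex) \<Rightarrow> real" where
  "slot_nrm s = (if fst s = 0 then norm_L2 else if fst s = 1 then norm_L1 else norm_Linf)"

lemma slot_affine:
  assumes "slot_mem s f" "slot_mem s g"
  shows "slot_mem s (\<lambda>x. f x + c * g x)" "slot_nrm s f \<ge> 0" "slot_nrm s (\<lambda>x. f x + c * g x) \<le> 2 * (slot_nrm s f + cmod c * slot_nrm s g)"
proof -
  consider "fst s = 0" | "fst s = 1" | "2 \<le> fst s" by linarith
  then have "slot_mem s (\<lambda>x. f x + c * g x) \<and> slot_nrm s f \<ge> 0 \<and> slot_nrm s (\<lambda>x. f x + c * g x) \<le> 2 * (slot_nrm s f + cmod c * slot_nrm s g)"
  proof cases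
    case 1
    then show ?thesis using assms bL2_affine(1,3)[of f g c] bL2_affine(2)[of f g] by (simp add: slot_mem_def slot_nrm_def)
  next
    case 2
    then show ?thesis using assms bL1_affine(1,3)[of f g c] bL1_affine(2)[of f g] by (simp add: slot_mem_def slot_nrm_def)
  next
    case 3
    then show ?thesis using assms bLinf_affine(1,3)[of f g c] bLinf_affine(2)[of f g] by (simp add: slot_mem_def slot_nrm_def)
  qed
  then show "slot_mem s (\<lambda>x. f x + c * g x)" "slot_nrm s f \<ge> 0" "slot_nrm s (\<lambda>x. f x + c * g x) \<le> 2 * (slot_nrm s f + cmod c * slot_nrm s g)" by auto
qed

lemma slot_borel: "slot_mem s f \<Longrightarrow> f \<in> borel_measurable borel"
  by (auto simp: slot_mem_def bL1_iff bL2_iff bLinf_def split: if_splits)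

definition slots :: "nat set \<Rightarrow> nat \<Rightarrow> (nat \<times> nat) set \<Rightarrow> (nat \<times> nat) set" where
  "slots D n S = insert (0, 0) (insert (0, 1) (Pair 1 ` (D - {n}) \<union> S))"

lemma prod_slots:
  assumes "finite D" "finite S" "\<forall>s\<in>S. 2 \<le> fst s"
  shows "(\<Prod>s\<in>slots D n S. f s) = f (0, 0) * f (0, 1) * (\<Prod>j\<in>D - {n}. f (1, j)) * (\<Prod>s\<in>S. f s)"
proof -
  have S: "(0, i) \<notin> S" "(Suc 0, i) \<notin> S" for i
    using bspec[OF assms(3), of "(0, i)"] bspec[OF assms(3), of "(Suc 0, i)"] by auto
  have "(0, 0) \<notin> insert (0, 1) (Pair 1 ` (D - {n}) \<union> S)" "(0, 1) \<notin> Pair 1 ` (D - {n}) \<union> S" "Pair 1 ` (D - {n}) \<inter> S = {}"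
    using S by auto
  then have "(\<Prod>s\<in>slots D n S. f s) = f (0, 0) * (f (0, 1) * (prod f (Pair 1 ` (D - {n})) * prod f S))"
    using assms(1,2) by (simp add: slots_def prod.union_disjoint)
  also have "prod f (Pair 1 ` (D - {n})) = (\<Prod>j\<in>D - {n}. f (1, j))" by (subst prod.reindex) (simp_all add: inj_on_def)
  finally show ?thesis by (simp only: mult.assoc)
qed

text \<open>Cauchy-Schwarz merges the two wave functions into one integrable function of
  \<open>x n\<close>, and every other variable has its own \<open>L1\<close> factor. The factors in
  \<open>S\<close> are essentially bounded, and \<open>nonsing\<close> carries these bounds over to
  their arguments.\<close>

lemma slot_integral_bound:
  fixes F :: "nat \<times> nat \<Rightarrow> real^'d \<Rightarrow> complex" and arg :: "nat \<times> nat \<Rightarrow> (nat \<Rightarrow> real^'d) \<Rightarrow> real^'d"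
  assumes D: "finite D" "n \<in> D" and S: "finite S" "\<And>s. s \<in> S \<Longrightarrow> 2 \<le> fst s" "\<And>s. s \<in> S \<Longrightarrow> nonsing D (arg s)"
    and arg: "\<And>i x. arg (0, i) x = x n" "\<And>j x. arg (1, j) x = x j"
    and F: "\<And>s. s \<in> slots D n S \<Longrightarrow> slot_mem s (F s)"
  shows "integrable (PiM D (\<lambda>_. lborel)) (\<lambda>x. \<Prod>s\<in>slots D n S. F s (arg s x))"
    "cmod (LINT x|PiM D (\<lambda>_. lborel). (\<Prod>s\<in>slots D n S. F s (arg s x))) \<le> 2 * (\<Prod>s\<in>slots D n S. slot_nrm s (F s))"
proof -
  interpret product_sigma_finite "\<lambda>_::nat. lborel :: (real^'d) measure" ..
  have S2: "\<forall>s\<in>S. 2 \<le> fst s" using S(2) by blast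
  define C where "C l = (if l = n then (\<lambda>y. F (0, 0) y * F (0, 1) y) else F (1, l))" for l
  have F0: "bL2 (F (0, 0))" "bL2 (F (0, 1))" using F[of "(0, 0)"] F[of "(0, 1)"] by (simp_all add: slots_def slot_mem_def)
  have F1: "bL1 (F (1, j))" if "j \<in> D - {n}" for j using F[of "(1, j)"] that by (simp add: slots_def slot_mem_def)
  have F2: "bLinf (F s)" if "s \<in> S" for s using F[of s] that S(2)[OF that] by (auto simp: slots_def slot_mem_def)
  have Ci: "integrable lborel (C l)" if "l \<in> D" for l
    using cauchy_schwarz_L2(1)[OF F0] F1[of l] that by (auto simp: C_def bL1_iff)
  define H where "H x = (\<Prod>s\<in>S. F s (arg s x))" for x
  have split: "(\<Prod>s\<in>slots D n S. F s (arg s x)) = (\<Prod>l\<in>D. C l (x l)) * H x" for x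
  proof -
    have "(\<Prod>l\<in>D. C l (x l)) = C n (x n) * (\<Prod>l\<in>D - {n}. C l (x l))" by (rule prod.remove[OF D])
    also have "(\<Prod>l\<in>D - {n}. C l (x l)) = (\<Prod>l\<in>D - {n}. F (1, l) (x l))" by (rule prod.cong) (auto simp: C_def)
    finally show ?thesis unfolding prod_slots[OF D(1) S(1) S2] by (simp add: arg H_def C_def del: One_nat_def)
  qed
  have Pi: "integrable (PiM D (\<lambda>_. lborel)) (\<lambda>x. \<Prod>l\<in>D. C l (x l))" by (rule product_integrable_prod[OF D(1) Ci])
  have Hm: "H \<in> borel_measurable (PiM D (\<lambda>_. lborel))"
    unfolding H_def[abs_def]
  proof (rule borel_measurable_prod)
    fix s assume s: "s \<in> S"
    have as: "arg s \<in> borel_measurable (PiM D (\<lambda>_. lborel))" using S(3)[OF s] by (simp add: nonsing_def)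
    have Fs: "F s \<in> borel_measurable borel" using F2[OF s] by (simp add: bLinf_def)
    show "(\<lambda>x. F s (arg s x)) \<in> borel_measurable (PiM D (\<lambda>_. lborel))" by (rule measurable_compose[OF as Fs])
  qed
  define K where "K = (\<Prod>s\<in>S. norm_Linf (F s))"
  have "AE x in PiM D (\<lambda>_. lborel). \<forall>s\<in>S. cmod (F s (arg s x)) \<le> norm_Linf (F s)"
    unfolding AE_finite_all[OF S(1)]
  proof
    fix s assume s: "s \<in> S"
    have "in_Linf (F s)" using F2[OF s] by (simp add: bLinf_def)
    from nonsing_AE[OF S(3)[OF s] in_Linf_AE(1)[OF this]]
    show "AE x in PiM D (\<lambda>_. lborel). cmod (F s (arg s x)) \<le> norm_Linf (F s)" .
  qed
  then have Hb: "AE x in PiM D (\<lambda>_. lborel). cmod (H x) \<le> K"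
    unfolding H_def K_def prod_norm[symmetric] by eventually_elim (auto intro!: prod_mono)
  have K0: "0 \<le> K" unfolding K_def by (intro prod_nonneg ballI in_Linf_AE(2)) (use F2 in \<open>auto simp: bLinf_def\<close>)
  show I: "integrable (PiM D (\<lambda>_. lborel)) (\<lambda>x. \<Prod>s\<in>slots D n S. F s (arg s x))"
    unfolding split by (rule integrable_mult_bounded[OF Pi Hm Hb])
  have "cmod (LINT x|PiM D (\<lambda>_. lborel). (\<Prod>s\<in>slots D n S. F s (arg s x))) \<le> (LINT x|PiM D (\<lambda>_. lborel). (\<Prod>l\<in>D. cmod (C l (x l))) * K)"
  proof (rule order_trans[OF integral_norm_bound], rule integral_mono_AE)
    show "integrable (PiM D (\<lambda>_. lborel)) (\<lambda>x. cmod (\<Prod>s\<in>slots D n S. F s (arg s x)))" using I by (rule integrable_norm)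
    show "integrable (PiM D (\<lambda>_. lborel)) (\<lambda>x. (\<Prod>l\<in>D. cmod (C l (x l))) * K)"
      using integrable_norm[OF Pi] by (simp add: prod_norm)
    show "AE x in PiM D (\<lambda>_. lborel). cmod (\<Prod>s\<in>slots D n S. F s (arg s x)) \<le> (\<Prod>l\<in>D. cmod (C l (x l))) * K"
      using Hb by eventually_elim (auto simp: split norm_mult prod_norm intro!: mult_left_mono)
  qed
  also have "\<dots> = (\<Prod>l\<in>D. LINT y|lborel. cmod (C l y)) * K"
    by (simp add: product_integral_prod[OF D(1) integrable_norm[OF Ci]])
  also have "(\<Prod>l\<in>D. LINT y|lborel. cmod (C l y)) = (LINT y|lborel. cmod (C n y)) * (\<Prod>l\<in>D - {n}. LINT y|lborel. cmod (C l y))"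
    by (rule prod.remove[OF D])
  also have "(\<Prod>l\<in>D - {n}. LINT y|lborel. cmod (C l y)) = (\<Prod>l\<in>D - {n}. norm_L1 (F (1, l)))"
    using F1 by (intro prod.cong) (auto simp: C_def norm_L1_borel bL1_iff)
  also have "(LINT y|lborel. cmod (C n y)) * (\<Prod>l\<in>D - {n}. norm_L1 (F (1, l))) * K \<le> 2 * (norm_L2 (F (0, 0)) * norm_L2 (F (0, 1))) * (\<Prod>l\<in>D - {n}. norm_L1 (F (1, l))) * K"
    using cauchy_schwarz_L2(2)[OF F0] F1 K0 by (intro mult_right_mono prod_nonneg) (auto simp: C_def intro: bL1_affine(2))
  also have "\<dots> = 2 * (\<Prod>s\<in>slots D n S. slot_nrm s (F s))"
  proof -
    have "(\<Prod>s\<in>S. slot_nrm s (F s)) = K" unfolding K_def using S(2) by (intro prod.cong) (fastforce simp: slot_nrm_def)+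
    then show ?thesis unfolding prod_slots[OF D(1) S(1) S2] by (simp add: slot_nrm_def mult_ac)
  qed
  finally show "cmod (LINT x|PiM D (\<lambda>_. lborel). (\<Prod>s\<in>slots D n S. F s (arg s x))) \<le> 2 * (\<Prod>s\<in>slots D n S. slot_nrm s (F s))" .
qed

lemma slot_integral_holomorphic:
  fixes A :: "nat \<times> nat \<Rightarrow> complex \<Rightarrow> real^'d \<Rightarrow> complex" and arg :: "nat \<times> nat \<Rightarrow> (nat \<Rightarrow> real^'d) \<Rightarrow> real^'d"
  assumes D: "finite D" "n \<in> D" and S: "finite S" "\<And>s. s \<in> S \<Longrightarrow> 2 \<le> fst s" "\<And>s. s \<in> S \<Longrightarrow> nonsing D (arg s)"
    and arg: "\<And>i x. arg (0, i) x = x n" "\<And>j x. arg (1, j) x = x j"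
    and ana: "\<And>s. s \<in> slots D n S \<Longrightarrow> analytic_into (slot_mem s) (slot_nrm s) U (A s)"
  shows "(\<lambda>z. LINT x|PiM D (\<lambda>_. lborel). (\<Prod>s\<in>slots D n S. A s z (arg s x))) holomorphic_on U"
proof (rule multilinear_holomorphic[where \<Phi> = "\<lambda>F. LINT x|PiM D (\<lambda>_. lborel). (\<Prod>s\<in>slots D n S. F s (arg s x))"
      and I = "slots D n S" and mem = slot_mem and nrm = slot_nrm and C = 2 and A = A])
  show fI: "finite (slots D n S)" using D S by (simp add: slots_def)
  show "cmod (LINT x|PiM D (\<lambda>_. lborel). (\<Prod>s\<in>slots D n S. F s (arg s x))) \<le> 2 * (\<Prod>s\<in>slots D n S. slot_nrm s (F s))"
    if "\<And>j. j \<in> slots D n S \<Longrightarrow> slot_mem j (F j)" for F by (rule slot_integral_bound(2)[OF D S arg that])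
  show "(LINT x|PiM D (\<lambda>_. lborel). (\<Prod>s\<in>slots D n S. F s (arg s x))) = (LINT x|PiM D (\<lambda>_. lborel). (\<Prod>s\<in>slots D n S. F' s (arg s x)))"
    if "\<And>j. j \<in> slots D n S \<Longrightarrow> F j = F' j" for F F' using that by simp
  fix i and F :: "nat \<times> nat \<Rightarrow> real^'d \<Rightarrow> complex" and f g :: "real^'d \<Rightarrow> complex" and c
  assume i: "i \<in> slots D n S" and Fm: "\<And>j. j \<in> slots D n S \<Longrightarrow> slot_mem j (F j)" and f: "slot_mem i f" and g: "slot_mem i g"
  have int: "integrable (PiM D (\<lambda>_. lborel)) (\<lambda>x. \<Prod>s\<in>slots D n S. (F(i := h)) s (arg s x))" if "slot_mem i h" for h :: "real^'d \<Rightarrow> complex"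
    by (rule slot_integral_bound(1)[OF D S arg]) (use that Fm in auto)
  have pr: "(\<Prod>s\<in>slots D n S. (F(i := h)) s (arg s x)) = h (arg i x) * (\<Prod>s\<in>slots D n S - {i}. F s (arg s x))" for h :: "real^'d \<Rightarrow> complex" and x
    unfolding prod.remove[OF fI i] by (auto intro!: arg_cong2[where f = "(*)"] prod.cong)
  show "(LINT x|PiM D (\<lambda>_. lborel). (\<Prod>s\<in>slots D n S. (F(i := \<lambda>x. f x + c * g x)) s (arg s x)))
     = (LINT x|PiM D (\<lambda>_. lborel). (\<Prod>s\<in>slots D n S. (F(i := f)) s (arg s x))) + c * (LINT x|PiM D (\<lambda>_. lborel). (\<Prod>s\<in>slots D n S. (F(i := g)) s (arg s x)))"
    using int[OF f] int[OF g] unfolding pr by (simp add: distrib_right mult.assoc)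
qed (use slot_affine ana in auto)

text \<open>The block representatives whose momentum transfer is not identically zero; for singleton blocks the
  transfer vanishes and the potential contributes the constant \<open>b 0\<close>.\<close>
definition tied_reps :: "nat \<Rightarrow> (nat \<Rightarrow> nat) \<Rightarrow> nat set" where
  "tied_reps n c = {j \<in> c ` {..<n}. \<exists>i<n. i \<notin> c ` {..<n} \<and> c i = j}"

definition bounded_slots :: "nat \<Rightarrow> (nat \<Rightarrow> nat) \<Rightarrow> (nat \<times> nat) set" where
  "bounded_slots n c = Pair 2 ` tied_reps n c \<union> Pair 3 ` {..n}"

definition slot_arg :: "nat \<Rightarrow> (nat \<Rightarrow> nat) \<Rightarrow> nat \<times> nat \<Rightarrow> (nat \<Rightarrow> real^'d) \<Rightarrow> real^'d" where
  "slot_arg n c s x = (if fst s = 0 then x n else if fst s = 1 then x (snd s) else if fst s = 2 then ext_mom n c x (snd s)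
     else x n - (\<Sum>i = snd s..<n. ext_mom n c x i))"

text \<open>The transfer of a tied representative contains some free variable of its block with
  coefficient -1. For a singleton block it would be constantly zero and the claim would
  fail.\<close>

lemma nonsing_tied:
  assumes c: "c \<in> reps n" and j: "j \<in> tied_reps n c"
  shows "nonsing (free_idx n c) (\<lambda>x :: nat \<Rightarrow> real^'d. ext_mom n c x j)"
proof -
  define T where "T = {i. i < n \<and> i \<notin> c ` {..<n} \<and> c i = j}"
  have fT: "finite T" by (simp add: T_def)
  obtain l where l: "l \<in> T" using j by (auto simp: tied_reps_def T_def)
  have lD: "l \<in> free_idx n c" using l by (simp add: T_def free_idx_def)
  have jn: "j \<le> n" using j reps_props(1)[OF c] unfolding tied_reps_def by fastforce
  have e: "ext_mom n c x j = - (\<Sum>i\<in>T. x i)" for x :: "nat \<Rightarrow> real^'d"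
    using j by (simp add: ext_mom_def T_def tied_reps_def)
  show ?thesis
  proof (rule nonsingI[OF _ lD ext_mom_measurable[OF c jn]])
    show "finite (free_idx n c)" by (simp add: free_idx_def)
    show "(-1::real) \<noteq> 0" by simp
    fix x :: "nat \<Rightarrow> real^'d" and y
    have "(\<Sum>i\<in>T. (x(l := y)) i) = y + (\<Sum>i\<in>T - {l}. x i)"
      unfolding sum.remove[OF fT l] by (auto intro!: sum.cong arg_cong2[where f = "(+)"])
    then show "ext_mom n c (x(l := y)) j = - (\<Sum>i\<in>T - {l}. x i) + (-1) *\<^sub>R y" by (simp add: e)
  qed
qed

lemma ext_mom_upd_last: "j < n \<Longrightarrow> ext_mom n c (x(n := y)) j = ext_mom n c x j"
  by (auto simp: ext_mom_def intro!: sum.cong)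

text \<open>The outgoing momentum appears with coefficient 1 and does not enter any of the transfers
  that are subtracted.\<close>

lemma nonsing_resolvent_arg:
  assumes c: "c \<in> reps n"
  shows "nonsing (free_idx n c) (\<lambda>x :: nat \<Rightarrow> real^'d. x n - (\<Sum>i = j..<n. ext_mom n c x i))"
proof (rule nonsingI[where l = n])
  have nD: "n \<in> free_idx n c" using free_idx_insert(1)[OF c] by simp
  show "finite (free_idx n c)" by (simp add: free_idx_def)
  show "n \<in> free_idx n c" by (rule nD)
  show "(1::real) \<noteq> 0" by simp
  have "(\<lambda>x. x n) \<in> borel_measurable (PiM (free_idx n c) (\<lambda>_. lborel :: (real^'d) measure))"
    using measurable_component_singleton[OF nD, of "\<lambda>_. lborel"] by (simp add: measurable_lborel1)
  then show "(\<lambda>x. x n - (\<Sum>i = j..<n. ext_mom n c x i)) \<in> borel_measurable (PiM (free_idx n c) (\<lambda>_. lborel :: (real^'d) measure))"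
    by (intro borel_measurable_diff borel_measurable_sum ext_mom_measurable[OF c]) auto
  show "(x(n := y)) n - (\<Sum>i = j..<n. ext_mom n c (x(n := y)) i) = - (\<Sum>i = j..<n. ext_mom n c x i) + 1 *\<^sub>R y" for x and y :: "real^'d"
    by (simp add: ext_mom_upd_last)
qed

lemma slot_arg_nonsing:
  assumes c: "c \<in> reps n" and s: "s \<in> slots (free_idx n c) n (bounded_slots n c)"
  shows "nonsing (free_idx n c) (slot_arg n c s :: (nat \<Rightarrow> real^'d) \<Rightarrow> real^'d)"
proof -
  have nD: "n \<in> free_idx n c" using free_idx_insert(1)[OF c] by simp
  have fD: "finite (free_idx n c)" by (simp add: free_idx_def)
  consider "fst s = 0" | j where "s = (1, j)" "j \<in> free_idx n c" | j where "s = (2, j)" "j \<in> tied_reps n c" | j where "s = (3, j)"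
    using s unfolding slots_def bounded_slots_def by fastforce
  then show ?thesis
  proof cases
    case 1
    then have "slot_arg n c s = (\<lambda>x :: nat \<Rightarrow> real^'d. x n)" by (simp add: slot_arg_def fun_eq_iff)
    then show ?thesis using nonsing_component[OF fD nD] by simp
  next
    case 2
    then have "slot_arg n c s = (\<lambda>x :: nat \<Rightarrow> real^'d. x j)" by (simp add: slot_arg_def fun_eq_iff)
    then show ?thesis using nonsing_component[OF fD 2(2)] by simp
  next
    case 3
    then have "slot_arg n c s = (\<lambda>x :: nat \<Rightarrow> real^'d. ext_mom n c x j)" by (simp add: slot_arg_def fun_eq_iff)
    then show ?thesis using nonsing_tied[OF c 3(2)] by simp
  next
    case 4
    then have "slot_arg n c s = (\<lambda>x :: nat \<Rightarrow> real^'d. x n - (\<Sum>i = j..<n. ext_mom n c x i))" by (simp add: slot_arg_def fun_eq_iff)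
    then show ?thesis using nonsing_resolvent_arg[OF c] by simp
  qed
qed

section \<open>Real dilations as a change of variables\<close>

lemma lborel_scaling:
  assumes t: "t > 0"
  shows "(lborel :: (real^'d) measure) = density (distr lborel borel (\<lambda>x. t *\<^sub>R x)) (\<lambda>_. ennreal (t ^ CARD('d)))"
  using lborel_affine[of t "0 :: real^'d"] t by simp

lemma emeasure_lborel_scaling:
  fixes A :: "(real^'d) set"
  assumes t: "t > 0" and A: "A \<in> sets borel"
  shows "emeasure lborel A = ennreal (t ^ CARD('d)) * emeasure lborel ((\<lambda>x. t *\<^sub>R x) -` A)"
proof -
  have m: "(\<lambda>x. t *\<^sub>R x) \<in> measurable lborel (borel :: (real^'d) measure)" by simp
  have "emeasure lborel A = emeasure (density (distr lborel borel (\<lambda>x. t *\<^sub>R x)) (\<lambda>_. ennreal (t ^ CARD('d)))) A"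
    using lborel_scaling[OF t, where 'd = 'd] by simp
  also have "\<dots> = ennreal (t ^ CARD('d)) * emeasure (distr lborel borel (\<lambda>x. t *\<^sub>R x)) A"
    using A by (subst emeasure_density_const) auto
  also have "emeasure (distr lborel borel (\<lambda>x. t *\<^sub>R x)) A = emeasure lborel ((\<lambda>x. t *\<^sub>R x) -` A)"
    using A by (subst emeasure_distr[OF m]) auto
  finally show ?thesis .
qed

lemma PiM_lborel_scaling:
  fixes D :: "nat set"
  assumes D: "finite D" and t: "t > 0"
  shows "PiM D (\<lambda>_. lborel :: (real^'d) measure) =
    density (distr (PiM D (\<lambda>_. lborel)) (PiM D (\<lambda>_. lborel)) (\<lambda>x. \<lambda>i\<in>D. t *\<^sub>R x i)) (\<lambda>_. ennreal ((t ^ CARD('d)) ^ card D))"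
    (is "?P = density (distr ?P ?P ?S) _")
proof (rule sym, rule product_sigma_finite.PiM_eqI)
  interpret product_sigma_finite "\<lambda>_::nat. lborel :: (real^'d) measure" ..
  show "product_sigma_finite (\<lambda>_::nat. lborel :: (real^'d) measure)" ..
  show "finite D" by (rule D)
  show "sets (density (distr ?P ?P ?S) (\<lambda>_. ennreal ((t ^ CARD('d)) ^ card D))) = sets ?P" by simp
  have Sm: "?S \<in> measurable ?P ?P"
  proof (rule measurable_restrict)
    fix i assume "i \<in> D"
    from measurable_component_singleton[OF this, of "\<lambda>_. lborel :: (real^'d) measure"]
    have "(\<lambda>x. x i) \<in> borel_measurable ?P" by (simp add: measurable_lborel1)
    then show "(\<lambda>x. t *\<^sub>R x i) \<in> measurable ?P lborel" by (simp add: measurable_lborel1)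
  qed
  fix A assume A: "\<And>i. i \<in> D \<Longrightarrow> A i \<in> sets (lborel :: (real^'d) measure)"
  have Am: "PiE D A \<in> sets ?P" using A D by (intro sets_PiM_I_finite) auto
  have pre: "?S -` PiE D A \<inter> space ?P = PiE D (\<lambda>i. (\<lambda>x. t *\<^sub>R x) -` A i)"
    by (auto simp: space_PiM PiE_iff extensional_def)
  have mA: "(\<lambda>x. t *\<^sub>R x) -` A i \<in> sets lborel" if "i \<in> D" for i
    using measurable_sets[of "\<lambda>x::real^'d. t *\<^sub>R x" borel borel "A i"] A[OF that] by simp
  have "emeasure (density (distr ?P ?P ?S) (\<lambda>_. ennreal ((t ^ CARD('d)) ^ card D))) (PiE D A)
     = ennreal ((t ^ CARD('d)) ^ card D) * emeasure ?P (PiE D (\<lambda>i. (\<lambda>x. t *\<^sub>R x) -` A i))"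
    using Am by (subst emeasure_density_const) (simp_all add: emeasure_distr[OF Sm] pre)
  also have "emeasure ?P (PiE D (\<lambda>i. (\<lambda>x. t *\<^sub>R x) -` A i)) = (\<Prod>i\<in>D. emeasure lborel ((\<lambda>x. t *\<^sub>R x) -` A i))"
    by (rule emeasure_PiM[OF D mA])
  also have "ennreal ((t ^ CARD('d)) ^ card D) * (\<Prod>i\<in>D. emeasure lborel ((\<lambda>x. t *\<^sub>R x) -` A i)) = (\<Prod>i\<in>D. emeasure lborel (A i))"
  proof -
    have pw: "ennreal ((t ^ CARD('d)) ^ card D) = (\<Prod>i\<in>D. ennreal (t ^ CARD('d)))" using t by (simp add: ennreal_power)
    show ?thesis unfolding pw prod.distrib[symmetric]
      using A by (intro prod.cong refl) (simp add: emeasure_lborel_scaling[OF t, symmetric])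
  qed
  finally show "emeasure (density (distr ?P ?P ?S) (\<lambda>_. ennreal ((t ^ CARD('d)) ^ card D))) (PiE D A) = (\<Prod>i\<in>D. emeasure lborel (A i))" .
qed

lemma integral_PiM_scaling:
  fixes D :: "nat set" and H :: "(nat \<Rightarrow> real^'d) \<Rightarrow> complex"
  assumes D: "finite D" and t: "t > 0" and H: "H \<in> borel_measurable (PiM D (\<lambda>_. lborel))"
  shows "(LINT x|PiM D (\<lambda>_. lborel). H x) = of_real ((t ^ CARD('d)) ^ card D) * (LINT x|PiM D (\<lambda>_. lborel). H (\<lambda>i\<in>D. t *\<^sub>R x i))"
    (is "(LINT x|?P. H x) = of_real ?k * _")
proof -
  let ?S = "\<lambda>x. \<lambda>i\<in>D. t *\<^sub>R x i"
  have Sm: "?S \<in> measurable ?P ?P"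
  proof (rule measurable_restrict)
    fix i assume "i \<in> D"
    from measurable_component_singleton[OF this, of "\<lambda>_. lborel :: (real^'d) measure"]
    have "(\<lambda>x. x i) \<in> borel_measurable ?P" by (simp add: measurable_lborel1)
    then show "(\<lambda>x. t *\<^sub>R x i) \<in> measurable ?P lborel" by (simp add: measurable_lborel1)
  qed
  have Hd: "H \<in> borel_measurable (distr ?P ?P ?S)" using H by simp
  have "(LINT x|?P. H x) = (LINT x|density (distr ?P ?P ?S) (\<lambda>_. ennreal ?k). H x)"
    using PiM_lborel_scaling[OF D t, where 'd = 'd] by simp
  also have "\<dots> = (LINT x|distr ?P ?P ?S. ?k *\<^sub>R H x)" by (rule integral_density[OF Hd]) (use t in auto)
  also have "\<dots> = ?k *\<^sub>R (LINT x|distr ?P ?P ?S. H x)" by simp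
  also have "(LINT x|distr ?P ?P ?S. H x) = (LINT x|?P. H (?S x))" by (rule integral_distr[OF Sm H])
  finally show ?thesis by (simp add: scaleR_conv_of_real)
qed

text \<open>The factors after scaling all momenta by \<open>exp t\<close>. Potentials carry the
  normalization of the unitary dilation, because their hypothesis is stated for it, while the
  hypothesis on the wave functions concerns plain dilation. The difference is compensated in
  \<open>slot_amp\<close>.\<close>

definition scaled_slot :: "(real^'d \<Rightarrow> complex) \<Rightarrow> (real^'d \<Rightarrow> complex) \<Rightarrow> (real^'d \<Rightarrow> complex) \<Rightarrow> complex \<Rightarrow> real \<Rightarrow> nat \<times> nat \<Rightarrow> real^'d \<Rightarrow> complex" where
  "scaled_slot b g1 g2 z t s y = (if s = (0, 0) then cnj (g1 (exp t *\<^sub>R y)) else if s = (0, 1) then g2 (exp t *\<^sub>R y)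
     else if fst s = 1 \<or> fst s = 2 then of_real (exp (real CARD('d) * t / 2)) * b (exp t *\<^sub>R y)
     else 1 / (of_real (exp (2 * t)) * of_real (nu y) - z))"

definition slot_count :: "nat \<Rightarrow> (nat \<Rightarrow> nat) \<Rightarrow> nat" where
  "slot_count n c = card (free_idx n c - {n}) + card (tied_reps n c)"

definition slot_int :: "nat \<Rightarrow> (nat \<Rightarrow> nat) \<Rightarrow> (nat \<times> nat \<Rightarrow> real^'d \<Rightarrow> complex) \<Rightarrow> complex" where
  "slot_int n c F = (LINT x|PiM (free_idx n c) (\<lambda>_. lborel). (\<Prod>s\<in>slots (free_idx n c) n (bounded_slots n c). F s (slot_arg n c s x)))"

text \<open>The exponent collects \<open>d * \<theta>\<close> per integration variable from the
  Jacobian, minus \<open>d * \<theta> / 2\<close> per slot of the potential, which undoes the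
  unitary normalization. The powers of \<open>b0\<close> come from singleton blocks, where the
  potential sits at momentum zero.\<close>

definition slot_amp :: "complex \<Rightarrow> nat \<Rightarrow> (nat \<Rightarrow> nat) \<Rightarrow> complex \<Rightarrow> (nat \<times> nat \<Rightarrow> real^'d \<Rightarrow> complex) \<Rightarrow> complex" where
  "slot_amp b0 n c \<theta> F = exp (of_real (real CARD('d) * (real (card (free_idx n c)) - real (slot_count n c) / 2)) * \<theta>) *
     b0 ^ card (c ` {..<n} - tied_reps n c) * slot_int n c F"

lemma nu_scaleR: "nu (t *\<^sub>R p) = t\<^sup>2 * nu p"
  by (simp add: nu_def power_mult_distrib)

lemma bounded_slots_props: "finite (bounded_slots n c)" "\<forall>s\<in>bounded_slots n c. 2 \<le> fst s"
  by (auto simp: bounded_slots_def tied_reps_def)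

text \<open>\<open>ext_mom\<close> is linear, so scaling the variables scales every momentum, and
  \<open>nu\<close> is quadratic. The exponential in front removes the normalizations that
  \<open>scaled_slot\<close> put in.\<close>

lemma T_term_scaled_integrand:
  fixes x :: "nat \<Rightarrow> real^'d" and t :: real
  assumes c: "c \<in> reps n"
  defines "y \<equiv> (\<lambda>i\<in>free_idx n c. exp t *\<^sub>R x i)"
  shows "cnj (g1 (y n)) * g2 (y n) * ((\<Prod>j<n. b (ext_mom n c y j)) * resprodR z n (y n) (ext_mom n c y))
    = of_real (exp (- (real CARD('d) * t / 2) * real (slot_count n c))) * b 0 ^ card (c ` {..<n} - tied_reps n c) *
      (\<Prod>s\<in>slots (free_idx n c) n (bounded_slots n c). scaled_slot b g1 g2 z t s (slot_arg n c s x))"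
proof -
  let ?D = "free_idx n c" and ?R = "c ` {..<n}" and ?T = "tied_reps n c" and ?u = "ext_mom n c x" and ?e = "exp (real CARD('d) * t / 2)"
  have D: "?D = insert n ({..<n} - ?R)" by (rule free_idx_insert(1)[OF c])
  have Rn: "?R \<subseteq> {..<n}" by (rule reps_props(1)[OF c])
  have TR: "?T \<subseteq> ?R" by (auto simp: tied_reps_def)
  have fin: "finite ?D" "finite ?T" "finite ?R" using TR by (auto simp: free_idx_def intro: finite_subset)
  have yn: "y n = exp t *\<^sub>R x n" by (simp add: y_def D)
  have ye: "ext_mom n c y j = exp t *\<^sub>R ?u j" if j: "j < n" for j
  proof (cases "j \<in> ?R")
    case True
    have "(\<Sum>i | i < n \<and> i \<notin> ?R \<and> c i = j. y i) = (\<Sum>i | i < n \<and> i \<notin> ?R \<and> c i = j. exp t *\<^sub>R x i)"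
      by (rule sum.cong) (auto simp: y_def D)
    then show ?thesis using True by (simp add: ext_mom_def scaleR_sum_right)
  next
    case False
    then have "j \<in> ?D" using j by (simp add: D)
    then show ?thesis using False by (simp add: ext_mom_def y_def)
  qed
  have res: "resprodR z n (y n) (ext_mom n c y) = (\<Prod>j\<le>n. 1 / (of_real (exp (2 * t)) * of_real (nu (x n - (\<Sum>i = j..<n. ?u i))) - z))"
    unfolding resprodR_def
  proof (rule prod.cong[OF refl])
    fix j
    have "(\<Sum>i = j..<n. ext_mom n c y i) = (\<Sum>i = j..<n. exp t *\<^sub>R ?u i)" by (rule sum.cong) (auto simp: ye)
    then have "y n - (\<Sum>i = j..<n. ext_mom n c y i) = exp t *\<^sub>R (x n - (\<Sum>i = j..<n. ?u i))"
      by (simp add: yn scaleR_sum_right scaleR_diff_right)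
    then show "1 / (of_real (nu (y n - (\<Sum>i = j..<n. ext_mom n c y i))) - z) = 1 / (of_real (exp (2 * t)) * of_real (nu (x n - (\<Sum>i = j..<n. ?u i))) - z)"
      by (simp add: nu_scaleR exp_double)
  qed
  \<comment> \<open>The \<open>n\<close> transfers are sorted into free variables, representatives
    tied to free variables, and representatives of singleton blocks, where the transfer is
    zero.\<close>
  have bs: "(\<Prod>j<n. b (ext_mom n c y j)) = (\<Prod>j\<in>?D - {n}. b (exp t *\<^sub>R x j)) * (\<Prod>j\<in>?T. b (exp t *\<^sub>R ?u j)) * b 0 ^ card (?R - ?T)"
  proof -
    let ?f = "\<lambda>j. b (exp t *\<^sub>R ?u j)"
    have DR: "(?D - {n}) \<inter> ?R = {}" by (auto simp: free_idx_def)
    have un: "{..<n} = (?D - {n}) \<union> (?T \<union> (?R - ?T))"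
    proof -
      have "?D - {n} = {..<n} - ?R" using D free_idx_insert(2)[OF c] by blast
      then show ?thesis using TR Rn by blast
    qed
    have "(\<Prod>j<n. b (ext_mom n c y j)) = prod ?f {..<n}" by (rule prod.cong) (auto simp: ye)
    also have "\<dots> = prod ?f ((?D - {n}) \<union> (?T \<union> (?R - ?T)))" by (rule arg_cong[OF un])
    also have "\<dots> = prod ?f (?D - {n}) * prod ?f (?T \<union> (?R - ?T))"
      by (rule prod.union_disjoint) (use fin DR TR in auto)
    also have "prod ?f (?T \<union> (?R - ?T)) = prod ?f ?T * prod ?f (?R - ?T)"
      by (rule prod.union_disjoint) (use fin in auto)
    also have "prod ?f (?R - ?T) = (\<Prod>j\<in>?R - ?T. b 0)"
    proof (rule prod.cong[OF refl])
      fix j assume j: "j \<in> ?R - ?T"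
      then have e: "{i. i < n \<and> i \<notin> ?R \<and> c i = j} = {}" unfolding tied_reps_def by blast
      have "j \<in> ?R" using j by blast
      then have "?u j = - (\<Sum>i | i < n \<and> i \<notin> ?R \<and> c i = j. x i)" by (simp add: ext_mom_def)
      then have "?u j = 0" unfolding e by simp
      then show "b (exp t *\<^sub>R ?u j) = b 0" by simp
    qed
    also have "prod ?f (?D - {n}) = (\<Prod>j\<in>?D - {n}. b (exp t *\<^sub>R x j))"
    proof (rule prod.cong[OF refl])
      fix j assume "j \<in> ?D - {n}"
      then have "j \<notin> ?R" using DR by blast
      then show "b (exp t *\<^sub>R ?u j) = b (exp t *\<^sub>R x j)" by (simp add: ext_mom_def)
    qed
    finally show ?thesis by (simp only: mult.assoc prod_constant)
  qed
  have dis: "Pair (2::nat) ` ?T \<inter> Pair 3 ` {..n} = {}" by auto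
  have sl: "(\<Prod>s\<in>slots ?D n (bounded_slots n c). scaled_slot b g1 g2 z t s (slot_arg n c s x))
    = cnj (g1 (exp t *\<^sub>R x n)) * g2 (exp t *\<^sub>R x n) * (of_real ?e ^ card (?D - {n}) * (\<Prod>j\<in>?D - {n}. b (exp t *\<^sub>R x j))) *
      ((of_real ?e ^ card ?T * (\<Prod>j\<in>?T. b (exp t *\<^sub>R ?u j))) * (\<Prod>j\<le>n. 1 / (of_real (exp (2 * t)) * of_real (nu (x n - (\<Sum>i = j..<n. ?u i))) - z)))"
    unfolding prod_slots[OF fin(1) bounded_slots_props]
    by (simp add: bounded_slots_def prod.union_disjoint[OF _ _ dis] fin prod.reindex inj_on_def scaled_slot_def slot_arg_def prod.distrib del: One_nat_def)
  have ex: "of_real (exp (- (real CARD('d) * t / 2) * real (slot_count n c))) * (of_real ?e ^ card (?D - {n}) * of_real ?e ^ card ?T) = (1 :: complex)"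
  proof -
    have "exp (- (real CARD('d) * t / 2) * real (slot_count n c)) * (?e ^ card (?D - {n}) * ?e ^ card ?T) = 1"
      by (simp add: slot_count_def power_add[symmetric] exp_of_nat_mult[symmetric] exp_add[symmetric] algebra_simps)
    then show ?thesis unfolding of_real_power[symmetric] of_real_mult[symmetric] by simp
  qed
  have "of_real (exp (- (real CARD('d) * t / 2) * real (slot_count n c))) * b 0 ^ card (?R - ?T) *
      (\<Prod>s\<in>slots ?D n (bounded_slots n c). scaled_slot b g1 g2 z t s (slot_arg n c s x))
    = (of_real (exp (- (real CARD('d) * t / 2) * real (slot_count n c))) * (of_real ?e ^ card (?D - {n}) * of_real ?e ^ card ?T)) *
      (cnj (g1 (exp t *\<^sub>R x n)) * g2 (exp t *\<^sub>R x n) * (((\<Prod>j\<in>?D - {n}. b (exp t *\<^sub>R x j)) * (\<Prod>j\<in>?T. b (exp t *\<^sub>R ?u j)) * b 0 ^ card (?R - ?T))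
      * (\<Prod>j\<le>n. 1 / (of_real (exp (2 * t)) * of_real (nu (x n - (\<Sum>i = j..<n. ?u i))) - z))))"
    unfolding sl by (simp only: mult_ac)
  then show ?thesis unfolding ex bs res unfolding yn mult_1 by (rule sym)
qed

text \<open>Substitution \<open>x \<mapsto> e^t x\<close> in the limit integral. The left side does
  not contain \<open>t\<close>, so the right side is constant along the real segment; this is the
  identity that is continued to complex parameters.\<close>

lemma T_term_eq_slot_amp:
  fixes b g1 g2 :: "real^'d \<Rightarrow> complex"
  assumes c: "c \<in> reps n" and m: "b \<in> borel_measurable borel" "g1 \<in> borel_measurable borel" "g2 \<in> borel_measurable borel"
    and F: "\<And>s. s \<in> slots (free_idx n c) n (bounded_slots n c) \<Longrightarrow> F s \<in> borel_measurable borel"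
      "\<And>s. s \<in> slots (free_idx n c) n (bounded_slots n c) \<Longrightarrow> AE y in lborel. F s y = scaled_slot b g1 g2 z t s y"
  shows "T_term b g1 g2 n z c = slot_amp (b 0) n c (of_real t) F"
proof -
  let ?D = "free_idx n c" and ?I = "slots (free_idx n c) n (bounded_slots n c)" and ?k = "card (c ` {..<n} - tied_reps n c)"
  let ?P = "PiM ?D (\<lambda>_. lborel :: (real^'d) measure)"
  have fD: "finite ?D" by (simp add: free_idx_def)
  have fI: "finite ?I" using fD bounded_slots_props(1) by (simp add: slots_def)
  have nD: "n \<in> ?D" using free_idx_insert(1)[OF c] by simp
  have xn: "(\<lambda>x. x n) \<in> borel_measurable ?P"
    using measurable_component_singleton[OF nD, of "\<lambda>_. lborel :: (real^'d) measure"] by (simp add: measurable_lborel1)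
  let ?H = "\<lambda>x. cnj (g1 (x n)) * g2 (x n) * ((\<Prod>j<n. b (ext_mom n c x j)) * resprodR z n (x n) (ext_mom n c x))"
  have Hm: "?H \<in> borel_measurable ?P"
    by (intro borel_measurable_times borel_measurable_prod resprodR_measurable xn ext_mom_measurable[OF c]
        measurable_compose[OF xn m(3)] measurable_compose[OF measurable_compose[OF xn m(2)] borel_measurable_cnj]
        measurable_compose[OF ext_mom_measurable[OF c] m(1)]) auto
  define E where "E = (of_real (exp (- (real CARD('d) * t / 2) * real (slot_count n c))) :: complex) * b 0 ^ ?k"
  have "T_term b g1 g2 n z c = of_real ((exp t ^ CARD('d)) ^ card ?D) * (LINT x|?P. ?H (\<lambda>i\<in>?D. exp t *\<^sub>R x i))"
    unfolding T_term_def by (rule integral_PiM_scaling[OF fD _ Hm]) simp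
  also have "(LINT x|?P. ?H (\<lambda>i\<in>?D. exp t *\<^sub>R x i)) = (LINT x|?P. E * (\<Prod>s\<in>?I. scaled_slot b g1 g2 z t s (slot_arg n c s x)))"
    unfolding E_def T_term_scaled_integrand[OF c] ..
  also have "\<dots> = E * (LINT x|?P. (\<Prod>s\<in>?I. scaled_slot b g1 g2 z t s (slot_arg n c s x)))" by simp
  also have "(LINT x|?P. (\<Prod>s\<in>?I. scaled_slot b g1 g2 z t s (slot_arg n c s x))) = slot_int n c F"
    unfolding slot_int_def
  proof (rule Bochner_Integration.integral_cong_AE)
    have am: "slot_arg n c s \<in> borel_measurable ?P" if "s \<in> ?I" for s by (rule conjunct1[OF slot_arg_nonsing[OF c that, unfolded nonsing_def]])
    have bc: "(\<lambda>y. cnj (g1 (exp t *\<^sub>R y))) \<in> borel_measurable borel"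
      by (intro measurable_compose[OF _ borel_measurable_cnj] measurable_compose[OF _ m(2)]) simp
    have g: "(\<lambda>y. g2 (exp t *\<^sub>R y)) \<in> borel_measurable borel" "(\<lambda>y. b (exp t *\<^sub>R y)) \<in> borel_measurable borel"
      by (intro measurable_compose[OF _ m(3)] measurable_compose[OF _ m(1)]; simp)+
    have ss: "scaled_slot b g1 g2 z t s \<in> borel_measurable borel" for s
      unfolding scaled_slot_def[abs_def] using bc g nu_borel by (cases "s = (0,0)"; cases "s = (0,1)"; cases "fst s = 1 \<or> fst s = 2"; simp)
    show "(\<lambda>x. \<Prod>s\<in>?I. scaled_slot b g1 g2 z t s (slot_arg n c s x)) \<in> borel_measurable ?P"
      by (intro borel_measurable_prod measurable_compose[OF am ss])
    show "(\<lambda>x. \<Prod>s\<in>?I. F s (slot_arg n c s x)) \<in> borel_measurable ?P"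
      by (intro borel_measurable_prod measurable_compose[OF am F(1)])
    have "AE x in ?P. \<forall>s\<in>?I. F s (slot_arg n c s x) = scaled_slot b g1 g2 z t s (slot_arg n c s x)"
      unfolding AE_finite_all[OF fI] by (intro ballI nonsing_AE[OF slot_arg_nonsing[OF c] F(2)])
    then show "AE x in ?P. (\<Prod>s\<in>?I. scaled_slot b g1 g2 z t s (slot_arg n c s x)) = (\<Prod>s\<in>?I. F s (slot_arg n c s x))"
      by eventually_elim simp
  qed
  also have "of_real ((exp t ^ CARD('d)) ^ card ?D) * (E * slot_int n c F) = slot_amp (b 0) n c (of_real t) F"
  proof -
    have "(exp t ^ CARD('d)) ^ card ?D * exp (- (real CARD('d) * t / 2) * real (slot_count n c))
      = exp (real CARD('d) * (real (card ?D) - real (slot_count n c) / 2) * t)"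
      by (simp add: exp_of_nat_mult[symmetric] power_mult[symmetric] exp_add[symmetric] algebra_simps)
    then have "of_real ((exp t ^ CARD('d)) ^ card ?D) * (of_real (exp (- (real CARD('d) * t / 2) * real (slot_count n c))) :: complex)
      = of_real (exp (real CARD('d) * (real (card ?D) - real (slot_count n c) / 2) * t))"
      unfolding of_real_mult[symmetric] by (rule arg_cong)
    also have "\<dots> = exp (of_real (real CARD('d) * (real (card ?D) - real (slot_count n c) / 2)) * of_real t)"
      unfolding exp_of_real[symmetric] of_real_mult ..
    finally have e: "of_real ((exp t ^ CARD('d)) ^ card ?D) * (of_real (exp (- (real CARD('d) * t / 2) * real (slot_count n c))) :: complex)
      = exp (of_real (real CARD('d) * (real (card ?D) - real (slot_count n c) / 2)) * of_real t)" .
    show ?thesis unfolding slot_amp_def E_def e[symmetric] by (simp only: mult.assoc)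
  qed
  finally show ?thesis .
qed

lemma integral_lborel_scaling:
  fixes H :: "real^'d \<Rightarrow> complex"
  assumes t: "t > 0" and H: "H \<in> borel_measurable borel"
  shows "(LINT x|lborel. H x) = of_real (t ^ CARD('d)) * (LINT x|lborel. H (t *\<^sub>R x))"
proof -
  have Sm: "(\<lambda>x. t *\<^sub>R x) \<in> measurable lborel (borel :: (real^'d) measure)" by simp
  have Hd: "H \<in> borel_measurable (distr lborel borel (\<lambda>x. t *\<^sub>R x))" using H by simp
  have "(LINT x|lborel. H x) = (LINT x|density (distr lborel borel (\<lambda>x. t *\<^sub>R x)) (\<lambda>_. ennreal (t ^ CARD('d))). H x)"
    using lborel_scaling[OF t, where 'd = 'd] by simp
  also have "\<dots> = (LINT x|distr lborel borel (\<lambda>x. t *\<^sub>R x). (t ^ CARD('d)) *\<^sub>R H x)" by (rule integral_density[OF Hd]) (use t in auto)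
  also have "\<dots> = (t ^ CARD('d)) *\<^sub>R (LINT x|distr lborel borel (\<lambda>x. t *\<^sub>R x). H x)" by simp
  also have "(LINT x|distr lborel borel (\<lambda>x. t *\<^sub>R x). H x) = (LINT x|lborel. H (t *\<^sub>R x))" by (rule integral_distr[OF Sm H])
  finally show ?thesis by (simp add: scaleR_conv_of_real)
qed

text \<open>Fourier transformation reverses the direction of a dilation, hence the sign of the
  parameter. The prefactor combines the unitary normalization with the Jacobian.\<close>

lemma ft_dil:
  fixes f :: "real^'d \<Rightarrow> complex"
  assumes f: "f \<in> borel_measurable borel"
  shows "ft (dil (- t) f) k = of_real (exp (real CARD('d) * t / 2)) * ft f (exp t *\<^sub>R k)"
proof -
  have ci: "(\<lambda>x. cis (- 2 * pi * (q \<bullet> x))) \<in> borel_measurable borel" for q :: "real^'d"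
    by (intro borel_measurable_continuous_onI continuous_intros)
  have sc: "(\<lambda>x. f (exp (- t) *\<^sub>R x)) \<in> borel_measurable borel" by (rule measurable_compose[OF _ f]) simp
  have m1: "(\<lambda>x. cis (- 2 * pi * ((exp t *\<^sub>R k) \<bullet> x)) * f x) \<in> borel_measurable borel" by (rule borel_measurable_times[OF ci f])
  have m2: "(\<lambda>x. cis (- 2 * pi * (k \<bullet> x)) * dil (- t) f x) \<in> borel_measurable borel"
    unfolding dil_def by (intro borel_measurable_times ci sc borel_measurable_const)
  define X where "X = (LINT x|lborel. cis (- 2 * pi * (k \<bullet> x)) * f (exp (- t) *\<^sub>R x))"
  have i: "(exp t *\<^sub>R k) \<bullet> (exp (- t) *\<^sub>R x) = k \<bullet> x" for x
  proof -
    have "exp (- t) * exp t = (1::real)" by (simp add: exp_minus)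
    then show ?thesis by (simp add: mult.assoc[symmetric])
  qed
  define G where "G x = cis (- 2 * pi * ((exp t *\<^sub>R k) \<bullet> x)) * f x" for x
  have Gm: "G \<in> borel_measurable borel" unfolding G_def[abs_def] by (rule m1)
  have GX: "(LINT x|lborel. G (exp (- t) *\<^sub>R x)) = X" unfolding G_def X_def i ..
  have "ft f (exp t *\<^sub>R k) = (LINT x|lborel. G x)"
    unfolding ft_def G_def[symmetric] by (rule integral_completion) (simp add: Gm)
  then have e: "ft f (exp t *\<^sub>R k) = of_real (exp (- t) ^ CARD('d)) * X"
    unfolding integral_lborel_scaling[OF exp_gt_zero[of "- t"] Gm] GX .
  define H where "H x = cis (- 2 * pi * (k \<bullet> x)) * dil (- t) f x" for x
  have Hm: "H \<in> borel_measurable borel" unfolding H_def[abs_def] by (rule m2)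
  have "ft (dil (- t) f) k = (LINT x|lborel. H x)"
    unfolding ft_def H_def[symmetric] by (rule integral_completion) (simp add: Hm)
  also have "\<dots> = (LINT x|lborel. of_real (exp (real CARD('d) * (- t) / 2)) * (cis (- 2 * pi * (k \<bullet> x)) * f (exp (- t) *\<^sub>R x)))"
    unfolding H_def dil_def by (rule Bochner_Integration.integral_cong[OF refl mult.left_commute])
  also have "\<dots> = of_real (exp (real CARD('d) * (- t) / 2)) * X" unfolding X_def by simp
  finally have "ft (dil (- t) f) k = of_real (exp (real CARD('d) * (- t) / 2)) * X" .
  moreover have "exp (real CARD('d) * t / 2) * exp (- t) ^ CARD('d) = exp (real CARD('d) * (- t) / 2)"
    by (simp add: exp_of_nat_mult[symmetric] exp_add[symmetric] field_simps)
  ultimately show ?thesis unfolding e mult.assoc[symmetric] of_real_mult[symmetric] by simp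
qed

section \<open>Complex dilations and continuation in the energy\<close>

text \<open>The complex-parameter counterpart of \<open>scaled_slot\<close>. The potential needs two
  families: \<open>Q1\<close> is analytic in \<open>L1\<close> and \<open>Q2\<close> in
  \<open>L\<infinity>\<close>, each extension being given by its own hypothesis.\<close>

definition slot_family :: "(complex \<Rightarrow> real^'d \<Rightarrow> complex) \<Rightarrow> (complex \<Rightarrow> real^'d \<Rightarrow> complex) \<Rightarrow> (complex \<Rightarrow> real^'d \<Rightarrow> complex) \<Rightarrow>
    (complex \<Rightarrow> real^'d \<Rightarrow> complex) \<Rightarrow> complex \<Rightarrow> complex \<Rightarrow> nat \<times> nat \<Rightarrow> real^'d \<Rightarrow> complex" where
  "slot_family P1 P2 Q1 Q2 \<theta> z s = (if s = (0, 0) then P1 \<theta> else if s = (0, 1) then P2 \<theta> else if fst s = 1 then Q1 \<theta>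
     else if fst s = 2 then Q2 \<theta> else (\<lambda>y. 1 / (exp (2 * \<theta>) * of_real (nu y) - z)))"

lemma slots_cases:
  assumes "s \<in> slots (free_idx n c) n (bounded_slots n c)"
  obtains "s = (0, 0)" | "s = (0, 1)" | j where "s = (1, j)" | j where "s = (2, j)" | j where "s = (3, j)"
  using assms unfolding slots_def bounded_slots_def by auto

lemma slot_const_analytic:
  fixes f :: "real^'d \<Rightarrow> complex"
  assumes f: "slot_mem s f"
  shows "analytic_into (slot_mem s) (slot_nrm s) Z (\<lambda>_. f)"
proof (rule analytic_into_const[of "slot_mem s", OF f])
  show "slot_mem s (\<lambda>_::real^'d. 0)" using slot_affine(1)[OF f f, of "-1"] by simp
  have "norm_Linf (\<lambda>_::real^'d. 0 :: complex) = 0"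
    using bLinf_I[of "\<lambda>_ :: real^'d. 0" 0] bLinf_affine(2)[of "\<lambda>_ :: real^'d. 0" "\<lambda>_. 0"] by simp
  then show "slot_nrm s (\<lambda>_::real^'d. 0) = 0" by (simp add: slot_nrm_def norm_L1_def norm_L2_def)
qed

text \<open>Compares imaginary part and modulus of a point of the rotated ray; the sign
  \<open>s\<close> lets one computation serve both half planes.\<close>

lemma rotated_ray:
  assumes s: "s \<in> {1, -1 :: real}" and z: "exp (2 * \<theta>) * of_real t = z" "0 \<le> t"
  shows "s * Im z = cmod z * sin (2 * (s * Im \<theta>))"
proof -
  have "Im z = t * exp (2 * Re \<theta>) * sin (2 * Im \<theta>)" "cmod z = t * exp (2 * Re \<theta>)"
    using z(2) by (simp_all add: z(1)[symmetric] Im_exp norm_mult)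
  then show ?thesis using s by auto
qed

text \<open>Turning away from \<open>z\<close> puts the ray into the opposite closed half plane.
  Turning slightly towards \<open>z\<close> is still safe, by \<open>sin x \<le> x\<close>; this
  slack makes the admissible parameters a neighbourhood of the real segment.\<close>

lemma rotated_ray_avoids_halfplane:
  assumes s: "s \<in> {1, -1 :: real}" and th: "\<bar>Im \<theta>\<bar> \<le> 1" and z: "0 < s * Im z" and lt: "s * Im \<theta> < s * Im z / (2 * cmod z)" and t: "0 \<le> t"
  shows "exp (2 * \<theta>) * of_real t \<noteq> z"
proof
  assume e: "exp (2 * \<theta>) * of_real t = z"
  have z0: "cmod z > 0" using z by auto
  have eq: "s * Im z = cmod z * sin (2 * (s * Im \<theta>))" by (rule rotated_ray[OF s e t])
  show False
  proof (cases "s * Im \<theta> \<le> 0")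
    case True
    have "\<bar>s * Im \<theta>\<bar> \<le> 1" using s th by auto
    then have "0 \<le> sin (- (2 * (s * Im \<theta>)))" using True pi_gt3 by (intro sin_ge_zero) auto
    then have "cmod z * sin (2 * (s * Im \<theta>)) \<le> 0" by (simp add: mult_nonneg_nonpos)
    then show False using eq z by simp
  next
    case False
    have "sin (2 * (s * Im \<theta>)) \<le> 2 * (s * Im \<theta>)" using False by (intro sin_x_le_x) auto
    then have "cmod z * sin (2 * (s * Im \<theta>)) \<le> cmod z * (2 * (s * Im \<theta>))" by (intro mult_left_mono) auto
    moreover have "cmod z * (2 * (s * Im \<theta>)) < s * Im z" using lt z0 by (simp add: field_simps)
    ultimately show False using eq by simp
  qed
qed

definition spectral_domain :: "real \<Rightarrow> complex set" where
  "spectral_domain s = {z. 0 < s * Im z} \<union> {z. 0 < Re z \<and> Im z = 0}"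

text \<open>At this fixed angle the ray without its origin lies strictly beyond the real axis, and
  the origin is outside the domain. The bound on \<open>r\<close> keeps the angle below
  \<open>pi\<close>.\<close>

lemma rotated_ray_avoids_domain:
  assumes s: "s \<in> {1, -1 :: real}" and r: "0 < r" "r \<le> 1" and z: "z \<in> spectral_domain s" and t: "0 \<le> t"
  shows "exp (2 * Complex 0 (- s * r / 2)) * of_real t \<noteq> z"
proof
  assume e: "exp (2 * Complex 0 (- s * r / 2)) * of_real t = z"
  have z0: "cmod z > 0" using z by (auto simp: spectral_domain_def)
  have "s * Im z = cmod z * sin (2 * (s * Im (Complex 0 (- s * r / 2))))" by (rule rotated_ray[OF s e t])
  also have "2 * (s * Im (Complex 0 (- s * r / 2))) = - r" using s by auto
  finally have "s * Im z = - (cmod z * sin r)" by simp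
  moreover have "0 < cmod z * sin r" using z0 r pi_gt3 by (intro mult_pos_pos sin_gt_zero) auto
  ultimately show False using z by (auto simp: spectral_domain_def)
qed

text \<open>For fixed \<open>z\<close> the dilated expression is holomorphic in
  \<open>\<theta>\<close> on \<open>U\<close> and equals \<open>T_term\<close> for real
  \<open>\<theta>\<close>, hence also at \<open>\<theta>0\<close>. With \<open>\<theta>0\<close>
  fixed, holomorphy in \<open>z\<close> holds on all of \<open>spectral_domain s\<close>, in the
  sense of differentiability within this set, which need not be open.\<close>

lemma T_term_continuation:
  fixes b g1 g2 :: "real^'d \<Rightarrow> complex"
  assumes c: "c \<in> reps n" and m: "b \<in> borel_measurable borel" "g1 \<in> borel_measurable borel" "g2 \<in> borel_measurable borel"
    and r: "0 < r" "r \<le> 1" and s: "s \<in> {1, -1 :: real}"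
    and P1: "analytic_into bL2 norm_L2 (ball 0 r) P1" "\<And>t. \<bar>t\<bar> < r \<Longrightarrow> AE y in lborel. P1 (of_real t) y = cnj (g1 (exp t *\<^sub>R y))"
    and P2: "analytic_into bL2 norm_L2 (ball 0 r) P2" "\<And>t. \<bar>t\<bar> < r \<Longrightarrow> AE y in lborel. P2 (of_real t) y = g2 (exp t *\<^sub>R y)"
    and Q1: "analytic_into bL1 norm_L1 (ball 0 r) Q1" "\<And>t. \<bar>t\<bar> < r \<Longrightarrow> AE y in lborel. Q1 (of_real t) y = of_real (exp (real CARD('d) * t / 2)) * b (exp t *\<^sub>R y)"
    and Q2: "analytic_into bLinf norm_Linf (ball 0 r) Q2" "\<And>t. \<bar>t\<bar> < r \<Longrightarrow> AE y in lborel. Q2 (of_real t) y = of_real (exp (real CARD('d) * t / 2)) * b (exp t *\<^sub>R y)"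
  defines "J \<equiv> (\<lambda>\<theta> z. slot_amp (b 0) n c \<theta> (slot_family P1 P2 Q1 Q2 \<theta> z))"
  shows "J (Complex 0 (- s * r / 2)) holomorphic_on spectral_domain s"
    "0 < s * Im z \<Longrightarrow> T_term b g1 g2 n z c = J (Complex 0 (- s * r / 2)) z"
proof -
  let ?I = "slots (free_idx n c) n (bounded_slots n c)"
  \<comment> \<open>The sign turns the ray away from the half plane of \<open>z\<close>, and half
    the radius keeps the point inside the ball of analyticity.\<close>
  define \<theta>0 where "\<theta>0 = Complex 0 (- s * r / 2)"
  have n0: "norm \<theta>0 = r / 2" using s r by (auto simp: \<theta>0_def complex_norm)
  have t0: "\<theta>0 \<in> ball 0 r" using n0 r by simp
  have nD: "n \<in> free_idx n c" using free_idx_insert(1)[OF c] by simp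
  have fD: "finite (free_idx n c)" by (simp add: free_idx_def)
  have holo: "(\<lambda>z. slot_int n c (\<lambda>s. A s z)) holomorphic_on U"
    if "\<And>s. s \<in> ?I \<Longrightarrow> analytic_into (slot_mem s) (slot_nrm s) U (A s)" for A :: "nat \<times> nat \<Rightarrow> complex \<Rightarrow> real^'d \<Rightarrow> complex" and U
    unfolding slot_int_def
  proof (rule slot_integral_holomorphic[OF fD nD bounded_slots_props(1)])
    show "2 \<le> fst s" if "s \<in> bounded_slots n c" for s using bounded_slots_props(2) that by blast
    show "nonsing (free_idx n c) (slot_arg n c s :: (nat \<Rightarrow> real^'d) \<Rightarrow> real^'d)" if "s \<in> bounded_slots n c" for s
      by (rule slot_arg_nonsing[OF c]) (use that in \<open>simp add: slots_def\<close>)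
    show "slot_arg n c (0, i) x = x n" "slot_arg n c (1, i) x = x i" for i and x :: "nat \<Rightarrow> real^'d" by (simp_all add: slot_arg_def)
  qed (rule that)
  have memP: "bL2 (P1 \<theta>)" "bL2 (P2 \<theta>)" "bL1 (Q1 \<theta>)" "bLinf (Q2 \<theta>)" if "\<theta> \<in> ball 0 r" for \<theta>
    using P1(1) P2(1) Q1(1) Q2(1) that by (auto simp: analytic_into_def)
  have sfth: "analytic_into (slot_mem s) (slot_nrm s) U (\<lambda>\<theta>. slot_family P1 P2 Q1 Q2 \<theta> z s)"
    if sI: "s \<in> ?I" and U: "U \<subseteq> ball 0 r" and ne: "\<And>\<theta> t::real. \<theta> \<in> U \<Longrightarrow> 0 \<le> t \<Longrightarrow> exp (2 * \<theta>) * of_real t \<noteq> z" for s U z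
    using sI
  proof (cases rule: slots_cases)
    case 1
    then show ?thesis using analytic_into_subset[OF P1(1) U] by (simp add: slot_family_def slot_mem_def slot_nrm_def)
  next
    case 2
    then show ?thesis using analytic_into_subset[OF P2(1) U] by (simp add: slot_family_def slot_mem_def slot_nrm_def)
  next
    case 3
    then show ?thesis using analytic_into_subset[OF Q1(1) U] by (simp add: slot_family_def slot_mem_def slot_nrm_def)
  next
    case 4
    then show ?thesis using analytic_into_subset[OF Q2(1) U] by (simp add: slot_family_def slot_mem_def slot_nrm_def)
  next
    case 5
    have "analytic_into bLinf norm_Linf U (\<lambda>w p::real^'d. 1 / (exp (2 * w) * of_real (nu p) - z))"
      by (rule resolvent_analytic[where a = "\<lambda>w. exp (2 * w)" and \<zeta> = "\<lambda>_. z" and a' = "\<lambda>w. exp (2 * w) * 2" and \<zeta>' = "\<lambda>_. 0"])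
        (use ne in \<open>auto intro!: derivative_eq_intros\<close>)
    with 5 show ?thesis by (simp add: slot_family_def slot_mem_def slot_nrm_def)
  qed
  have sfz: "analytic_into (slot_mem s') (slot_nrm s') (spectral_domain s) (\<lambda>z. slot_family P1 P2 Q1 Q2 \<theta>0 z s')"
    if sI: "s' \<in> ?I" for s'
    using sI
  proof (cases rule: slots_cases)
    case 1
    then show ?thesis using slot_const_analytic[of s' "P1 \<theta>0"] memP[OF t0] by (simp add: slot_family_def slot_mem_def)
  next
    case 2
    then show ?thesis using slot_const_analytic[of s' "P2 \<theta>0"] memP[OF t0] by (simp add: slot_family_def slot_mem_def)
  next
    case 3
    then show ?thesis using slot_const_analytic[of s' "Q1 \<theta>0"] memP[OF t0] by (simp add: slot_family_def slot_mem_def)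
  next
    case 4
    then show ?thesis using slot_const_analytic[of s' "Q2 \<theta>0"] memP[OF t0] by (simp add: slot_family_def slot_mem_def)
  next
    case 5
    have ne: "exp (2 * \<theta>0) * of_real t \<noteq> w" if "w \<in> spectral_domain s" "0 \<le> t" for w t
      unfolding \<theta>0_def by (rule rotated_ray_avoids_domain[OF s r that])
    have "analytic_into bLinf norm_Linf (spectral_domain s) (\<lambda>w p::real^'d. 1 / (exp (2 * \<theta>0) * of_real (nu p) - w))"
      by (rule resolvent_analytic[where a = "\<lambda>_. exp (2 * \<theta>0)" and \<zeta> = "\<lambda>w. w" and a' = "\<lambda>_. 0" and \<zeta>' = "\<lambda>_. 1"])
        (use ne in \<open>auto intro!: derivative_eq_intros\<close>)
    with 5 show ?thesis by (simp add: slot_family_def slot_mem_def slot_nrm_def)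
  qed
  have "(\<lambda>z. slot_int n c (\<lambda>s. slot_family P1 P2 Q1 Q2 \<theta>0 z s)) holomorphic_on spectral_domain s"
    by (rule holo[OF sfz])
  then show "J (Complex 0 (- s * r / 2)) holomorphic_on spectral_domain s"
    unfolding J_def \<theta>0_def[symmetric] slot_amp_def by (intro holomorphic_intros)
  assume z: "0 < s * Im z"
  define \<epsilon> where "\<epsilon> = s * Im z / (2 * cmod z)"
  have e0: "\<epsilon> > 0" using z by (auto simp: \<epsilon>_def intro!: divide_pos_pos)
  \<comment> \<open>An intersection of convex sets, hence connected. Although
    \<open>\<epsilon>\<close> depends on \<open>z\<close>, the set always contains
    \<open>\<theta>0\<close>, where \<open>s * Im \<theta>0 = - r / 2\<close> is negative.\<close>
  define U where "U = ball (0::complex) r \<inter> {\<theta>. s * Im \<theta> < \<epsilon>}"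
  have hs: "open {\<theta>. s * Im \<theta> < \<epsilon>} \<and> convex {\<theta>. s * Im \<theta> < \<epsilon>}"
  proof (cases "s = 1")
    case True
    then show ?thesis by (simp add: open_halfspace_Im_lt convex_halfspace_Im_lt)
  next
    case False
    then have "{\<theta>. s * Im \<theta> < \<epsilon>} = {\<theta>. - \<epsilon> < Im \<theta>}" using s by auto
    then show ?thesis by (simp add: open_halfspace_Im_gt convex_halfspace_Im_gt)
  qed
  have Uo: "open U" "connected U" using hs by (auto simp: U_def intro!: convex_connected convex_Int)
  have Ub: "U \<subseteq> ball 0 r" by (auto simp: U_def)
  have Une: "exp (2 * \<theta>) * of_real t \<noteq> z" if "\<theta> \<in> U" "0 \<le> t" for \<theta> and t :: real
  proof (rule rotated_ray_avoids_halfplane[OF s _ z _ that(2)])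
    show "s * Im \<theta> < s * Im z / (2 * cmod z)" using that(1) by (simp add: U_def \<epsilon>_def)
    show "\<bar>Im \<theta>\<bar> \<le> 1" using abs_Im_le_cmod[of \<theta>] that(1) r by (simp add: U_def)
  qed
  have "(\<lambda>\<theta>. slot_int n c (\<lambda>s. slot_family P1 P2 Q1 Q2 \<theta> z s)) holomorphic_on U"
    by (rule holo[OF sfth[OF _ Ub Une]])
  then have hol: "(\<lambda>\<theta>. J \<theta> z - T_term b g1 g2 n z c) holomorphic_on U"
    unfolding J_def slot_amp_def by (intro holomorphic_intros)
  define R where "R = of_real ` {t::real. \<bar>t\<bar> < r} \<inter> U"
  have Rz: "J \<theta> z - T_term b g1 g2 n z c = 0" if "\<theta> \<in> R" for \<theta>
  proof -
    obtain t where t: "\<theta> = of_real t" "\<bar>t\<bar> < r" using \<open>\<theta> \<in> R\<close> by (auto simp: R_def)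
    have tU: "\<theta> \<in> U" using \<open>\<theta> \<in> R\<close> by (simp add: R_def)
    have "T_term b g1 g2 n z c = slot_amp (b 0) n c (of_real t) (slot_family P1 P2 Q1 Q2 (of_real t) z)"
    proof (rule T_term_eq_slot_amp[OF c m])
      fix s' assume s': "s' \<in> ?I"
      have "slot_mem s' (slot_family P1 P2 Q1 Q2 \<theta> z s')"
        using sfth[OF s' Ub Une] tU by (simp add: analytic_into_def)
      then show "slot_family P1 P2 Q1 Q2 (of_real t) z s' \<in> borel_measurable borel" unfolding t(1) by (rule slot_borel)
      show "AE y in lborel. slot_family P1 P2 Q1 Q2 (of_real t) z s' y = scaled_slot b g1 g2 z t s' y"
        using s'
      proof (cases rule: slots_cases)
        case 1
        then show ?thesis using P1(2)[OF t(2)] by (simp add: slot_family_def scaled_slot_def)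
      next
        case 2
        then show ?thesis using P2(2)[OF t(2)] by (simp add: slot_family_def scaled_slot_def)
      next
        case 3
        then show ?thesis using Q1(2)[OF t(2)] by (simp add: slot_family_def scaled_slot_def)
      next
        case 4
        then show ?thesis using Q2(2)[OF t(2)] by (simp add: slot_family_def scaled_slot_def)
      next
        case 5
        then show ?thesis by (simp add: slot_family_def scaled_slot_def exp_of_real[symmetric])
      qed
    qed
    then show ?thesis by (simp add: J_def t(1))
  qed
  have lim: "0 islimpt R" unfolding islimpt_approachable
  proof (intro allI impI)
    fix e :: real assume e: "e > 0"
    define t where "t = min e r / 2"
    have t: "0 < t" "t < e" "t < r" using e r by (auto simp: t_def)
    have "of_real t \<in> R" using t e0 by (auto simp: R_def U_def)
    then show "\<exists>x'\<in>R. x' \<noteq> 0 \<and> dist x' 0 < e" by (rule bexI[rotated]) (use t in auto)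
  qed
  have "\<theta>0 \<in> U" using t0 s r e0 by (auto simp: U_def \<theta>0_def)
  moreover have "0 \<in> U" using r e0 by (simp add: U_def)
  ultimately have "J \<theta>0 z - T_term b g1 g2 n z c = 0"
    using analytic_continuation[OF hol Uo, of R 0 \<theta>0] Rz lim by (auto simp: R_def)
  then show "T_term b g1 g2 n z c = J (Complex 0 (- s * r / 2)) z" by (simp add: \<theta>0_def)
qed

section \<open>From the hypotheses to the boundary values\<close>

lemma AE_lborel_scale:
  assumes P: "AE y in (lborel :: (real^'d) measure). P y" and c: "c \<noteq> 0"
  shows "AE y in lborel. P (c *\<^sub>R y)"
proof -
  obtain N where N: "N \<in> null_sets lborel" "{y \<in> space lborel. \<not> P y} \<subseteq> N" using P by (auto simp: eventually_ae_filter)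
  have "AE y in lborel. 0 + c *\<^sub>R y \<notin> N" by (rule AE_lborel_affine[OF N(1) c])
  then show ?thesis by eventually_elim (use N(2) in auto)
qed

text \<open>Borel representatives are chosen for the transform and for the family. Scaling by a
  nonzero factor preserves null sets, so the identity at real parameters survives the
  replacement.\<close>

lemma psi_hyp_family:
  fixes \<psi> :: "real^'d \<Rightarrow> complex"
  assumes "psi_hyp \<psi>"
  obtains g0 g r F where "is_ft_L2 \<psi> g0" "g \<in> borel_measurable borel" "AE x in lborel. g0 x = g x" "r > 0"
    "analytic_into bL2 norm_L2 (ball 0 r) F" "\<And>t. \<bar>t\<bar> < r \<Longrightarrow> AE y in lborel. F (of_real t) y = g (exp t *\<^sub>R y)"
proof -
  obtain g0 r F where g0: "is_ft_L2 \<psi> g0" and r: "r > 0" and F: "analytic_into in_L2 norm_L2 (ball 0 r) F"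
    and Ft: "\<And>t::real. \<bar>t\<bar> < r \<Longrightarrow> AE k in lebesgue. F (of_real t) k = g0 (exp t *\<^sub>R k)"
    using assms unfolding psi_hyp_def by blast
  have "g0 \<in> borel_measurable lebesgue" using g0 by (simp add: is_ft_L2_def in_L2_def)
  then obtain g where g: "g \<in> borel_measurable borel" "AE x in lborel. g0 x = g x" using lebesgue_complex_ex_borel by blast
  obtain F' where F': "\<And>z. z \<in> ball 0 r \<Longrightarrow> AE x in lborel. F z x = F' z x" "analytic_into bL2 norm_L2 (ball 0 r) F'"
    using analytic_L2_borel[OF F] by blast
  have "AE y in lborel. F' (of_real t) y = g (exp t *\<^sub>R y)" if t: "\<bar>t\<bar> < r" for t
  proof -
    have a: "AE y in lborel. F (of_real t) y = g0 (exp t *\<^sub>R y)" using Ft[OF t] by (simp add: AE_completion_iff)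
    have b: "AE y in lborel. F (of_real t) y = F' (of_real t) y" by (rule F'(1)) (use t in simp)
    have c: "AE y in lborel. g0 (exp t *\<^sub>R y) = g (exp t *\<^sub>R y)" by (rule AE_lborel_scale[OF g(2)]) simp
    show ?thesis using a b c by eventually_elim simp
  qed
  then show ?thesis by (rule that[OF g0 g r F'(2)])
qed

text \<open>The hypothesis dilates \<open>B\<close> in position space. Reversing the parameter, as
  \<open>ft_dil\<close> demands, dilates its transform in the same direction as those of the wave
  functions.\<close>

lemma B_hyp_family:
  fixes B :: "real^'d \<Rightarrow> real"
  assumes "B_hyp B" and m: "B \<in> borel_measurable borel"
  obtains r Q1 Q2 where "r > 0" "analytic_into bL1 norm_L1 (ball 0 r) Q1" "analytic_into bLinf norm_Linf (ball 0 r) Q2"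
    "\<And>t. \<bar>t\<bar> < r \<Longrightarrow> AE y in lborel. Q1 (of_real t) y = of_real (exp (real CARD('d) * t / 2)) * ft (\<lambda>x. of_real (B x)) (exp t *\<^sub>R y)"
    "\<And>t. \<bar>t\<bar> < r \<Longrightarrow> AE y in lborel. Q2 (of_real t) y = of_real (exp (real CARD('d) * t / 2)) * ft (\<lambda>x. of_real (B x)) (exp t *\<^sub>R y)"
proof -
  let ?f = "\<lambda>x. complex_of_real (B x)"
  have fm: "?f \<in> borel_measurable borel" using m by simp
  obtain r F1 F2 where r: "r > 0" and F1: "analytic_into in_L1 norm_L1 (ball 0 r) F1" and F2: "analytic_into in_Linf norm_Linf (ball 0 r) F2"
    and F1t: "\<And>t::real. \<bar>t\<bar> < r \<Longrightarrow> AE k in lebesgue. F1 (of_real t) k = ft (dil t ?f) k"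
    and F2t: "\<And>t::real. \<bar>t\<bar> < r \<Longrightarrow> AE k in lebesgue. F2 (of_real t) k = ft (dil t ?f) k"
    using assms(1) unfolding B_hyp_def by blast
  obtain G1 where G1: "\<And>z. z \<in> ball 0 r \<Longrightarrow> AE x in lborel. F1 z x = G1 z x" "analytic_into bL1 norm_L1 (ball 0 r) G1"
    using analytic_L1_borel[OF F1] by blast
  obtain G2 where G2: "\<And>z. z \<in> ball 0 r \<Longrightarrow> AE x in lborel. F2 z x = G2 z x" "analytic_into bLinf norm_Linf (ball 0 r) G2"
    using analytic_Linf_borel[OF F2] by blast
  have q: "(p - q) / (w - z) - - g = - ((p - q) / (- w - - z) - g)" for p q w z g :: complex
  proof -
    have "- w - - z = - (w - z)" by simp
    then show ?thesis by (simp only: divide_minus_right) simp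
  qed
  have n1: "bL1 (\<lambda>x. - f x)" if "bL1 f" for f :: "real^'d \<Rightarrow> complex" using that by (simp add: bL1_iff)
  have n2: "bLinf (\<lambda>x. - f x)" if "bLinf f" for f :: "real^'d \<Rightarrow> complex"
    using that by (simp add: bLinf_def in_Linf_def)
  have A1: "analytic_into bL1 norm_L1 (ball 0 r) (\<lambda>z x. G1 (- z) x)"
  proof (rule analytic_into_transform[OF G1(2), where \<sigma> = uminus and \<rho> = "\<lambda>x. x" and \<rho>' = uminus])
    show "(p - q) / (w - z) - - g = - ((p - q) / (- w - - z) - g)" for p q w z g :: complex by (rule q)
    show "norm_L1 (\<lambda>x. - f x) = norm_L1 f" for f :: "real^'d \<Rightarrow> complex" by (simp add: norm_L1_def)
  qed (auto simp: inj_def intro: n1)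
  have A2: "analytic_into bLinf norm_Linf (ball 0 r) (\<lambda>z x. G2 (- z) x)"
  proof (rule analytic_into_transform[OF G2(2), where \<sigma> = uminus and \<rho> = "\<lambda>x. x" and \<rho>' = uminus])
    show "(p - q) / (w - z) - - g = - ((p - q) / (- w - - z) - g)" for p q w z g :: complex by (rule q)
    show "norm_Linf (\<lambda>x. - f x) = norm_Linf f" for f :: "real^'d \<Rightarrow> complex" by (simp add: norm_Linf_def)
  qed (auto simp: inj_def intro: n2)
  have t1: "AE y in lborel. G1 (- of_real t) y = of_real (exp (real CARD('d) * t / 2)) * ft ?f (exp t *\<^sub>R y)" if t: "\<bar>t\<bar> < r" for t
  proof -
    have a: "AE y in lborel. F1 (of_real (- t)) y = ft (dil (- t) ?f) y" using F1t[of "- t"] t by (simp add: AE_completion_iff)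
    have b: "AE y in lborel. F1 (of_real (- t)) y = G1 (of_real (- t)) y" by (rule G1(1)) (use t in simp)
    show ?thesis using a b by eventually_elim (simp add: ft_dil[OF fm])
  qed
  have t2: "AE y in lborel. G2 (- of_real t) y = of_real (exp (real CARD('d) * t / 2)) * ft ?f (exp t *\<^sub>R y)" if t: "\<bar>t\<bar> < r" for t
  proof -
    have a: "AE y in lborel. F2 (of_real (- t)) y = ft (dil (- t) ?f) y" using F2t[of "- t"] t by (simp add: AE_completion_iff)
    have b: "AE y in lborel. F2 (of_real (- t)) y = G2 (of_real (- t)) y" by (rule G2(1)) (use t in simp)
    show ?thesis using a b by eventually_elim (simp add: ft_dil[OF fm])
  qed
  show ?thesis by (rule that[OF r A1 A2 t1 t2])
qed

text \<open>The rotation angle is determined by the radii of analyticity and by \<open>s\<close>,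
  not by \<open>z\<close>, so one formula serves the whole domain, and the finite sum over
  partitions preserves continuity.\<close>

lemma T_inf_extension:
  fixes B :: "real^'d \<Rightarrow> real" and \<psi>1 \<psi>2 :: "real^'d \<Rightarrow> complex"
  assumes B: "schwartz B"
    and hyp: "(\<exists>R. \<forall>x. R < norm x \<longrightarrow> B x = 0) \<or> (\<forall>j x. B (\<chi> i. if i = j then - (x $ i) else x $ i) = B x)"
    and mu: "prob_space \<mu>" and mom: "\<And>k::nat. integrable \<mu> (\<lambda>v. v ^ k)"
    and BH: "B_hyp B" and psi1: "in_L2 \<psi>1" "psi_hyp \<psi>1" and psi2: "in_L2 \<psi>2" "psi_hyp \<psi>2"
    and s: "s \<in> {1, -1 :: real}"
  obtains G where "continuous_on (spectral_domain s) G" "\<And>z. 0 < s * Im z \<Longrightarrow> G z = T_inf \<mu> B n z \<psi>1 \<psi>2"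
proof -
  let ?b = "ft (\<lambda>x. complex_of_real (B x))"
  have Bc: "continuous_on UNIV B" and Bi: "integrable lborel B" using schwartz_pderivs(2,4)[OF B, of "[]"] by auto
  have Bm: "B \<in> borel_measurable borel" using Bc by (rule borel_measurable_continuous_onI)
  have "integrable lborel (\<lambda>x. complex_of_real (B x))" using Bi by simp
  then have "integrable lebesgue (\<lambda>x. complex_of_real (B x))" using Bm by (subst integrable_completion) (simp_all add: measurable_lborel1)
  then have bm: "?b \<in> borel_measurable borel" by (rule ft_borel)
  obtain r0 Q1 Q2 where r0: "r0 > 0" and Q: "analytic_into bL1 norm_L1 (ball 0 r0) Q1" "analytic_into bLinf norm_Linf (ball 0 r0) Q2"
    and Q1: "\<And>t. \<bar>t\<bar> < r0 \<Longrightarrow> AE y in lborel. Q1 (of_real t) y = of_real (exp (real CARD('d) * t / 2)) * ?b (exp t *\<^sub>R y)"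
    and Q2: "\<And>t. \<bar>t\<bar> < r0 \<Longrightarrow> AE y in lborel. Q2 (of_real t) y = of_real (exp (real CARD('d) * t / 2)) * ?b (exp t *\<^sub>R y)"
    using B_hyp_family[OF BH Bm] by blast
  obtain g01 g1 r1 F1 where g1: "is_ft_L2 \<psi>1 g01" "g1 \<in> borel_measurable borel" "AE x in lborel. g01 x = g1 x" and r1: "r1 > 0"
    and F1: "analytic_into bL2 norm_L2 (ball 0 r1) F1" "\<And>t. \<bar>t\<bar> < r1 \<Longrightarrow> AE y in lborel. F1 (of_real t) y = g1 (exp t *\<^sub>R y)"
    using psi_hyp_family[OF psi1(2)] by blast
  obtain g02 g2 r2 F2 where g2: "is_ft_L2 \<psi>2 g02" "g2 \<in> borel_measurable borel" "AE x in lborel. g02 x = g2 x" and r2: "r2 > 0"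
    and F2: "analytic_into bL2 norm_L2 (ball 0 r2) F2" "\<And>t. \<bar>t\<bar> < r2 \<Longrightarrow> AE y in lborel. F2 (of_real t) y = g2 (exp t *\<^sub>R y)"
    using psi_hyp_family[OF psi2(2)] by blast
  \<comment> \<open>The 1 keeps the doubled rotation angles within the range where the sign of the
    sine is known.\<close>
  define r where "r = Min {1, r0, r1, r2}"
  have r: "0 < r" "r \<le> 1" "r \<le> r0" "r \<le> r1" "r \<le> r2" using r0 r1 r2 by (auto simp: r_def)
  have sub: "ball 0 r \<subseteq> ball (0::complex) r0" "ball 0 r \<subseteq> ball (0::complex) r1" "ball 0 r \<subseteq> ball (0::complex) r2" using r by auto
  have cj: "(cnj p - cnj q) / (w - z) - cnj g = cnj ((p - q) / (cnj w - cnj z) - g)" for p q w z g by simp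
  have nc: "bL2 (\<lambda>x. cnj (f x))" if "bL2 f" for f :: "real^'d \<Rightarrow> complex"
    using that measurable_compose[of f borel borel cnj, OF _ borel_measurable_cnj] by (simp add: bL2_iff)
  \<comment> \<open>The first wave function enters conjugated; conjugating the parameter as well
    keeps the family holomorphic and changes nothing at real parameters.\<close>
  have P1: "analytic_into bL2 norm_L2 (ball 0 r) (\<lambda>z x. cnj (F1 (cnj z) x))"
  proof (rule analytic_into_transform[OF F1(1), where \<sigma> = cnj and \<rho> = cnj and \<rho>' = cnj])
    show "cnj z \<in> ball 0 r1" if "z \<in> ball 0 r" for z using that r by simp
    show "isCont cnj z" for z by (intro continuous_intros)
    show "norm_L2 (\<lambda>x. cnj (f x)) = norm_L2 f" for f :: "real^'d \<Rightarrow> complex" by (simp add: norm_L2_def)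
    show "(cnj p - cnj q) / (w - z) - cnj g = cnj ((p - q) / (cnj w - cnj z) - g)" for p q w z g by (rule cj)
  qed (auto simp: inj_def intro: nc)
  have P1t: "AE y in lborel. cnj (F1 (cnj (of_real t)) y) = cnj (g1 (exp t *\<^sub>R y))" if "\<bar>t\<bar> < r" for t
    using F1(2)[of t] that r by simp
  define J where "J c z = slot_amp (?b 0) n c (Complex 0 (- s * r / 2)) (slot_family (\<lambda>z x. cnj (F1 (cnj z) x)) F2 Q1 Q2 (Complex 0 (- s * r / 2)) z)" for c z
  have F2t: "AE y in lborel. F2 (of_real t) y = g2 (exp t *\<^sub>R y)" if "\<bar>t\<bar> < r" for t using F2(2)[of t] that r by simp
  have Q1t: "AE y in lborel. Q1 (of_real t) y = of_real (exp (real CARD('d) * t / 2)) * ?b (exp t *\<^sub>R y)" if "\<bar>t\<bar> < r" for t using Q1[of t] that r by simp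
  have Q2t: "AE y in lborel. Q2 (of_real t) y = of_real (exp (real CARD('d) * t / 2)) * ?b (exp t *\<^sub>R y)" if "\<bar>t\<bar> < r" for t using Q2[of t] that r by simp
  note cont = T_term_continuation[OF _ bm g1(2) g2(2) r(1,2) s P1 P1t analytic_into_subset[OF F2(1) sub(3)] F2t
      analytic_into_subset[OF Q(1) sub(1)] Q1t analytic_into_subset[OF Q(2) sub(1)] Q2t]
  have Jh: "J c holomorphic_on spectral_domain s" if "c \<in> reps n" for c
    unfolding J_def[abs_def] by (rule cont(1)) (use that in auto)
  have JT: "T_term ?b g1 g2 n z c = J c z" if "c \<in> reps n" "0 < s * Im z" for c z
    unfolding J_def by (rule cont(2)) (use that in auto)
  define G where "G z = (\<Sum>c\<in>reps n. mom_weight \<mu> n c * J c z)" for z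
  show ?thesis
  proof (rule that)
    show "continuous_on (spectral_domain s) G"
      unfolding G_def[abs_def] by (intro continuous_on_sum continuous_on_mult continuous_on_const holomorphic_on_imp_continuous_on Jh)
    fix z assume z: "0 < s * Im z"
    then have z0: "Im z \<noteq> 0" by auto
    \<comment> \<open>\<open>T_inf\<close> is a \<open>Lim\<close>, whose value is determined here
      because the convergence at \<open>z\<close> has been established.\<close>
    have "T_inf \<mu> B n z \<psi>1 \<psi>2 = (\<Sum>c\<in>reps n. mom_weight \<mu> n c * T_term ?b g1 g2 n z c)"
      unfolding T_inf_def
      by (rule tendsto_Lim[OF _ T_L_limit[OF z0 B hyp mu mom psi1(1) psi2(1) g1(1) g2(1) g1(2) g2(2) g1(3) g2(3)]]) simp
    then show "G z = T_inf \<mu> B n z \<psi>1 \<psi>2" unfolding G_def by (simp add: JT[OF _ z])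
  qed
qed

theorem theorem3:
  fixes B :: "real^'d \<Rightarrow> real" and \<psi>1 \<psi>2 :: "real^'d \<Rightarrow> complex"
    and \<mu> :: "real measure" and n :: nat
  assumes "schwartz B"
    and "(\<exists>R. \<forall>x. R < norm x \<longrightarrow> B x = 0) \<or>
         (\<forall>j x. B (\<chi> i. if i = j then - (x $ i) else x $ i) = B x)"
    and "prob_space \<mu>" and "sets \<mu> = sets borel"
    and "\<forall>k::nat. integrable \<mu> (\<lambda>v. v ^ k)"
    and "B_hyp B"
    and "in_L2 \<psi>1" and "psi_hyp \<psi>1"
    and "in_L2 \<psi>2" and "psi_hyp \<psi>2"
  shows "(\<forall>E>0. \<forall>s\<in>{1, -1::real}. \<exists>c.
            ((\<lambda>\<eta>. T_inf \<mu> B n (Complex E (s * \<eta>)) \<psi>1 \<psi>2) \<longlongrightarrow> c) (at_right 0))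
       \<and> (\<exists>G. continuous_on ({z. 0 < Im z} \<union> {z. 0 < Re z \<and> Im z = 0}) G \<and>
              (\<forall>z. 0 < Im z \<longrightarrow> G z = T_inf \<mu> B n z \<psi>1 \<psi>2))"
proof (intro conjI allI ballI impI)
  have mom: "integrable \<mu> (\<lambda>v. v ^ k)" for k :: nat using assms(5) by blast
  note ex = T_inf_extension[OF assms(1-3) mom assms(6-10), where n = n]
  fix E s :: real assume E: "0 < E" and s: "s \<in> {1, -1}"
  \<comment> \<open>For \<open>s = -1\<close> the extension starts from the lower half plane; the
    boundary values from the two sides need not agree.\<close>
  obtain G where G: "continuous_on (spectral_domain s) G" "\<And>z. 0 < s * Im z \<Longrightarrow> G z = T_inf \<mu> B n z \<psi>1 \<psi>2"
    using ex[OF s] by blast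
  have ss: "s * (s * \<eta>) = \<eta>" for \<eta> using s by auto
  have E0: "Complex E 0 \<in> spectral_domain s" using E by (simp add: spectral_domain_def)
  have lim: "(G \<longlongrightarrow> G (Complex E 0)) (at (Complex E 0) within spectral_domain s)"
    using G(1) E0 by (simp add: continuous_on)
  have pos: "\<forall>\<^sub>F \<eta> in at_right (0::real). 0 < \<eta>" by (simp add: eventually_at_right_less)
  have path: "filterlim (\<lambda>\<eta>. Complex E (s * \<eta>)) (at (Complex E 0) within spectral_domain s) (at_right 0)"
    unfolding filterlim_at
  proof
    show "\<forall>\<^sub>F \<eta> in at_right 0. Complex E (s * \<eta>) \<in> spectral_domain s \<and> Complex E (s * \<eta>) \<noteq> Complex E 0"
      using pos by eventually_elim (use s in \<open>auto simp: spectral_domain_def ss\<close>)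
    have "((\<lambda>\<eta>. Complex E (s * \<eta>)) \<longlongrightarrow> Complex E (s * 0)) (at_right 0)" by (intro tendsto_Complex tendsto_intros)
    then show "((\<lambda>\<eta>. Complex E (s * \<eta>)) \<longlongrightarrow> Complex E 0) (at_right 0)" by simp
  qed
  have "((\<lambda>\<eta>. T_inf \<mu> B n (Complex E (s * \<eta>)) \<psi>1 \<psi>2) \<longlongrightarrow> G (Complex E 0)) (at_right 0)"
  proof (rule Lim_transform_eventually[OF filterlim_compose[OF lim path]])
    show "\<forall>\<^sub>F \<eta> in at_right 0. G (Complex E (s * \<eta>)) = T_inf \<mu> B n (Complex E (s * \<eta>)) \<psi>1 \<psi>2"
      using pos by eventually_elim (rule G(2), simp add: ss)
  qed
  then show "\<exists>c. ((\<lambda>\<eta>. T_inf \<mu> B n (Complex E (s * \<eta>)) \<psi>1 \<psi>2) \<longlongrightarrow> c) (at_right 0)" by blast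
next
  have mom: "integrable \<mu> (\<lambda>v. v ^ k)" for k :: nat using assms(5) by blast
  obtain G where "continuous_on (spectral_domain 1) G" "\<And>z. 0 < 1 * Im z \<Longrightarrow> G z = T_inf \<mu> B n z \<psi>1 \<psi>2"
    using T_inf_extension[OF assms(1-3) mom assms(6-10), where n = n and s = 1] by blast
  then show "\<exists>G. continuous_on ({z. 0 < Im z} \<union> {z. 0 < Re z \<and> Im z = 0}) G \<and> (\<forall>z. 0 < Im z \<longrightarrow> G z = T_inf \<mu> B n z \<psi>1 \<psi>2)"
    by (auto simp: spectral_domain_def)
qed

end
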